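(* Let $\Phi^t:\Omega\to\Omega$ be a uniformly expanding semiflow on a two-dimensional $C^2$ branched manifold, with expansion constant $\lambda>0$. Then: (1) Suppose $\Re(z)>0$. Then $z^{-1}$ is in the spectrum of $\mathcal P(z):\mathfrak D\to\mathfrak D$. If $|z|<\Re(z)+\lambda$ then $z^{-1}$ is an eigenvalue for $\mathcal P(z):\mathfrak D\to\mathfrak D$. (2) Suppose $\Re(z)>0$, $\Re(w)>0$ and $\mu$ is an eigenvector for $\mathcal P(z)$ corresponding to the eigenvalue $z^{-1}$. Then $\mu$ is an eigenvector for $\mathcal P(w)$ corresponding to the eigenvalue $w^{-1}$. (3) For all $t>0$, $1$ is an eigenvalue for $\Phi^t_*:\mathfrak D\to\mathfrak D$ (perhaps not isolated). Moreover each eigenvector corresponding to this eigenvalue is also an eigenvector for $\mathcal P(z)$ corresponding to the eigenvalue $z^{-1}$, where $\Re(z)>0$. (4) The function $z\mapsto\mathcal P(z)$, taking values in $\mathcal B(\mathfrak D,\mathfrak D)$, has a pole at $z=0$.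
   Context: Branched manifolds. A $d$-dimensional branched manifold of class $C^r$ is a metrizable space $\Omega$ together with a countable collection $\{U_i\}_{i\in I}$ of closed subsets (charts), for each $i$ a map $\varphi_i:U_i\to D_i$ where $D_i$ is a closed $d$-ball in $\mathbb R^d$, and for each $i$ a countable collection $\{V_{ij}\}_{j\in J_i}$ of closed subsets of $U_i$ (subcharts), such that: $\bigcup_j V_{ij}=U_i$ for each $i$; $\bigcup_i \mathrm{Int}\,U_i=\Omega$; each $\varphi_i|_{V_{ij}}$ is a homeomorphism onto its image, which is a closed subset of $D_i$; for all $i,i'$ there is a $C^r$-diffeomorphism $\alpha_{ii'}$ with domain $\varphi_{i'}(U_i\cap U_{i'})$ such that $\varphi_i=\alpha_{ii'}\circ\varphi_{i'}$ when defined. A point $p$ is interior if there are $i$, $G\subset U_i$, $\delta>0$ with $p\in G$ and $\varphi_i(G)=\{\varphi_i(p)+y:y\in\mathbb R^d,|y|<\delta\}$; the boundary $\partial\Omega$ is the set of all other points. $C^k(\Omega)$ is the set of $f:\Omega\to\mathbb C$ such that every $f\circ(\varphi_i|_{V_{ij}})^{-1}$ is of class $C^k$. The tangent bundle $T\Omega$ is the set of $(x,v,i,j)$ with $x\in V_{ij}$, $v\in T_{\varphi_i(x)}\mathbb R^d$, modulo $(x,v,i,j)\sim(x',v',i',j')$ if $x=x'$ and $(D\alpha_{i'i})v=v'$. An $n$-dimensional-parameter foliation is given by coordinate charts whose transition maps have the form $\alpha_{ii'}(x,y)=(\alpha^{(1)}_{ii'}(x),\alpha^{(2)}_{ii'}(x,y))$,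 with $x$ representing $n$ coordinates and $y$ the remaining $d-n$; the sets $x=\mathrm{const}$ in charts (plaques) match up to form the leaves. For a vector field $U$ and a $C^1$ function $\eta$, $U\eta$ is the derivative of $\eta$ along $U$. Standing setting. $\Omega$ is a 2-dimensional $C^2$ branched manifold, possibly with boundary and with finite branches, with an inner product $\langle\cdot,\cdot\rangle$ on the tangent spaces $T_p\Omega$ and the corresponding norm. $X$ is a $C^2$ vector field whose associated semiflow $\Phi^t:\Omega\to\Omega$, $t\ge0$, is globally defined ($\Phi^0=\mathrm{id}$, $\Phi^t\circ\Phi^s=\Phi^{t+s}$ for $t,s\ge0$). It is uniformly expanding: there is an orientable $C^2$ foliation $\mathcal F_V$ of $\Omega$ such that (1) its leaves are all one-dimensional curves with end points contained in $\partial\Omega$ and of length greater than $\delta$ for some constant $\delta>0$; (2) its leaves are uniformly transversal to the flow direction; (3) with $V$ the unit vector field tangent to $\mathcal F_V$, there are constants $C<\infty$, $\lambda>0$ with $\langle D\Phi^t u,V\rangle\ge C^{-1}e^{\lambda t}\langle u,V\rangle$ for all $u\in T_p\Omega$, $p\in\Omega$, $t\ge0$. Spaces and operators. $C(\Omega)$ is the space of continuous complex-valued functions on $\Omega$, with sup norm $|\cdot|_\infty$; $C_0(\Omega)$ is the subspace of functions vanishing on $\partial\Omega$; $C^1_0(\Omega)=C^1(\Omega)\cap C_0(\Omega)$. $\mathfrak M$ is the Banach space of complex (Borel) measures on $\Omega$ with the total variation norm $\|\mu\|_{\mathfrak M}=\sup\{|\mu(\eta)|:\eta\in C(\Omega),|\eta|_\infty\le1\}$.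 The push-forward $\Phi^t_*:\mathfrak M\to\mathfrak M$ is $\Phi^t_*\mu(\eta)=\mu(\eta\circ\Phi^t)$ for $\eta\in C(\Omega)$. For $\Re(z)>0$, $\mathcal P(z):\mathfrak M\to\mathfrak M$ is the Bochner integral $\mathcal P(z)=\int_0^\infty e^{-zt}\Phi^t_*\,dt$. For a continuous vector field $U$, $\mu\in\mathfrak M$ is differentiable with respect to $U$ if there is a measure $D_U\mu\in\mathfrak M$ with $\mu(U\eta)=-D_U\mu(\eta)$ for all $\eta\in C^1_0(\Omega)$. Let $\|D\mu\|_{\mathfrak M}=\sup\{\|D_U\mu\|_{\mathfrak M}:U\text{ a continuous vector field on }\Omega,\ |U|_\infty\le1\}$. $\mathfrak D$ is the Banach space of all $\mu\in\mathfrak M$ for which this quantity is finite, with norm $\|\mu\|_{\mathfrak D}=\|D\mu\|_{\mathfrak M}+\|\mu\|_{\mathfrak M}$. $\mathcal B(\mathfrak D,\mathfrak D)$ is the space of bounded linear operators on $\mathfrak D$. There are constants $C<\infty$, $\alpha<\infty$ with $\|\Phi^t_*\|_{\mathfrak D}\le Ce^{\alpha t}$ (operator norm on $\mathfrak D$) for all $t\ge0$, so $\mathcal P(z)$ acts as a bounded operator $\mathfrak D\to\mathfrak D$ for $\Re(z)>\alpha$. The function $z\mapsto\mathcal P(z)\in\mathcal B(\mathfrak D,\mathfrak D)$ admits an extension which is holomorphic on $\{\Re(z)>0\}$ and meromorphic on $\{\Re(z)>-\lambda\}$; the extension is denoted by the same symbol.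
   Formalization: In the norm of 𝔇, U ranges over C¹ fields with |U|≤1 and coordinate derivative ≤1 (with all continuous U, 𝔇 can be {0}); in (3) "each eigenvector" means one common to all t>0 (false for a single t); 𝒫(z) is a weak integral. *)

theory Defs
  imports "HOL-Analysis.Analysis"
begin

(* f is of class C^k on the open set W. *)
fun Ck_on :: "nat \<Rightarrow> 'e::euclidean_space set \<Rightarrow> ('e \<Rightarrow> 'b::real_normed_vector) \<Rightarrow> bool" where
  "Ck_on 0 W f \<longleftrightarrow> continuous_on W f"
| "Ck_on (Suc k) W f \<longleftrightarrow> (\<forall>x\<in>W. f differentiable (at x)) \<and>
     (\<forall>v. Ck_on k W (\<lambda>x. frechet_derivative f (at x) v))"

(* On a set S that need not be open, class C^k means: restriction of a C^k map
   defined on an open neighbourhood of S. *)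
definition Ck_on_set :: "nat \<Rightarrow> 'e::euclidean_space set \<Rightarrow> ('e \<Rightarrow> 'b::real_normed_vector) \<Rightarrow> bool" where
  "Ck_on_set k S f \<longleftrightarrow> (\<exists>W h. open W \<and> S \<subseteq> W \<and> Ck_on k W h \<and> (\<forall>x\<in>S. h x = f x))"

(* Here f itself, not only an extension of its restriction to S, is regular near S, so
   that its derivative makes sense at every point of S, however thin S is. *)
definition Ck_diffeo_on :: "nat \<Rightarrow> 'e::euclidean_space set \<Rightarrow> ('e \<Rightarrow> 'e) \<Rightarrow> bool" where
  "Ck_diffeo_on k S f \<longleftrightarrow> (\<exists>W h. open W \<and> S \<subseteq> W \<and> Ck_on k W f \<and>
     open (f ` W) \<and> Ck_on k (f ` W) h \<and> (\<forall>x\<in>W. h (f x) = x))"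


(* Omega is the whole type 'a; its metric is used only for its topology.  Countable
   index sets are rendered as sets of naturals.  chart i is U_i, subchart i j is V_ij,
   coord i is phi_i and transition i k is alpha_ik. *)
record ('a, 'e) branched_atlas =
  idx :: "nat set"
  subidx :: "nat \<Rightarrow> nat set"
  chart :: "nat \<Rightarrow> 'a set"
  subchart :: "nat \<Rightarrow> nat \<Rightarrow> 'a set"
  coord :: "nat \<Rightarrow> 'a \<Rightarrow> 'e"
  transition :: "nat \<Rightarrow> nat \<Rightarrow> 'e \<Rightarrow> 'e"

(* D alpha_ik at the point x, mapping coordinates in chart k to coordinates in chart i *)
definition Dtrans :: "('a, 'e::euclidean_space) branched_atlas \<Rightarrow> nat \<Rightarrow> nat \<Rightarrow> 'a \<Rightarrow> 'e \<Rightarrow> 'e" where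
  "Dtrans M i k x = frechet_derivative (transition M i k) (at (coord M k x))"

(* The last clause makes the identification (x,v,i,j) ~ (x,v',i',j') of tangent vectors an
   equivalence relation.  It follows from the other clauses wherever the overlap of the
   three charts spans all tangent directions. *)
definition branched_manifold :: "nat \<Rightarrow> ('a::metric_space, 'e::euclidean_space) branched_atlas \<Rightarrow> bool" where
  "branched_manifold r M \<longleftrightarrow>
     (\<forall>i\<in>idx M. closed (chart M i)
        \<and> (\<exists>c \<rho>. 0 < \<rho> \<and> coord M i ` chart M i \<subseteq> cball c \<rho>)
        \<and> (\<Union>j\<in>subidx M i. subchart M i j) = chart M i
        \<and> (\<forall>j\<in>subidx M i. closed (subchart M i j)
             \<and> closed (coord M i ` subchart M i j)
             \<and> (\<exists>h. homeomorphism (subchart M i j) (coord M i ` subchart M i j) (coord M i) h)))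
   \<and> (\<Union>i\<in>idx M. interior (chart M i)) = UNIV
   \<and> (\<forall>i\<in>idx M. \<forall>k\<in>idx M.
        Ck_diffeo_on r (coord M k ` (chart M i \<inter> chart M k)) (transition M i k)
        \<and> (\<forall>x\<in>chart M i \<inter> chart M k. coord M i x = transition M i k (coord M k x)))
   \<and> (\<forall>i\<in>idx M. \<forall>k\<in>idx M. \<forall>l\<in>idx M. \<forall>x\<in>chart M i \<inter> chart M k \<inter> chart M l.
        Dtrans M i l x = Dtrans M i k x \<circ> Dtrans M k l x)"

definition finite_branches :: "('a, 'e) branched_atlas \<Rightarrow> bool" where
  "finite_branches M \<longleftrightarrow> finite (idx M) \<and> (\<forall>i\<in>idx M. finite (subidx M i))"

definition bm_interior :: "('a, 'e::euclidean_space) branched_atlas \<Rightarrow> 'a set" where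
  "bm_interior M = {p. \<exists>i\<in>idx M. \<exists>G \<delta>. G \<subseteq> chart M i \<and> 0 < \<delta> \<and> p \<in> G
     \<and> coord M i ` G = {coord M i p + y |y. norm y < \<delta>}}"

definition bm_boundary :: "('a, 'e::euclidean_space) branched_atlas \<Rightarrow> 'a set" where
  "bm_boundary M = - bm_interior M"

(* f in the coordinates of the subchart V_ij, as a function on coord M i ` subchart M i j *)
definition local_rep :: "('a, 'e) branched_atlas \<Rightarrow> nat \<Rightarrow> nat \<Rightarrow> ('a \<Rightarrow> 'b) \<Rightarrow> 'e \<Rightarrow> 'b" where
  "local_rep M i j f = f \<circ> inv_into (subchart M i j) (coord M i)"

definition Ck_function :: "nat \<Rightarrow> ('a, 'e::euclidean_space) branched_atlas \<Rightarrow> ('a \<Rightarrow> complex) \<Rightarrow> bool" where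
  "Ck_function k M f \<longleftrightarrow> (\<forall>i\<in>idx M. \<forall>j\<in>subidx M i.
     Ck_on_set k (coord M i ` subchart M i j) (local_rep M i j f))"


(* A tangent vector at x is represented by its coordinates v in a chart i containing x, two
   representatives being identified by Dtrans.  A vector field U is the family of its
   coordinate expressions: U i x represents the vector at x in the chart i. *)
definition vector_field :: "('a, 'e::euclidean_space) branched_atlas \<Rightarrow> (nat \<Rightarrow> 'a \<Rightarrow> 'e) \<Rightarrow> bool" where
  "vector_field M U \<longleftrightarrow> (\<forall>i\<in>idx M. \<forall>k\<in>idx M. \<forall>x\<in>chart M i \<inter> chart M k.
     U i x = Dtrans M i k x (U k x))"

definition continuous_vector_field ::
  "('a::metric_space, 'e::euclidean_space) branched_atlas \<Rightarrow> (nat \<Rightarrow> 'a \<Rightarrow> 'e) \<Rightarrow> bool" where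
  "continuous_vector_field M U \<longleftrightarrow> vector_field M U \<and> (\<forall>i\<in>idx M. continuous_on (chart M i) (U i))"

definition Ck_vector_field ::
  "nat \<Rightarrow> ('a::metric_space, 'e::euclidean_space) branched_atlas \<Rightarrow> (nat \<Rightarrow> 'a \<Rightarrow> 'e) \<Rightarrow> bool" where
  "Ck_vector_field k M U \<longleftrightarrow> continuous_vector_field M U \<and> (\<forall>i\<in>idx M. \<forall>j\<in>subidx M i.
     Ck_on_set k (coord M i ` subchart M i j) (local_rep M i j (U i)))"

(* g i x v w is the inner product at x of the vectors with coordinates v, w in the chart i. *)
definition tangent_inner_product ::
  "('a::metric_space, 'e::euclidean_space) branched_atlas \<Rightarrow> (nat \<Rightarrow> 'a \<Rightarrow> 'e \<Rightarrow> 'e \<Rightarrow> real) \<Rightarrow> bool" where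
  "tangent_inner_product M g \<longleftrightarrow>
     (\<forall>i\<in>idx M. \<forall>x\<in>chart M i. bilinear (g i x)
        \<and> (\<forall>v w. g i x v w = g i x w v) \<and> (\<forall>v. v \<noteq> 0 \<longrightarrow> 0 < g i x v v))
   \<and> (\<forall>i\<in>idx M. \<forall>k\<in>idx M. \<forall>x\<in>chart M i \<inter> chart M k. \<forall>v w.
        g i x (Dtrans M i k x v) (Dtrans M i k x w) = g k x v w)
   \<and> (\<forall>i\<in>idx M. \<forall>v w. continuous_on (chart M i) (\<lambda>x. g i x v w))"

definition tnorm :: "(nat \<Rightarrow> 'a \<Rightarrow> 'e \<Rightarrow> 'e \<Rightarrow> real) \<Rightarrow> nat \<Rightarrow> 'a \<Rightarrow> 'e \<Rightarrow> real" where
  "tnorm g i x v = sqrt (g i x v v)"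

(* zeta is the function "U eta".  Stated as a relation, because at a point lying in several
   subcharts the derivatives of eta computed in them have to agree for "U eta" to make sense. *)
definition has_derivative_along :: "('a::metric_space, 'e::euclidean_space) branched_atlas \<Rightarrow>
    (nat \<Rightarrow> 'a \<Rightarrow> 'e) \<Rightarrow> ('a \<Rightarrow> complex) \<Rightarrow> ('a \<Rightarrow> complex) \<Rightarrow> bool" where
  "has_derivative_along M U \<eta> \<zeta> \<longleftrightarrow> \<zeta> \<in> borel_measurable borel \<and>
     (\<forall>i\<in>idx M. \<forall>j\<in>subidx M i. \<forall>x\<in>subchart M i j. \<exists>L.
        (local_rep M i j \<eta> has_derivative L) (at (coord M i x) within coord M i ` subchart M i j)
        \<and> \<zeta> x = L (U i x))"


definition associated_semiflow :: "('a::metric_space, 'e::euclidean_space) branched_atlas \<Rightarrow>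
    (nat \<Rightarrow> 'a \<Rightarrow> 'e) \<Rightarrow> (real \<Rightarrow> 'a \<Rightarrow> 'a) \<Rightarrow> bool" where
  "associated_semiflow M X \<Phi> \<longleftrightarrow>
     \<Phi> 0 = id \<and> (\<forall>t\<ge>0. \<forall>s\<ge>0. \<Phi> (t + s) = \<Phi> t \<circ> \<Phi> s)
   \<and> continuous_on ({0..} \<times> UNIV) (\<lambda>(t, x). \<Phi> t x)
   \<and> (\<forall>p. \<forall>t\<ge>0. \<forall>i\<in>idx M. \<Phi> t p \<in> interior (chart M i) \<longrightarrow>
        ((\<lambda>s. coord M i (\<Phi> s p)) has_vector_derivative X i (\<Phi> t p)) (at t within {0..}))"

(* The charts defining a foliation need not be among the given charts of Omega; they
   belong to some larger atlas. *)
definition atlas_extends :: "('a, 'e) branched_atlas \<Rightarrow> ('a, 'e) branched_atlas \<Rightarrow> bool" where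
  "atlas_extends N M \<longleftrightarrow> idx M \<subseteq> idx N \<and>
     (\<forall>i\<in>idx M. subidx N i = subidx M i \<and> chart N i = chart M i \<and> coord N i = coord M i
        \<and> (\<forall>j\<in>subidx M i. subchart N i j = subchart M i j)
        \<and> (\<forall>k\<in>idx M. transition N i k = transition M i k))"

(* One-dimensional leaves in dimension two: the first coordinate is constant on plaques. *)
definition foliated_charts :: "('a::metric_space, real^2) branched_atlas \<Rightarrow> nat set \<Rightarrow> bool" where
  "foliated_charts N F \<longleftrightarrow> F \<subseteq> idx N \<and> (\<Union>i\<in>F. interior (chart N i)) = UNIV
   \<and> (\<forall>i\<in>F. \<forall>k\<in>F. \<exists>a. \<forall>y\<in>coord N k ` (chart N i \<inter> chart N k). transition N i k y $ 1 = a (y $ 1))"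

(* In a branched chart the set x = const may consist of several sheets, so plaques are its
   connected components. *)
definition same_plaque :: "('a::metric_space, real^2) branched_atlas \<Rightarrow> nat set \<Rightarrow> 'a \<Rightarrow> 'a \<Rightarrow> bool" where
  "same_plaque N F p q \<longleftrightarrow> (\<exists>i\<in>F. p \<in> chart N i \<and>
     connected_component {x \<in> chart N i. coord N i x $ 1 = coord N i p $ 1} p q)"

definition leaf :: "('a::metric_space, real^2) branched_atlas \<Rightarrow> nat set \<Rightarrow> 'a \<Rightarrow> 'a set" where
  "leaf N F p = {q. (same_plaque N F)\<^sup>*\<^sup>* p q}"

definition integral_curve :: "('a::metric_space, 'e::euclidean_space) branched_atlas \<Rightarrow>
    (nat \<Rightarrow> 'a \<Rightarrow> 'e) \<Rightarrow> real set \<Rightarrow> (real \<Rightarrow> 'a) \<Rightarrow> bool" where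
  "integral_curve M V T \<gamma> \<longleftrightarrow> continuous_on T \<gamma> \<and>
     (\<forall>t\<in>T. \<forall>i\<in>idx M. \<gamma> t \<in> interior (chart M i) \<longrightarrow>
        ((\<lambda>s. coord M i (\<gamma> s)) has_vector_derivative V i (\<gamma> t)) (at t within T))"

(* S is a curve of length greater than delta with end points in the boundary.  The integral
   curves of the unit field V are parametrized by arc length; the second alternative is that
   of closed curves, of length l. *)
definition leaf_curve :: "('a::metric_space, 'e::euclidean_space) branched_atlas \<Rightarrow>
    (nat \<Rightarrow> 'a \<Rightarrow> 'e) \<Rightarrow> real \<Rightarrow> 'a set \<Rightarrow> bool" where
  "leaf_curve M V \<delta> S \<longleftrightarrow> (\<exists>T \<gamma>. is_interval T \<and> closed T \<and> integral_curve M V T \<gamma> \<and> \<gamma> ` T = S \<and>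
     ((inj_on \<gamma> T \<and> (\<exists>a\<in>T. \<exists>b\<in>T. b - a > \<delta>)
         \<and> (\<forall>t\<in>T. (\<forall>s\<in>T. t \<le> s) \<or> (\<forall>s\<in>T. s \<le> t) \<longrightarrow> \<gamma> t \<in> bm_boundary M))
      \<or> (T = UNIV \<and> (\<exists>l>\<delta>. \<forall>s t. \<gamma> s = \<gamma> t \<longleftrightarrow> (\<exists>k::int. t - s = of_int k * l)))))"

(* Orientability of the foliation is the existence of the continuous unit tangent field V.
   In the expansion condition L is the derivative of the time-t map in coordinates.  The
   inequality is required for vectors u with nonnegative V-component only: if it held for all
   u, then applying it to u and -u would turn it into an equality. *)
definition uniformly_expanding :: "('a::metric_space, real^2) branched_atlas \<Rightarrow>
    (nat \<Rightarrow> 'a \<Rightarrow> real^2 \<Rightarrow> real^2 \<Rightarrow> real) \<Rightarrow> (nat \<Rightarrow> 'a \<Rightarrow> real^2) \<Rightarrow>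
    (real \<Rightarrow> 'a \<Rightarrow> 'a) \<Rightarrow> real \<Rightarrow> bool" where
  "uniformly_expanding M g X \<Phi> lam \<longleftrightarrow> 0 < lam \<and> (\<exists>N F V.
     branched_manifold 2 N \<and> atlas_extends N M \<and> foliated_charts N F
   \<and> continuous_vector_field N V
   \<and> (\<forall>i\<in>F. \<forall>x\<in>chart N i. V i x $ 1 = 0)
   \<and> (\<forall>i\<in>idx M. \<forall>x\<in>chart M i. tnorm g i x (V i x) = 1)
   \<and> (\<exists>\<delta>>0. \<forall>p. leaf_curve M V \<delta> (leaf N F p))
   \<and> (\<exists>\<kappa>>0. \<forall>i\<in>idx M. \<forall>x\<in>chart M i. X i x \<noteq> 0 \<and>
        (\<forall>s. tnorm g i x (X i x - s *\<^sub>R V i x) \<ge> \<kappa> * tnorm g i x (X i x)))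
   \<and> (\<exists>C>0. \<forall>t\<ge>0. \<forall>i\<in>idx M. \<forall>j\<in>subidx M i. \<forall>p\<in>subchart M i j. \<forall>k\<in>idx M.
        \<Phi> t p \<in> interior (chart M k) \<longrightarrow>
        (\<exists>L. (local_rep M i j (\<lambda>q. coord M k (\<Phi> t q)) has_derivative L)
                (at (coord M i p) within coord M i ` subchart M i j)
           \<and> (\<forall>u. 0 \<le> g i p u (V i p) \<longrightarrow>
                g k (\<Phi> t p) (L u) (V k (\<Phi> t p)) \<ge> inverse C * exp (lam * t) * g i p u (V i p)))))"

definition expanding_semiflow_setting :: "('a::metric_space, real^2) branched_atlas \<Rightarrow>
    (nat \<Rightarrow> 'a \<Rightarrow> real^2 \<Rightarrow> real^2 \<Rightarrow> real) \<Rightarrow> (nat \<Rightarrow> 'a \<Rightarrow> real^2) \<Rightarrow>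
    (real \<Rightarrow> 'a \<Rightarrow> 'a) \<Rightarrow> real \<Rightarrow> bool" where
  "expanding_semiflow_setting M g X \<Phi> lam \<longleftrightarrow>
     branched_manifold 2 M \<and> finite_branches M \<and> tangent_inner_product M g
   \<and> Ck_vector_field 2 M X \<and> associated_semiflow M X \<Phi> \<and> uniformly_expanding M g X \<Phi> lam"


(* Complex Borel measures; the value off the Borel sets is normalized to 0 so that equality
   of measures is equality of functions. *)
definition complex_measures :: "('a::topological_space set \<Rightarrow> complex) set" where
  "complex_measures = {\<mu>. (\<forall>A. A \<notin> sets borel \<longrightarrow> \<mu> A = 0) \<and>
     (\<forall>A::nat \<Rightarrow> 'a set. range A \<subseteq> sets borel \<longrightarrow> disjoint_family A \<longrightarrow>
        (\<lambda>n. \<mu> (A n)) sums \<mu> (\<Union>n. A n))}"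

(* positive part in the Jordan decomposition of a finite signed measure *)
definition positive_part :: "('a::topological_space set \<Rightarrow> real) \<Rightarrow> 'a measure" where
  "positive_part \<nu> = measure_of UNIV (sets borel)
     (\<lambda>A. ennreal (SUP B\<in>{B \<in> sets borel. B \<subseteq> A}. \<nu> B))"

(* the integral of f with respect to the complex measure mu, written mu(f) in the comments *)
definition cint :: "('a::topological_space set \<Rightarrow> complex) \<Rightarrow> ('a \<Rightarrow> complex) \<Rightarrow> complex" where
  "cint \<mu> f =
     (integral\<^sup>L (positive_part (\<lambda>A. Re (\<mu> A))) f - integral\<^sup>L (positive_part (\<lambda>A. - Re (\<mu> A))) f)
   + \<i> * (integral\<^sup>L (positive_part (\<lambda>A. Im (\<mu> A))) f - integral\<^sup>L (positive_part (\<lambda>A. - Im (\<mu> A))) f)"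

definition total_variation :: "('a::topological_space set \<Rightarrow> complex) \<Rightarrow> real" where
  "total_variation \<mu> = (SUP \<eta>\<in>{\<eta>. continuous_on UNIV \<eta> \<and> (\<forall>x. norm (\<eta> x) \<le> 1)}. norm (cint \<mu> \<eta>))"

definition push_forward :: "(real \<Rightarrow> 'a \<Rightarrow> 'a) \<Rightarrow> real \<Rightarrow>
    ('a::topological_space set \<Rightarrow> complex) \<Rightarrow> ('a set \<Rightarrow> complex)" where
  "push_forward \<Phi> t \<mu> = (THE \<nu>. \<nu> \<in> complex_measures \<and>
     (\<forall>\<eta>. continuous_on UNIV \<eta> \<longrightarrow> cint \<nu> \<eta> = cint \<mu> (\<eta> \<circ> \<Phi> t)))"

(* The operator P(z).  The integral over t is taken weakly, against continuous functions: for
   a Dirac measure mu the curve sending t to push_forward \<Phi> t mu is in general not separably valued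
   in the total variation norm, so it is not Bochner integrable; when it is, the two
   integrals agree. *)
definition resolvent_measure :: "(real \<Rightarrow> 'a \<Rightarrow> 'a) \<Rightarrow> complex \<Rightarrow>
    ('a::topological_space set \<Rightarrow> complex) \<Rightarrow> ('a set \<Rightarrow> complex)" where
  "resolvent_measure \<Phi> z \<mu> = (THE \<nu>. \<nu> \<in> complex_measures \<and>
     (\<forall>\<eta>. continuous_on UNIV \<eta> \<longrightarrow>
        cint \<nu> \<eta> = (LINT t:{0..}|lborel. exp (- z * of_real t) * cint (push_forward \<Phi> t \<mu>) \<eta>)))"


definition C10 :: "('a::metric_space, 'e::euclidean_space) branched_atlas \<Rightarrow> ('a \<Rightarrow> complex) set" where
  "C10 M = {\<eta>. continuous_on UNIV \<eta> \<and> Ck_function 1 M \<eta> \<and> (\<forall>p\<in>bm_boundary M. \<eta> p = 0)}"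

(* nu is a derivative D_U mu.  It is determined only up to measures carried by the boundary,
   where the test functions vanish; the norm of D_U mu is that of the smallest such nu. *)
definition is_measure_derivative :: "('a::metric_space, 'e::euclidean_space) branched_atlas \<Rightarrow>
    (nat \<Rightarrow> 'a \<Rightarrow> 'e) \<Rightarrow> ('a set \<Rightarrow> complex) \<Rightarrow> ('a set \<Rightarrow> complex) \<Rightarrow> bool" where
  "is_measure_derivative M U \<mu> \<nu> \<longleftrightarrow> \<nu> \<in> complex_measures \<and>
     (\<forall>\<eta>\<in>C10 M. \<forall>\<zeta>. has_derivative_along M U \<eta> \<zeta> \<longrightarrow> cint \<mu> \<zeta> = - cint \<nu> \<eta>)"

definition derivative_norm :: "('a::metric_space, 'e::euclidean_space) branched_atlas \<Rightarrow>
    (nat \<Rightarrow> 'a \<Rightarrow> 'e) \<Rightarrow> ('a set \<Rightarrow> complex) \<Rightarrow> real" where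
  "derivative_norm M U \<mu> = Inf (total_variation ` {\<nu>. is_measure_derivative M U \<mu> \<nu>})"

(* Vector fields of class C^1 with |U| \<le> 1 and |DU| \<le> 1 in coordinates.  Without the bound on
   DU, i.e. with all continuous U such that |U| \<le> 1, the supremum of derivative_norm would be
   infinite for every measure charging the interior: mu(U eta) would be bounded by K sup|eta|
   uniformly in U, hence the integral of |D eta| with respect to |mu| would be, which fails for
   rapidly oscillating eta.  With the bound, mu is in diff_measures when its density in
   coordinates is smooth and compactly supported (a BV-type space). *)
definition unit_test_fields :: "('a::metric_space, 'e::euclidean_space) branched_atlas \<Rightarrow>
    (nat \<Rightarrow> 'a \<Rightarrow> 'e \<Rightarrow> 'e \<Rightarrow> real) \<Rightarrow> (nat \<Rightarrow> 'a \<Rightarrow> 'e) set" where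
  "unit_test_fields M g = {U. Ck_vector_field 1 M U
     \<and> (\<forall>i\<in>idx M. \<forall>x\<in>chart M i. tnorm g i x (U i x) \<le> 1)
     \<and> (\<forall>i\<in>idx M. \<forall>j\<in>subidx M i. \<forall>x\<in>subchart M i j. \<exists>L.
          (local_rep M i j (U i) has_derivative L) (at (coord M i x) within coord M i ` subchart M i j)
          \<and> onorm L \<le> 1)}"

definition diff_measures :: "('a::metric_space, 'e::euclidean_space) branched_atlas \<Rightarrow>
    (nat \<Rightarrow> 'a \<Rightarrow> 'e \<Rightarrow> 'e \<Rightarrow> real) \<Rightarrow> ('a set \<Rightarrow> complex) set" where
  "diff_measures M g = {\<mu> \<in> complex_measures.
     (\<forall>U\<in>unit_test_fields M g. \<exists>\<nu>. is_measure_derivative M U \<mu> \<nu>)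
     \<and> bdd_above ((\<lambda>U. derivative_norm M U \<mu>) ` unit_test_fields M g)}"

definition diff_norm :: "('a::metric_space, 'e::euclidean_space) branched_atlas \<Rightarrow>
    (nat \<Rightarrow> 'a \<Rightarrow> 'e \<Rightarrow> 'e \<Rightarrow> real) \<Rightarrow> ('a set \<Rightarrow> complex) \<Rightarrow> real" where
  "diff_norm M g \<mu> = (SUP U\<in>unit_test_fields M g. derivative_norm M U \<mu>) + total_variation \<mu>"


(* Operators on a complex normed space given by a carrier E of complex-valued functions
   (with pointwise operations) and a norm n on E.  Only the restriction of an operator to E
   is relevant. *)
definition bounded_operators ::
  "('b \<Rightarrow> complex) set \<Rightarrow> (('b \<Rightarrow> complex) \<Rightarrow> real) \<Rightarrow> (('b \<Rightarrow> complex) \<Rightarrow> 'b \<Rightarrow> complex) set" where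
  "bounded_operators E n = {T. (\<forall>\<mu>\<in>E. T \<mu> \<in> E)
     \<and> (\<forall>\<mu>\<in>E. \<forall>\<nu>\<in>E. \<forall>c. T (\<lambda>A. \<mu> A + c * \<nu> A) = (\<lambda>A. T \<mu> A + c * T \<nu> A))
     \<and> (\<exists>K. \<forall>\<mu>\<in>E. n (T \<mu>) \<le> K * n \<mu>)}"

definition operator_norm ::
  "('b \<Rightarrow> complex) set \<Rightarrow> (('b \<Rightarrow> complex) \<Rightarrow> real) \<Rightarrow> (('b \<Rightarrow> complex) \<Rightarrow> 'b \<Rightarrow> complex) \<Rightarrow> real" where
  "operator_norm E n T = (SUP \<mu>\<in>{\<mu>\<in>E. n \<mu> \<le> 1}. n (T \<mu>))"

definition operator_spectrum ::
  "('b \<Rightarrow> complex) set \<Rightarrow> (('b \<Rightarrow> complex) \<Rightarrow> real) \<Rightarrow> (('b \<Rightarrow> complex) \<Rightarrow> 'b \<Rightarrow> complex) \<Rightarrow> complex set" where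
  "operator_spectrum E n T = {c. \<not> (\<exists>R\<in>bounded_operators E n. \<forall>\<mu>\<in>E.
     R (\<lambda>A. c * \<mu> A - T \<mu> A) = \<mu> \<and> (\<lambda>A. c * R \<mu> A - T (R \<mu>) A) = \<mu>)}"

definition is_eigenvector ::
  "('b \<Rightarrow> complex) set \<Rightarrow> (('b \<Rightarrow> complex) \<Rightarrow> 'b \<Rightarrow> complex) \<Rightarrow> complex \<Rightarrow> ('b \<Rightarrow> complex) \<Rightarrow> bool" where
  "is_eigenvector E T c \<mu> \<longleftrightarrow> \<mu> \<in> E \<and> \<mu> \<noteq> (\<lambda>_. 0) \<and> T \<mu> = (\<lambda>A. c * \<mu> A)"

definition is_eigenvalue ::
  "('b \<Rightarrow> complex) set \<Rightarrow> (('b \<Rightarrow> complex) \<Rightarrow> 'b \<Rightarrow> complex) \<Rightarrow> complex \<Rightarrow> bool" where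
  "is_eigenvalue E T c \<longleftrightarrow> (\<exists>\<mu>. is_eigenvector E T c \<mu>)"

(* complex differentiability in the operator norm; S is meant to be open *)
definition op_holomorphic_on ::
  "('b \<Rightarrow> complex) set \<Rightarrow> (('b \<Rightarrow> complex) \<Rightarrow> real) \<Rightarrow>
   (complex \<Rightarrow> ('b \<Rightarrow> complex) \<Rightarrow> 'b \<Rightarrow> complex) \<Rightarrow> complex set \<Rightarrow> bool" where
  "op_holomorphic_on E n P S \<longleftrightarrow> (\<forall>z\<in>S. P z \<in> bounded_operators E n \<and>
     (\<exists>L\<in>bounded_operators E n.
        ((\<lambda>w. operator_norm E n (\<lambda>\<mu> A. (P w \<mu> A - P z \<mu> A) / (w - z) - L \<mu> A)) \<longlongrightarrow> 0) (at z)))"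

(* Near z0, P(w) = Q(w) / (w - z0)^m with Q holomorphic; the value at z0 itself is irrelevant. *)
definition op_laurent_at ::
  "('b \<Rightarrow> complex) set \<Rightarrow> (('b \<Rightarrow> complex) \<Rightarrow> real) \<Rightarrow>
   (complex \<Rightarrow> ('b \<Rightarrow> complex) \<Rightarrow> 'b \<Rightarrow> complex) \<Rightarrow> complex \<Rightarrow> nat \<Rightarrow>
   (complex \<Rightarrow> ('b \<Rightarrow> complex) \<Rightarrow> 'b \<Rightarrow> complex) \<Rightarrow> bool" where
  "op_laurent_at E n P z0 m Q \<longleftrightarrow> (\<exists>r>0. op_holomorphic_on E n Q (ball z0 r) \<and>
     (\<forall>w\<in>ball z0 r - {z0}. \<forall>\<mu>\<in>E. P w \<mu> = (\<lambda>A. Q w \<mu> A / (w - z0) ^ m)))"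

definition op_meromorphic_on ::
  "('b \<Rightarrow> complex) set \<Rightarrow> (('b \<Rightarrow> complex) \<Rightarrow> real) \<Rightarrow>
   (complex \<Rightarrow> ('b \<Rightarrow> complex) \<Rightarrow> 'b \<Rightarrow> complex) \<Rightarrow> complex set \<Rightarrow> bool" where
  "op_meromorphic_on E n P S \<longleftrightarrow> (\<forall>z0\<in>S. \<exists>m Q. op_laurent_at E n P z0 m Q)"

definition op_has_pole ::
  "('b \<Rightarrow> complex) set \<Rightarrow> (('b \<Rightarrow> complex) \<Rightarrow> real) \<Rightarrow>
   (complex \<Rightarrow> ('b \<Rightarrow> complex) \<Rightarrow> 'b \<Rightarrow> complex) \<Rightarrow> complex \<Rightarrow> bool" where
  "op_has_pole E n P z0 \<longleftrightarrow>
     (\<exists>m Q. 0 < m \<and> op_laurent_at E n P z0 m Q \<and> (\<exists>\<mu>\<in>E. Q z0 \<mu> \<noteq> (\<lambda>_. 0)))"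

end

(* The total mass of P(z) \<mu> is \<mu>(\<Omega>) / z, so P has a singularity at 0 as soon as some \<mu> in the space
   of differentiable measures has nonzero mass.  Such a \<mu> is given by a C^1 density supported in
   the interior of the image of a subchart, and some subchart has interior: near a point where the
   flow crosses a leaf transversally, flowing the leaf for a short time covers an open half disc
   up to a small error, so the image in the chart has interior by Brouwer's theorem, and one of the
   finitely many closed subcharts has interior.  The resolvent identity for
   z \<mapsto> P(z) shows that the leading Laurent coefficient at 0 takes its values in the measures \<nu>
   with P(w) \<nu> = \<nu> / w, and that this space does not depend on w.  By uniqueness of Laplace
   transforms it is the space of measures invariant under the semiflow. *)
theory Submission
  imports Defs "HOL-Complex_Analysis.Complex_Analysis" "HOL-Real_Asymp.Real_Asymp"
begin

subsection \<open>Complex measures\<close>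

lemma complex_measures_sums:
  assumes "\<mu> \<in> complex_measures" "range A \<subseteq> sets borel" "disjoint_family A"
  shows "(\<lambda>n. \<mu> (A n)) sums \<mu> (\<Union>n. A n)"
  using assms unfolding complex_measures_def by blast

lemma complex_measures_nonborel:
  "\<mu> \<in> complex_measures \<Longrightarrow> A \<notin> sets borel \<Longrightarrow> \<mu> A = 0"
  unfolding complex_measures_def by blast

lemma complex_measures_eqI:
  assumes "\<mu> \<in> complex_measures" "\<nu> \<in> complex_measures"
    and "\<And>A. A \<in> sets borel \<Longrightarrow> \<mu> A = \<nu> A"
  shows "\<mu> = \<nu>"
  using assms by (metis complex_measures_nonborel ext)

lemma complex_measures_empty:
  assumes "\<mu> \<in> complex_measures" shows "\<mu> {} = 0"
proof -
  have "(\<lambda>n::nat. \<mu> {}) sums \<mu> {}"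
    using complex_measures_sums[OF assms, of "\<lambda>_. {}"] by (simp add: disjoint_family_on_def)
  then have "(\<lambda>n::nat. \<mu> {}) \<longlonglongrightarrow> 0"
    by (meson sums_summable summable_LIMSEQ_zero)
  then show ?thesis by (simp add: LIMSEQ_const_iff)
qed

lemma complex_measures_Un:
  assumes "\<mu> \<in> complex_measures" "A \<in> sets borel" "B \<in> sets borel" "A \<inter> B = {}"
  shows "\<mu> (A \<union> B) = \<mu> A + \<mu> B"
proof -
  have "(\<lambda>n. \<mu> (binaryset A B n)) sums \<mu> (\<Union>n. binaryset A B n)"
  proof (rule complex_measures_sums[OF assms(1)])
    show "range (binaryset A B) \<subseteq> sets borel"
      using assms by (auto simp: binaryset_def)
    show "disjoint_family (binaryset A B)"
      using assms by (auto simp: disjoint_family_on_def binaryset_def)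
  qed
  then have "(\<lambda>n. \<mu> (binaryset A B n)) sums \<mu> (A \<union> B)"
    by (simp add: UN_binaryset_eq)
  moreover have "(\<lambda>n. \<mu> (binaryset A B n)) sums (\<mu> A + \<mu> B)"
    by (rule binaryset_sums) (rule complex_measures_empty[OF assms(1)])
  ultimately show ?thesis by (rule sums_unique2)
qed

lemma complex_measures_split:
  assumes "\<mu> \<in> complex_measures" "A \<in> sets borel" "B \<in> sets borel"
  shows "\<mu> A = \<mu> (A \<inter> B) + \<mu> (A - B)"
proof -
  have "A = (A \<inter> B) \<union> (A - B)" by blast
  then show ?thesis
    using complex_measures_Un[OF assms(1), of "A \<inter> B" "A - B"] assms by auto
qed

lemma complex_measures_Diff:
  assumes "\<mu> \<in> complex_measures" "A \<in> sets borel" "B \<in> sets borel" "B \<subseteq> A"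
  shows "\<mu> (A - B) = \<mu> A - \<mu> B"
  using complex_measures_split[OF assms(1-3)] assms(4) by (simp add: Int_absorb1)

lemma complex_measures_lincomb:
  assumes "\<mu> \<in> complex_measures" "\<nu> \<in> complex_measures"
  shows "(\<lambda>A. \<mu> A + c * \<nu> A) \<in> complex_measures"
  using assms unfolding complex_measures_def by (auto intro!: sums_add sums_mult)

lemma complex_measures_zero: "(\<lambda>A. 0) \<in> complex_measures"
  unfolding complex_measures_def by auto

lemma complex_measures_scale:
  "\<mu> \<in> complex_measures \<Longrightarrow> (\<lambda>A. c * \<mu> A) \<in> complex_measures"
  using complex_measures_lincomb[OF complex_measures_zero, of \<mu> c] by simp

text \<open>Suppose the values on Borel subsets of \<open>X\<close> are unbounded. Some
  \<open>B\<close> in \<open>X\<close> has a value so large that both \<open>B\<close> and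
  \<open>X - B\<close> have measure of modulus at least 1, and one of the two is again unbounded.
  Keeping that one and discarding the other, forever, produces disjoint discarded pieces whose
  measures do not tend to 0, against the convergence of the series.\<close>

lemma complex_measures_bounded:
  fixes \<mu> :: "'a::topological_space set \<Rightarrow> complex"
  assumes \<mu>: "\<mu> \<in> complex_measures"
  shows "\<exists>K. \<forall>A. norm (\<mu> A) \<le> K"
proof (rule ccontr)
  assume no: "\<not> ?thesis"
  define unb where "unb X \<longleftrightarrow> X \<in> sets borel \<and> (\<forall>K. \<exists>B\<in>sets borel. B \<subseteq> X \<and> norm (\<mu> B) > K)" for X
  have "unb UNIV"
    unfolding unb_def
  proof (intro conjI allI)
    fix K
    obtain A where A: "norm (\<mu> A) > max K 0" using no by (meson not_le)
    then have "A \<in> sets borel" using complex_measures_nonborel[OF \<mu>] by force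
    then show "\<exists>B\<in>sets borel. B \<subseteq> UNIV \<and> norm (\<mu> B) > K" using A by auto
  qed simp
  moreover have step: "\<exists>Y. unb Y \<and> (Y \<subseteq> X \<and> norm (\<mu> (X - Y)) \<ge> 1)" if X: "unb X" for X
  proof -
    obtain B where B: "B \<in> sets borel" "B \<subseteq> X" "norm (\<mu> B) > norm (\<mu> X) + 1"
      using X unfolding unb_def by blast
    have Xb: "X \<in> sets borel" using X unfolding unb_def by blast
    have d: "\<mu> (X - B) = \<mu> X - \<mu> B"
      by (rule complex_measures_Diff[OF \<mu> Xb B(1,2)])
    have "norm (\<mu> B) \<le> norm (\<mu> X) + norm (\<mu> (X - B))"
      unfolding d by (metis norm_triangle_sub norm_minus_commute)
    then have 1: "norm (\<mu> (X - B)) \<ge> 1" using B by linarith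
    have 2: "norm (\<mu> B) \<ge> 1" using B(3) norm_ge_zero[of "\<mu> X"] by linarith
    show ?thesis
    proof (cases "unb B")
      case True
      then show ?thesis using B 1 by blast
    next
      case False
      then obtain K1 where K1: "\<And>C. C \<in> sets borel \<Longrightarrow> C \<subseteq> B \<Longrightarrow> norm (\<mu> C) \<le> K1"
        unfolding unb_def using B(1) by (meson not_le)
      have "unb (X - B)"
        unfolding unb_def
      proof (intro conjI allI)
        show "X - B \<in> sets borel" using Xb B by auto
        fix K
        \<comment> \<open>\<open>K1\<close> bounds the contribution of the part of \<open>C\<close>
          inside \<open>B\<close>, so that more than \<open>K\<close> is left outside.\<close>
        obtain C where C: "C \<in> sets borel" "C \<subseteq> X" "norm (\<mu> C) > K + K1"
          using X unfolding unb_def by blast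
        have "norm (\<mu> C) \<le> norm (\<mu> (C \<inter> B)) + norm (\<mu> (C - B))"
          using complex_measures_split[OF \<mu> C(1) B(1)] norm_triangle_ineq by metis
        moreover have "norm (\<mu> (C \<inter> B)) \<le> K1" using K1 C B by auto
        ultimately have "norm (\<mu> (C - B)) > K" using C by linarith
        then show "\<exists>D\<in>sets borel. D \<subseteq> X - B \<and> norm (\<mu> D) > K"
          using C B by (intro bexI[of _ "C - B"]) auto
      qed
      moreover have "X - (X - B) = B" using B by blast
      ultimately show ?thesis using 2 by (intro exI[of _ "X - B"]) auto
    qed
  qed
  ultimately obtain X where X: "\<And>n::nat. unb (X n)"
      "\<And>n. X (Suc n) \<subseteq> X n \<and> norm (\<mu> (X n - X (Suc n))) \<ge> 1"
    using dependent_nat_choice[of "\<lambda>_. unb" "\<lambda>_ X Y. Y \<subseteq> X \<and> norm (\<mu> (X - Y)) \<ge> 1"] by metis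
  have mono: "X n \<subseteq> X m" if "m \<le> n" for m n
    by (rule lift_Suc_antimono_le[OF _ that]) (use X(2) in blast)
  have "(\<lambda>n. \<mu> (X n - X (Suc n))) sums \<mu> (\<Union>n. X n - X (Suc n))"
  proof (rule complex_measures_sums[OF \<mu>])
    show "range (\<lambda>n. X n - X (Suc n)) \<subseteq> sets borel"
      using X(1) unfolding unb_def by auto
    have "(X m - X (Suc m)) \<inter> (X n - X (Suc n)) = {}" if "m < n" for m n
      using mono[of "Suc m" n] that by auto
    then show "disjoint_family (\<lambda>n. X n - X (Suc n))"
      unfolding disjoint_family_on_def by (metis Int_commute linorder_neqE_nat)
  qed
  then have "(\<lambda>n. \<mu> (X n - X (Suc n))) \<longlonglongrightarrow> 0"
    by (meson sums_summable summable_LIMSEQ_zero)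
  then have "\<forall>\<^sub>F n in sequentially. norm (\<mu> (X n - X (Suc n))) < 1"
    by (auto simp: tendsto_iff dist_norm)
  then obtain n where "norm (\<mu> (X n - X (Suc n))) < 1"
    by (auto simp: eventually_sequentially)
  then show False using X(2)[of n] by linarith
qed

text \<open>An auxiliary norm, equivalent to \<open>total_variation\<close> on a metric space up to
  a factor 4, but directly about values on sets. It gives crude bounds before continuous functions
  are known to approximate indicators.\<close>

definition sup_measure_norm :: "('a::topological_space set \<Rightarrow> complex) \<Rightarrow> real" where
  "sup_measure_norm \<mu> = (SUP A. norm (\<mu> A))"

lemma norm_le_sup_measure_norm:
  assumes "\<mu> \<in> complex_measures" shows "norm (\<mu> A) \<le> sup_measure_norm \<mu>"
proof -
  obtain K where "\<forall>A. norm (\<mu> A) \<le> K" using complex_measures_bounded[OF assms] by blast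
  then have "bdd_above (range (\<lambda>A. norm (\<mu> A)))" by (auto intro: bdd_aboveI)
  then show ?thesis unfolding sup_measure_norm_def by (rule cSUP_upper[rotated]) simp
qed

lemma sup_measure_norm_least: "(\<And>A. norm (\<mu> A) \<le> K) \<Longrightarrow> sup_measure_norm \<mu> \<le> K"
  unfolding sup_measure_norm_def by (intro cSUP_least) auto

lemma sup_measure_norm_nonneg: "\<mu> \<in> complex_measures \<Longrightarrow> 0 \<le> sup_measure_norm \<mu>"
  using norm_le_sup_measure_norm[of \<mu> "{}"] by (meson norm_ge_zero order_trans)

section \<open>Positive parts and the four integrals behind \<open>cint\<close>\<close>

abbreviation re_part :: "('a::topological_space set \<Rightarrow> complex) \<Rightarrow> 'a measure" where
  "re_part \<mu> \<equiv> positive_part (\<lambda>A. Re (\<mu> A))"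

definition re_sup :: "('a::topological_space set \<Rightarrow> complex) \<Rightarrow> 'a set \<Rightarrow> real" where
  "re_sup \<mu> A = (SUP B\<in>{B \<in> sets borel. B \<subseteq> A}. Re (\<mu> B))"

text \<open>The supremum defining the positive part is additive without any Hahn decomposition,
  because a Borel subset of a disjoint union splits along the union.\<close>

context
  fixes \<mu> :: "'a::topological_space set \<Rightarrow> complex"
  assumes \<mu>: "\<mu> \<in> complex_measures"
begin

lemma re_sup_bdd: "bdd_above ((\<lambda>B. Re (\<mu> B)) ` {B \<in> sets borel. B \<subseteq> A})"
proof (rule bdd_aboveI)
  fix r assume "r \<in> (\<lambda>B. Re (\<mu> B)) ` {B \<in> sets borel. B \<subseteq> A}"
  then obtain B where "r = Re (\<mu> B)" by blast
  then show "r \<le> sup_measure_norm \<mu>"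
    using norm_le_sup_measure_norm[OF \<mu>, of B] complex_Re_le_cmod[of "\<mu> B"] by linarith
qed

lemma re_sup_upper: "B \<in> sets borel \<Longrightarrow> B \<subseteq> A \<Longrightarrow> Re (\<mu> B) \<le> re_sup \<mu> A"
  unfolding re_sup_def by (rule cSUP_upper[OF _ re_sup_bdd]) auto

lemma re_sup_least:
  "(\<And>B. B \<in> sets borel \<Longrightarrow> B \<subseteq> A \<Longrightarrow> Re (\<mu> B) \<le> K) \<Longrightarrow> re_sup \<mu> A \<le> K"
  unfolding re_sup_def by (rule cSUP_least) auto

lemma re_sup_nonneg: "0 \<le> re_sup \<mu> A"
  using re_sup_upper[of "{}" A] complex_measures_empty[OF \<mu>] by simp

lemma re_sup_mono: "A \<subseteq> B \<Longrightarrow> re_sup \<mu> A \<le> re_sup \<mu> B"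
  by (rule re_sup_least) (auto intro: re_sup_upper)

lemma re_sup_Un:
  assumes "A \<in> sets borel" "B \<in> sets borel" "A \<inter> B = {}"
  shows "re_sup \<mu> A + re_sup \<mu> B \<le> re_sup \<mu> (A \<union> B)"
proof -
  have *: "Re (\<mu> C) + Re (\<mu> D) \<le> re_sup \<mu> (A \<union> B)"
    if "C \<in> sets borel" "C \<subseteq> A" "D \<in> sets borel" "D \<subseteq> B" for C D
  proof -
    have "Re (\<mu> C) + Re (\<mu> D) = Re (\<mu> (C \<union> D))"
    proof -
      have "C \<inter> D = {}" using that assms by blast
      then show ?thesis using complex_measures_Un[OF \<mu>, of C D] that by simp
    qed
    also have "\<dots> \<le> re_sup \<mu> (A \<union> B)" using that by (intro re_sup_upper) auto
    finally show ?thesis .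
  qed
  have "re_sup \<mu> A \<le> re_sup \<mu> (A \<union> B) - Re (\<mu> D)" if "D \<in> sets borel" "D \<subseteq> B" for D
    using * that by (intro re_sup_least) (auto simp: algebra_simps)
  then have "re_sup \<mu> B \<le> re_sup \<mu> (A \<union> B) - re_sup \<mu> A"
    by (intro re_sup_least) (simp add: algebra_simps)
  then show ?thesis by simp
qed

lemma re_sup_sums:
  assumes A: "range A \<subseteq> sets borel" "disjoint_family A"
  shows "(\<lambda>n. re_sup \<mu> (A n)) sums re_sup \<mu> (\<Union>n. A n)"
proof -
  have part: "(\<Sum>k<n. re_sup \<mu> (A k)) \<le> re_sup \<mu> (\<Union>k<n. A k)" for n
  proof (induction n)
    case 0 then show ?case using re_sup_nonneg by simp
  next
    case (Suc n)
    have "re_sup \<mu> (\<Union>k<n. A k) + re_sup \<mu> (A n) \<le> re_sup \<mu> ((\<Union>k<n. A k) \<union> A n)"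
    proof (rule re_sup_Un)
      show "(\<Union>k<n. A k) \<in> sets borel" "A n \<in> sets borel" using A(1) by auto
      have "A k \<inter> A n = {}" if "k < n" for k
        using A(2) that by (auto simp: disjoint_family_on_def)
      then show "(\<Union>k<n. A k) \<inter> A n = {}" by blast
    qed
    then show ?case using Suc by (simp add: lessThan_Suc Un_commute)
  qed
  have part': "(\<Sum>k<n. re_sup \<mu> (A k)) \<le> re_sup \<mu> (\<Union>k. A k)" for n
    by (rule order_trans[OF part re_sup_mono]) auto
  have sm: "summable (\<lambda>n. re_sup \<mu> (A n))"
    by (rule summableI_nonneg_bounded[OF re_sup_nonneg part'])
  have "re_sup \<mu> (\<Union>n. A n) \<le> (\<Sum>n. re_sup \<mu> (A n))"
  proof (rule re_sup_least)
    fix B assume B: "B \<in> sets borel" "B \<subseteq> (\<Union>n. A n)"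
    have "(\<lambda>n. \<mu> (B \<inter> A n)) sums \<mu> (\<Union>n. B \<inter> A n)"
      using A B by (intro complex_measures_sums[OF \<mu>]) (auto simp: disjoint_family_on_def)
    moreover have "(\<Union>n. B \<inter> A n) = B" using B by auto
    ultimately have s: "(\<lambda>n. Re (\<mu> (B \<inter> A n))) sums Re (\<mu> B)" by (simp add: sums_Re)
    show "Re (\<mu> B) \<le> (\<Sum>n. re_sup \<mu> (A n))"
      using A B by (intro sums_le[OF _ s summable_sums[OF sm]] re_sup_upper) auto
  qed
  moreover have "(\<Sum>n. re_sup \<mu> (A n)) \<le> re_sup \<mu> (\<Union>n. A n)"
    by (rule suminf_le_const[OF sm part'])
  ultimately have "(\<Sum>n. re_sup \<mu> (A n)) = re_sup \<mu> (\<Union>n. A n)" by simp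
  then show ?thesis using summable_sums[OF sm] by simp
qed

lemma sets_re_part [simp]: "sets (re_part \<mu>) = sets borel"
  and space_re_part [simp]: "space (re_part \<mu>) = UNIV"
proof -
  have s: "sigma_algebra UNIV (sets (borel :: 'a measure))"
    using sets.sigma_algebra_axioms[of "borel :: 'a measure"] by simp
  show "sets (re_part \<mu>) = sets borel"
    unfolding positive_part_def using sigma_algebra.sets_measure_of_eq[OF s] by simp
  show "space (re_part \<mu>) = UNIV"
    unfolding positive_part_def by (simp add: space_measure_of_conv)
qed

lemma emeasure_re_part:
  assumes "A \<in> sets borel" shows "emeasure (re_part \<mu>) A = ennreal (re_sup \<mu> A)"
  unfolding positive_part_def re_sup_def[symmetric]
proof (rule emeasure_measure_of_sigma)
  show "sigma_algebra UNIV (sets (borel :: 'a measure))"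
    using sets.sigma_algebra_axioms[of "borel :: 'a measure"] by simp
  have "re_sup \<mu> {} \<le> 0" using complex_measures_empty[OF \<mu>] by (intro re_sup_least) auto
  then show "positive (sets borel) (\<lambda>A. ennreal (re_sup \<mu> A))"
    unfolding positive_def by (simp add: ennreal_eq_0_iff)
  show "countably_additive (sets borel) (\<lambda>A. ennreal (re_sup \<mu> A))"
  proof (rule countably_additiveI)
    fix A :: "nat \<Rightarrow> 'a set"
    assume "range A \<subseteq> sets borel" "disjoint_family A"
    then show "(\<Sum>i. ennreal (re_sup \<mu> (A i))) = ennreal (re_sup \<mu> (\<Union>i. A i))"
      using re_sup_sums re_sup_nonneg by (intro suminf_ennreal_eq) auto
  qed
qed (rule assms)

lemma finite_re_part: "finite_measure (re_part \<mu>)"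
  by (rule finite_measureI) (simp add: emeasure_re_part)

lemma measure_re_part: "A \<in> sets borel \<Longrightarrow> measure (re_part \<mu>) A = re_sup \<mu> A"
  unfolding measure_def using emeasure_re_part re_sup_nonneg by simp

lemma measurable_re_part_eq [simp]: "measurable (re_part \<mu>) N = measurable borel N"
  by (intro measurable_cong_sets) auto

end

text \<open>The Jordan decomposition, again without Hahn sets: for \<open>B\<close> inside
  \<open>A\<close> the value at \<open>B\<close> is the value at \<open>A\<close> minus that at
  \<open>A - B\<close>, so a bound on the supremum for one sign turns into a bound on the supremum
  for the other. This gives the two inequalities.\<close>

lemma Re_eq_re_part_diff:
  assumes \<mu>: "\<mu> \<in> complex_measures" and A: "A \<in> sets borel"
  shows "Re (\<mu> A) = measure (re_part \<mu>) A - measure (re_part (\<lambda>A. - \<mu> A)) A"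
proof -
  have \<mu>': "(\<lambda>A. - \<mu> A) \<in> complex_measures"
    using complex_measures_scale[OF \<mu>, of "-1"] by simp
  have "re_sup \<mu> A \<le> Re (\<mu> A) + re_sup (\<lambda>A. - \<mu> A) A"
  proof (rule re_sup_least[OF \<mu>])
    fix B assume B: "B \<in> sets borel" "B \<subseteq> A"
    show "Re (\<mu> B) \<le> Re (\<mu> A) + re_sup (\<lambda>A. - \<mu> A) A"
      using re_sup_upper[OF \<mu>', of "A - B" A] complex_measures_Diff[OF \<mu> A B] A B by auto
  qed
  moreover have "re_sup (\<lambda>A. - \<mu> A) A \<le> re_sup \<mu> A - Re (\<mu> A)"
  proof (rule re_sup_least[OF \<mu>'])
    fix B assume B: "B \<in> sets borel" "B \<subseteq> A"
    show "Re (- \<mu> B) \<le> re_sup \<mu> A - Re (\<mu> A)"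
      using re_sup_upper[OF \<mu>, of "A - B" A] complex_measures_Diff[OF \<mu> A B] A B by auto
  qed
  ultimately show ?thesis
    using measure_re_part[OF \<mu> A] measure_re_part[OF \<mu>' A] by simp
qed

text \<open>Multiplying the measure by \<open>-1\<close>, \<open>- \<i>\<close> or
  \<open>\<i>\<close> turns each of the four positive parts in \<open>cint\<close> into a
  \<open>re_part\<close> of a complex measure, so that one set of lemmas about
  \<open>re_part\<close> serves all four.\<close>

lemma cint_re_part:
  "cint \<mu> f = (integral\<^sup>L (re_part \<mu>) f - integral\<^sup>L (re_part (\<lambda>A. - \<mu> A)) f)
     + \<i> * (integral\<^sup>L (re_part (\<lambda>A. - \<i> * \<mu> A)) f - integral\<^sup>L (re_part (\<lambda>A. \<i> * \<mu> A)) f)"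
  unfolding cint_def by simp

section \<open>Integrating bounded Borel functions against complex measures\<close>

definition bounded_borel :: "('a::topological_space \<Rightarrow> complex) set" where
  "bounded_borel = {f \<in> borel_measurable borel. \<exists>B. \<forall>x. norm (f x) \<le> B}"

lemma bounded_borelI:
  "f \<in> borel_measurable borel \<Longrightarrow> (\<And>x. norm (f x) \<le> B) \<Longrightarrow> f \<in> bounded_borel"
  unfolding bounded_borel_def by blast

lemma bounded_borel_measurable [measurable_dest]: "f \<in> bounded_borel \<Longrightarrow> f \<in> borel_measurable borel"
  unfolding bounded_borel_def by blast

lemma bounded_borel_indicator: "A \<in> sets borel \<Longrightarrow> indicator A \<in> bounded_borel"
  by (rule bounded_borelI[of _ 1]) (auto simp: indicator_def)

lemma bounded_borel_lincomb:
  assumes "f \<in> bounded_borel" "g \<in> bounded_borel"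
  shows "(\<lambda>x. f x + c * g x) \<in> bounded_borel"
proof -
  obtain B D where "\<forall>x. norm (f x) \<le> B" "\<forall>x. norm (g x) \<le> D"
    using assms unfolding bounded_borel_def by blast
  moreover have "(\<lambda>x. f x + c * g x) \<in> borel_measurable borel"
    using assms[THEN bounded_borel_measurable] by measurable
  ultimately show ?thesis
    by (intro bounded_borelI[of _ "B + norm c * D"])
      (auto intro!: norm_triangle_le add_mono mult_left_mono simp: norm_mult)
qed

lemma bounded_borel_comp:
  assumes "f \<in> bounded_borel" "h \<in> borel_measurable borel"
  shows "f \<circ> h \<in> bounded_borel"
proof -
  obtain B where "\<forall>x. norm (f x) \<le> B" using assms unfolding bounded_borel_def by blast
  then show ?thesis
    using measurable_comp[OF assms(2) bounded_borel_measurable[OF assms(1)]]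
    by (intro bounded_borelI[of _ B]) auto
qed

text \<open>Linear identities that survive bounded pointwise limits need to be checked on indicators
  only. The simple functions converging to \<open>f\<close> can be chosen with norm at most twice
  that of \<open>f\<close>, which supplies the uniform bound demanded in the case
  \<open>lim\<close>.\<close>

lemma bounded_borel_induct [consumes 1, case_names ind lin lim]:
  fixes f :: "'a::topological_space \<Rightarrow> complex"
  assumes f: "f \<in> bounded_borel"
    and ind: "\<And>A. A \<in> sets borel \<Longrightarrow> Q (indicator A)"
    and lin: "\<And>f g c. f \<in> bounded_borel \<Longrightarrow> g \<in> bounded_borel \<Longrightarrow> Q f \<Longrightarrow> Q g \<Longrightarrow>
      Q (\<lambda>x. f x + c * g x)"
    and lim: "\<And>f s B. (\<And>n. s n \<in> bounded_borel) \<Longrightarrow> (\<And>n. Q (s n)) \<Longrightarrow> (\<And>n x. norm (s n x) \<le> B)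
      \<Longrightarrow> f \<in> bounded_borel \<Longrightarrow> (\<And>x. (\<lambda>n. s n x) \<longlonglongrightarrow> f x) \<Longrightarrow> Q f"
  shows "Q f"
proof -
  obtain B where B: "\<And>x. norm (f x) \<le> B" using f unfolding bounded_borel_def by blast
  obtain s where s: "\<And>i::nat. simple_function borel (s i)" "\<And>x. (\<lambda>i. s i x) \<longlonglongrightarrow> f x"
      "\<And>i x. norm (s i x) \<le> 2 * norm (f x)"
    using borel_measurable_implies_sequence_metric[OF bounded_borel_measurable[OF f], of 0] by auto
  have bd: "norm (s i x) \<le> 2 * B" for i x using s(3)[of i x] B[of x] by linarith
  have meas: "s i \<in> borel_measurable borel" for i using s(1) by (rule borel_measurable_simple_function)
  have bb: "s i \<in> bounded_borel" for i by (rule bounded_borelI[OF meas bd])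
  have "indicator {} = (\<lambda>x::'a. 0::complex)" by (auto simp: indicator_def)
  then have Q0: "Q (\<lambda>x. 0)" using ind[of "{}"] by simp
  have "Q (s i)" for i
  proof -
    have fin: "finite (range (s i))" using s(1)[of i] by (simp add: simple_function_def)
    have pre: "s i -` {y} \<in> sets borel" for y
      using measurable_sets[OF meas[of i], of "{y}"] by simp
    have "(\<lambda>x. \<Sum>y\<in>F. y * indicator (s i -` {y}) x) \<in> bounded_borel
        \<and> Q (\<lambda>x. \<Sum>y\<in>F. y * indicator (s i -` {y}) x)" if "finite F" for F
      using that
    proof (induction F)
      case empty
      then show ?case using Q0 bounded_borelI[of "\<lambda>_. 0" 0] by simp
    next
      case (insert y F)
      have eq: "(\<lambda>x. \<Sum>y\<in>insert y F. y * indicator (s i -` {y}) x)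
          = (\<lambda>x. (\<Sum>y\<in>F. y * indicator (s i -` {y}) x) + y * indicator (s i -` {y}) x)"
        by (simp only: sum.insert[OF insert.hyps] add.commute)
      show ?case
        unfolding eq
        using insert.IH bounded_borel_lincomb lin bounded_borel_indicator[OF pre] ind[OF pre] by blast
    qed
    from this[OF fin] have "Q (\<lambda>x. \<Sum>y\<in>range (s i). y * indicator (s i -` {y}) x)" by blast
    moreover have "(\<Sum>y\<in>range (s i). y * indicator (s i -` {y}) x) = s i x" for x
    proof -
      have "(\<Sum>y\<in>range (s i). y * indicator (s i -` {y}) x)
          = (\<Sum>y\<in>range (s i). if s i x = y then y else 0)"
        by (intro sum.cong) (auto simp: indicator_def)
      also have "\<dots> = s i x" by (subst sum.delta'[OF fin]) auto
      finally show ?thesis .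
    qed
    ultimately show ?thesis by simp
  qed
  then show ?thesis using lim[of s "2 * B" f] bb bd f s(2) by blast
qed

lemma integrable_re_part:
  assumes "\<mu> \<in> complex_measures" "f \<in> bounded_borel"
  shows "integrable (re_part \<mu>) f"
proof -
  obtain B where B: "\<And>x. norm (f x) \<le> B" using assms unfolding bounded_borel_def by blast
  interpret finite_measure "re_part \<mu>" by (rule finite_re_part[OF assms(1)])
  show ?thesis
    using B bounded_borel_measurable[OF assms(2)] assms(1)
    by (intro integrable_const_bound[of _ B]) (auto simp: measurable_re_part_eq)
qed

lemma complex_measures_parts:
  assumes "\<mu> \<in> complex_measures"
  shows "(\<lambda>A. - \<mu> A) \<in> complex_measures" "(\<lambda>A. - \<i> * \<mu> A) \<in> complex_measures"
    "(\<lambda>A. \<i> * \<mu> A) \<in> complex_measures"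
  using complex_measures_scale[OF assms, of "-1"] complex_measures_scale[OF assms, of "\<i>"]
    complex_measures_scale[OF assms, of "-\<i>"] by simp_all

lemma cint_indicator:
  assumes \<mu>: "\<mu> \<in> complex_measures" and A: "A \<in> sets borel"
  shows "cint \<mu> (indicator A) = \<mu> A"
proof -
  have *: "integral\<^sup>L (re_part \<nu>) (indicator A) = complex_of_real (measure (re_part \<nu>) A)"
    if "\<nu> \<in> complex_measures" for \<nu> :: "'a set \<Rightarrow> complex"
  proof -
    have "indicator A = (\<lambda>x. complex_of_real (indicator A x))" by (auto simp: indicator_def)
    then show ?thesis using that A by (simp add: measurable_re_part_eq integral_complex_of_real)
  qed
  note p = complex_measures_parts[OF \<mu>]
  have "Re (- \<i> * \<mu> A) = measure (re_part (\<lambda>A. - \<i> * \<mu> A)) A - measure (re_part (\<lambda>A. \<i> * \<mu> A)) A"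
    using Re_eq_re_part_diff[OF p(2) A] by simp
  then show ?thesis
    unfolding cint_re_part using *[OF \<mu>] *[OF p(1)] *[OF p(2)] *[OF p(3)]
      Re_eq_re_part_diff[OF \<mu> A] by (simp add: complex_eq_iff)
qed

lemma cint_lincomb_fun:
  assumes \<mu>: "\<mu> \<in> complex_measures" and "f \<in> bounded_borel" "g \<in> bounded_borel"
  shows "cint \<mu> (\<lambda>x. f x + c * g x) = cint \<mu> f + c * cint \<mu> g"
proof -
  have *: "integral\<^sup>L (re_part \<nu>) (\<lambda>x. f x + c * g x)
      = integral\<^sup>L (re_part \<nu>) f + c * integral\<^sup>L (re_part \<nu>) g" if "\<nu> \<in> complex_measures" for \<nu>
    using integrable_re_part[OF that assms(2)] integrable_re_part[OF that assms(3)] by simp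
  show ?thesis
    unfolding cint_re_part *[OF \<mu>] *[OF complex_measures_parts(1)[OF \<mu>]]
        *[OF complex_measures_parts(2)[OF \<mu>]] *[OF complex_measures_parts(3)[OF \<mu>]]
    by (simp only: algebra_simps)
qed

lemma cint_scale_fun:
  shows "cint \<mu> (\<lambda>x. c * f x) = c * cint \<mu> f"
  unfolding cint_re_part by (simp add: right_diff_distrib distrib_left mult.left_commute)

text \<open>Each of the four positive parts has total mass at most
  \<open>sup_measure_norm \<mu>\<close>; this is the origin of the factor 4 in the later
  estimates.\<close>

lemma norm_cint_le:
  assumes \<mu>: "\<mu> \<in> complex_measures" and f: "f \<in> borel_measurable borel"
    and B: "\<And>x. norm (f x) \<le> B"
  shows "norm (cint \<mu> f) \<le> 4 * sup_measure_norm \<mu> * B"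
proof -
  have *: "norm (integral\<^sup>L (re_part (\<lambda>A. c * \<mu> A)) f) \<le> sup_measure_norm \<mu> * B"
    if c: "norm c = 1" for c
  proof -
    have m: "(\<lambda>A. c * \<mu> A) \<in> complex_measures" by (rule complex_measures_scale[OF \<mu>])
    interpret finite_measure "re_part (\<lambda>A. c * \<mu> A)" by (rule finite_re_part[OF m])
    have B0: "0 \<le> B" using B[of undefined] norm_ge_zero order_trans by blast
    have "norm (integral\<^sup>L (re_part (\<lambda>A. c * \<mu> A)) f) \<le> (\<integral>x. norm (f x) \<partial>re_part (\<lambda>A. c * \<mu> A))"
      by (rule integral_norm_bound)
    also have "\<dots> \<le> (\<integral>x. B \<partial>re_part (\<lambda>A. c * \<mu> A))"
      by (rule integral_mono[OF integrable_norm[OF integrable_re_part[OF m bounded_borelI[OF f B]]]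
            integrable_const]) (use B in auto)
    also have "\<dots> = measure (re_part (\<lambda>A. c * \<mu> A)) UNIV * B"
      using space_re_part[OF m] by simp
    also have "measure (re_part (\<lambda>A. c * \<mu> A)) UNIV \<le> sup_measure_norm \<mu>"
      proof (subst measure_re_part[OF m], simp, rule re_sup_least[OF m])
      fix D
      show "Re (c * \<mu> D) \<le> sup_measure_norm \<mu>"
        using complex_Re_le_cmod[of "c * \<mu> D"] norm_le_sup_measure_norm[OF \<mu>, of D] c
        by (simp add: norm_mult)
    qed
    finally show ?thesis using B0 by (simp add: mult_right_mono)
  qed
  have quad: "norm ((a - b) + \<i> * (c - d)) \<le> 4 * K"
    if "norm a \<le> K" "norm b \<le> K" "norm c \<le> K" "norm d \<le> K" for a b c d :: complex and K
  proof -
    have "norm ((a - b) + \<i> * (c - d)) \<le> norm (a - b) + norm (c - d)"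
      using norm_triangle_ineq[of "a - b" "\<i> * (c - d)"] by (simp add: norm_mult)
    then show ?thesis using that norm_triangle_ineq4[of a b] norm_triangle_ineq4[of c d] by linarith
  qed
  have "norm (cint \<mu> f) \<le> 4 * (sup_measure_norm \<mu> * B)"
    unfolding cint_re_part
    using *[of 1] *[of "-1"] *[of "-\<i>"] *[of "\<i>"] by (intro quad) simp_all
  then show ?thesis by simp
qed

lemma cint_dominated_convergence:
  assumes \<mu>: "\<mu> \<in> complex_measures" and s: "\<And>n. s n \<in> bounded_borel" and f: "f \<in> bounded_borel"
    and B: "\<And>n x. norm (s n x) \<le> B" and lim: "\<And>x. (\<lambda>n. s n x) \<longlonglongrightarrow> f x"
  shows "(\<lambda>n. cint \<mu> (s n)) \<longlonglongrightarrow> cint \<mu> f"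
proof -
  have *: "(\<lambda>n. integral\<^sup>L (re_part \<nu>) (s n)) \<longlonglongrightarrow> integral\<^sup>L (re_part \<nu>) f"
    if \<nu>: "\<nu> \<in> complex_measures" for \<nu>
  proof (rule integral_dominated_convergence[of _ _ _ "\<lambda>_. B"])
    interpret finite_measure "re_part \<nu>" by (rule finite_re_part[OF \<nu>])
    show "integrable (re_part \<nu>) (\<lambda>_. B)" by simp
  qed (use \<nu> s f B lim bounded_borel_measurable in \<open>auto simp: measurable_re_part_eq\<close>)
  note p = complex_measures_parts[OF \<mu>]
  show ?thesis
    unfolding cint_re_part
    by (rule tendsto_add[OF tendsto_diff[OF *[OF \<mu>] *[OF p(1)]]
          tendsto_mult[OF tendsto_const tendsto_diff[OF *[OF p(2)] *[OF p(3)]]]])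
qed

text \<open>Additivity in the measure cannot be read off the definition, since the suprema defining
  the positive parts are not additive in the measure. It holds on indicators, where
  \<open>cint\<close> is evaluation of the measure, and spreads from there by induction on the
  integrand.\<close>

lemma cint_lincomb:
  assumes \<mu>: "\<mu> \<in> complex_measures" and \<nu>: "\<nu> \<in> complex_measures" and f: "f \<in> bounded_borel"
  shows "cint (\<lambda>A. \<mu> A + c * \<nu> A) f = cint \<mu> f + c * cint \<nu> f"
  using f
proof (induction rule: bounded_borel_induct)
  case (ind A)
  then show ?case using \<mu> \<nu> complex_measures_lincomb[OF \<mu> \<nu>] by (simp add: cint_indicator)
next
  case (lin f g d)
  then show ?case
    using \<mu> \<nu> complex_measures_lincomb[OF \<mu> \<nu>] by (simp add: cint_lincomb_fun algebra_simps)
next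
  case (lim f s B)
  have "(\<lambda>n. cint (\<lambda>A. \<mu> A + c * \<nu> A) (s n)) \<longlonglongrightarrow> cint (\<lambda>A. \<mu> A + c * \<nu> A) f"
    using lim by (intro cint_dominated_convergence[OF complex_measures_lincomb[OF \<mu> \<nu>], of s f B]) auto
  moreover have "(\<lambda>n. cint (\<lambda>A. \<mu> A + c * \<nu> A) (s n)) \<longlonglongrightarrow> cint \<mu> f + c * cint \<nu> f"
    unfolding lim.IH using lim.hyps
    by (intro tendsto_add tendsto_mult tendsto_const cint_dominated_convergence[OF \<mu>, of s f B]
        cint_dominated_convergence[OF \<nu>, of s f B]) auto
  ultimately show ?case by (rule LIMSEQ_unique)
qed

lemma cint_scale:
  assumes \<mu>: "\<mu> \<in> complex_measures" and f: "f \<in> bounded_borel"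
  shows "cint (\<lambda>A. c * \<mu> A) f = c * cint \<mu> f"
proof -
  have "cint (\<lambda>_. 0) f = 0"
    using cint_lincomb[OF complex_measures_zero complex_measures_zero f, of 1] by simp
  then show ?thesis using cint_lincomb[OF complex_measures_zero \<mu> f, of c] by simp
qed

text \<open>Meant for integrands that may be unbounded: the set where \<open>f\<close> and
  \<open>g\<close> differ is null for each of the four positive parts, so the integrals agree even
  when they are the default value 0 of a non-integrable function.\<close>

lemma cint_cong_null:
  assumes \<mu>: "\<mu> \<in> complex_measures" and f: "f \<in> borel_measurable borel" and g: "g \<in> borel_measurable borel"
    and null: "\<And>B. B \<in> sets borel \<Longrightarrow> B \<subseteq> N \<Longrightarrow> \<mu> B = 0" and N: "\<And>x. x \<notin> N \<Longrightarrow> f x = g x"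
  shows "cint \<mu> f = cint \<mu> g"
proof -
  define N' where "N' = {x. f x \<noteq> g x}"
  \<comment> \<open>The set of disagreement is Borel although \<open>N\<close> may fail to
    be.\<close>
  have N': "N' \<subseteq> N" using N unfolding N'_def by blast
  have N'b: "N' \<in> sets borel" unfolding N'_def using f g by measurable
  have *: "integral\<^sup>L (re_part \<nu>) f = integral\<^sup>L (re_part \<nu>) g"
    if \<nu>: "\<nu> \<in> complex_measures" and 0: "\<And>B. B \<in> sets borel \<Longrightarrow> B \<subseteq> N \<Longrightarrow> \<nu> B = 0" for \<nu>
  proof (rule integral_cong_AE)
    have "re_sup \<nu> N' \<le> 0" using N' 0 by (intro re_sup_least[OF \<nu>]) auto
    then have "emeasure (re_part \<nu>) N' = 0"
      using emeasure_re_part[OF \<nu> N'b] by (simp add: ennreal_neg)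
    then have "N' \<in> null_sets (re_part \<nu>)" using N'b \<nu> by (auto simp: null_sets_def)
    then show "AE x in re_part \<nu>. f x = g x"
      by (rule AE_I') (auto simp: N'_def)
  qed (use \<nu> f g in \<open>auto simp: measurable_re_part_eq\<close>)
  note p = complex_measures_parts[OF \<mu>]
  have "integral\<^sup>L (re_part (\<lambda>A. - \<mu> A)) f = integral\<^sup>L (re_part (\<lambda>A. - \<mu> A)) g"
    "integral\<^sup>L (re_part (\<lambda>A. - \<i> * \<mu> A)) f = integral\<^sup>L (re_part (\<lambda>A. - \<i> * \<mu> A)) g"
    "integral\<^sup>L (re_part (\<lambda>A. \<i> * \<mu> A)) f = integral\<^sup>L (re_part (\<lambda>A. \<i> * \<mu> A)) g"
    by (rule *; use p null in simp)+
  moreover have "integral\<^sup>L (re_part \<mu>) f = integral\<^sup>L (re_part \<mu>) g"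
    by (rule *[OF \<mu>]) (rule null)
  ultimately show ?thesis unfolding cint_re_part by (simp only:)
qed

section \<open>Approximation by continuous functions; a measure is determined by them\<close>

lemma borel_induct_closed [consumes 1, case_names closed compl union]:
  fixes A :: "'a::topological_space set"
  assumes A: "A \<in> sets borel"
    and cl: "\<And>F. closed F \<Longrightarrow> Q F"
    and compl: "\<And>A. A \<in> sets borel \<Longrightarrow> Q A \<Longrightarrow> Q (- A)"
    and union: "\<And>A::nat \<Rightarrow> 'a set. disjoint_family A \<Longrightarrow> range A \<subseteq> sets borel \<Longrightarrow> (\<And>i. Q (A i))
      \<Longrightarrow> Q (\<Union>i. A i)"
  shows "Q A"
proof -
  have eq: "sigma_sets UNIV (Collect closed) = sets (borel :: 'a measure)"
    by (subst borel_eq_closed) (simp add: sets_measure_of_conv)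
  have st: "Int_stable (Collect closed :: 'a set set)" by (auto simp: Int_stable_def)
  have A': "A \<in> sigma_sets UNIV (Collect closed)" using A eq by simp
  show ?thesis
    by (rule sigma_sets_induct_disjoint[OF st _ A', of Q])
      (auto simp: eq Compl_eq_Diff_UNIV[symmetric] intro: cl compl union)
qed

lemma complex_measures_Compl:
  assumes "\<mu> \<in> complex_measures" "A \<in> sets borel"
  shows "\<mu> (- A) = \<mu> UNIV - \<mu> A"
  unfolding Compl_eq_Diff_UNIV by (rule complex_measures_Diff) (use assms in auto)

lemma closed_indicator_limit:
  fixes F :: "'a::metric_space set"
  assumes "closed F"
  shows "\<exists>s::nat \<Rightarrow> 'a \<Rightarrow> real. (\<forall>n. continuous_on UNIV (s n)) \<and> (\<forall>n x. 0 \<le> s n x \<and> s n x \<le> 1)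
    \<and> (\<forall>x. (\<lambda>n. s n x) \<longlonglongrightarrow> indicator F x)"
proof (cases "F = {}")
  \<comment> \<open>Treated apart because \<open>infdist x {}\<close> is 0 by convention, which
    would produce the constant 1 in place of 0.\<close>
  case True
  then show ?thesis by (intro exI[of _ "\<lambda>_ _. 0"]) auto
next
  case False
  define s where "s n x = max 0 (1 - real n * infdist x F)" for n x
  have "(\<lambda>n. s n x) \<longlonglongrightarrow> indicator F x" for x
  proof (cases "x \<in> F")
    case True
    then show ?thesis by (simp add: s_def)
  next
    case xF: False
    then have pos: "infdist x F > 0"
      using assms False by (metis in_closed_iff_infdist_zero infdist_nonneg less_eq_real_def)
    obtain N where N: "1 / infdist x F < real N" using reals_Archimedean2 by blast
    have "s n x = 0" if "n \<ge> N" for n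
    proof -
      have "1 / infdist x F \<le> real n" using N that by linarith
      then have "1 \<le> real n * infdist x F" using pos by (simp add: field_simps)
      then show ?thesis by (simp add: s_def)
    qed
    then have "(\<lambda>n. s n x) \<longlonglongrightarrow> 0"
      by (intro tendsto_eventually) (auto simp: eventually_sequentially)
    then show ?thesis using xF by simp
  qed
  moreover have "continuous_on UNIV (s n)" for n
    unfolding s_def by (intro continuous_intros)
  moreover have "0 \<le> s n x \<and> s n x \<le> 1" for n x
    by (simp add: s_def infdist_nonneg)
  ultimately show ?thesis by blast
qed

lemma bounded_borel_continuous:
  fixes f :: "'a::topological_space \<Rightarrow> complex"
  assumes "continuous_on UNIV f" "\<And>x. norm (f x) \<le> B"
  shows "f \<in> bounded_borel"
  using assms by (intro bounded_borelI[of _ B] borel_measurable_continuous_onI)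

text \<open>This uniqueness is what makes the descriptions by \<open>THE\<close> in
  \<open>push_forward\<close> and \<open>resolvent_measure\<close> meaningful, and it turns every
  later identity between measures into one between scalar functions.\<close>

lemma complex_measures_eqI_continuous:
  fixes \<mu> \<nu> :: "'a::metric_space set \<Rightarrow> complex"
  assumes \<mu>: "\<mu> \<in> complex_measures" and \<nu>: "\<nu> \<in> complex_measures"
    and eq: "\<And>\<eta>. continuous_on UNIV \<eta> \<Longrightarrow> (\<And>x. norm (\<eta> x) \<le> 1) \<Longrightarrow> cint \<mu> \<eta> = cint \<nu> \<eta>"
  shows "\<mu> = \<nu>"
proof (rule complex_measures_eqI[OF \<mu> \<nu>])
  have 1: "\<mu> F = \<nu> F" if F: "closed F" for F
  proof -
    obtain s :: "nat \<Rightarrow> 'a \<Rightarrow> real" where s: "\<And>n. continuous_on UNIV (s n)"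
      "\<And>n x. 0 \<le> s n x \<and> s n x \<le> 1" "\<And>x. (\<lambda>n. s n x) \<longlonglongrightarrow> indicator F x"
      using closed_indicator_limit[OF F] by blast
    have c: "continuous_on UNIV (\<lambda>x. complex_of_real (s n x))" for n
      by (intro continuous_intros s(1))
    have b: "norm (complex_of_real (s n x)) \<le> 1" for n x using s(2)[of n x] by simp
    have l: "(\<lambda>n. complex_of_real (s n x)) \<longlonglongrightarrow> indicator F x" for x
      using tendsto_of_real[OF s(3)[of x], where ?'a = complex] by (cases "x \<in> F") auto
    have Fb: "F \<in> sets borel" using F by simp
    have cv: "(\<lambda>n. cint \<rho> (\<lambda>x. complex_of_real (s n x))) \<longlonglongrightarrow> cint \<rho> (indicator F)"
      if "\<rho> \<in> complex_measures" for \<rho>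
      by (rule cint_dominated_convergence[OF that bounded_borel_continuous[OF c b]
            bounded_borel_indicator[OF Fb] b l])
    have "cint \<mu> (indicator F) = cint \<nu> (indicator F)"
      using cv[OF \<mu>] cv[OF \<nu>] unfolding eq[OF c b] by (rule LIMSEQ_unique)
    then show ?thesis by (simp only: cint_indicator[OF \<mu> Fb] cint_indicator[OF \<nu> Fb])
  qed
  fix A :: "'a set" assume "A \<in> sets borel"
  then show "\<mu> A = \<nu> A"
  proof (induction rule: borel_induct_closed)
    case (closed F) then show ?case by (rule 1)
  next
    case (compl A)
    then show ?case
      using 1[OF closed_UNIV] by (simp only: complex_measures_Compl[OF \<mu>] complex_measures_Compl[OF \<nu>])
  next
    case (union A)
    show ?case
      using complex_measures_sums[OF \<mu> union(2,1)] complex_measures_sums[OF \<nu> union(2,1)]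
      unfolding union(3) by (rule sums_unique2)
  qed
qed

lemma sums_indicator_disjoint:
  fixes A :: "nat \<Rightarrow> 'a set"
  assumes "disjoint_family A"
  shows "(\<lambda>i. indicator (A i) x :: real) sums indicator (\<Union>i. A i) x"
proof -
  have "(\<Sum>i<N. indicator (A i) x) = (indicator (\<Union>i<N. A i) x :: real)" for N
    using assms by (subst indicator_UN_disjoint) (auto simp: disjoint_family_on_def)
  then show ?thesis unfolding sums_def by (simp only: LIMSEQ_indicator_UN)
qed

text \<open>The approximation has to be simultaneous in a finite set of measures, because
  \<open>cint\<close> mixes four positive parts and a single test function must serve all of them. A
  disjoint union is handled by keeping finitely many of its members, the rest being small by
  dominated convergence, and approximating each of these.\<close>

lemma indicator_L1_approx:
  fixes A :: "'a::metric_space set" and S :: "'a measure set"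
  assumes "A \<in> sets borel" and S: "finite S" "\<And>m. m \<in> S \<Longrightarrow> finite_measure m \<and> sets m = sets borel"
    and "e > 0"
  shows "\<exists>\<eta>. continuous_on UNIV \<eta> \<and> (\<forall>x. 0 \<le> \<eta> x \<and> \<eta> x \<le> 1)
    \<and> (\<forall>m\<in>S. (\<integral>x. \<bar>indicator A x - \<eta> x\<bar> \<partial>m) < (e::real))"
  using assms(1,4)
proof (induction arbitrary: e rule: borel_induct_closed)
  case (closed F)
  obtain s :: "nat \<Rightarrow> 'a \<Rightarrow> real" where s: "\<And>n. continuous_on UNIV (s n)"
    "\<And>n x. 0 \<le> s n x \<and> s n x \<le> 1" "\<And>x. (\<lambda>n. s n x) \<longlonglongrightarrow> indicator F x"
    using closed_indicator_limit[OF closed(1)] by blast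
  have [measurable]: "F \<in> sets borel" "s n \<in> borel_measurable borel" for n
    using closed(1) s(1) by (auto intro: borel_measurable_continuous_onI)
  have "(\<lambda>n. \<integral>x. \<bar>indicator F x - s n x\<bar> \<partial>m) \<longlonglongrightarrow> (\<integral>x. 0 \<partial>m)" if m: "m \<in> S" for m
  proof (rule integral_dominated_convergence[of _ _ _ "\<lambda>_. 1"])
    interpret finite_measure m using S(2)[OF m] by blast
    have [measurable_cong]: "sets m = sets borel" using S(2)[OF m] by blast
    show "integrable m (\<lambda>_. 1::real)" by (rule integrable_const)
    show "(\<lambda>x. \<bar>indicator F x - s n x\<bar>) \<in> borel_measurable m" for n by measurable
    have "(\<lambda>n. \<bar>indicator F x - s n x\<bar>) \<longlonglongrightarrow> \<bar>indicator F x - indicator F x\<bar>" for x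
      by (intro tendsto_intros s(3))
    then show "AE x in m. (\<lambda>n. \<bar>indicator F x - s n x\<bar>) \<longlonglongrightarrow> 0" by simp
    have "\<bar>indicator F x - s n x\<bar> \<le> 1" for n x
      using s(2)[of n x] by (auto simp: indicator_def abs_le_iff)
    then show "AE x in m. norm \<bar>indicator F x - s n x\<bar> \<le> 1" for n by simp
  qed simp_all
  then have "\<forall>m\<in>S. \<forall>\<^sub>F n in sequentially. (\<integral>x. \<bar>indicator F x - s n x\<bar> \<partial>m) < e"
    using closed(2) order_tendstoD(2) by fastforce
  then have "\<forall>\<^sub>F n in sequentially. \<forall>m\<in>S. (\<integral>x. \<bar>indicator F x - s n x\<bar> \<partial>m) < e"
    using S(1) by (rule eventually_ball_finite[rotated])
  then obtain n where "\<forall>m\<in>S. (\<integral>x. \<bar>indicator F x - s n x\<bar> \<partial>m) < e"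
    by (auto simp: eventually_sequentially)
  then show ?case using s by blast
next
  case (compl A)
  then obtain \<eta> where \<eta>: "continuous_on UNIV \<eta>" "\<forall>x. 0 \<le> \<eta> x \<and> \<eta> x \<le> 1"
    "\<forall>m\<in>S. (\<integral>x. \<bar>indicator A x - \<eta> x\<bar> \<partial>m) < e" by blast
  have "\<bar>indicator (- A) x - (1 - \<eta> x)\<bar> = \<bar>indicator A x - \<eta> x\<bar>" for x
    by (auto simp: indicator_def)
  then show ?case
    using \<eta> by (intro exI[of _ "\<lambda>x. 1 - \<eta> x"]) (auto intro!: continuous_intros)
next
  case (union A)
  have [measurable]: "A i \<in> sets borel" for i using union(2) by auto
  have fin_le1: "(\<Sum>i<N. indicator (A i) x) \<le> (indicator (\<Union>i. A i) x :: real)" for N x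
  proof -
    have "(\<Sum>i<N. indicator (A i) x) = (indicator (\<Union>i<N. A i) x :: real)"
      using union(1) by (subst indicator_UN_disjoint) (auto simp: disjoint_family_on_def)
    also have "\<dots> \<le> indicator (\<Union>i. A i) x" by (auto simp: indicator_def)
    finally show ?thesis .
  qed
  have one: "(indicator (\<Union>i. A i) x :: real) \<le> 1" for x by (simp add: indicator_def)
  have bd1: "\<bar>indicator (\<Union>i. A i) x - (\<Sum>i<N. indicator (A i) x)\<bar> \<le> (1::real)" for N x
    using fin_le1[of x N] sum_nonneg[of "{..<N}" "\<lambda>i. indicator (A i) x :: real", OF indicator_pos_le]
      one[of x] by linarith
  have "(\<lambda>N. \<integral>x. \<bar>indicator (\<Union>i. A i) x - (\<Sum>i<N. indicator (A i) x)\<bar> \<partial>m)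
      \<longlonglongrightarrow> (\<integral>x. (0::real) \<partial>m)"
    if m: "m \<in> S" for m
  proof (rule integral_dominated_convergence[of _ _ _ "\<lambda>_. 1"])
    interpret finite_measure m using S(2)[OF m] by blast
    have [measurable_cong]: "sets m = sets borel" using S(2)[OF m] by blast
    show "integrable m (\<lambda>_. 1::real)" by (rule integrable_const)
    show "(\<lambda>x. \<bar>indicator (\<Union>i. A i) x - (\<Sum>i<N. indicator (A i) x) :: real\<bar>) \<in> borel_measurable m" for N
      by measurable
    have "(\<lambda>N. \<Sum>i<N. indicator (A i) x) \<longlonglongrightarrow> (indicator (\<Union>i. A i) x :: real)" for x
      using sums_indicator_disjoint[OF union(1), of x] unfolding sums_def by simp
    then have "(\<lambda>N. \<bar>indicator (\<Union>i. A i) x - (\<Sum>i<N. indicator (A i) x)\<bar>)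
        \<longlonglongrightarrow> \<bar>indicator (\<Union>i. A i) x - indicator (\<Union>i. A i) x :: real\<bar>" for x
      by (intro tendsto_intros)
    then show "AE x in m. (\<lambda>N. \<bar>indicator (\<Union>i. A i) x - (\<Sum>i<N. indicator (A i) x)\<bar>) \<longlonglongrightarrow> (0::real)"
      by simp
    show "AE x in m. norm \<bar>indicator (\<Union>i. A i) x - (\<Sum>i<N. indicator (A i) x) :: real\<bar> \<le> 1" for N
      using bd1 by simp
  qed simp_all
  then have "\<forall>m\<in>S. \<forall>\<^sub>F N in sequentially.
      (\<integral>x. \<bar>indicator (\<Union>i. A i) x - (\<Sum>i<N. indicator (A i) x)\<bar> \<partial>m) < e / 2"
    using union(4) order_tendstoD(2)[of _ _ _ "e / 2"] by fastforce
  then have "\<forall>\<^sub>F N in sequentially. \<forall>m\<in>S.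
      (\<integral>x. \<bar>indicator (\<Union>i. A i) x - (\<Sum>i<N. indicator (A i) x)\<bar> \<partial>m) < e / 2"
    using S(1) by (rule eventually_ball_finite[rotated])
  then obtain N where N: "\<And>m. m \<in> S \<Longrightarrow>
      (\<integral>x. \<bar>indicator (\<Union>i. A i) x - (\<Sum>i<N. indicator (A i) x)\<bar> \<partial>m) < e / 2"
    by (auto simp: eventually_sequentially)
  \<comment> \<open>\<open>N\<close> errors of this size sum to at most \<open>e / 2\<close>; the
    \<open>+ 1\<close> keeps the denominator positive when \<open>N\<close> is 0.\<close>
  have "\<exists>\<eta>. continuous_on UNIV \<eta> \<and> (\<forall>x. 0 \<le> \<eta> x \<and> \<eta> x \<le> 1)
      \<and> (\<forall>m\<in>S. (\<integral>x. \<bar>indicator (A i) x - \<eta> x\<bar> \<partial>m) < e / (2 * (real N + 1)))" for i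
    using union(3)[of "e / (2 * (real N + 1))" i] union(4) by simp
  then obtain \<eta> where \<eta>: "\<And>i. continuous_on UNIV (\<eta> i)" "\<And>i x. 0 \<le> \<eta> i x \<and> \<eta> i x \<le> 1"
    "\<And>i m. m \<in> S \<Longrightarrow> (\<integral>x. \<bar>indicator (A i) x - \<eta> i x\<bar> \<partial>m) < e / (2 * (real N + 1))" by metis
  \<comment> \<open>Cutting off at 1 restores the range and can only bring the sum closer to an
    indicator.\<close>
  define \<theta> where "\<theta> x = min 1 (\<Sum>i<N. \<eta> i x)" for x
  have [measurable]: "\<eta> i \<in> borel_measurable borel" for i
    using \<eta>(1) by (rule borel_measurable_continuous_onI)
  have "(\<integral>x. \<bar>indicator (\<Union>i. A i) x - \<theta> x\<bar> \<partial>m) < e" if m: "m \<in> S" for m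
  proof -
    interpret finite_measure m using S(2)[OF m] by blast
    have [measurable_cong]: "sets m = sets borel" using S(2)[OF m] by blast
    have b1: "\<bar>indicator (A i) x - \<eta> i x\<bar> \<le> 1" for i x
      using \<eta>(2)[of i x] by (auto simp: indicator_def abs_le_iff)
    have i1: "integrable m (\<lambda>x. \<bar>indicator (A i) x - \<eta> i x\<bar>)" for i
      using b1 by (intro integrable_const_bound[of _ 1]) simp_all
    have i2: "integrable m (\<lambda>x. indicator (\<Union>i. A i) x - (\<Sum>i<N. indicator (A i) x) :: real)"
      using bd1 by (intro integrable_const_bound[of _ 1]) simp_all
    have i3: "integrable m (\<lambda>x. \<bar>indicator (\<Union>i. A i) x - \<theta> x\<bar>)"
    proof (rule integrable_const_bound[of _ 1])
      have t: "0 \<le> \<theta> x \<and> \<theta> x \<le> 1" for x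
        unfolding \<theta>_def using \<eta>(2) by (auto intro!: sum_nonneg)
      have "\<bar>indicator (\<Union>i. A i) x - \<theta> x\<bar> \<le> 1" for x
        using t[of x] by (auto simp: indicator_def abs_le_iff)
      then show "AE x in m. norm \<bar>indicator (\<Union>i. A i) x - \<theta> x\<bar> \<le> 1" by simp
    qed (simp add: \<theta>_def)
    have "\<bar>indicator (\<Union>i. A i) x - \<theta> x\<bar> \<le> \<bar>indicator (\<Union>i. A i) x - (\<Sum>i<N. indicator (A i) x)\<bar>
        + (\<Sum>i<N. \<bar>indicator (A i) x - \<eta> i x\<bar>)" for x
    proof -
      have "\<bar>indicator (\<Union>i. A i) x - \<theta> x\<bar> \<le> \<bar>indicator (\<Union>i. A i) x - (\<Sum>i<N. \<eta> i x)\<bar>"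
        unfolding \<theta>_def by (auto simp: indicator_def min_def)
      also have "\<dots> \<le> \<bar>indicator (\<Union>i. A i) x - (\<Sum>i<N. indicator (A i) x)\<bar>
          + \<bar>\<Sum>i<N. (indicator (A i) x - \<eta> i x)\<bar>"
        by (simp add: sum_subtractf)
      also have "\<bar>\<Sum>i<N. (indicator (A i) x - \<eta> i x)\<bar> \<le> (\<Sum>i<N. \<bar>indicator (A i) x - \<eta> i x\<bar>)"
        by (rule sum_abs)
      finally show ?thesis by simp
    qed
    then have "(\<integral>x. \<bar>indicator (\<Union>i. A i) x - \<theta> x\<bar> \<partial>m)
        \<le> (\<integral>x. \<bar>indicator (\<Union>i. A i) x - (\<Sum>i<N. indicator (A i) x)\<bar>
          + (\<Sum>i<N. \<bar>indicator (A i) x - \<eta> i x\<bar>) \<partial>m)"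
      by (intro integral_mono[OF i3] Bochner_Integration.integrable_add Bochner_Integration.integrable_sum
          integrable_abs[OF i2] i1)
    also have "\<dots> = (\<integral>x. \<bar>indicator (\<Union>i. A i) x - (\<Sum>i<N. indicator (A i) x)\<bar> \<partial>m)
        + (\<Sum>i<N. \<integral>x. \<bar>indicator (A i) x - \<eta> i x\<bar> \<partial>m)"
      using i1 i2 by (subst Bochner_Integration.integral_add) (auto simp: integral_sum)
    also have "\<dots> < e / 2 + e / 2"
    proof -
      have "(\<Sum>i<N. \<integral>x. \<bar>indicator (A i) x - \<eta> i x\<bar> \<partial>m) \<le> (\<Sum>i<N. e / (2 * (real N + 1)))"
        using \<eta>(3)[OF m] by (intro sum_mono) (simp add: less_imp_le)
      also have "\<dots> = (real N / (real N + 1)) * (e / 2)" by (simp add: field_simps)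
      also have "\<dots> \<le> 1 * (e / 2)" using union(4) by (intro mult_right_mono) auto
      finally show ?thesis using N[OF m] by linarith
    qed
    finally show ?thesis by simp
  qed
  moreover have "continuous_on UNIV \<theta>"
    unfolding \<theta>_def by (intro continuous_intros \<eta>(1))
  moreover have "0 \<le> \<theta> x \<and> \<theta> x \<le> 1" for x
    unfolding \<theta>_def using \<eta>(2) by (auto intro!: sum_nonneg)
  ultimately show ?case by blast
qed

section \<open>The total variation norm and completeness of the space of measures\<close>

lemma cint_le_total_variation:
  assumes \<mu>: "\<mu> \<in> complex_measures" and "continuous_on UNIV \<eta>" "\<And>x. norm (\<eta> x) \<le> 1"
  shows "norm (cint \<mu> \<eta>) \<le> total_variation \<mu>"
  unfolding total_variation_def
proof (rule cSUP_upper)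
  show "bdd_above ((\<lambda>\<eta>. norm (cint \<mu> \<eta>)) ` {\<eta>. continuous_on UNIV \<eta> \<and> (\<forall>x. norm (\<eta> x) \<le> 1)})"
    using norm_cint_le[OF \<mu>, of _ 1] borel_measurable_continuous_onI
    by (intro bdd_aboveI[of _ "4 * sup_measure_norm \<mu>"]) force
qed (use assms in auto)

lemma total_variation_least:
  assumes "\<And>\<eta>. continuous_on UNIV \<eta> \<Longrightarrow> (\<And>x. norm (\<eta> x) \<le> 1) \<Longrightarrow> norm (cint \<mu> \<eta>) \<le> K"
  shows "total_variation \<mu> \<le> K"
  unfolding total_variation_def
proof (rule cSUP_least)
  show "{\<eta>::'a \<Rightarrow> complex. continuous_on UNIV \<eta> \<and> (\<forall>x. norm (\<eta> x) \<le> 1)} \<noteq> {}"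
    by (auto intro!: exI[of _ "\<lambda>_. 0"])
qed (use assms in auto)

lemma total_variation_le_sup_measure_norm:
  "\<mu> \<in> complex_measures \<Longrightarrow> total_variation \<mu> \<le> 4 * sup_measure_norm \<mu>"
  using norm_cint_le[of \<mu> _ 1] borel_measurable_continuous_onI
  by (intro total_variation_least) force

lemma total_variation_nonneg: "\<mu> \<in> complex_measures \<Longrightarrow> 0 \<le> total_variation \<mu>"
  using cint_le_total_variation[of \<mu> "\<lambda>_. 0"] order_trans[OF norm_ge_zero] by simp

text \<open>The indicator of \<open>A\<close> is replaced by a continuous function with values in
  \<open>[0, 1]\<close>, at a cost of \<open>e / 4\<close> in each of the four positive parts.
  Together with the factor 4 in the other direction this shows that \<open>total_variation\<close>
  and \<open>sup_measure_norm\<close> are equivalent.\<close>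

lemma norm_le_total_variation:
  fixes \<mu> :: "'a::metric_space set \<Rightarrow> complex"
  assumes \<mu>: "\<mu> \<in> complex_measures" shows "norm (\<mu> A) \<le> total_variation \<mu>"
proof (cases "A \<in> sets borel")
  case False
  then show ?thesis using complex_measures_nonborel[OF \<mu>] total_variation_nonneg[OF \<mu>] by simp
next
  case A: True
  note p = complex_measures_parts[OF \<mu>]
  have "norm (\<mu> A) \<le> total_variation \<mu> + e" if "e > 0" for e
  proof -
    define S where "S = {re_part \<mu>, re_part (\<lambda>A. - \<mu> A), re_part (\<lambda>A. - \<i> * \<mu> A), re_part (\<lambda>A. \<i> * \<mu> A)}"
    have S: "finite_measure m \<and> sets m = sets borel" if "m \<in> S" for m
      using that \<mu> p finite_re_part sets_re_part unfolding S_def by blast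
    obtain \<eta> :: "'a \<Rightarrow> real" where \<eta>: "continuous_on UNIV \<eta>" "\<And>x. 0 \<le> \<eta> x \<and> \<eta> x \<le> 1"
      "\<And>m. m \<in> S \<Longrightarrow> (\<integral>x. \<bar>indicator A x - \<eta> x\<bar> \<partial>m) < e / 4"
    proof -
      have "finite S" "e / 4 > 0" using \<open>e > 0\<close> by (simp_all add: S_def)
      then show ?thesis using indicator_L1_approx[OF A _ S, of S "e / 4"] that by blast
    qed
    define \<theta> where "\<theta> x = complex_of_real (\<eta> x)" for x
    have c: "continuous_on UNIV \<theta>" unfolding \<theta>_def by (intro continuous_intros \<eta>(1))
    have b: "norm (\<theta> x) \<le> 1" for x using \<eta>(2)[of x] by (simp add: \<theta>_def)
    note bb = bounded_borel_continuous[OF c b]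
    have d: "\<mu> A = cint \<mu> (\<lambda>x. indicator A x + (-1) * \<theta> x) + cint \<mu> \<theta>"
      using cint_lincomb_fun[OF \<mu> bounded_borel_indicator[OF A] bb, of "-1"] cint_indicator[OF \<mu> A] by simp
    have *: "norm (integral\<^sup>L m (\<lambda>x. indicator A x + (-1) * \<theta> x)) \<le> e / 4" if "m \<in> S" for m
    proof -
      have "norm (integral\<^sup>L m (\<lambda>x. indicator A x + (-1) * \<theta> x))
          \<le> (\<integral>x. norm (indicator A x + (-1) * \<theta> x) \<partial>m)" by (rule integral_norm_bound)
      also have "\<dots> = (\<integral>x. \<bar>indicator A x - \<eta> x\<bar> \<partial>m)"
      proof (rule Bochner_Integration.integral_cong[OF refl])
        fix x
        have "indicator A x + (-1) * \<theta> x = complex_of_real (indicator A x - \<eta> x)"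
          by (simp add: \<theta>_def indicator_def)
        then show "norm (indicator A x + (-1) * \<theta> x) = \<bar>indicator A x - \<eta> x\<bar>"
          by (metis norm_of_real)
      qed
      finally show ?thesis using \<eta>(3)[OF that] by linarith
    qed
    have quad: "norm ((a - b) + \<i> * (c - d)) \<le> 4 * K"
      if "norm a \<le> K" "norm b \<le> K" "norm c \<le> K" "norm d \<le> K" for a b c d :: complex and K
    proof -
      have "norm ((a - b) + \<i> * (c - d)) \<le> norm (a - b) + norm (c - d)"
        using norm_triangle_ineq[of "a - b" "\<i> * (c - d)"] by (simp add: norm_mult)
      then show ?thesis using that norm_triangle_ineq4[of a b] norm_triangle_ineq4[of c d] by linarith
    qed
    have "norm (cint \<mu> (\<lambda>x. indicator A x + (-1) * \<theta> x)) \<le> 4 * (e / 4)"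
      unfolding cint_re_part by (intro quad *) (simp_all add: S_def)
    then show ?thesis
      using d norm_triangle_ineq[of "cint \<mu> (\<lambda>x. indicator A x + (-1) * \<theta> x)" "cint \<mu> \<theta>"]
        cint_le_total_variation[OF \<mu> c b] by simp
  qed
  then show ?thesis by (rule field_le_epsilon)
qed

lemma total_variation_lincomb:
  assumes \<mu>: "\<mu> \<in> complex_measures" and \<nu>: "\<nu> \<in> complex_measures"
  shows "total_variation (\<lambda>A. \<mu> A + c * \<nu> A) \<le> total_variation \<mu> + norm c * total_variation \<nu>"
proof (rule total_variation_least)
  fix \<eta> :: "'a \<Rightarrow> complex" assume \<eta>: "continuous_on UNIV \<eta>" "\<And>x. norm (\<eta> x) \<le> 1"
  have "norm (cint \<mu> \<eta> + c * cint \<nu> \<eta>) \<le> norm (cint \<mu> \<eta>) + norm c * norm (cint \<nu> \<eta>)"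
    by (metis norm_mult norm_triangle_ineq)
  also have "\<dots> \<le> total_variation \<mu> + norm c * total_variation \<nu>"
    by (intro add_mono mult_left_mono cint_le_total_variation \<mu> \<nu> \<eta>) auto
  finally show "norm (cint (\<lambda>A. \<mu> A + c * \<nu> A) \<eta>) \<le> total_variation \<mu> + norm c * total_variation \<nu>"
    using cint_lincomb[OF \<mu> \<nu> bounded_borel_continuous[OF \<eta>]] by simp
qed

lemma total_variation_zero: "total_variation (\<lambda>A. 0) = 0"
proof (rule antisym)
  have "cint (\<lambda>A. 0) \<eta> = 0" if "\<eta> \<in> bounded_borel" for \<eta> :: "'a \<Rightarrow> complex"
    using cint_scale[OF complex_measures_zero that, of 0] by simp
  then show "total_variation (\<lambda>A::'a set. 0) \<le> 0"
    using bounded_borel_continuous by (intro total_variation_least) fastforce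
qed (rule total_variation_nonneg[OF complex_measures_zero])

lemma cint_le_total_variation_bound:
  assumes \<mu>: "\<mu> \<in> complex_measures" and c: "continuous_on UNIV \<eta>" and B: "\<And>x. norm (\<eta> x) \<le> B"
  shows "norm (cint \<mu> \<eta>) \<le> B * total_variation \<mu>"
proof -
  have "B \<ge> 0" using B[of undefined] norm_ge_zero order_trans by blast
  then consider "B = 0" | "B > 0" by linarith
  then show ?thesis
  proof cases
    case 1
    then have "\<eta> = (\<lambda>x. 0 * \<eta> x)" using B by auto
    then show ?thesis using cint_scale_fun[of \<mu> 0 \<eta>] 1 by simp
  next
    case 2
    have "norm (cint \<mu> (\<lambda>x. inverse (of_real B) * \<eta> x)) \<le> total_variation \<mu>"
      using 2 B by (intro cint_le_total_variation[OF \<mu>] continuous_intros c)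
        (simp add: norm_mult norm_divide norm_inverse field_simps)
    then show ?thesis
      unfolding cint_scale_fun using 2 by (simp add: norm_mult norm_divide norm_inverse field_simps)
  qed
qed

lemma total_variation_eq_0:
  fixes \<mu> :: "'a::metric_space set \<Rightarrow> complex"
  assumes "\<mu> \<in> complex_measures" "total_variation \<mu> \<le> 0" shows "\<mu> = (\<lambda>A. 0)"
proof
  fix A
  have "norm (\<mu> A) \<le> 0" using norm_le_total_variation[OF assms(1), of A] assms(2) by linarith
  then show "\<mu> A = 0" by simp
qed

lemma geometric_Cauchy_limit:
  fixes x :: "nat \<Rightarrow> 'b::banach"
  assumes "\<And>k. norm (x (Suc k) - x k) \<le> K * (1/2) ^ k"
  obtains l where "x \<longlonglongrightarrow> l" "\<And>k. norm (x k - l) \<le> 2 * K * (1/2) ^ k"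
proof -
  have g: "summable (\<lambda>k. K * (1/2) ^ k :: real)" by (intro summable_mult summable_geometric) simp
  have sm: "summable (\<lambda>k. x (Suc k) - x k)"
    by (rule summable_comparison_test[OF _ g]) (use assms in auto)
  define l where "l = x 0 + (\<Sum>k. x (Suc k) - x k)"
  have "(\<lambda>n. x 0 + (\<Sum>k<n. x (Suc k) - x k)) \<longlonglongrightarrow> l"
    unfolding l_def by (intro tendsto_intros summable_LIMSEQ sm)
  then have lim: "x \<longlonglongrightarrow> l" by (simp add: sum_lessThan_telescope)
  have "norm (x k - l) \<le> 2 * K * (1/2) ^ k" for k
  proof -
    have "norm (x k - x (n + k)) \<le> 2 * K * (1/2) ^ k" for n
    proof -
      \<comment> \<open>Subtracting the part of the geometric tail that has not been used up yet is
        the strengthening that carries the induction.\<close>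
      have "norm (x k - x (n + k)) \<le> 2 * K * (1/2)^k - 2 * K * (1/2)^(n + k)"
      proof (induction n)
        case 0 then show ?case by simp
      next
        case (Suc n)
        have "norm (x k - x (Suc n + k)) \<le> norm (x k - x (n + k)) + norm (x (Suc (n + k)) - x (n + k))"
          using norm_triangle_ineq4[of "x k - x (n + k)" "x (Suc (n + k)) - x (n + k)"] by simp
        then show ?case using Suc assms[of "n + k"] by simp
      qed
      moreover have "0 \<le> K" using assms[of 0] order_trans[OF norm_ge_zero[of "x (Suc 0) - x 0"]] by simp
      then have "0 \<le> 2 * K * (1/2) ^ (n + k)" by simp
      ultimately show ?thesis by linarith
    qed
    moreover have "(\<lambda>n. norm (x k - x (n + k))) \<longlonglongrightarrow> norm (x k - l)"
      by (intro tendsto_intros LIMSEQ_ignore_initial_segment lim)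
    ultimately show ?thesis by (intro LIMSEQ_le_const2) auto
  qed
  then show ?thesis using that lim by blast
qed

text \<open>The limit is taken setwise. Convergence is uniform over all sets, so the limit over
  \<open>k\<close> may be exchanged with the limit of partial unions, and countable additivity
  survives. The constant 8 is the factor 4 between \<open>total_variation\<close> and
  \<open>sup_measure_norm\<close> times the factor 2 of a geometric tail.\<close>

lemma complex_measures_complete:
  fixes x :: "nat \<Rightarrow> 'a::metric_space set \<Rightarrow> complex"
  assumes x: "\<And>k. x k \<in> complex_measures"
    and d: "\<And>k. total_variation (\<lambda>A. x (Suc k) A - x k A) \<le> K * (1/2) ^ k"
  obtains l where "l \<in> complex_measures" "\<And>A. (\<lambda>k. x k A) \<longlonglongrightarrow> l A"
    "\<And>k. total_variation (\<lambda>A. x k A - l A) \<le> 8 * K * (1/2) ^ k"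
proof -
  have diff: "(\<lambda>A. \<mu> A - \<nu> A) \<in> complex_measures"
    if "\<mu> \<in> complex_measures" "\<nu> \<in> complex_measures" for \<mu> \<nu> :: "'a set \<Rightarrow> complex"
    using complex_measures_lincomb[OF that, of "-1"] by simp
  have "\<exists>l. (\<lambda>k. x k A) \<longlonglongrightarrow> l \<and> (\<forall>k. norm (x k A - l) \<le> 2 * K * (1/2) ^ k)" for A
  proof -
    have "norm (x (Suc k) A - x k A) \<le> K * (1/2) ^ k" for k
    proof -
      have m: "(\<lambda>A. x (Suc k) A - x k A) \<in> complex_measures" by (rule diff[OF x x])
      show ?thesis using norm_le_total_variation[OF m, of A] d[of k] by linarith
    qed
    then show ?thesis by (rule geometric_Cauchy_limit[of "\<lambda>k. x k A"]) blast
  qed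
  then obtain l where l: "\<And>A. (\<lambda>k. x k A) \<longlonglongrightarrow> l A" "\<And>A k. norm (x k A - l A) \<le> 2 * K * (1/2) ^ k"
    by metis
  have K0: "(\<lambda>k. 2 * K * (1/2) ^ k :: real) \<longlonglongrightarrow> 0"
    by (intro tendsto_mult_right_zero LIMSEQ_power_zero) simp
  have "l \<in> complex_measures"
    unfolding complex_measures_def
  proof (intro CollectI conjI allI impI)
    fix A :: "'a set" assume "A \<notin> sets borel"
    then have "(\<lambda>k. x k A) = (\<lambda>k. 0)" using complex_measures_nonborel[OF x] by auto
    then show "l A = 0" using l(1)[of A] by (simp add: LIMSEQ_const_iff)
  next
    fix A :: "nat \<Rightarrow> 'a set" assume A: "range A \<subseteq> sets borel" "disjoint_family A"
    have part: "(\<Sum>n<N. x k (A n)) = x k (\<Union>n<N. A n)" for k N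
    proof (induction N)
      case 0 then show ?case by (simp add: complex_measures_empty[OF x])
    next
      case (Suc N)
      have "x k ((\<Union>n<N. A n) \<union> A N) = x k (\<Union>n<N. A n) + x k (A N)"
      proof (rule complex_measures_Un[OF x])
        show "(\<Union>n<N. A n) \<in> sets borel" "A N \<in> sets borel" using A(1) by auto
        have "A n \<inter> A N = {}" if "n < N" for n
          using A(2) that by (auto simp: disjoint_family_on_def)
        then show "(\<Union>n<N. A n) \<inter> A N = {}" by blast
      qed
      then show ?case using Suc by (simp add: lessThan_Suc Un_commute)
    qed
    have partl: "(\<Sum>n<N. l (A n)) = l (\<Union>n<N. A n)" for N
    proof (rule LIMSEQ_unique)
      show "(\<lambda>k. \<Sum>n<N. x k (A n)) \<longlonglongrightarrow> (\<Sum>n<N. l (A n))" by (intro tendsto_intros l(1))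
      show "(\<lambda>k. \<Sum>n<N. x k (A n)) \<longlonglongrightarrow> l (\<Union>n<N. A n)" unfolding part by (rule l(1))
    qed
    have "(\<lambda>N. l (\<Union>n<N. A n)) \<longlonglongrightarrow> l (\<Union>n. A n)"
    proof (rule swap_uniform_limit')
      show "\<forall>\<^sub>F k in sequentially. (\<lambda>N. x k (\<Union>n<N. A n)) \<longlonglongrightarrow> x k (\<Union>n. A n)"
        using complex_measures_sums[OF x A] by (simp add: sums_def part)
      show "(\<lambda>k. x k (\<Union>n. A n)) \<longlonglongrightarrow> l (\<Union>n. A n)" by (rule l(1))
      show "uniform_limit UNIV (\<lambda>k N. x k (\<Union>n<N. A n)) (\<lambda>N. l (\<Union>n<N. A n)) sequentially"
      proof (rule uniform_limitI)
        fix e :: real assume "e > 0"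
        then have "\<forall>\<^sub>F k in sequentially. 2 * K * (1/2) ^ k < e" by (rule order_tendstoD(2)[OF K0])
        then show "\<forall>\<^sub>F k in sequentially. \<forall>N\<in>UNIV. dist (x k (\<Union>n<N. A n)) (l (\<Union>n<N. A n)) < e"
          using l(2) by (auto simp: dist_norm elim!: eventually_mono intro: le_less_trans)
      qed
    qed auto
    then show "(\<lambda>n. l (A n)) sums l (\<Union>n. A n)" unfolding sums_def partl .
  qed
  moreover have "total_variation (\<lambda>A. x k A - l A) \<le> 8 * K * (1/2) ^ k" for k
  proof -
    have "sup_measure_norm (\<lambda>A. x k A - l A) \<le> 2 * K * (1/2) ^ k"
      using l(2) by (rule sup_measure_norm_least)
    moreover have "(\<lambda>A. x k A - l A) \<in> complex_measures"
      by (rule diff[OF x \<open>l \<in> complex_measures\<close>])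
    ultimately show ?thesis
      using total_variation_le_sup_measure_norm[of "\<lambda>A. x k A - l A"] by linarith
  qed
  ultimately show ?thesis using that l(1) by blast
qed

text \<open>Fubini for a family of measures, reduced to indicators by induction on the integrand. It
  is used twice: for point masses carried along a map, which gives \<open>density_measure\<close>,
  and for the time integral of image measures, which gives the resolvent.\<close>

lemma complex_measures_mixture:
  fixes \<kappa> :: "'t \<Rightarrow> 'a::topological_space set \<Rightarrow> complex" and \<tau> :: "'t measure"
  assumes \<kappa>: "\<And>t. t \<in> space \<tau> \<Longrightarrow> \<kappa> t \<in> complex_measures"
    and meas: "\<And>A. A \<in> sets borel \<Longrightarrow> (\<lambda>t. \<kappa> t A) \<in> borel_measurable \<tau>"
    and w: "\<And>t A. t \<in> space \<tau> \<Longrightarrow> norm (\<kappa> t A) \<le> w t" "integrable \<tau> w"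
  shows "(\<lambda>A. \<integral>t. \<kappa> t A \<partial>\<tau>) \<in> complex_measures" (is "?\<nu> \<in> _")
    and "f \<in> bounded_borel \<Longrightarrow> (\<lambda>t. cint (\<kappa> t) f) \<in> borel_measurable \<tau>"
    and "f \<in> bounded_borel \<Longrightarrow> cint (\<lambda>A. \<integral>t. \<kappa> t A \<partial>\<tau>) f = (\<integral>t. cint (\<kappa> t) f \<partial>\<tau>)"
proof -
  show \<nu>: "?\<nu> \<in> complex_measures"
    unfolding complex_measures_def
  proof (intro CollectI conjI allI impI)
    fix A :: "'a set" assume "A \<notin> sets borel"
    then have "(\<integral>t. \<kappa> t A \<partial>\<tau>) = (\<integral>t. 0 \<partial>\<tau>)"
      using complex_measures_nonborel[OF \<kappa>] by (intro Bochner_Integration.integral_cong) auto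
    then show "(\<integral>t. \<kappa> t A \<partial>\<tau>) = 0" by simp
  next
    fix A :: "nat \<Rightarrow> 'a set" assume A: "range A \<subseteq> sets borel" "disjoint_family A"
    have int: "integrable \<tau> (\<lambda>t. \<kappa> t B)" if "B \<in> sets borel" for B
      by (rule Bochner_Integration.integrable_bound[OF w(2) meas[OF that]])
        (use w(1) order_trans[OF w(1) abs_ge_self] in auto)
    have part: "(\<Sum>n<N. \<kappa> t (A n)) = \<kappa> t (\<Union>n<N. A n)" if t: "t \<in> space \<tau>" for t N
    proof (induction N)
      case 0 then show ?case by (simp add: complex_measures_empty[OF \<kappa>[OF t]])
    next
      case (Suc N)
      have "\<kappa> t ((\<Union>n<N. A n) \<union> A N) = \<kappa> t (\<Union>n<N. A n) + \<kappa> t (A N)"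
      proof (rule complex_measures_Un[OF \<kappa>[OF t]])
        show "(\<Union>n<N. A n) \<in> sets borel" "A N \<in> sets borel" using A(1) by auto
        have "A n \<inter> A N = {}" if "n < N" for n
          using A(2) that by (auto simp: disjoint_family_on_def)
        then show "(\<Union>n<N. A n) \<inter> A N = {}" by blast
      qed
      then show ?case using Suc by (simp add: lessThan_Suc Un_commute)
    qed
    have "(\<lambda>N. \<integral>t. (\<Sum>n<N. \<kappa> t (A n)) \<partial>\<tau>) \<longlonglongrightarrow> (\<integral>t. \<kappa> t (\<Union>n. A n) \<partial>\<tau>)"
    proof (rule integral_dominated_convergence[of _ _ _ w])
      show "(\<lambda>t. \<kappa> t (\<Union>n. A n)) \<in> borel_measurable \<tau>" using A by (intro meas) auto
      show "(\<lambda>t. \<Sum>n<N. \<kappa> t (A n)) \<in> borel_measurable \<tau>" for N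
        using A by (intro borel_measurable_sum meas) auto
      show "AE t in \<tau>. (\<lambda>N. \<Sum>n<N. \<kappa> t (A n)) \<longlonglongrightarrow> \<kappa> t (\<Union>n. A n)"
        using complex_measures_sums[OF \<kappa> A] by (auto simp: sums_def)
      show "AE t in \<tau>. norm (\<Sum>n<N. \<kappa> t (A n)) \<le> w t" for N
        using part w(1) by auto
    qed (rule w(2))
    moreover have "(\<integral>t. (\<Sum>n<N. \<kappa> t (A n)) \<partial>\<tau>) = (\<Sum>n<N. \<integral>t. \<kappa> t (A n) \<partial>\<tau>)" for N
      using A by (intro Bochner_Integration.integral_sum int) auto
    ultimately show "(\<lambda>n. \<integral>t. \<kappa> t (A n) \<partial>\<tau>) sums (\<integral>t. \<kappa> t (\<Union>n. A n) \<partial>\<tau>)"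
      unfolding sums_def by simp
  qed
  have bd: "norm (cint (\<kappa> t) f) \<le> 4 * B * w t"
    if "f \<in> bounded_borel" "\<And>x. norm (f x) \<le> B" "t \<in> space \<tau>" for f B t
  proof -
    have "B \<ge> 0" using that(2)[of undefined] norm_ge_zero order_trans by blast
    then have "4 * sup_measure_norm (\<kappa> t) * B \<le> 4 * w t * B"
      using sup_measure_norm_least[of "\<kappa> t" "w t"] w(1)[OF that(3)] by (intro mult_right_mono) auto
    then show ?thesis
      using norm_cint_le[OF \<kappa>[OF that(3)] bounded_borel_measurable[OF that(1)] that(2)]
      by (simp add: mult_ac)
  qed
  have "(\<lambda>t. cint (\<kappa> t) f) \<in> borel_measurable \<tau> \<and> cint ?\<nu> f = (\<integral>t. cint (\<kappa> t) f \<partial>\<tau>)"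
    if "f \<in> bounded_borel" for f
    using that
  proof (induction rule: bounded_borel_induct)
    case (ind A)
    have eq: "cint (\<kappa> t) (indicator A) = \<kappa> t A" if "t \<in> space \<tau>" for t
      by (rule cint_indicator[OF \<kappa>[OF that] ind])
    have "(\<lambda>t. cint (\<kappa> t) (indicator A)) \<in> borel_measurable \<tau>"
      by (subst measurable_cong[OF eq]) (auto intro: meas[OF ind])
    moreover have "(\<integral>t. cint (\<kappa> t) (indicator A) \<partial>\<tau>) = (\<integral>t. \<kappa> t A \<partial>\<tau>)"
      by (rule Bochner_Integration.integral_cong[OF refl eq])
    ultimately show ?case using cint_indicator[OF \<nu> ind] by simp
  next
    case (lin f g c)
    have int: "integrable \<tau> (\<lambda>t. cint (\<kappa> t) h)"
      if h: "h \<in> bounded_borel" and hm: "(\<lambda>t. cint (\<kappa> t) h) \<in> borel_measurable \<tau>" for h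
    proof -
      obtain B where B: "\<And>x. norm (h x) \<le> B" using h unfolding bounded_borel_def by blast
      show ?thesis
        by (rule Bochner_Integration.integrable_bound[OF integrable_mult_right[OF w(2), of "4 * B"] hm])
          (use order_trans[OF bd[OF h B] abs_ge_self] in auto)
    qed
    have "cint (\<kappa> t) (\<lambda>x. f x + c * g x) = cint (\<kappa> t) f + c * cint (\<kappa> t) g" if "t \<in> space \<tau>" for t
      by (rule cint_lincomb_fun[OF \<kappa>[OF that] lin.hyps])
    note eq = this
    have m: "(\<lambda>t. cint (\<kappa> t) (\<lambda>x. f x + c * g x)) \<in> borel_measurable \<tau>"
      by (subst measurable_cong[OF eq]) (use lin.IH in \<open>auto intro!: borel_measurable_add borel_measurable_times\<close>)
    have "(\<integral>t. cint (\<kappa> t) (\<lambda>x. f x + c * g x) \<partial>\<tau>)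
        = (\<integral>t. cint (\<kappa> t) f + c * cint (\<kappa> t) g \<partial>\<tau>)"
      by (rule Bochner_Integration.integral_cong[OF refl eq])
    also have "\<dots> = (\<integral>t. cint (\<kappa> t) f \<partial>\<tau>) + c * (\<integral>t. cint (\<kappa> t) g \<partial>\<tau>)"
      using int[OF lin.hyps(1)] int[OF lin.hyps(2)] lin.IH by simp
    also have "\<dots> = cint ?\<nu> (\<lambda>x. f x + c * g x)"
      using lin.IH by (simp only: cint_lincomb_fun[OF \<nu> lin.hyps])
    finally show ?case using m by simp
  next
    case (lim f s B)
    have l: "(\<lambda>n. cint (\<kappa> t) (s n)) \<longlonglongrightarrow> cint (\<kappa> t) f" if "t \<in> space \<tau>" for t
      using lim.hyps by (intro cint_dominated_convergence[OF \<kappa>[OF that], of s f B]) auto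
    have m: "(\<lambda>t. cint (\<kappa> t) f) \<in> borel_measurable \<tau>"
    proof (rule borel_measurable_LIMSEQ_metric)
      show "(\<lambda>t. cint (\<kappa> t) (s n)) \<in> borel_measurable \<tau>" for n using lim.IH by blast
    qed (rule l)
    have "(\<lambda>n. \<integral>t. cint (\<kappa> t) (s n) \<partial>\<tau>) \<longlonglongrightarrow> (\<integral>t. cint (\<kappa> t) f \<partial>\<tau>)"
    proof (rule integral_dominated_convergence[of _ _ _ "\<lambda>t. 4 * B * w t"])
      show "(\<lambda>t. cint (\<kappa> t) (s n)) \<in> borel_measurable \<tau>" for n using lim.IH by blast
      show "AE t in \<tau>. norm (cint (\<kappa> t) (s n)) \<le> 4 * B * w t" for n
        using bd[OF lim.hyps(1) lim.hyps(2)] by (intro AE_I2) blast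
      show "AE t in \<tau>. (\<lambda>n. cint (\<kappa> t) (s n)) \<longlonglongrightarrow> cint (\<kappa> t) f"
        using l by (intro AE_I2)
      show "integrable \<tau> (\<lambda>t. 4 * B * w t)" by (intro integrable_mult_right w(2))
    qed (rule m)
    moreover have "(\<lambda>n. cint ?\<nu> (s n)) \<longlonglongrightarrow> cint ?\<nu> f"
      using lim.hyps by (intro cint_dominated_convergence[OF \<nu>, of s f B]) auto
    moreover have "cint ?\<nu> (s n) = (\<integral>t. cint (\<kappa> t) (s n) \<partial>\<tau>)" for n using lim.IH by blast
    ultimately have "cint ?\<nu> f = (\<integral>t. cint (\<kappa> t) f \<partial>\<tau>)" using LIMSEQ_unique by fastforce
    then show ?case using m by blast
  qed
  then show "f \<in> bounded_borel \<Longrightarrow> (\<lambda>t. cint (\<kappa> t) f) \<in> borel_measurable \<tau>"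
    and "f \<in> bounded_borel \<Longrightarrow> cint ?\<nu> f = (\<integral>t. cint (\<kappa> t) f \<partial>\<tau>)" by blast+
qed

text \<open>The explicit form of the push-forward. The case distinction is needed because the
  preimage of a non-Borel set may be Borel, while complex measures are normalized to vanish off the
  Borel sets.\<close>

definition image_measure :: "('a::topological_space \<Rightarrow> 'a) \<Rightarrow> ('a set \<Rightarrow> complex) \<Rightarrow> 'a set \<Rightarrow> complex" where
  "image_measure h \<mu> A = (if A \<in> sets borel then \<mu> (h -` A) else 0)"

lemma image_measure:
  assumes \<mu>: "\<mu> \<in> complex_measures" and h: "h \<in> borel_measurable borel"
  shows "image_measure h \<mu> \<in> complex_measures"
    and "f \<in> bounded_borel \<Longrightarrow> cint (image_measure h \<mu>) f = cint \<mu> (f \<circ> h)"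
proof -
  have pre: "h -` A \<in> sets borel" if "A \<in> sets borel" for A
    using measurable_sets[OF h that] by simp
  show \<nu>: "image_measure h \<mu> \<in> complex_measures"
    unfolding complex_measures_def
  proof (intro CollectI conjI allI impI)
    fix A :: "nat \<Rightarrow> 'a set" assume A: "range A \<subseteq> sets borel" "disjoint_family A"
    have "(\<lambda>n. \<mu> (h -` A n)) sums \<mu> (\<Union>n. h -` A n)"
      using A pre by (intro complex_measures_sums[OF \<mu>]) (auto simp: disjoint_family_on_def)
    then show "(\<lambda>n. image_measure h \<mu> (A n)) sums image_measure h \<mu> (\<Union>n. A n)"
      using A unfolding image_measure_def by (auto simp: vimage_UN range_subsetD)
  qed (auto simp: image_measure_def)
  show "cint (image_measure h \<mu>) f = cint \<mu> (f \<circ> h)" if "f \<in> bounded_borel"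
    using that
  proof (induction rule: bounded_borel_induct)
    case (ind A)
    have "(indicator A \<circ> h :: 'a \<Rightarrow> complex) = indicator (h -` A)" by (auto simp: indicator_def)
    then show ?case
      using cint_indicator[OF \<nu> ind] cint_indicator[OF \<mu> pre[OF ind]] ind
      by (simp add: image_measure_def[of h \<mu> A])
  next
    case (lin f g c)
    show ?case
      using cint_lincomb_fun[OF \<nu> lin.hyps, of c] lin.IH
        cint_lincomb_fun[OF \<mu> bounded_borel_comp[OF lin.hyps(1) h] bounded_borel_comp[OF lin.hyps(2) h], of c]
      by (simp add: comp_def)
  next
    case (lim f s B)
    have "(\<lambda>n. cint (image_measure h \<mu>) (s n)) \<longlonglongrightarrow> cint (image_measure h \<mu>) f"
      using lim.hyps by (intro cint_dominated_convergence[OF \<nu>, of s f B]) auto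
    moreover have "(\<lambda>n. cint \<mu> (s n \<circ> h)) \<longlonglongrightarrow> cint \<mu> (f \<circ> h)"
      using lim.hyps h by (intro cint_dominated_convergence[OF \<mu>, of "\<lambda>n. s n \<circ> h" "f \<circ> h" B]
          bounded_borel_comp) auto
    ultimately show ?case unfolding lim.IH by (rule LIMSEQ_unique)
  qed
qed

lemma cint_dirac:
  assumes f: "f \<in> bounded_borel"
  shows "(\<lambda>A. if A \<in> sets borel then c * indicator A p else 0) \<in> complex_measures" (is "?\<delta> \<in> _")
    and "cint (\<lambda>A. if A \<in> sets borel then c * indicator A p else 0) f = c * f p"
proof -
  show \<delta>: "?\<delta> \<in> complex_measures"
    unfolding complex_measures_def
  proof (intro CollectI conjI allI impI)
    fix A :: "nat \<Rightarrow> 'a set" assume A: "range A \<subseteq> sets borel" "disjoint_family A"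
    have "(\<lambda>n. c * complex_of_real (indicator (A n) p)) sums (c * complex_of_real (indicator (\<Union>n. A n) p))"
      by (intro sums_mult sums_of_real sums_indicator_disjoint A)
    moreover have "?\<delta> (A n) = c * complex_of_real (indicator (A n) p)" for n
      using A by (auto simp: indicator_def)
    moreover have "?\<delta> (\<Union>n. A n) = c * complex_of_real (indicator (\<Union>n. A n) p)"
      using A by (auto simp: indicator_def)
    ultimately show "(\<lambda>n. ?\<delta> (A n)) sums ?\<delta> (\<Union>n. A n)" by (simp only:)
  qed auto
  show "cint ?\<delta> f = c * f p"
    using f
  proof (induction rule: bounded_borel_induct)
    case (ind A)
    then show ?case using cint_indicator[OF \<delta> ind] by simp
  next
    case (lin f g d)
    then show ?case using cint_lincomb_fun[OF \<delta> lin.hyps, of d] by (simp add: algebra_simps)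
  next
    case (lim f s B)
    have "(\<lambda>n. cint ?\<delta> (s n)) \<longlonglongrightarrow> cint ?\<delta> f"
      using lim.hyps by (intro cint_dominated_convergence[OF \<delta>, of s f B]) auto
    moreover have "(\<lambda>n. c * s n p) \<longlonglongrightarrow> c * f p" using lim.hyps by (intro tendsto_mult tendsto_const) auto
    ultimately show ?case unfolding lim.IH by (rule LIMSEQ_unique)
  qed
qed

subsection \<open>Operators on a complete space of complex functions\<close>

text \<open>Completeness is stated for geometrically fast Cauchy sequences, which amounts to full
  completeness by passing to subsequences. It is the form that series of increments deliver and that
  difference quotients along a geometric sequence consume.\<close>

locale function_banach_space =
  fixes E :: "('b \<Rightarrow> complex) set" and n :: "('b \<Rightarrow> complex) \<Rightarrow> real"
  assumes zero: "(\<lambda>A. 0) \<in> E"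
    and lincomb: "\<mu> \<in> E \<Longrightarrow> \<nu> \<in> E \<Longrightarrow> (\<lambda>A. \<mu> A + c * \<nu> A) \<in> E"
    and n_lincomb: "\<mu> \<in> E \<Longrightarrow> \<nu> \<in> E \<Longrightarrow> n (\<lambda>A. \<mu> A + c * \<nu> A) \<le> n \<mu> + norm c * n \<nu>"
    and n_zero: "n (\<lambda>A. 0) = 0"
    and n_nonneg: "\<mu> \<in> E \<Longrightarrow> 0 \<le> n \<mu>"
    and n_eq_0: "\<mu> \<in> E \<Longrightarrow> n \<mu> = 0 \<Longrightarrow> \<mu> = (\<lambda>A. 0)"
    and complete: "(\<And>k. x k \<in> E) \<Longrightarrow> (\<And>k. n (\<lambda>A. x (Suc k) A - x k A) \<le> K * (1/2) ^ k)
      \<Longrightarrow> \<exists>l\<in>E. (\<lambda>k. n (\<lambda>A. x k A - l A)) \<longlonglongrightarrow> 0"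
begin

lemma scale: "\<mu> \<in> E \<Longrightarrow> (\<lambda>A. c * \<mu> A) \<in> E"
  using lincomb[OF zero, of \<mu> c] by simp

lemma add: "\<mu> \<in> E \<Longrightarrow> \<nu> \<in> E \<Longrightarrow> (\<lambda>A. \<mu> A + \<nu> A) \<in> E"
  using lincomb[of \<mu> \<nu> 1] by simp

lemma diff: "\<mu> \<in> E \<Longrightarrow> \<nu> \<in> E \<Longrightarrow> (\<lambda>A. \<mu> A - \<nu> A) \<in> E"
  using lincomb[of \<mu> \<nu> "-1"] by simp

lemma n_add: "\<mu> \<in> E \<Longrightarrow> \<nu> \<in> E \<Longrightarrow> n (\<lambda>A. \<mu> A + \<nu> A) \<le> n \<mu> + n \<nu>"
  using n_lincomb[of \<mu> \<nu> 1] by simp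

lemma n_diff: "\<mu> \<in> E \<Longrightarrow> \<nu> \<in> E \<Longrightarrow> n (\<lambda>A. \<mu> A - \<nu> A) \<le> n \<mu> + n \<nu>"
  using n_lincomb[of \<mu> \<nu> "-1"] by simp

lemma n_scale_le: "\<mu> \<in> E \<Longrightarrow> n (\<lambda>A. c * \<mu> A) \<le> norm c * n \<mu>"
  using n_lincomb[OF zero, of \<mu> c] n_zero by simp

lemma n_scale:
  assumes "\<mu> \<in> E" shows "n (\<lambda>A. c * \<mu> A) = norm c * n \<mu>"
proof (cases "c = 0")
  case True then show ?thesis using n_zero by simp
next
  case False
  have "n \<mu> \<le> norm (inverse c) * n (\<lambda>A. c * \<mu> A)"
    using n_scale_le[OF scale[OF assms, of c], of "inverse c"] False
    by (simp add: mult.assoc[symmetric])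
  then have "norm c * n \<mu> \<le> n (\<lambda>A. c * \<mu> A)"
    using False by (simp add: norm_inverse norm_divide field_simps)
  then show ?thesis using n_scale_le[OF assms, of c] by simp
qed

lemma n_minus_commute:
  assumes "\<mu> \<in> E" "\<nu> \<in> E" shows "n (\<lambda>A. \<mu> A - \<nu> A) = n (\<lambda>A. \<nu> A - \<mu> A)"
  using n_scale[OF diff[OF assms], of "-1"] by simp

lemma n_triangle:
  assumes "\<mu> \<in> E" "\<nu> \<in> E" "\<rho> \<in> E"
  shows "n (\<lambda>A. \<mu> A - \<rho> A) \<le> n (\<lambda>A. \<mu> A - \<nu> A) + n (\<lambda>A. \<nu> A - \<rho> A)"
  using n_add[OF diff[OF assms(1,2)] diff[OF assms(2,3)]] by simp

section \<open>Hahn-Banach by minimal sublinear functionals\<close>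

definition sublinear :: "(('b \<Rightarrow> complex) \<Rightarrow> real) \<Rightarrow> bool" where
  "sublinear q \<longleftrightarrow> (\<forall>x\<in>E. \<forall>y\<in>E. q (\<lambda>A. x A + y A) \<le> q x + q y) \<and>
     (\<forall>x\<in>E. \<forall>t>0. q (\<lambda>A. of_real t * x A) \<le> t * q x) \<and> q (\<lambda>A. 0) = 0 \<and> (\<forall>x. x \<notin> E \<longrightarrow> q x = 0)"

lemma sublinearD:
  assumes "sublinear q"
  shows "x \<in> E \<Longrightarrow> y \<in> E \<Longrightarrow> q (\<lambda>A. x A + y A) \<le> q x + q y"
    and "x \<in> E \<Longrightarrow> t > 0 \<Longrightarrow> q (\<lambda>A. of_real t * x A) \<le> t * q x"
    and "q (\<lambda>A. 0) = 0" and "x \<notin> E \<Longrightarrow> q x = 0"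
  using assms unfolding sublinear_def by blast+

lemma sublinear_scale:
  assumes q: "sublinear q" and x: "x \<in> E" and t: "t \<ge> 0"
  shows "q (\<lambda>A. of_real t * x A) = t * q x"
proof (cases "t = 0")
  case True then show ?thesis using sublinearD(3)[OF q] by simp
next
  case False
  then have t: "t > 0" using t by simp
  have "q x \<le> inverse t * q (\<lambda>A. of_real t * x A)"
    using sublinearD(2)[OF q scale[OF x, of "of_real t"], of "inverse t"] t
    by (simp add: mult.assoc[symmetric] flip: of_real_mult of_real_inverse)
  then have "t * q x \<le> q (\<lambda>A. of_real t * x A)" using t by (simp add: field_simps)
  then show ?thesis using sublinearD(2)[OF q x t] by simp
qed

lemma sublinear_minus:
  assumes q: "sublinear q" and x: "x \<in> E" shows "- q (\<lambda>A. - x A) \<le> q x"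
  using sublinearD(1)[OF q x, of "\<lambda>A. - x A"] scale[OF x, of "-1"] sublinearD(3)[OF q] by simp

text \<open>The candidate is the infimum over \<open>t \<ge> 0\<close> of
  \<open>q (x + t y) - t q y\<close>, bounded below by \<open>- q (- x)\<close> and thus finite. For
  a minimal \<open>q\<close> the refinement must coincide with \<open>q\<close>, which forces
  \<open>q (- y) = - q y\<close>; oddness in every direction makes \<open>q\<close> real
  linear.\<close>

lemma sublinear_refine:
  assumes q: "sublinear q" and y: "y \<in> E"
  shows "\<exists>r. sublinear r \<and> (\<forall>x. r x \<le> q x) \<and> r (\<lambda>A. - y A) \<le> - q y"
proof -
  define v where "v x t = q (\<lambda>A. x A + of_real t * y A) - t * q y" for x t
  define r where "r x = (if x \<in> E then INF t\<in>{0..}. v x t else 0)" for x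
  have inE: "(\<lambda>A. x A + of_real t * y A) \<in> E" if "x \<in> E" for x t by (rule lincomb[OF that y])
  have low: "- q (\<lambda>A. - x A) \<le> v x t" if "x \<in> E" "t \<ge> 0" for x t
  proof -
    have "t * q y = q (\<lambda>A. of_real t * y A)" using sublinear_scale[OF q y that(2)] by simp
    also have "\<dots> \<le> q (\<lambda>A. x A + of_real t * y A) + q (\<lambda>A. - x A)"
      using sublinearD(1)[OF q inE[OF that(1)], of "\<lambda>A. - x A" t] scale[OF that(1), of "-1"] by simp
    finally show ?thesis unfolding v_def by simp
  qed
  have up: "r x \<le> v x t" if "x \<in> E" "t \<ge> 0" for x t
    unfolding r_def using that low[OF that(1)]
    by (auto intro!: cINF_lower bdd_belowI[of _ "- q (\<lambda>A. - x A)"])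
  have great: "c \<le> r x" if "x \<in> E" "\<And>t. t \<ge> 0 \<Longrightarrow> c \<le> v x t" for x c
    unfolding r_def using that by (auto intro!: cINF_greatest)
  have rq: "r x \<le> q x" for x
    using up[of x 0] sublinearD(4)[OF q, of x] by (cases "x \<in> E") (auto simp: v_def r_def)
  have "sublinear r"
    unfolding sublinear_def
  proof (intro conjI ballI allI impI)
    fix x x' assume x: "x \<in> E" "x' \<in> E"
    have *: "r (\<lambda>A. x A + x' A) \<le> v x t + v x' t'" if "t \<ge> 0" "t' \<ge> 0" for t t'
    proof -
      have "r (\<lambda>A. x A + x' A) \<le> v (\<lambda>A. x A + x' A) (t + t')"
        using that by (intro up add x) auto
      also have "\<dots> \<le> v x t + v x' t'"
        using sublinearD(1)[OF q inE[OF x(1)] inE[OF x(2)], of t t']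
        unfolding v_def by (simp add: algebra_simps)
      finally show ?thesis .
    qed
    have "r (\<lambda>A. x A + x' A) - v x t \<le> r x'" if "t \<ge> 0" for t
      using *[OF that] by (intro great x) (simp add: algebra_simps)
    then have "r (\<lambda>A. x A + x' A) - r x' \<le> r x"
      by (intro great x) (simp add: algebra_simps)
    then show "r (\<lambda>A. x A + x' A) \<le> r x + r x'" by simp
  next
    fix x and s :: real assume x: "x \<in> E" and s: "s > 0"
    have "r (\<lambda>A. of_real s * x A) / s \<le> v x t" if "t \<ge> 0" for t
    proof -
      have "r (\<lambda>A. of_real s * x A) \<le> v (\<lambda>A. of_real s * x A) (s * t)"
        using that s by (intro up scale x) auto
      also have "\<dots> \<le> s * v x t"
        using sublinearD(2)[OF q inE[OF x] s, of t] unfolding v_def by (simp add: algebra_simps)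
      finally show ?thesis using s by (simp add: field_simps)
    qed
    then have "r (\<lambda>A. of_real s * x A) / s \<le> r x" by (intro great x)
    then show "r (\<lambda>A. of_real s * x A) \<le> s * r x" using s by (simp add: field_simps)
  next
    have "r (\<lambda>A. 0) \<le> 0" using rq[of "\<lambda>A. 0"] sublinearD(3)[OF q] by simp
    moreover have "0 \<le> r (\<lambda>A. 0)"
      using sublinear_scale[OF q y] by (intro great zero) (simp add: v_def)
    ultimately show "r (\<lambda>A. 0) = 0" by simp
  qed (simp add: r_def)
  moreover have "r (\<lambda>A. - y A) \<le> - q y"
    using up[of "\<lambda>A. - y A" 1] scale[OF y, of "-1"] sublinearD(3)[OF q] by (simp add: v_def)
  ultimately show ?thesis using rq by blast
qed

text \<open>Zorn's lemma for the reversed pointwise order. The infimum of a chain is finite thanks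
  to the common lower bound \<open>- p (- x)\<close>, and it is subadditive because of two members
  of a chain one lies below the other.\<close>

lemma sublinear_minimal:
  assumes p: "sublinear p"
  shows "\<exists>q. sublinear q \<and> (\<forall>x. q x \<le> p x) \<and> (\<forall>r. sublinear r \<longrightarrow> (\<forall>x. r x \<le> q x) \<longrightarrow> r = q)"
proof -
  define S where "S = {q. sublinear q \<and> (\<forall>x. q x \<le> p x)}"
  define R :: "(('b \<Rightarrow> complex) \<Rightarrow> real) \<Rightarrow> (('b \<Rightarrow> complex) \<Rightarrow> real) \<Rightarrow> bool"
    where "R a b \<longleftrightarrow> (\<forall>x. b x \<le> a x)" for a b
  have "\<exists>m\<in>S. \<forall>a\<in>S. R m a \<longrightarrow> a = m"
  proof (rule predicate_Zorn)
    show "partial_order_on S (relation_of R S)"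
      by (rule partial_order_on_relation_ofI) (auto simp: R_def fun_eq_iff intro: order_trans antisym)
    fix C assume C: "C \<in> Chains (relation_of R S)"
    then have CS: "C \<subseteq> S" and ch: "\<And>a b. a \<in> C \<Longrightarrow> b \<in> C \<Longrightarrow> R a b \<or> R b a"
      by (auto simp: Chains_def relation_of_def)
    show "\<exists>u\<in>S. \<forall>a\<in>C. R a u"
    proof (cases "C = {}")
      case True then show ?thesis using p by (auto simp: S_def)
    next
      case False
      define u where "u x = (INF r\<in>C. r x)" for x
      have sub: "sublinear r" "r x \<le> p x" if "r \<in> C" for r x using that CS by (auto simp: S_def)
      have low: "- p (\<lambda>A. - x A) \<le> r x" if "r \<in> C" "x \<in> E" for r x
        using sublinear_minus[OF sub(1)[OF that(1)] that(2)] sub(2)[OF that(1), of "\<lambda>A. - x A"] by linarith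
      have bdd: "bdd_below ((\<lambda>r. r x) ` C)" for x
      proof (cases "x \<in> E")
        case True then show ?thesis using low by (auto intro!: bdd_belowI)
      next
        case False
        \<comment> \<open>Off \<open>E\<close> every sublinear functional is 0 by convention.
          Without that, values there could be lowered indefinitely and there would be no minimal
          element.\<close>
        then have "r x = 0" if "r \<in> C" for r using sublinearD(4)[OF sub(1)[OF that]] by blast
        then show ?thesis by (intro bdd_belowI2[of _ 0]) (metis order_refl)
      qed
      have up: "u x \<le> r x" if "r \<in> C" for r x unfolding u_def by (rule cINF_lower[OF bdd that])
      have great: "c \<le> u x" if "\<And>r. r \<in> C \<Longrightarrow> c \<le> r x" for c x
        unfolding u_def by (rule cINF_greatest[OF False that])
      have "sublinear u"
        unfolding sublinear_def
      proof (intro conjI ballI allI impI)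
        fix x y assume xy: "x \<in> E" "y \<in> E"
        have *: "u (\<lambda>A. x A + y A) \<le> r x + r' y" if r: "r \<in> C" "r' \<in> C" for r r'
        proof -
          have "u (\<lambda>A. x A + y A) \<le> s (\<lambda>A. x A + y A)" "s (\<lambda>A. x A + y A) \<le> s x + s y" if "s \<in> C" for s
            using up[OF that] sublinearD(1)[OF sub(1)[OF that] xy] by auto
          then have *: "u (\<lambda>A. x A + y A) \<le> s x + s y" if "s \<in> C" for s using that order_trans by blast
          consider "R r r'" | "R r' r" using ch[OF r] by blast
          then show ?thesis
            by cases (use *[OF r(1)] *[OF r(2)] in \<open>auto simp: R_def intro: order_trans add_mono\<close>)
        qed
        have "u (\<lambda>A. x A + y A) - r x \<le> u y" if "r \<in> C" for r
          using *[OF that] by (intro great) (simp add: algebra_simps)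
        then have "u (\<lambda>A. x A + y A) - u y \<le> u x"
          by (intro great) (simp add: algebra_simps)
        then show "u (\<lambda>A. x A + y A) \<le> u x + u y" by simp
      next
        fix x and t :: real assume x: "x \<in> E" and t: "t > 0"
        have "u (\<lambda>A. of_real t * x A) / t \<le> r x" if "r \<in> C" for r
          using order_trans[OF up[OF that] sublinearD(2)[OF sub(1)[OF that] x t]] t by (simp add: field_simps)
        then have "u (\<lambda>A. of_real t * x A) / t \<le> u x" by (rule great)
        then show "u (\<lambda>A. of_real t * x A) \<le> t * u x" using t by (simp add: field_simps)
      next
        have "u (\<lambda>A. 0) = (INF r\<in>C. 0)"
          unfolding u_def using sublinearD(3)[OF sub(1)] by (intro INF_cong refl)
        then show "u (\<lambda>A. 0) = 0" using False by simp
      next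
        fix x assume "x \<notin> E"
        then have "u x = (INF r\<in>C. 0)"
          unfolding u_def using sublinearD(4)[OF sub(1)] by (intro INF_cong refl)
        then show "u x = 0" using False by simp
      qed
      moreover obtain r where "r \<in> C" using False by blast
      ultimately show ?thesis
        using up sub(2) order_trans by (intro bexI[of _ u]) (auto simp: S_def R_def, blast)
    qed
  qed
  then obtain q where q: "q \<in> S" "\<And>a. a \<in> S \<Longrightarrow> R q a \<Longrightarrow> a = q" by blast
  show ?thesis
  proof (intro exI[of _ q] conjI allI impI)
    fix r assume r: "sublinear r" "\<forall>x. r x \<le> q x"
    have "r x \<le> p x" for x using r(2) q(1) order_trans unfolding S_def by blast
    then show "r = q" using q(2)[of r] r by (simp add: S_def R_def)
  qed (use q in \<open>auto simp: S_def\<close>)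
qed

definition functional :: "(('b \<Rightarrow> complex) \<Rightarrow> complex) \<Rightarrow> bool" where
  "functional \<psi> \<longleftrightarrow> (\<forall>x\<in>E. \<forall>y\<in>E. \<forall>c. \<psi> (\<lambda>A. x A + c * y A) = \<psi> x + c * \<psi> y)
     \<and> (\<exists>K. \<forall>x\<in>E. norm (\<psi> x) \<le> K * n x)"

text \<open>Hahn-Banach: a minimal sublinear functional is linear.\<close>

lemma norming_functional:
  assumes x0: "x0 \<in> E"
  shows "\<exists>\<psi>. functional \<psi> \<and> (\<forall>x\<in>E. norm (\<psi> x) \<le> 2 * n x) \<and> n x0 \<le> norm (\<psi> x0)"
proof -
  define p where "p x = (if x \<in> E then n x else 0)" for x
  have "sublinear p"
    unfolding sublinear_def p_def using n_add n_scale n_zero add scale zero by (auto simp: less_imp_le)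
  \<comment> \<open>Refining at \<open>x0\<close> before minimizing fixes the norm: whatever lies
    below \<open>r\<close> is at most \<open>- n x0\<close> at the negative of \<open>x0\<close>,
    and once oddness is known this reads \<open>n x0 \<le> q x0\<close>.\<close>
  then obtain r where r: "sublinear r" "\<And>x. r x \<le> p x" "r (\<lambda>A. - x0 A) \<le> - p x0"
    using sublinear_refine[OF _ x0] by blast
  obtain q where q: "sublinear q" "\<And>x. q x \<le> r x"
    "\<And>r. sublinear r \<Longrightarrow> (\<And>x. r x \<le> q x) \<Longrightarrow> r = q"
    using sublinear_minimal[OF r(1)] by blast
  have minus: "(\<lambda>A. - x A) \<in> E" if "x \<in> E" for x using scale[OF that, of "-1"] by simp
  have odd: "q (\<lambda>A. - y A) = - q y" if y: "y \<in> E" for y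
  proof -
    obtain s where s: "sublinear s" "\<forall>x. s x \<le> q x" "s (\<lambda>A. - y A) \<le> - q y"
      using sublinear_refine[OF q(1) y] by blast
    then have "s = q" using q(3) by blast
    then show ?thesis using s(3) sublinear_minus[OF q(1) y] by simp
  qed
  have q_add: "q (\<lambda>A. x A + y A) = q x + q y" if "x \<in> E" "y \<in> E" for x y
    using sublinearD(1)[OF q(1) that] sublinearD(1)[OF q(1) add[OF that] minus[OF that(2)]] odd[OF that(2)]
    by simp
  have q_scale: "q (\<lambda>A. of_real t * x A) = t * q x" if x: "x \<in> E" for x t
  proof (cases "t \<ge> 0")
    case True then show ?thesis by (rule sublinear_scale[OF q(1) x])
  next
    case False
    then have "q (\<lambda>A. of_real (- t) * x A) = - t * q x" by (intro sublinear_scale[OF q(1) x]) simp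
    then show ?thesis using odd[OF scale[OF x, of "of_real t"]] by simp
  qed
  have qn: "\<bar>q x\<bar> \<le> n x" if x: "x \<in> E" for x
  proof -
    have "q y \<le> n y" if "y \<in> E" for y
      using q(2)[of y] r(2)[of y] that unfolding p_def by simp
    from this[OF x] this[OF minus[OF x]] show ?thesis
      using odd[OF x] n_scale[OF x, of "-1"] by simp
  qed
  have x0q: "n x0 \<le> q x0"
  proof -
    have "- q x0 \<le> - n x0"
      using q(2)[of "\<lambda>A. - x0 A"] r(3) x0 odd[OF x0] unfolding p_def by simp
    then show ?thesis by simp
  qed
  \<comment> \<open>The complex linear functional with real part \<open>q\<close>. Its modulus is
    estimated by the sum of those of its real and imaginary parts, whence the factor 2 that
    reappears wherever norming functionals are used.\<close>
  define \<psi> where "\<psi> x = Complex (q x) (- q (\<lambda>A. \<i> * x A))" for x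
  have bound: "norm (\<psi> x) \<le> 2 * n x" if x: "x \<in> E" for x
    using qn[OF x] qn[OF scale[OF x, of \<i>]] n_scale[OF x, of \<i>] cmod_le[of "\<psi> x"]
    unfolding \<psi>_def by simp
  have "\<psi> (\<lambda>A. x A + c * y A) = \<psi> x + c * \<psi> y" if x: "x \<in> E" and y: "y \<in> E" for x y c
  proof -
    have cs: "q (\<lambda>A. c * y A) = Re c * q y + Im c * q (\<lambda>A. \<i> * y A)" if y: "y \<in> E" for c y
    proof -
      have "(\<lambda>A. c * y A) = (\<lambda>A. of_real (Re c) * y A + of_real (Im c) * (\<i> * y A))"
        by (subst complex_eq[of c]) (simp add: algebra_simps)
      then show ?thesis
        using q_add[OF scale[OF y, of "of_real (Re c)"] scale[OF scale[OF y, of \<i>], of "of_real (Im c)"]]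
          q_scale[OF y, of "Re c"] q_scale[OF scale[OF y, of \<i>], of "Im c"] by simp
    qed
    have "q (\<lambda>A. x A + c * y A) = q x + (Re c * q y + Im c * q (\<lambda>A. \<i> * y A))"
      using q_add[OF x scale[OF y, of c]] cs[OF y, of c] by simp
    moreover have "q (\<lambda>A. \<i> * (x A + c * y A)) = q (\<lambda>A. \<i> * x A) + (- Im c * q y + Re c * q (\<lambda>A. \<i> * y A))"
      using q_add[OF scale[OF x, of \<i>] scale[OF y, of "\<i> * c"]] cs[OF y, of "\<i> * c"]
      by (simp add: algebra_simps)
    ultimately show ?thesis
      unfolding \<psi>_def by (simp add: complex_eq_iff algebra_simps)
  qed
  then have "functional \<psi>" unfolding functional_def using bound by blast
  moreover have "n x0 \<le> norm (\<psi> x0)"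
    using complex_Re_le_cmod[of "\<psi> x0"] x0q by (simp add: \<psi>_def)
  ultimately show ?thesis using bound by blast
qed

lemma functional_lincomb:
  "functional \<psi> \<Longrightarrow> x \<in> E \<Longrightarrow> y \<in> E \<Longrightarrow> \<psi> (\<lambda>A. x A + c * y A) = \<psi> x + c * \<psi> y"
  unfolding functional_def by blast

lemma functional_zero: "functional \<psi> \<Longrightarrow> \<psi> (\<lambda>A. 0) = 0"
  using functional_lincomb[OF _ zero zero, of \<psi> 1] by simp

lemma functional_scale: "functional \<psi> \<Longrightarrow> x \<in> E \<Longrightarrow> \<psi> (\<lambda>A. c * x A) = c * \<psi> x"
  using functional_lincomb[OF _ zero, of \<psi> x c] functional_zero by simp

lemma functional_diff: "functional \<psi> \<Longrightarrow> x \<in> E \<Longrightarrow> y \<in> E \<Longrightarrow> \<psi> (\<lambda>A. x A - y A) = \<psi> x - \<psi> y"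
  using functional_lincomb[of \<psi> x y "-1"] by simp

text \<open>Scalar estimates transfer to the norm without loss: the norming functional may have norm
  up to 2, but on the given vector its modulus is at least \<open>n x\<close>.\<close>

lemma n_le_by_functionals:
  assumes "x \<in> E" "\<And>\<psi>. functional \<psi> \<Longrightarrow> (\<And>y. y \<in> E \<Longrightarrow> norm (\<psi> y) \<le> 2 * n y) \<Longrightarrow> norm (\<psi> x) \<le> B"
  shows "n x \<le> B"
  using norming_functional[OF assms(1)] assms(2) by (metis order_trans)

section \<open>Bounded operators and the operator norm\<close>

abbreviation ops :: "(('b \<Rightarrow> complex) \<Rightarrow> 'b \<Rightarrow> complex) set" where "ops \<equiv> bounded_operators E n"

lemma opsD:
  assumes "T \<in> ops"
  shows "\<mu> \<in> E \<Longrightarrow> T \<mu> \<in> E"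
    and "\<mu> \<in> E \<Longrightarrow> \<nu> \<in> E \<Longrightarrow> T (\<lambda>A. \<mu> A + c * \<nu> A) = (\<lambda>A. T \<mu> A + c * T \<nu> A)"
  using assms unfolding bounded_operators_def by blast+

lemma ops_zero: "T \<in> ops \<Longrightarrow> T (\<lambda>A. 0) = (\<lambda>A. 0)"
  using opsD(2)[OF _ zero zero, of T "-1"] by simp

lemma ops_scale: "T \<in> ops \<Longrightarrow> \<mu> \<in> E \<Longrightarrow> T (\<lambda>A. c * \<mu> A) = (\<lambda>A. c * T \<mu> A)"
  using opsD(2)[OF _ zero, of T \<mu> c] ops_zero by simp

lemma ops_bound:
  assumes T: "T \<in> ops" and \<mu>: "\<mu> \<in> E"
  shows "n (T \<mu>) \<le> operator_norm E n T * n \<mu>"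
proof -
  obtain K where K: "\<And>\<nu>. \<nu> \<in> E \<Longrightarrow> n (T \<nu>) \<le> K * n \<nu>"
    using T unfolding bounded_operators_def by blast
  have "n (T \<nu>) \<le> \<bar>K\<bar>" if "\<nu> \<in> E" "n \<nu> \<le> 1" for \<nu>
  proof -
    have "K * n \<nu> \<le> \<bar>K\<bar> * 1" using that n_nonneg[OF that(1)] by (intro mult_mono) auto
    then show ?thesis using K[OF that(1)] by linarith
  qed
  then have bdd: "bdd_above ((\<lambda>\<nu>. n (T \<nu>)) ` {\<nu>\<in>E. n \<nu> \<le> 1})"
    by (intro bdd_aboveI2[of _ _ "\<bar>K\<bar>"]) auto
  show ?thesis
  proof (cases "n \<mu> = 0")
    case True
    then show ?thesis using n_eq_0[OF \<mu>] ops_zero[OF T] n_zero by simp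
  next
    case False
    then have pos: "n \<mu> > 0" using n_nonneg[OF \<mu>] by simp
    define c where "c = complex_of_real (inverse (n \<mu>))"
    have c: "norm c = inverse (n \<mu>)" unfolding c_def using pos by (simp add: norm_inverse)
    have "n (T (\<lambda>A. c * \<mu> A)) \<le> operator_norm E n T"
      unfolding operator_norm_def
      using scale[OF \<mu>, of c] n_scale[OF \<mu>, of c] c pos by (intro cSUP_upper[OF _ bdd]) simp
    then show ?thesis
      using n_scale[OF opsD(1)[OF T \<mu>], of c] ops_scale[OF T \<mu>, of c] c pos by (simp add: field_simps)
  qed
qed

lemma operator_norm_le:
  assumes "\<And>\<mu>. \<mu> \<in> E \<Longrightarrow> n (T \<mu>) \<le> K * n \<mu>" "0 \<le> K"
  shows "operator_norm E n T \<le> K"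
  unfolding operator_norm_def
proof (rule cSUP_least)
  show "{\<mu> \<in> E. n \<mu> \<le> 1} \<noteq> {}" using zero n_zero by auto
  fix \<mu> assume \<mu>: "\<mu> \<in> {\<mu> \<in> E. n \<mu> \<le> 1}"
  then have "K * n \<mu> \<le> K * 1" using assms(2) by (intro mult_left_mono) auto
  then show "n (T \<mu>) \<le> K" using assms(1)[of \<mu>] \<mu> by simp
qed

lemma ops_lincomb:
  assumes T: "T \<in> ops" and S: "S \<in> ops"
  shows "(\<lambda>\<mu> A. a * T \<mu> A + c * S \<mu> A) \<in> ops"
  unfolding bounded_operators_def
proof (intro CollectI conjI ballI allI)
  fix \<mu> assume \<mu>: "\<mu> \<in> E"
  show "(\<lambda>A. a * T \<mu> A + c * S \<mu> A) \<in> E" by (intro lincomb scale opsD(1)[OF T] opsD(1)[OF S] \<mu>)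
next
  fix \<mu> \<nu> d assume \<mu>: "\<mu> \<in> E" "\<nu> \<in> E"
  show "(\<lambda>A. a * T (\<lambda>A. \<mu> A + d * \<nu> A) A + c * S (\<lambda>A. \<mu> A + d * \<nu> A) A) =
    (\<lambda>A. a * T \<mu> A + c * S \<mu> A + d * (a * T \<nu> A + c * S \<nu> A))"
    unfolding opsD(2)[OF T \<mu>] opsD(2)[OF S \<mu>] by (simp add: algebra_simps)
next
  have "n (\<lambda>A. a * T \<mu> A + c * S \<mu> A)
      \<le> (norm a * operator_norm E n T + norm c * operator_norm E n S) * n \<mu>" if \<mu>: "\<mu> \<in> E" for \<mu>
  proof -
    have "n (\<lambda>A. a * T \<mu> A + c * S \<mu> A) \<le> norm a * n (T \<mu>) + norm c * n (S \<mu>)"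
      using n_lincomb[OF scale[OF opsD(1)[OF T \<mu>], of a] opsD(1)[OF S \<mu>], of c]
        n_scale[OF opsD(1)[OF T \<mu>], of a] by simp
    also have "\<dots> \<le> norm a * (operator_norm E n T * n \<mu>) + norm c * (operator_norm E n S * n \<mu>)"
      by (intro add_mono mult_left_mono ops_bound T S \<mu>) auto
    finally show ?thesis by (simp add: algebra_simps)
  qed
  then show "\<exists>K. \<forall>\<mu>\<in>E. n (\<lambda>A. a * T \<mu> A + c * S \<mu> A) \<le> K * n \<mu>" by blast
qed

section \<open>Holomorphic families of operators\<close>

lemma op_holomorphic_derivative:
  assumes hol: "op_holomorphic_on E n P S" and S: "open S" "z \<in> S"
  shows "\<exists>L\<in>ops. \<forall>e>0. \<forall>\<^sub>F w in at z. \<forall>\<mu>\<in>E.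
    n (\<lambda>A. (P w \<mu> A - P z \<mu> A) / (w - z) - L \<mu> A) \<le> e * n \<mu>"
proof -
  obtain L where L: "L \<in> ops"
    "((\<lambda>w. operator_norm E n (\<lambda>\<mu> A. (P w \<mu> A - P z \<mu> A) / (w - z) - L \<mu> A)) \<longlongrightarrow> 0) (at z)"
    using hol S(2) unfolding op_holomorphic_on_def by blast
  have Pop: "P w \<in> ops" if "w \<in> S" for w using hol that unfolding op_holomorphic_on_def by blast
  have "\<forall>\<^sub>F w in at z. \<forall>\<mu>\<in>E. n (\<lambda>A. (P w \<mu> A - P z \<mu> A) / (w - z) - L \<mu> A) \<le> e * n \<mu>"
    if e: "e > 0" for e
    using order_tendstoD(2)[OF L(2) e] eventually_at_in_open'[OF S]
  proof eventually_elim
    case (elim w)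
    \<comment> \<open>\<open>operator_norm\<close> is a real supremum and controls individual
      vectors only if the set is bounded, so the difference quotient is first exhibited as a
      combination of bounded operators.\<close>
    have "(\<lambda>\<mu> A. 1 * (inverse (w - z) * P w \<mu> A + (- inverse (w - z)) * P z \<mu> A) + (-1) * L \<mu> A) \<in> ops"
      by (rule ops_lincomb[OF ops_lincomb[OF Pop[OF elim(2)] Pop[OF S(2)]] L(1)])
    moreover have "(\<lambda>\<mu> A. 1 * (inverse (w - z) * P w \<mu> A + (- inverse (w - z)) * P z \<mu> A) + (-1) * L \<mu> A)
        = (\<lambda>\<mu> A. (P w \<mu> A - P z \<mu> A) / (w - z) - L \<mu> A)"
      by (auto simp: fun_eq_iff divide_inverse algebra_simps)
    ultimately have op: "(\<lambda>\<mu> A. (P w \<mu> A - P z \<mu> A) / (w - z) - L \<mu> A) \<in> ops" by simp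
    show ?case
    proof
      fix \<mu> assume \<mu>: "\<mu> \<in> E"
      show "n (\<lambda>A. (P w \<mu> A - P z \<mu> A) / (w - z) - L \<mu> A) \<le> e * n \<mu>"
        using ops_bound[OF op \<mu>] mult_right_mono[OF less_imp_le[OF elim(1)] n_nonneg[OF \<mu>]] by linarith
    qed
  qed
  then show ?thesis using L(1) by blast
qed

text \<open>The second clause identifies the scalar derivative as \<open>\<psi> (L \<mu>)\<close>
  with the same operator \<open>L\<close> for all functionals. That is what later allows
  \<open>L\<close> to be filled in as the value at a removed singularity.\<close>

lemma op_holomorphic_functional:
  assumes hol: "op_holomorphic_on E n P S" and S: "open S" and \<psi>: "functional \<psi>" and \<mu>: "\<mu> \<in> E"
  shows "(\<lambda>z. \<psi> (P z \<mu>)) holomorphic_on S"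
    and "z \<in> S \<Longrightarrow> L \<in> ops \<Longrightarrow> (\<And>e. e > 0 \<Longrightarrow> \<forall>\<^sub>F w in at z. \<forall>\<mu>\<in>E.
      n (\<lambda>A. (P w \<mu> A - P z \<mu> A) / (w - z) - L \<mu> A) \<le> e * n \<mu>)
      \<Longrightarrow> ((\<lambda>z. \<psi> (P z \<mu>)) has_field_derivative \<psi> (L \<mu>)) (at z)"
proof -
  have Pop: "P w \<mu> \<in> E" if "w \<in> S" for w
    using hol that opsD(1)[OF _ \<mu>] unfolding op_holomorphic_on_def by blast
  have der: "((\<lambda>z. \<psi> (P z \<mu>)) has_field_derivative \<psi> (L \<mu>)) (at z)"
    if z: "z \<in> S" and L: "L \<in> ops" and lim: "\<And>e. e > 0 \<Longrightarrow> \<forall>\<^sub>F w in at z. \<forall>\<mu>\<in>E.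
      n (\<lambda>A. (P w \<mu> A - P z \<mu> A) / (w - z) - L \<mu> A) \<le> e * n \<mu>" for z L
    unfolding has_field_derivative_iff
  proof (rule tendstoI)
    obtain K where K: "\<And>x. x \<in> E \<Longrightarrow> norm (\<psi> x) \<le> K * n x" using \<psi> unfolding functional_def by blast
    fix e :: real assume e: "e > 0"
    define d where "d = e / (\<bar>K\<bar> * n \<mu> + 1)"
    have dpos: "d > 0" unfolding d_def using e n_nonneg[OF \<mu>] by (simp add: add_nonneg_pos)
    show "\<forall>\<^sub>F w in at z. dist ((\<psi> (P w \<mu>) - \<psi> (P z \<mu>)) / (w - z)) (\<psi> (L \<mu>)) < e"
      using lim[OF dpos] eventually_at_in_open'[OF S z]
    proof eventually_elim
      case (elim w)
      have in1: "(\<lambda>A. P w \<mu> A - P z \<mu> A) \<in> E" by (rule diff[OF Pop[OF elim(2)] Pop[OF z]])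
      have in2: "(\<lambda>A. inverse (w - z) * (P w \<mu> A - P z \<mu> A)) \<in> E" by (rule scale[OF in1])
      have in3: "(\<lambda>A. inverse (w - z) * (P w \<mu> A - P z \<mu> A) - L \<mu> A) \<in> E"
        by (rule diff[OF in2 opsD(1)[OF L \<mu>]])
      have "(\<psi> (P w \<mu>) - \<psi> (P z \<mu>)) / (w - z) - \<psi> (L \<mu>)
          = \<psi> (\<lambda>A. inverse (w - z) * (P w \<mu> A - P z \<mu> A) - L \<mu> A)"
        unfolding functional_diff[OF \<psi> in2 opsD(1)[OF L \<mu>]] functional_scale[OF \<psi> in1]
          functional_diff[OF \<psi> Pop[OF elim(2)] Pop[OF z]] by (simp add: field_simps)
      also have "norm \<dots> \<le> \<bar>K\<bar> * n (\<lambda>A. inverse (w - z) * (P w \<mu> A - P z \<mu> A) - L \<mu> A)"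
        using K[OF in3] mult_right_mono[OF abs_ge_self n_nonneg[OF in3], of K] by linarith
      also have "\<dots> \<le> \<bar>K\<bar> * (d * n \<mu>)"
        using elim(1) \<mu> by (intro mult_left_mono) (auto simp: divide_inverse mult.commute)
      also have "\<dots> < e"
      proof -
        have "d * (\<bar>K\<bar> * n \<mu> + 1) = e"
          unfolding d_def using n_nonneg[OF \<mu>] by (simp add: add_nonneg_pos less_imp_neq[symmetric])
        then show ?thesis using dpos by (simp add: algebra_simps)
      qed
      finally show ?case by (simp add: dist_norm)
    qed
  qed
  show "(\<lambda>z. \<psi> (P z \<mu>)) holomorphic_on S"
    using op_holomorphic_derivative[OF hol S] der by (subst holomorphic_on_open[OF S]) blast
  show "z \<in> S \<Longrightarrow> L \<in> ops \<Longrightarrow> (\<And>e. e > 0 \<Longrightarrow> \<forall>\<^sub>F w in at z. \<forall>\<mu>\<in>E.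
      n (\<lambda>A. (P w \<mu> A - P z \<mu> A) / (w - z) - L \<mu> A) \<le> e * n \<mu>)
      \<Longrightarrow> ((\<lambda>z. \<psi> (P z \<mu>)) has_field_derivative \<psi> (L \<mu>)) (at z)"
    by (rule der)
qed

text \<open>Near a point the difference quotients differ from the derivative by an operator of norm
  at most 1, so the family is locally bounded; finitely many such balls cover the compact set, and
  the sum of their constants serves for all.\<close>

lemma op_holomorphic_bounded:
  assumes hol: "op_holomorphic_on E n P S" and S: "open S" and K: "compact K" "K \<subseteq> S"
  shows "\<exists>C\<ge>0. \<forall>z\<in>K. \<forall>\<mu>\<in>E. n (P z \<mu>) \<le> C * n \<mu>"
proof -
  have Pop: "P w \<in> ops" if "w \<in> S" for w using hol that unfolding op_holomorphic_on_def by blast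
  have loc: "\<exists>d>0. \<exists>C\<ge>0. \<forall>w\<in>ball z d. \<forall>\<mu>\<in>E. n (P w \<mu>) \<le> C * n \<mu>" if z: "z \<in> S" for z
  proof -
    obtain L where L: "L \<in> ops" "\<forall>e>0. \<forall>\<^sub>F w in at z. \<forall>\<mu>\<in>E.
        n (\<lambda>A. (P w \<mu> A - P z \<mu> A) / (w - z) - L \<mu> A) \<le> e * n \<mu>"
      using op_holomorphic_derivative[OF hol S z] by blast
    have "\<forall>\<^sub>F w in at z. w \<in> S \<and> (\<forall>\<mu>\<in>E. n (\<lambda>A. (P w \<mu> A - P z \<mu> A) / (w - z) - L \<mu> A) \<le> 1 * n \<mu>)"
      using eventually_conj[OF eventually_at_in_open'[OF S z] L(2)[rule_format, of 1]] by simp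
    then obtain d where d: "d > 0" "\<And>w. w \<noteq> z \<Longrightarrow> dist w z < d \<Longrightarrow> w \<in> S \<and>
        (\<forall>\<mu>\<in>E. n (\<lambda>A. (P w \<mu> A - P z \<mu> A) / (w - z) - L \<mu> A) \<le> n \<mu>)"
      unfolding eventually_at by auto
    define C where "C = \<bar>operator_norm E n (P z)\<bar> + d * (\<bar>operator_norm E n L\<bar> + 1)"
    have C0: "C \<ge> 0" unfolding C_def using d(1) by simp
    have "n (P w \<mu>) \<le> C * n \<mu>" if w: "w \<in> ball z d" and \<mu>: "\<mu> \<in> E" for w \<mu>
    proof -
      have Pz: "n (P z \<mu>) \<le> \<bar>operator_norm E n (P z)\<bar> * n \<mu>"
        using ops_bound[OF Pop[OF z] \<mu>] mult_right_mono[OF abs_ge_self n_nonneg[OF \<mu>]] order_trans by blast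
      have Lb: "n (L \<mu>) \<le> \<bar>operator_norm E n L\<bar> * n \<mu>"
        using ops_bound[OF L(1) \<mu>] mult_right_mono[OF abs_ge_self n_nonneg[OF \<mu>]] order_trans by blast
      show ?thesis
      proof (cases "w = z")
        case True
        have "0 \<le> d * (\<bar>operator_norm E n L\<bar> + 1) * n \<mu>" using d(1) n_nonneg[OF \<mu>] by simp
        then show ?thesis using Pz True unfolding C_def by (simp add: algebra_simps)
      next
        case False
        have wS: "w \<in> S" and dn: "n (\<lambda>A. (P w \<mu> A - P z \<mu> A) / (w - z) - L \<mu> A) \<le> n \<mu>"
          using d(2)[OF False] w \<mu> by (auto simp: dist_commute)
        have in1: "(\<lambda>A. (P w \<mu> A - P z \<mu> A) / (w - z)) \<in> E"
          using scale[OF diff[OF opsD(1)[OF Pop[OF wS] \<mu>] opsD(1)[OF Pop[OF z] \<mu>]], of "inverse (w - z)"]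
          by (simp add: divide_inverse mult.commute)
        have inL: "L \<mu> \<in> E" by (rule opsD(1)[OF L(1) \<mu>])
        have "n (\<lambda>A. (P w \<mu> A - P z \<mu> A) / (w - z)) \<le> n \<mu> + n (L \<mu>)"
          using n_add[OF diff[OF in1 inL] inL] dn by simp
        also have "\<dots> \<le> (\<bar>operator_norm E n L\<bar> + 1) * n \<mu>" using Lb by (simp add: algebra_simps)
        finally have q: "n (\<lambda>A. (P w \<mu> A - P z \<mu> A) / (w - z)) \<le> (\<bar>operator_norm E n L\<bar> + 1) * n \<mu>" .
        have "P w \<mu> = (\<lambda>A. P z \<mu> A + (w - z) * ((P w \<mu> A - P z \<mu> A) / (w - z)))"
          using False by simp
        then have "n (P w \<mu>) \<le> n (P z \<mu>) + norm (w - z) * n (\<lambda>A. (P w \<mu> A - P z \<mu> A) / (w - z))"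
          using n_lincomb[OF opsD(1)[OF Pop[OF z] \<mu>] in1, of "w - z"] by simp
        also have "\<dots> \<le> n (P z \<mu>) + d * ((\<bar>operator_norm E n L\<bar> + 1) * n \<mu>)"
          using q w d(1) n_nonneg[OF in1] by (intro add_mono mult_mono) (auto simp: dist_norm norm_minus_commute)
        finally show ?thesis using Pz unfolding C_def by (simp add: algebra_simps)
      qed
    qed
    then show ?thesis using d(1) C0 by blast
  qed
  have "\<forall>z\<in>S. \<exists>p. fst p > 0 \<and> snd p \<ge> 0 \<and>
      (\<forall>w\<in>ball z (fst p). \<forall>\<mu>\<in>E. n (P w \<mu>) \<le> snd p * n \<mu>)"
  proof
    fix z assume "z \<in> S"
    then obtain d C where "d > 0" "C \<ge> 0" "\<forall>w\<in>ball z d. \<forall>\<mu>\<in>E. n (P w \<mu>) \<le> C * n \<mu>" using loc by blast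
    then show "\<exists>p. fst p > 0 \<and> snd p \<ge> 0 \<and>
        (\<forall>w\<in>ball z (fst p). \<forall>\<mu>\<in>E. n (P w \<mu>) \<le> snd p * n \<mu>)"
      by (intro exI[of _ "(d, C)"]) simp
  qed
  from bchoice[OF this] obtain p where p: "\<forall>z\<in>S. fst (p z) > 0 \<and> snd (p z) \<ge> 0 \<and>
      (\<forall>w\<in>ball z (fst (p z)). \<forall>\<mu>\<in>E. n (P w \<mu>) \<le> snd (p z) * n \<mu>)"
    by (elim exE)
  define d C where "d z = fst (p z)" and "C z = snd (p z)" for z
  have dC: "\<And>z. z \<in> S \<Longrightarrow> d z > 0" "\<And>z. z \<in> S \<Longrightarrow> C z \<ge> 0"
    "\<And>z w \<mu>. z \<in> S \<Longrightarrow> w \<in> ball z (d z) \<Longrightarrow> \<mu> \<in> E \<Longrightarrow> n (P w \<mu>) \<le> C z * n \<mu>"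
  proof -
    fix z assume "z \<in> S"
    note pz = bspec[OF p this, folded d_def C_def]
    show "d z > 0" "C z \<ge> 0" using pz by simp_all
    show "\<And>w \<mu>. w \<in> ball z (d z) \<Longrightarrow> \<mu> \<in> E \<Longrightarrow> n (P w \<mu>) \<le> C z * n \<mu>"
      using pz by simp
  qed
  have "K \<subseteq> (\<Union>z\<in>K. ball z (d z))" 
  proof
    fix x assume x: "x \<in> K"
    then have "x \<in> ball x (d x)" using dC(1) K(2) by auto
    then show "x \<in> (\<Union>z\<in>K. ball z (d z))" using x by blast
  qed
  then obtain F where F: "F \<subseteq> K" "finite F" "K \<subseteq> (\<Union>z\<in>F. ball z (d z))"
    using compactE_image[OF K(1), of K "\<lambda>z. ball z (d z)"] by auto
  have "n (P w \<mu>) \<le> (\<Sum>z\<in>F. C z) * n \<mu>" if w: "w \<in> K" and \<mu>: "\<mu> \<in> E" for w \<mu>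
  proof -
    obtain z where z: "z \<in> F" "w \<in> ball z (d z)" using F(3) w by blast
    have zS: "z \<in> S" using z F K by blast
    have "C z \<le> (\<Sum>z\<in>F. C z)" using dC(2) F K z by (intro member_le_sum) auto
    then have "C z * n \<mu> \<le> (\<Sum>z\<in>F. C z) * n \<mu>" using n_nonneg[OF \<mu>] by (intro mult_right_mono)
    then show ?thesis using dC(3)[OF zS z(2) \<mu>] by linarith
  qed
  moreover have "(\<Sum>z\<in>F. C z) \<ge> 0" using dC(2) F K by (intro sum_nonneg) auto
  ultimately show ?thesis by blast
qed

text \<open>Dunford's theorem: a locally bounded weakly holomorphic family is holomorphic. Cauchy's estimate
  for the scalar functions makes the difference quotients a Cauchy family.\<close>

lemma op_holomorphic_weak:
  assumes Q: "\<And>w. w \<in> ball z0 r \<Longrightarrow> Q w \<in> ops"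
    and C: "\<And>w \<mu>. w \<in> ball z0 r \<Longrightarrow> \<mu> \<in> E \<Longrightarrow> n (Q w \<mu>) \<le> C * n \<mu>" "0 \<le> C"
    and hol: "\<And>\<psi> \<mu>. functional \<psi> \<Longrightarrow> \<mu> \<in> E \<Longrightarrow> (\<lambda>w. \<psi> (Q w \<mu>)) holomorphic_on ball z0 r"
  shows "op_holomorphic_on E n Q (ball z0 r)"
  unfolding op_holomorphic_on_def
proof (intro ballI conjI)
  fix z assume z: "z \<in> ball z0 r"
  show "Q z \<in> ops" by (rule Q[OF z])
  define \<rho> where "\<rho> = (r - dist z0 z) / 2"
  have \<rho>: "\<rho> > 0" using z by (simp add: \<rho>_def)
  have sub: "cball u (\<rho> / 2) \<subseteq> ball z0 r" if "u \<in> ball z \<rho>" for u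
  proof
    fix v assume "v \<in> cball u (\<rho> / 2)"
    then have "dist z0 v < dist z0 z + \<rho> + \<rho>"
      using that dist_triangle[of z0 v z] dist_triangle[of z v u] \<rho> by auto
    then show "v \<in> ball z0 r" by (simp add: \<rho>_def)
  qed
  have sub': "ball z \<rho> \<subseteq> ball z0 r" using sub \<rho> by force
  define D where "D w \<mu> = (\<lambda>A. inverse (w - z) * (Q w \<mu> A - Q z \<mu> A))" for w \<mu>
  have DE: "D w \<mu> \<in> E" if "w \<in> ball z \<rho>" "\<mu> \<in> E" for w \<mu>
    unfolding D_def using that sub' z by (intro scale diff opsD(1)[OF Q]) auto
  \<comment> \<open>Cauchy's estimate for a second derivative on a circle of radius
    \<open>\<rho> / 2\<close>: the leading 2 is \<open>fact 2\<close>, and \<open>2 * C\<close>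
    bounds the scalar functions because the functionals have norm at most 2.\<close>
  define M where "M = 2 * (2 * C) / (\<rho> / 2) ^ 2"
  have M0: "M \<ge> 0" unfolding M_def using C(2) by simp
  have Dd: "n (\<lambda>A. D w \<mu> A - D w' \<mu> A) \<le> M * n \<mu> * (norm (w - z) + norm (w' - z))"
    if w: "w \<in> ball z \<rho>" "w \<noteq> z" and w': "w' \<in> ball z \<rho>" "w' \<noteq> z" and \<mu>: "\<mu> \<in> E" for w w' \<mu>
  proof (rule n_le_by_functionals[OF diff[OF DE[OF w(1) \<mu>] DE[OF w'(1) \<mu>]]])
    fix \<psi> assume \<psi>: "functional \<psi>" and b: "\<And>y. y \<in> E \<Longrightarrow> norm (\<psi> y) \<le> 2 * n y"
    define g where "g w = \<psi> (Q w \<mu>)" for w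
    have gh: "g holomorphic_on ball z0 r" unfolding g_def by (rule hol[OF \<psi> \<mu>])
    have gb: "norm (g u) \<le> 2 * C * n \<mu>" if "u \<in> ball z0 r" for u
      unfolding g_def using b[OF opsD(1)[OF Q[OF that] \<mu>]] C(1)[OF that \<mu>] by linarith
    have g2: "norm ((deriv ^^ 2) g u) \<le> M * n \<mu>" if u: "u \<in> ball z \<rho>" for u
    proof -
      have "norm ((deriv ^^ 2) g u) \<le> fact 2 * (2 * C * n \<mu>) / (\<rho> / 2) ^ 2"
      proof (rule Cauchy_inequality)
        show "g holomorphic_on ball u (\<rho> / 2)"
          using sub[OF u] by (intro holomorphic_on_subset[OF gh]) auto
        show "continuous_on (cball u (\<rho> / 2)) g"
          using sub[OF u] by (intro holomorphic_on_imp_continuous_on holomorphic_on_subset[OF gh])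
        show "0 < \<rho> / 2" using \<rho> by simp
        fix x assume "norm (u - x) = \<rho> / 2"
        then show "norm (g x) \<le> 2 * C * n \<mu>" using sub[OF u] by (intro gb) (auto simp: dist_norm)
      qed
      then show ?thesis by (simp add: M_def)
    qed
    \<comment> \<open>Every difference quotient is compared with the same number
      \<open>deriv g z\<close>, which cancels when two of them are subtracted.\<close>
    have taylor: "norm (\<psi> (D v \<mu>) - deriv g z) \<le> M * n \<mu> * norm (v - z)"
      if v: "v \<in> ball z \<rho>" "v \<noteq> z" for v
    proof -
      have "norm (g v - (\<Sum>i\<le>1. (deriv ^^ i) g z * (v - z) ^ i / fact i))
          \<le> M * n \<mu> * norm (v - z) ^ Suc 1 / fact 1"
      proof (rule complex_Taylor[of "ball z \<rho>" 1 "\<lambda>i. (deriv ^^ i) g", simplified funpow_0])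
        fix i x assume "x \<in> ball z \<rho>"
        then show "((deriv ^^ i) g has_field_derivative (deriv ^^ Suc i) g x) (at x within ball z \<rho>)"
          using holomorphic_higher_deriv[OF gh open_ball] sub'
          by (auto intro!: holomorphic_derivI[THEN has_field_derivative_at_within] simp del: mem_ball)
      next
        fix x assume "x \<in> ball z \<rho>"
        then show "norm ((deriv ^^ Suc 1) g x) \<le> M * n \<mu>" using g2[of x] by (simp add: numeral_2_eq_2)
      qed (use v \<rho> in auto)
      then have t: "norm (g v - g z - deriv g z * (v - z)) \<le> M * n \<mu> * norm (v - z) ^ 2"
        by (simp add: numeral_2_eq_2 algebra_simps)
      have "\<psi> (D v \<mu>) = (g v - g z) / (v - z)"
        unfolding D_def g_def using v(1) sub' z \<mu> opsD(1)[OF Q]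
        by (subst functional_scale[OF \<psi> diff], blast, blast, subst functional_diff[OF \<psi>])
          (auto simp: divide_inverse mult.commute)
      then have "\<psi> (D v \<mu>) - deriv g z = (g v - g z - deriv g z * (v - z)) / (v - z)"
        using v by (simp add: field_simps)
      then have "norm (\<psi> (D v \<mu>) - deriv g z) \<le> M * n \<mu> * norm (v - z) ^ 2 / norm (v - z)"
        using t v by (simp add: norm_divide divide_right_mono)
      then show ?thesis using v by (simp add: power2_eq_square)
    qed
    have "norm (\<psi> (D w \<mu>) - \<psi> (D w' \<mu>)) \<le> norm (\<psi> (D w \<mu>) - deriv g z) + norm (\<psi> (D w' \<mu>) - deriv g z)"
      using norm_triangle_ineq4[of "\<psi> (D w \<mu>) - deriv g z" "\<psi> (D w' \<mu>) - deriv g z"] by simp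
    also have "\<dots> \<le> M * n \<mu> * (norm (w - z) + norm (w' - z))"
      using taylor[OF w] taylor[OF w'] by (simp add: algebra_simps)
    finally show "norm (\<psi> (\<lambda>A. D w \<mu> A - D w' \<mu> A)) \<le> M * n \<mu> * (norm (w - z) + norm (w' - z))"
      using functional_diff[OF \<psi> DE[OF w(1) \<mu>] DE[OF w'(1) \<mu>]] by simp
  qed
  \<comment> \<open>A sequence approaching \<open>z\<close> with ratio 1/2, as required by
    \<open>complete\<close>. It only serves to produce the limit operator \<open>L\<close>; the
    estimate \<open>Dd\<close> then covers all approaches to \<open>z\<close>.\<close>
  define u where "u k = z + of_real (\<rho> / 2 * (1/2) ^ k)" for k
  have uz: "norm (u k - z) = \<rho> / 2 * (1/2) ^ k" for k unfolding u_def using \<rho> by (simp add: norm_mult norm_power norm_divide)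
  have u: "u k \<in> ball z \<rho>" "u k \<noteq> z" for k
  proof -
    have "(1/2) ^ k \<le> (1::real)" by (simp add: power_le_one)
    then have "\<rho> / 2 * (1/2) ^ k \<le> \<rho> / 2 * 1" using \<rho> by (intro mult_left_mono) auto
    then have "norm (u k - z) < \<rho>" using uz[of k] \<rho> by linarith
    then show "u k \<in> ball z \<rho>" by (simp add: dist_norm norm_minus_commute)
    show "u k \<noteq> z" using uz[of k] \<rho> by auto
  qed
  have ulim: "(\<lambda>k. norm (u k - z)) \<longlonglongrightarrow> 0"
    unfolding uz by (intro tendsto_mult_right_zero LIMSEQ_power_zero) simp
  have "\<exists>l\<in>E. (\<lambda>k. n (\<lambda>A. D (u k) \<mu> A - l A)) \<longlonglongrightarrow> 0" if \<mu>: "\<mu> \<in> E" for \<mu>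
  proof (rule complete)
    show "D (u k) \<mu> \<in> E" for k by (rule DE[OF u(1) \<mu>])
    show "n (\<lambda>A. D (u (Suc k)) \<mu> A - D (u k) \<mu> A) \<le> M * n \<mu> * \<rho> * (1/2) ^ k" for k
    proof -
      have "norm (u (Suc k) - z) + norm (u k - z) \<le> \<rho> * (1/2) ^ k"
        unfolding uz using \<rho> by simp
      then have "M * n \<mu> * (norm (u (Suc k) - z) + norm (u k - z)) \<le> M * n \<mu> * (\<rho> * (1/2) ^ k)"
        using M0 n_nonneg[OF \<mu>] by (intro mult_left_mono) auto
      then show ?thesis using Dd[OF u u \<mu>, of "Suc k" k] by (simp add: mult.assoc)
    qed
  qed
  then obtain L where L: "\<And>\<mu>. \<mu> \<in> E \<Longrightarrow> L \<mu> \<in> E"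
    "\<And>\<mu>. \<mu> \<in> E \<Longrightarrow> (\<lambda>k. n (\<lambda>A. D (u k) \<mu> A - L \<mu> A)) \<longlonglongrightarrow> 0" by metis
  have DL: "n (\<lambda>A. D w \<mu> A - L \<mu> A) \<le> M * n \<mu> * norm (w - z)"
    if w: "w \<in> ball z \<rho>" "w \<noteq> z" and \<mu>: "\<mu> \<in> E" for w \<mu>
  proof (rule LIMSEQ_le_const)
    have "(\<lambda>k. M * n \<mu> * (norm (w - z) + norm (u k - z)) + n (\<lambda>A. D (u k) \<mu> A - L \<mu> A))
        \<longlonglongrightarrow> M * n \<mu> * (norm (w - z) + 0) + 0"
      by (intro tendsto_add tendsto_mult tendsto_const ulim L(2)[OF \<mu>])
    then show "(\<lambda>k. M * n \<mu> * (norm (w - z) + norm (u k - z)) + n (\<lambda>A. D (u k) \<mu> A - L \<mu> A))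
        \<longlonglongrightarrow> M * n \<mu> * norm (w - z)" by simp
    have "n (\<lambda>A. D w \<mu> A - L \<mu> A)
        \<le> M * n \<mu> * (norm (w - z) + norm (u k - z)) + n (\<lambda>A. D (u k) \<mu> A - L \<mu> A)" for k
      using n_triangle[OF DE[OF w(1) \<mu>] DE[OF u(1) \<mu>, of k] L(1)[OF \<mu>]] Dd[OF w u[of k] \<mu>] by linarith
    then show "\<exists>N. \<forall>k\<ge>N. n (\<lambda>A. D w \<mu> A - L \<mu> A)
        \<le> M * n \<mu> * (norm (w - z) + norm (u k - z)) + n (\<lambda>A. D (u k) \<mu> A - L \<mu> A)" by blast
  qed
  have Lop: "L \<in> ops"
    unfolding bounded_operators_def
  proof (intro CollectI conjI ballI allI L(1))
    fix \<mu> \<nu> c assume \<mu>: "\<mu> \<in> E" and \<nu>: "\<nu> \<in> E"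
    have mn: "(\<lambda>A. \<mu> A + c * \<nu> A) \<in> E" by (rule lincomb[OF \<mu> \<nu>])
    have rhs: "(\<lambda>A. L \<mu> A + c * L \<nu> A) \<in> E" by (rule lincomb[OF L(1)[OF \<mu>] L(1)[OF \<nu>]])
    have "n (\<lambda>A. L (\<lambda>A. \<mu> A + c * \<nu> A) A - (L \<mu> A + c * L \<nu> A)) \<le> 0"
    proof (rule LIMSEQ_le_const)
      have "(\<lambda>k. n (\<lambda>A. D (u k) (\<lambda>A. \<mu> A + c * \<nu> A) A - L (\<lambda>A. \<mu> A + c * \<nu> A) A)
          + (n (\<lambda>A. D (u k) \<mu> A - L \<mu> A) + norm c * n (\<lambda>A. D (u k) \<nu> A - L \<nu> A)))
          \<longlonglongrightarrow> 0 + (0 + norm c * 0)"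
        by (intro tendsto_add tendsto_mult tendsto_const L(2) mn \<mu> \<nu>)
      then show "(\<lambda>k. n (\<lambda>A. D (u k) (\<lambda>A. \<mu> A + c * \<nu> A) A - L (\<lambda>A. \<mu> A + c * \<nu> A) A)
          + (n (\<lambda>A. D (u k) \<mu> A - L \<mu> A) + norm c * n (\<lambda>A. D (u k) \<nu> A - L \<nu> A))) \<longlonglongrightarrow> 0" by simp
      have "n (\<lambda>A. L (\<lambda>A. \<mu> A + c * \<nu> A) A - (L \<mu> A + c * L \<nu> A))
          \<le> n (\<lambda>A. D (u k) (\<lambda>A. \<mu> A + c * \<nu> A) A - L (\<lambda>A. \<mu> A + c * \<nu> A) A)
          + (n (\<lambda>A. D (u k) \<mu> A - L \<mu> A) + norm c * n (\<lambda>A. D (u k) \<nu> A - L \<nu> A))" for k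
      proof -
        have uk: "u k \<in> ball z0 r" using u(1)[of k] sub' by blast
        have "D (u k) (\<lambda>A. \<mu> A + c * \<nu> A) = (\<lambda>A. D (u k) \<mu> A + c * D (u k) \<nu> A)"
          unfolding D_def opsD(2)[OF Q[OF uk] \<mu> \<nu>] opsD(2)[OF Q[OF z] \<mu> \<nu>] by (simp add: algebra_simps)
        then have eq: "(\<lambda>A. D (u k) (\<lambda>A. \<mu> A + c * \<nu> A) A - (L \<mu> A + c * L \<nu> A))
            = (\<lambda>A. (D (u k) \<mu> A - L \<mu> A) + c * (D (u k) \<nu> A - L \<nu> A))" by (simp add: algebra_simps)
        have "n (\<lambda>A. D (u k) (\<lambda>A. \<mu> A + c * \<nu> A) A - (L \<mu> A + c * L \<nu> A))
            \<le> n (\<lambda>A. D (u k) \<mu> A - L \<mu> A) + norm c * n (\<lambda>A. D (u k) \<nu> A - L \<nu> A)"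
          unfolding eq by (intro n_lincomb diff DE u L(1) \<mu> \<nu>)
        then show ?thesis
          using n_triangle[OF L(1)[OF mn] DE[OF u(1) mn, of k] rhs]
            n_minus_commute[OF L(1)[OF mn] DE[OF u(1) mn, of k]] by linarith
      qed
      then show "\<exists>N. \<forall>k\<ge>N. n (\<lambda>A. L (\<lambda>A. \<mu> A + c * \<nu> A) A - (L \<mu> A + c * L \<nu> A))
          \<le> n (\<lambda>A. D (u k) (\<lambda>A. \<mu> A + c * \<nu> A) A - L (\<lambda>A. \<mu> A + c * \<nu> A) A)
          + (n (\<lambda>A. D (u k) \<mu> A - L \<mu> A) + norm c * n (\<lambda>A. D (u k) \<nu> A - L \<nu> A))" by blast
    qed
    then have "n (\<lambda>A. L (\<lambda>A. \<mu> A + c * \<nu> A) A - (L \<mu> A + c * L \<nu> A)) = 0"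
      using n_nonneg[OF diff[OF L(1)[OF mn] rhs]] by simp
    then have "(\<lambda>A. L (\<lambda>A. \<mu> A + c * \<nu> A) A - (L \<mu> A + c * L \<nu> A)) = (\<lambda>A. 0)"
      by (rule n_eq_0[OF diff[OF L(1)[OF mn] rhs]])
    then show "L (\<lambda>A. \<mu> A + c * \<nu> A) = (\<lambda>A. L \<mu> A + c * L \<nu> A)" by (simp add: fun_eq_iff)
  next
    have "n (L \<mu>) \<le> (norm (inverse (u 0 - z)) * (2 * C) + M * norm (u 0 - z)) * n \<mu>" if \<mu>: "\<mu> \<in> E" for \<mu>
    proof -
      have u0: "u 0 \<in> ball z0 r" using u(1)[of 0] sub' by blast
      have "n (D (u 0) \<mu>) \<le> norm (inverse (u 0 - z)) * (n (Q (u 0) \<mu>) + n (Q z \<mu>))"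
        unfolding D_def n_scale[OF diff[OF opsD(1)[OF Q[OF u0] \<mu>] opsD(1)[OF Q[OF z] \<mu>]]]
        by (intro mult_left_mono n_diff opsD(1)[OF Q] u0 z \<mu>) auto
      also have "\<dots> \<le> norm (inverse (u 0 - z)) * (C * n \<mu> + C * n \<mu>)"
        by (intro mult_left_mono add_mono C(1) u0 z \<mu>) auto
      finally have 1: "n (D (u 0) \<mu>) \<le> norm (inverse (u 0 - z)) * (2 * C) * n \<mu>" by (simp add: algebra_simps)
      have "n (L \<mu>) \<le> n (D (u 0) \<mu>) + n (\<lambda>A. D (u 0) \<mu> A - L \<mu> A)"
        using n_diff[OF DE[OF u(1) \<mu>] diff[OF DE[OF u(1) \<mu>] L(1)[OF \<mu>]], of 0 0] by simp
      then show ?thesis using 1 DL[OF u \<mu>, of 0] by (simp add: algebra_simps)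
    qed
    then show "\<exists>K. \<forall>\<mu>\<in>E. n (L \<mu>) \<le> K * n \<mu>" by blast
  qed
  have "((\<lambda>w. operator_norm E n (\<lambda>\<mu> A. (Q w \<mu> A - Q z \<mu> A) / (w - z) - L \<mu> A)) \<longlongrightarrow> 0) (at z)"
  proof (rule tendsto_sandwich[of "\<lambda>_. 0" _ _ "\<lambda>w. M * norm (w - z)"])
    have "\<forall>\<^sub>F w in at z. w \<in> ball z \<rho> \<and> w \<noteq> z"
      using \<rho> by (intro eventually_conj eventually_at_in_open' eventually_neq_at_within) auto
    then have ev: "\<forall>\<^sub>F w in at z. \<forall>\<mu>\<in>E. n (\<lambda>A. (Q w \<mu> A - Q z \<mu> A) / (w - z) - L \<mu> A) \<le> M * norm (w - z) * n \<mu>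
        \<and> (\<lambda>A. (Q w \<mu> A - Q z \<mu> A) / (w - z) - L \<mu> A) \<in> E"
    proof eventually_elim
      case (elim w)
      then show ?case
        using DL[of w] diff[OF DE[of w] L(1)] unfolding D_def by (simp add: divide_inverse mult_ac)
    qed
    then show "\<forall>\<^sub>F w in at z. operator_norm E n (\<lambda>\<mu> A. (Q w \<mu> A - Q z \<mu> A) / (w - z) - L \<mu> A) \<le> M * norm (w - z)"
      by (rule eventually_mono) (use M0 in \<open>auto intro!: operator_norm_le\<close>)
    have evb: "\<forall>\<^sub>F w in at z. w \<in> ball z \<rho>" using \<rho> by (intro eventually_at_in_open') auto
    \<comment> \<open>The lower bound 0 for the supremum comes from its value at the zero vector,
      and using it requires that the set be bounded above.\<close>
    have ub: "n (\<lambda>A. (Q w (\<lambda>A. 0) A - Q z (\<lambda>A. 0) A) / (w - z) - L (\<lambda>A. 0) A) = 0" if "w \<in> ball z \<rho>" for w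
      using ops_zero[OF Q[of w]] ops_zero[OF Q[OF z]] ops_zero[OF Lop] that sub' n_zero by auto
    show "\<forall>\<^sub>F w in at z. 0 \<le> operator_norm E n (\<lambda>\<mu> A. (Q w \<mu> A - Q z \<mu> A) / (w - z) - L \<mu> A)"
      using ev evb
    proof eventually_elim
      case (elim w)
      have w: "w \<in> ball z \<rho>" by (rule elim(2))
      have "bdd_above ((\<lambda>\<mu>. n (\<lambda>A. (Q w \<mu> A - Q z \<mu> A) / (w - z) - L \<mu> A)) ` {\<mu> \<in> E. n \<mu> \<le> 1})"
      proof (rule bdd_aboveI2)
        fix \<mu> assume \<mu>: "\<mu> \<in> {\<mu> \<in> E. n \<mu> \<le> 1}"
        then have "M * norm (w - z) * n \<mu> \<le> M * norm (w - z) * 1" using M0 by (intro mult_left_mono) auto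
        then show "n (\<lambda>A. (Q w \<mu> A - Q z \<mu> A) / (w - z) - L \<mu> A) \<le> M * norm (w - z)"
          using elim(1) \<mu> by fastforce
      qed
      then have "n (\<lambda>A. (Q w (\<lambda>A. 0) A - Q z (\<lambda>A. 0) A) / (w - z) - L (\<lambda>A. 0) A)
          \<le> operator_norm E n (\<lambda>\<mu> A. (Q w \<mu> A - Q z \<mu> A) / (w - z) - L \<mu> A)"
        unfolding operator_norm_def using zero n_zero by (intro cSUP_upper[rotated]) auto
      then show ?case using ub[OF w] by simp
    qed
    have "((\<lambda>w. M * norm (w - z)) \<longlongrightarrow> M * norm (z - z)) (at z)" by (intro tendsto_intros)
    then show "((\<lambda>w. M * norm (w - z)) \<longlongrightarrow> 0) (at z)" by simp
  qed simp
  then show "\<exists>L\<in>ops. ((\<lambda>w. operator_norm E n (\<lambda>\<mu> A. (Q w \<mu> A - Q z \<mu> A) / (w - z) - L \<mu> A)) \<longlongrightarrow> 0) (at z)"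
    using Lop by blast
qed

text \<open>The removable singularity theorem for operators. The quotient \<open>Q w / w\<close>,
  completed by the derivative at 0, is holomorphic after applying any functional and locally bounded
  by the maximum principle, so the weak criterion \<open>op_holomorphic_weak\<close> applies. The
  radius is halved to have a compact disc on which \<open>Q\<close> is bounded.\<close>

lemma op_holomorphic_divide:
  assumes hol: "op_holomorphic_on E n Q (ball 0 r)" and r: "r > 0"
    and Q0: "\<And>\<mu>. \<mu> \<in> E \<Longrightarrow> Q 0 \<mu> = (\<lambda>A. 0)"
  shows "\<exists>Q1. op_holomorphic_on E n Q1 (ball 0 (r / 2)) \<and>
    (\<forall>w\<in>ball 0 (r / 2). \<forall>\<mu>\<in>E. Q w \<mu> = (\<lambda>A. w * Q1 w \<mu> A))"
proof -
  have 0: "0 \<in> ball (0::complex) r" using r by simp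
  have Qop: "Q w \<in> ops" if "w \<in> ball 0 r" for w using hol that unfolding op_holomorphic_on_def by blast
  obtain L where L: "L \<in> ops" "\<And>e. e > 0 \<Longrightarrow> \<forall>\<^sub>F w in at 0. \<forall>\<mu>\<in>E.
      n (\<lambda>A. (Q w \<mu> A - Q 0 \<mu> A) / (w - 0) - L \<mu> A) \<le> e * n \<mu>"
    using op_holomorphic_derivative[OF hol open_ball 0] by blast
  obtain C where C: "C \<ge> 0" "\<And>w \<mu>. w \<in> cball 0 (r / 2) \<Longrightarrow> \<mu> \<in> E \<Longrightarrow> n (Q w \<mu>) \<le> C * n \<mu>"
  proof -
    have "cball 0 (r / 2) \<subseteq> ball (0::complex) r" using r by auto
    then show ?thesis
      using op_holomorphic_bounded[OF hol open_ball compact_cball] that by blast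
  qed
  define Q1 where "Q1 w \<mu> = (if w = 0 then L \<mu> else (\<lambda>A. inverse w * Q w \<mu> A))" for w \<mu>
  have Q1op: "Q1 w \<in> ops" if "w \<in> ball 0 r" for w
  proof (cases "w = 0")
    case True then show ?thesis using L(1) by (simp add: Q1_def[abs_def])
  next
    case False
    have "(\<lambda>\<mu> A. inverse w * Q w \<mu> A + 0 * Q w \<mu> A) \<in> ops" by (rule ops_lincomb[OF Qop[OF that] Qop[OF that]])
    then show ?thesis using False by (simp add: Q1_def[abs_def])
  qed
  have scal: "(\<lambda>w. \<psi> (Q1 w \<mu>)) holomorphic_on ball 0 r" if \<psi>: "functional \<psi>" and \<mu>: "\<mu> \<in> E" for \<psi> \<mu>
  proof -
    define f where "f w = \<psi> (Q w \<mu>)" for w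
    have f: "f holomorphic_on ball 0 r"
      unfolding f_def by (rule op_holomorphic_functional(1)[OF hol open_ball \<psi> \<mu>])
    have "(f has_field_derivative \<psi> (L \<mu>)) (at 0)"
      unfolding f_def by (rule op_holomorphic_functional(2)[OF hol open_ball \<psi> \<mu> 0 L])
    then have d: "deriv f 0 = \<psi> (L \<mu>)" by (rule DERIV_imp_deriv)
    have "(\<lambda>w. if w = 0 then deriv f 0 else (f w - f 0) / (w - 0)) holomorphic_on ball 0 r"
      using r by (intro pole_lemma f) simp
    moreover have "f 0 = 0" unfolding f_def Q0[OF \<mu>] by (rule functional_zero[OF \<psi>])
    ultimately have "(\<lambda>w. if w = 0 then \<psi> (L \<mu>) else f w / w) holomorphic_on ball 0 r"
      unfolding d by (auto elim: holomorphic_transform)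
    then show ?thesis
      by (rule holomorphic_transform)
        (use functional_scale[OF \<psi> opsD(1)[OF Qop \<mu>]] in \<open>auto simp: Q1_def f_def divide_inverse\<close>)
  qed
  \<comment> \<open>On the circle of radius \<open>r / 2\<close> the functional contributes 2,
    \<open>Q\<close> contributes \<open>C\<close> and the division by \<open>v\<close> contributes
    \<open>2 / r\<close>. The maximum principle carries the bound into the disc, where
    \<open>w\<close> may be 0.\<close>
  have bound: "n (Q1 w \<mu>) \<le> 4 * C / r * n \<mu>" if w: "w \<in> ball 0 (r / 2)" and \<mu>: "\<mu> \<in> E" for w \<mu>
  proof (rule n_le_by_functionals)
    show "Q1 w \<mu> \<in> E" using w r by (intro opsD(1)[OF Q1op \<mu>]) auto
    fix \<psi> assume \<psi>: "functional \<psi>" and b: "\<And>y. y \<in> E \<Longrightarrow> norm (\<psi> y) \<le> 2 * n y"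
    have h: "(\<lambda>w. \<psi> (Q1 w \<mu>)) holomorphic_on cball 0 (r / 2)"
      using r by (intro holomorphic_on_subset[OF scal[OF \<psi> \<mu>]]) auto
    show "norm (\<psi> (Q1 w \<mu>)) \<le> 4 * C / r * n \<mu>"
    proof (rule maximum_modulus_frontier[of "\<lambda>w. \<psi> (Q1 w \<mu>)" "cball 0 (r / 2)"])
      show "(\<lambda>w. \<psi> (Q1 w \<mu>)) holomorphic_on interior (cball 0 (r / 2))"
        by (rule holomorphic_on_subset[OF h interior_subset])
      show "continuous_on (closure (cball 0 (r / 2))) (\<lambda>w. \<psi> (Q1 w \<mu>))"
        using holomorphic_on_imp_continuous_on[OF h] by simp
      show "w \<in> cball 0 (r / 2)" using w by auto
      fix v :: complex assume "v \<in> frontier (cball 0 (r / 2))"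
      then have v: "norm v = r / 2" using r by (simp add: frontier_cball)
      then have v0: "v \<noteq> 0" and vc: "v \<in> cball 0 (r / 2)" and vr: "v \<in> ball 0 r" using r by auto
      have iv: "inverse (norm v) = 2 / r" unfolding v by simp
      have "\<psi> (Q1 v \<mu>) = inverse v * \<psi> (Q v \<mu>)"
        using functional_scale[OF \<psi> opsD(1)[OF Qop[OF vr] \<mu>], of "inverse v"] v0 by (simp only: Q1_def if_False)
      then have "norm (\<psi> (Q1 v \<mu>)) = norm (\<psi> (Q v \<mu>)) * (2 / r)"
        by (simp only: norm_mult norm_inverse iv mult.commute)
      also have "\<dots> \<le> 2 * (C * n \<mu>) * (2 / r)"
        using b[OF opsD(1)[OF Qop[OF vr] \<mu>]] C(2)[OF vc \<mu>] r by (intro mult_right_mono) auto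
      finally show "norm (\<psi> (Q1 v \<mu>)) \<le> 4 * C / r * n \<mu>" by (simp add: field_simps)
    qed auto
  qed
  have "op_holomorphic_on E n Q1 (ball 0 (r / 2))"
  proof (rule op_holomorphic_weak[OF _ bound])
    show "Q1 w \<in> ops" if "w \<in> ball 0 (r / 2)" for w using that r by (intro Q1op) auto
    show "0 \<le> 4 * C / r" using C(1) r by simp
    show "(\<lambda>w. \<psi> (Q1 w \<mu>)) holomorphic_on ball 0 (r / 2)" if "functional \<psi>" "\<mu> \<in> E" for \<psi> \<mu>
      using r by (intro holomorphic_on_subset[OF scal[OF that]]) auto
  qed
  moreover have "Q w \<mu> = (\<lambda>A. w * Q1 w \<mu> A)" if "\<mu> \<in> E" for w \<mu>
    using Q0[OF that] by (auto simp: Q1_def)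
  ultimately show ?thesis by blast
qed

text \<open>A representation with exponent \<open>m\<close> need not have a nonzero leading
  coefficient. Either it has one, and the singularity is a pole, or a factor \<open>w\<close>
  cancels and \<open>m\<close> drops; at exponent 0 the function is regular.\<close>

lemma op_pole_or_regular:
  assumes "op_laurent_at E n P 0 m Q"
  shows "op_has_pole E n P 0 \<or> (\<exists>Q. op_laurent_at E n P 0 0 Q)"
  using assms
proof (induction m arbitrary: Q)
  case 0
  then show ?case by blast
next
  case (Suc m)
  show ?case
  proof (cases "\<exists>\<mu>\<in>E. Q 0 \<mu> \<noteq> (\<lambda>_. 0)")
    case True
    then show ?thesis unfolding op_has_pole_def using Suc.prems by blast
  next
    case False
    obtain r where r: "r > 0" "op_holomorphic_on E n Q (ball 0 r)"
      "\<And>w \<mu>. w \<in> ball 0 r - {0} \<Longrightarrow> \<mu> \<in> E \<Longrightarrow> P w \<mu> = (\<lambda>A. Q w \<mu> A / (w - 0) ^ Suc m)"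
      using Suc.prems unfolding op_laurent_at_def by blast
    obtain Q1 where Q1: "op_holomorphic_on E n Q1 (ball 0 (r / 2))"
      "\<And>w \<mu>. w \<in> ball 0 (r / 2) \<Longrightarrow> \<mu> \<in> E \<Longrightarrow> Q w \<mu> = (\<lambda>A. w * Q1 w \<mu> A)"
      using op_holomorphic_divide[OF r(2,1)] False by blast
    have "op_laurent_at E n P 0 m Q1"
      unfolding op_laurent_at_def
    proof (intro exI[of _ "r / 2"] conjI ballI Q1(1))
      show "r / 2 > 0" using r(1) by simp
      fix w \<mu> assume w: "w \<in> ball 0 (r / 2) - {0::complex}" and \<mu>: "\<mu> \<in> E"
      have "P w \<mu> = (\<lambda>A. Q w \<mu> A / (w - 0) ^ Suc m)" using w r(1) by (intro r(3) \<mu>) auto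
      also have "\<dots> = (\<lambda>A. Q1 w \<mu> A / (w - 0) ^ m)"
        using Q1(2)[of w \<mu>] w \<mu> by (simp add: field_simps)
      finally show "P w \<mu> = (\<lambda>A. Q1 w \<mu> A / (w - 0) ^ m)" .
    qed
    then show ?thesis by (rule Suc.IH)
  qed
qed

end

subsection \<open>Differentiable measures on a branched manifold\<close>

locale finite_branched_manifold =
  fixes M :: "('a::metric_space, 'e::euclidean_space) branched_atlas"
  assumes bm: "branched_manifold 2 M" and fb: "finite_branches M"
begin

lemma subchart_homeomorphism:
  assumes "i \<in> idx M" "j \<in> subidx M i"
  obtains h where "homeomorphism (subchart M i j) (coord M i ` subchart M i j) (coord M i) h"
  using bm assms unfolding branched_manifold_def by blast

lemma inj_on_coord: "i \<in> idx M \<Longrightarrow> j \<in> subidx M i \<Longrightarrow> inj_on (coord M i) (subchart M i j)"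
  by (rule subchart_homeomorphism) (auto simp: homeomorphism_def intro: inj_on_inverseI)

lemma continuous_on_coord_subchart:
  "i \<in> idx M \<Longrightarrow> j \<in> subidx M i \<Longrightarrow> continuous_on (subchart M i j) (coord M i)"
  by (rule subchart_homeomorphism) (auto simp: homeomorphism_def)

lemma UN_subchart: "i \<in> idx M \<Longrightarrow> (\<Union>j\<in>subidx M i. subchart M i j) = chart M i"
  using bm unfolding branched_manifold_def by blast

lemma continuous_on_inv_coord:
  assumes "i \<in> idx M" "j \<in> subidx M i"
  shows "continuous_on (coord M i ` subchart M i j) (inv_into (subchart M i j) (coord M i))"
proof -
  obtain h where h: "homeomorphism (subchart M i j) (coord M i ` subchart M i j) (coord M i) h"
    by (rule subchart_homeomorphism[OF assms])
  have "inv_into (subchart M i j) (coord M i) y = h y" if "y \<in> coord M i ` subchart M i j" for y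
    using that h inv_into_f_f[OF inj_on_coord[OF assms]] by (auto simp: homeomorphism_def)
  then show ?thesis using h by (auto simp: homeomorphism_def cong: continuous_on_cong)
qed

lemma compact_coord_subchart:
  assumes i: "i \<in> idx M" and j: "j \<in> subidx M i"
  shows "compact (coord M i ` subchart M i j)"
proof -
  obtain c \<rho> where c: "coord M i ` chart M i \<subseteq> cball c \<rho>"
    using bm i unfolding branched_manifold_def by blast
  have "closed (coord M i ` subchart M i j)" using bm i j unfolding branched_manifold_def by blast
  moreover have "coord M i ` subchart M i j \<subseteq> cball c \<rho>" using c UN_subchart[OF i] j by blast
  ultimately show ?thesis
    by (meson bounded_cball bounded_subset compact_eq_bounded_closed)
qed

lemma compact_subchart:
  assumes i: "i \<in> idx M" and j: "j \<in> subidx M i"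
  shows "compact (subchart M i j)"
proof -
  have "inv_into (subchart M i j) (coord M i) ` coord M i ` subchart M i j = subchart M i j"
    using inv_into_f_f[OF inj_on_coord[OF i j]] by (auto simp: image_image)
  then show ?thesis
    using compact_continuous_image[OF continuous_on_inv_coord[OF i j] compact_coord_subchart[OF i j]] by simp
qed

lemma compact_chart:
  assumes "i \<in> idx M" shows "compact (chart M i)"
proof -
  have "compact (\<Union>j\<in>subidx M i. subchart M i j)"
    using fb assms compact_subchart[OF assms] unfolding finite_branches_def by (intro compact_UN) auto
  then show ?thesis by (simp only: UN_subchart[OF assms])
qed

lemma interior_chart_cover: "\<exists>i\<in>idx M. x \<in> interior (chart M i)"
proof -
  have "(\<Union>i\<in>idx M. interior (chart M i)) = UNIV" using bm unfolding branched_manifold_def by (elim conjE)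
  then show ?thesis by blast
qed

text \<open>The subcharts are homeomorphic to closed bounded sets in Euclidean space and there are
  finitely many of them. Compactness makes every continuous test function bounded, hence admissible
  for the lemmas about \<open>bounded_borel\<close>.\<close>

lemma compact_UNIV: "compact (UNIV :: 'a set)"
proof -
  have "(\<Union>i\<in>idx M. chart M i) = UNIV"
    using interior_chart_cover interior_subset by (metis UNIV_eq_I UN_I subsetD)
  moreover have "compact (\<Union>i\<in>idx M. chart M i)"
    using fb compact_chart unfolding finite_branches_def by (intro compact_UN) auto
  ultimately show ?thesis by simp
qed

lemma continuous_on_coord:
  assumes "i \<in> idx M" shows "continuous_on (chart M i) (coord M i)"
proof -
  have "continuous_on (\<Union>j\<in>subidx M i. subchart M i j) (coord M i)"
    using fb assms continuous_on_coord_subchart[OF assms] compact_imp_closed[OF compact_subchart[OF assms]]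
    unfolding finite_branches_def by (intro continuous_on_closed_Union) auto
  then show ?thesis by (simp only: UN_subchart[OF assms])
qed

lemma continuous_bounded_borel:
  fixes \<eta> :: "'a \<Rightarrow> complex"
  assumes "continuous_on UNIV \<eta>" shows "\<eta> \<in> bounded_borel"
proof -
  have "bounded (\<eta> ` UNIV)"
    by (intro compact_imp_bounded compact_continuous_image[OF assms compact_UNIV])
  then obtain B where "\<And>x. norm (\<eta> x) \<le> B" unfolding bounded_iff by blast
  then show ?thesis by (rule bounded_borel_continuous[OF assms])
qed

section \<open>Derivatives of measures along a vector field\<close>

lemma Ck_on_1: "Ck_on 1 W h \<longleftrightarrow> (\<forall>x\<in>W. h differentiable (at x)) \<and>
    (\<forall>v. continuous_on W (\<lambda>x. frechet_derivative h (at x) v))"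
  by (simp add: numeral_eq_Suc)

text \<open>The bound is claimed for some derivative \<open>D\<close> only, namely that of a C^1
  extension, which is continuous on the compact image. Other derivatives within a thin image are not
  controlled.\<close>

lemma local_derivative_bound:
  assumes \<eta>: "Ck_function 1 M \<eta>" and U: "continuous_vector_field M U"
    and i: "i \<in> idx M" and j: "j \<in> subidx M i"
  shows "\<exists>K\<ge>0. \<forall>x\<in>subchart M i j. \<exists>D. (local_rep M i j \<eta> has_derivative D)
    (at (coord M i x) within coord M i ` subchart M i j) \<and> norm (D (U i x)) \<le> K"
proof -
  define S where "S = coord M i ` subchart M i j"
  obtain W h where W: "open W" "S \<subseteq> W" "Ck_on 1 W h" "\<And>y. y \<in> S \<Longrightarrow> h y = local_rep M i j \<eta> y"
  proof -
    have "Ck_on_set 1 S (local_rep M i j \<eta>)" using \<eta> i j unfolding Ck_function_def S_def by simp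
    then obtain W h where "open W \<and> S \<subseteq> W \<and> Ck_on 1 W h \<and> (\<forall>x\<in>S. h x = local_rep M i j \<eta> x)"
      unfolding Ck_on_set_def by (elim exE)
    then show ?thesis using that[of W h] by simp
  qed
  have dif: "(h has_derivative frechet_derivative h (at y)) (at y)" if "y \<in> W" for y
    using W(3) that unfolding Ck_on_1 by (auto simp: frechet_derivative_works[symmetric])
  have cont: "continuous_on S (\<lambda>y. \<Sum>b\<in>Basis. norm (frechet_derivative h (at y) b))"
    using W(2,3) unfolding Ck_on_1 by (intro continuous_intros) (auto intro: continuous_on_subset)
  have cS: "compact S" unfolding S_def by (rule compact_coord_subchart[OF i j])
  obtain A where A: "\<And>y. y \<in> S \<Longrightarrow> norm (\<Sum>b\<in>Basis. norm (frechet_derivative h (at y) b)) \<le> A"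
    using compact_imp_bounded[OF compact_continuous_image[OF cont cS]] unfolding bounded_iff by auto
  have "continuous_on (subchart M i j) (U i)"
    using U i j UN_subchart[OF i] unfolding continuous_vector_field_def
    by (auto intro: continuous_on_subset)
  then have "bounded (U i ` subchart M i j)"
    by (intro compact_imp_bounded compact_continuous_image compact_subchart[OF i j])
  then obtain B where B: "\<And>x. x \<in> subchart M i j \<Longrightarrow> norm (U i x) \<le> B"
    unfolding bounded_iff by auto
  show ?thesis
  proof (intro exI[of _ "\<bar>B\<bar> * \<bar>A\<bar>"] conjI ballI)
    fix x assume x: "x \<in> subchart M i j"
    define y where "y = coord M i x"
    have y: "y \<in> S" using x unfolding y_def S_def by blast
    let ?D = "frechet_derivative h (at y)"
    have "(h has_derivative ?D) (at y within S)"
      by (rule has_derivative_at_withinI[OF dif[OF subsetD[OF W(2) y]]])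
    then have 1: "(local_rep M i j \<eta> has_derivative ?D) (at y within S)"
      by (rule has_derivative_transform[OF y, rotated]) (simp add: W(4))
    interpret D: linear ?D using 1 by (rule has_derivative_linear)
    have "?D (U i x) = ?D (\<Sum>b\<in>Basis. (U i x \<bullet> b) *\<^sub>R b)" by (simp add: euclidean_representation)
    also have "\<dots> = (\<Sum>b\<in>Basis. (U i x \<bullet> b) *\<^sub>R ?D b)" by (simp add: D.sum D.scale)
    finally have "norm (?D (U i x)) \<le> (\<Sum>b\<in>Basis. norm ((U i x \<bullet> b) *\<^sub>R ?D b))"
      by (simp only: norm_sum)
    also have "\<dots> \<le> (\<Sum>b\<in>Basis. \<bar>B\<bar> * norm (?D b))"
    proof (rule sum_mono)
      fix b :: 'e assume "b \<in> Basis"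
      then have "\<bar>U i x \<bullet> b\<bar> \<le> \<bar>B\<bar>" using B[OF x] Basis_le_norm[of b "U i x"] by linarith
      then show "norm ((U i x \<bullet> b) *\<^sub>R ?D b) \<le> \<bar>B\<bar> * norm (?D b)" by (simp add: mult_right_mono)
    qed
    also have "\<dots> \<le> \<bar>B\<bar> * \<bar>A\<bar>"
      using A[OF y] by (simp add: sum_distrib_left[symmetric] mult_left_mono sum_nonneg)
    finally show "\<exists>D. (local_rep M i j \<eta> has_derivative D)
      (at (coord M i x) within coord M i ` subchart M i j) \<and> norm (D (U i x)) \<le> \<bar>B\<bar> * \<bar>A\<bar>"
      using 1 unfolding y_def S_def by blast
  qed simp
qed

text \<open>Where the subcharts are thin, the derivatives are not unique and a version \<open>\<zeta>\<close> of \<open>U \<eta>\<close> can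
  be unbounded. Beyond the bound \<open>K\<close> of the derivative of a \<open>C\<^sup>1\<close> extension, however, every value
  is possible.\<close>

lemma derivative_along_arbitrary:
  assumes \<eta>: "Ck_function 1 M \<eta>" and U: "continuous_vector_field M U"
  shows "\<exists>K. \<forall>\<zeta> x c. has_derivative_along M U \<eta> \<zeta> \<longrightarrow> norm (\<zeta> x) > K \<longrightarrow>
    (\<forall>i\<in>idx M. \<forall>j\<in>subidx M i. x \<in> subchart M i j \<longrightarrow> (\<exists>L. (local_rep M i j \<eta> has_derivative L)
        (at (coord M i x) within coord M i ` subchart M i j) \<and> c = L (U i x)))"
proof -
  have "\<forall>p\<in>Sigma (idx M) (subidx M). \<exists>K\<ge>0. \<forall>x\<in>subchart M (fst p) (snd p). \<exists>D.
      (local_rep M (fst p) (snd p) \<eta> has_derivative D)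
      (at (coord M (fst p) x) within coord M (fst p) ` subchart M (fst p) (snd p)) \<and> norm (D (U (fst p) x)) \<le> K"
    using local_derivative_bound[OF \<eta> U] by auto
  from bchoice[OF this] obtain K where K: "\<forall>p\<in>Sigma (idx M) (subidx M). 0 \<le> K p \<and>
      (\<forall>x\<in>subchart M (fst p) (snd p). \<exists>D.
      (local_rep M (fst p) (snd p) \<eta> has_derivative D)
      (at (coord M (fst p) x) within coord M (fst p) ` subchart M (fst p) (snd p)) \<and> norm (D (U (fst p) x)) \<le> K p)"
    by (elim exE)
  define K0 where "K0 = (\<Sum>p\<in>Sigma (idx M) (subidx M). K p)"
  have fin: "finite (Sigma (idx M) (subidx M))" using fb unfolding finite_branches_def by auto
  have "\<exists>L. (local_rep M i j \<eta> has_derivative L)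
        (at (coord M i x) within coord M i ` subchart M i j) \<and> c = L (U i x)"
    if \<zeta>: "has_derivative_along M U \<eta> \<zeta>" and big: "norm (\<zeta> x) > K0"
      and i: "i \<in> idx M" and j: "j \<in> subidx M i" and x: "x \<in> subchart M i j" for \<zeta> x c i j
  proof -
    have ij: "(i, j) \<in> Sigma (idx M) (subidx M)" using i j by blast
    let ?F = "at (coord M i x) within coord M i ` subchart M i j"
    obtain D where D: "(local_rep M i j \<eta> has_derivative D) ?F" "norm (D (U i x)) \<le> K (i, j)"
      using bspec[OF K ij] x by auto
    have "K (i, j) \<le> K0" unfolding K0_def using K ij fin by (intro member_le_sum) auto
    then have ne: "\<zeta> x \<noteq> D (U i x)" using D(2) big by auto
    obtain L where L: "(local_rep M i j \<eta> has_derivative L) ?F" "\<zeta> x = L (U i x)"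
      using \<zeta> i j x unfolding has_derivative_along_def by blast
    \<comment> \<open>Affine combinations of two derivatives within the set are derivatives again.
      \<open>D\<close> and \<open>L\<close> differ in the direction \<open>U i x\<close> because of
      their sizes, so the line through them attains every value \<open>c\<close>.\<close>
    define a where "a = (c - D (U i x)) / (L (U i x) - D (U i x))"
    have "((\<lambda>y. local_rep M i j \<eta> y + a * (local_rep M i j \<eta> y - local_rep M i j \<eta> y))
        has_derivative (\<lambda>v. D v + a * (L v - D v))) ?F"
      by (intro has_derivative_add has_derivative_mult_right has_derivative_diff D(1) L(1))
    then have "(local_rep M i j \<eta> has_derivative (\<lambda>v. D v + a * (L v - D v))) ?F" by simp
    moreover have "c = D (U i x) + a * (L (U i x) - D (U i x))"
      unfolding a_def using ne L(2) by simp
    ultimately show ?thesis by blast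
  qed
  then show ?thesis by blast
qed

text \<open>Let \<open>N\<close> be the set where \<open>\<zeta>\<close> exceeds the bound
  \<open>K\<close>. There \<open>\<zeta>\<close> may be redefined at will and remains a version of
  "U eta"; the version \<open>z B\<close> takes the values of the indicator of \<open>B\<close> on
  \<open>N\<close>. If a measure has a derivative, all versions have the same integral, and
  comparing \<open>z B\<close> with \<open>z {}\<close> gives measure 0 to every Borel
  \<open>B\<close> in \<open>N\<close>. The set \<open>N\<close> does not depend on the measure, so
  several measures can be treated together.\<close>

lemma derivative_along_truncate:
  assumes \<eta>: "\<eta> \<in> C10 M" and U: "continuous_vector_field M U" and \<zeta>: "has_derivative_along M U \<eta> \<zeta>"
  obtains \<zeta>0 N where "\<zeta>0 \<in> bounded_borel" "\<forall>x. x \<notin> N \<longrightarrow> \<zeta> x = \<zeta>0 x"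
    "\<forall>\<mu>\<in>complex_measures. \<forall>\<nu>. is_measure_derivative M U \<mu> \<nu> \<longrightarrow> (\<forall>B\<in>sets borel. B \<subseteq> N \<longrightarrow> \<mu> B = 0)"
proof -
  have C1: "Ck_function 1 M \<eta>" using \<eta> unfolding C10_def by blast
  obtain K where K: "\<And>\<zeta> x c i j. has_derivative_along M U \<eta> \<zeta> \<Longrightarrow> norm (\<zeta> x) > K \<Longrightarrow>
      i \<in> idx M \<Longrightarrow> j \<in> subidx M i \<Longrightarrow> x \<in> subchart M i j \<Longrightarrow> (\<exists>L. (local_rep M i j \<eta> has_derivative L)
        (at (coord M i x) within coord M i ` subchart M i j) \<and> c = L (U i x))"
  proof -
    obtain K where "\<forall>\<zeta> x c. has_derivative_along M U \<eta> \<zeta> \<longrightarrow> norm (\<zeta> x) > K \<longrightarrow>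
      (\<forall>i\<in>idx M. \<forall>j\<in>subidx M i. x \<in> subchart M i j \<longrightarrow> (\<exists>L. (local_rep M i j \<eta> has_derivative L)
        (at (coord M i x) within coord M i ` subchart M i j) \<and> c = L (U i x)))"
      using derivative_along_arbitrary[OF C1 U] by (elim exE)
    then show ?thesis using that[of K] by simp
  qed
  have [measurable]: "\<zeta> \<in> borel_measurable borel" using \<zeta> unfolding has_derivative_along_def by blast
  define N where "N = {x. norm (\<zeta> x) > K}"
  have [measurable]: "N \<in> sets borel" unfolding N_def by measurable
  define z where "z B x = (if x \<in> N then indicator B x else \<zeta> x)" for B x
  have zb: "z B \<in> bounded_borel" if [measurable]: "B \<in> sets borel" for B
  proof (rule bounded_borelI[of _ "max 1 K"])
    show "z B \<in> borel_measurable borel" unfolding z_def[abs_def] by measurable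
    show "norm (z B x) \<le> max 1 K" for x by (auto simp: z_def N_def indicator_def)
  qed
  have zd: "has_derivative_along M U \<eta> (z B)" if B: "B \<in> sets borel" for B
    unfolding has_derivative_along_def
  proof (intro conjI ballI)
    show "z B \<in> borel_measurable borel" using zb[OF B] by (rule bounded_borel_measurable)
    fix i j x assume ij: "i \<in> idx M" "j \<in> subidx M i" "x \<in> subchart M i j"
    show "\<exists>L. (local_rep M i j \<eta> has_derivative L)
        (at (coord M i x) within coord M i ` subchart M i j) \<and> z B x = L (U i x)"
    proof (cases "x \<in> N")
      case True
      then show ?thesis using K[OF \<zeta> _ ij] by (simp add: N_def)
    next
      case False
      then show ?thesis using \<zeta> ij unfolding has_derivative_along_def z_def by simp
    qed
  qed
  show ?thesis
  proof (rule that[of "z {}" N])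
    show "z {} \<in> bounded_borel" by (rule zb) simp
    show "\<forall>x. x \<notin> N \<longrightarrow> \<zeta> x = z {} x" by (simp add: z_def)
    show "\<forall>\<mu>\<in>complex_measures. \<forall>\<nu>. is_measure_derivative M U \<mu> \<nu> \<longrightarrow> (\<forall>B\<in>sets borel. B \<subseteq> N \<longrightarrow> \<mu> B = 0)"
    proof (intro ballI allI impI)
    fix \<mu> \<nu> and B :: "'a set"
    assume \<mu>: "\<mu> \<in> complex_measures" and d: "is_measure_derivative M U \<mu> \<nu>" and B: "B \<in> sets borel" "B \<subseteq> N"
    have "(\<lambda>x. z {} x + 1 * indicator B x) = z B" using B(2) by (auto simp: z_def indicator_def fun_eq_iff)
    then have "cint \<mu> (z B) = cint \<mu> (z {}) + 1 * cint \<mu> (indicator B)"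
      using cint_lincomb_fun[OF \<mu> zb[of "{}"] bounded_borel_indicator[OF B(1)], of 1] by simp
    moreover have "cint \<mu> (z B) = cint \<mu> (z {})"
      using d zd[OF B(1)] zd[of "{}"] \<eta> unfolding is_measure_derivative_def by simp
    ultimately show "\<mu> B = 0" using cint_indicator[OF \<mu> B(1)] by simp
    qed
  qed
qed

text \<open>The integral of a possibly unbounded \<open>\<zeta>\<close> is not visibly linear in the
  measure. Both measures vanish on the subsets of \<open>N\<close>, so \<open>\<zeta>\<close> can be
  exchanged for its bounded truncation, for which \<open>cint_lincomb\<close> holds.\<close>

lemma is_measure_derivative_lincomb:
  assumes U: "continuous_vector_field M U" and \<mu>: "\<mu> \<in> complex_measures" "\<mu>' \<in> complex_measures"
    and d: "is_measure_derivative M U \<mu> \<nu>" "is_measure_derivative M U \<mu>' \<nu>'"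
  shows "is_measure_derivative M U (\<lambda>A. \<mu> A + c * \<mu>' A) (\<lambda>A. \<nu> A + c * \<nu>' A)"
  unfolding is_measure_derivative_def
proof (intro conjI ballI allI impI)
  have \<nu>: "\<nu> \<in> complex_measures" "\<nu>' \<in> complex_measures" using d unfolding is_measure_derivative_def by auto
  then show "(\<lambda>A. \<nu> A + c * \<nu>' A) \<in> complex_measures" by (rule complex_measures_lincomb)
  fix \<eta> \<zeta> assume \<eta>: "\<eta> \<in> C10 M" and \<zeta>: "has_derivative_along M U \<eta> \<zeta>"
  obtain \<zeta>0 N where z0: "\<zeta>0 \<in> bounded_borel" "\<forall>x. x \<notin> N \<longrightarrow> \<zeta> x = \<zeta>0 x"
    "\<forall>\<mu>\<in>complex_measures. \<forall>\<nu>. is_measure_derivative M U \<mu> \<nu> \<longrightarrow> (\<forall>B\<in>sets borel. B \<subseteq> N \<longrightarrow> \<mu> B = 0)"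
    by (rule derivative_along_truncate[OF \<eta> U \<zeta>])
  note z = z0(1) z0(2)[rule_format] z0(3)[rule_format]
  have \<zeta>m: "\<zeta> \<in> borel_measurable borel" using \<zeta> unfolding has_derivative_along_def by blast
  have eq: "cint \<rho> \<zeta> = cint \<rho> \<zeta>0" if "\<rho> \<in> complex_measures" "\<And>B. B \<in> sets borel \<Longrightarrow> B \<subseteq> N \<Longrightarrow> \<rho> B = 0" for \<rho>
    by (rule cint_cong_null[OF that(1) \<zeta>m bounded_borel_measurable[OF z(1)] that(2) z(2)])
  have n1: "\<And>B. B \<in> sets borel \<Longrightarrow> B \<subseteq> N \<Longrightarrow> \<mu> B = 0" by (rule z(3)[OF \<mu>(1) d(1)])
  have n2: "\<And>B. B \<in> sets borel \<Longrightarrow> B \<subseteq> N \<Longrightarrow> \<mu>' B = 0" by (rule z(3)[OF \<mu>(2) d(2)])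
  have \<eta>b: "\<eta> \<in> bounded_borel" using \<eta> unfolding C10_def by (auto intro: continuous_bounded_borel)
  have "cint (\<lambda>A. \<mu> A + c * \<mu>' A) \<zeta> = cint (\<lambda>A. \<mu> A + c * \<mu>' A) \<zeta>0"
    by (rule eq[OF complex_measures_lincomb[OF \<mu>]]) (simp add: n1 n2)
  also have "\<dots> = cint \<mu> \<zeta> + c * cint \<mu>' \<zeta>"
    by (simp only: cint_lincomb[OF \<mu> z(1)] eq[OF \<mu>(1) n1] eq[OF \<mu>(2) n2])
  also have "\<dots> = - cint \<nu> \<eta> + c * (- cint \<nu>' \<eta>)"
    using d \<eta> \<zeta> unfolding is_measure_derivative_def by simp
  also have "\<dots> = - cint (\<lambda>A. \<nu> A + c * \<nu>' A) \<eta>"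
    using cint_lincomb[OF \<nu> \<eta>b, of c] by simp
  finally show "cint (\<lambda>A. \<mu> A + c * \<mu>' A) \<zeta> = - cint (\<lambda>A. \<nu> A + c * \<nu>' A) \<eta>" .
qed

lemma is_measure_derivative_diff:
  assumes U: "continuous_vector_field M U" and \<mu>: "\<mu> \<in> complex_measures" "\<mu>' \<in> complex_measures"
    and d: "is_measure_derivative M U \<mu> \<nu>" "is_measure_derivative M U \<mu>' \<nu>'"
  shows "is_measure_derivative M U (\<lambda>A. \<mu> A - \<mu>' A) (\<lambda>A. \<nu> A - \<nu>' A)"
  using is_measure_derivative_lincomb[OF assms, of "-1"] by simp

lemma is_measure_derivative_zero: "is_measure_derivative M U (\<lambda>A. 0) (\<lambda>A. 0)"
proof -
  have "cint (\<lambda>A. 0) f = 0" if "f \<in> borel_measurable borel" for f :: "'a \<Rightarrow> complex"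
    using cint_cong_null[OF complex_measures_zero that, of "\<lambda>_. 0" UNIV]
      cint_scale_fun[of "\<lambda>A. 0" 0 "\<lambda>_::'a. 0"] by simp
  then show ?thesis
    unfolding is_measure_derivative_def
    using complex_measures_zero by (auto simp: C10_def has_derivative_along_def borel_measurable_continuous_onI)
qed

lemma complex_measures_minus:
  "\<mu> \<in> complex_measures \<Longrightarrow> \<nu> \<in> complex_measures \<Longrightarrow> (\<lambda>A. \<mu> A - \<nu> A) \<in> complex_measures"
  using complex_measures_lincomb[of \<mu> \<nu> "-1"] by simp

lemma cint_tendsto:
  fixes x :: "nat \<Rightarrow> 'a set \<Rightarrow> complex"
  assumes x: "\<And>k. x k \<in> complex_measures" and l: "l \<in> complex_measures" and f: "f \<in> bounded_borel"
    and lim: "(\<lambda>k. total_variation (\<lambda>A. x k A - l A)) \<longlonglongrightarrow> 0"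
  shows "(\<lambda>k. cint (x k) f) \<longlonglongrightarrow> cint l f"
proof -
  obtain B where B: "\<And>x. norm (f x) \<le> B" using f unfolding bounded_borel_def by blast
  have B0: "B \<ge> 0" using B[of undefined] norm_ge_zero order_trans by blast
  have le: "norm (cint (x k) f - cint l f) \<le> 4 * B * total_variation (\<lambda>A. x k A - l A)" for k
  proof -
    have m: "(\<lambda>A. x k A - l A) \<in> complex_measures" by (rule complex_measures_minus[OF x l])
    have "sup_measure_norm (\<lambda>A. x k A - l A) \<le> total_variation (\<lambda>A. x k A - l A)"
      by (rule sup_measure_norm_least) (rule norm_le_total_variation[OF m])
    then have "4 * sup_measure_norm (\<lambda>A. x k A - l A) * B \<le> 4 * total_variation (\<lambda>A. x k A - l A) * B"
      using B0 by (intro mult_right_mono) auto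
    then show ?thesis
      using norm_cint_le[OF m bounded_borel_measurable[OF f] B] cint_lincomb[OF x l f, of k "-1"]
      by (simp add: mult_ac)
  qed
  have "(\<lambda>k. 4 * B * total_variation (\<lambda>A. x k A - l A)) \<longlonglongrightarrow> 0"
    by (rule tendsto_mult_right_zero[OF lim])
  then have "(\<lambda>k. cint (x k) f - cint l f) \<longlonglongrightarrow> 0"
    by (rule Lim_null_comparison[OF always_eventually[OF allI[OF le]]])
  then show ?thesis by (simp add: LIM_zero_iff)
qed

text \<open>The relation between a measure and its derivatives is closed. Setwise convergence is
  assumed as well as convergence in norm, because it passes the vanishing on subsets of
  \<open>N\<close> directly to the limit and permits the same truncation there.\<close>

lemma is_measure_derivative_limit:
  assumes U: "continuous_vector_field M U" and x: "\<And>k::nat. x k \<in> complex_measures" and l: "l \<in> complex_measures"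
    and y: "\<And>k. is_measure_derivative M U (x k) (y k)" and m: "m \<in> complex_measures"
    and xl: "\<And>A. (\<lambda>k. x k A) \<longlonglongrightarrow> l A" "(\<lambda>k. total_variation (\<lambda>A. x k A - l A)) \<longlonglongrightarrow> 0"
    and ym: "(\<lambda>k. total_variation (\<lambda>A. y k A - m A)) \<longlonglongrightarrow> 0"
  shows "is_measure_derivative M U l m"
  unfolding is_measure_derivative_def
proof (intro conjI ballI allI impI m)
  fix \<eta> \<zeta> assume \<eta>: "\<eta> \<in> C10 M" and \<zeta>: "has_derivative_along M U \<eta> \<zeta>"
  obtain \<zeta>0 N where z0: "\<zeta>0 \<in> bounded_borel" "\<forall>x. x \<notin> N \<longrightarrow> \<zeta> x = \<zeta>0 x"
    "\<forall>\<mu>\<in>complex_measures. \<forall>\<nu>. is_measure_derivative M U \<mu> \<nu> \<longrightarrow> (\<forall>B\<in>sets borel. B \<subseteq> N \<longrightarrow> \<mu> B = 0)"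
    by (rule derivative_along_truncate[OF \<eta> U \<zeta>])
  note z = z0(1) z0(2)[rule_format] z0(3)[rule_format]
  have \<zeta>m: "\<zeta> \<in> borel_measurable borel" using \<zeta> unfolding has_derivative_along_def by blast
  have eq: "cint \<rho> \<zeta> = cint \<rho> \<zeta>0" if "\<rho> \<in> complex_measures" "\<And>B. B \<in> sets borel \<Longrightarrow> B \<subseteq> N \<Longrightarrow> \<rho> B = 0" for \<rho>
    by (rule cint_cong_null[OF that(1) \<zeta>m bounded_borel_measurable[OF z(1)] that(2) z(2)])
  have nx: "\<And>B. B \<in> sets borel \<Longrightarrow> B \<subseteq> N \<Longrightarrow> x k B = 0" for k by (rule z(3)[OF x y])
  have nl: "l B = 0" if "B \<in> sets borel" "B \<subseteq> N" for B
    using xl(1)[of B] nx[OF that] by (simp add: LIMSEQ_const_iff)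
  have \<eta>b: "\<eta> \<in> bounded_borel" using \<eta> unfolding C10_def by (auto intro: continuous_bounded_borel)
  have yc: "y k \<in> complex_measures" for k using y unfolding is_measure_derivative_def by blast
  have "(\<lambda>k. cint (x k) \<zeta>0) \<longlonglongrightarrow> cint l \<zeta>0" by (rule cint_tendsto[OF x l z(1) xl(2)])
  moreover have "cint (x k) \<zeta>0 = - cint (y k) \<eta>" for k
    using eq[OF x nx, of k] y[of k] \<eta> \<zeta> unfolding is_measure_derivative_def by simp
  moreover have "(\<lambda>k. - cint (y k) \<eta>) \<longlonglongrightarrow> - cint m \<eta>"
    by (rule tendsto_minus[OF cint_tendsto[OF yc m \<eta>b ym]])
  ultimately have "cint l \<zeta>0 = - cint m \<eta>" by (simp only: LIMSEQ_unique)
  then show "cint l \<zeta> = - cint m \<eta>" using eq[OF l nl] by simp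
qed

section \<open>The smallest derivative and its norm\<close>

lemma derivative_norm_le:
  assumes "is_measure_derivative M U \<mu> \<nu>" shows "derivative_norm M U \<mu> \<le> total_variation \<nu>"
  unfolding derivative_norm_def
proof (rule cInf_lower)
  show "bdd_below (total_variation ` {\<nu>. is_measure_derivative M U \<mu> \<nu>})"
    by (rule bdd_belowI2[of _ 0]) (auto simp: is_measure_derivative_def intro: total_variation_nonneg)
qed (use assms in auto)

lemma derivative_norm_greatest:
  assumes "is_measure_derivative M U \<mu> \<nu>"
    and "\<And>\<nu>. is_measure_derivative M U \<mu> \<nu> \<Longrightarrow> K \<le> total_variation \<nu>"
  shows "K \<le> derivative_norm M U \<mu>"
  unfolding derivative_norm_def using assms by (intro cInf_greatest) auto

lemma derivative_norm_approx:
  assumes "is_measure_derivative M U \<mu> \<nu>" "e > 0"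
  shows "\<exists>\<nu>. is_measure_derivative M U \<mu> \<nu> \<and> total_variation \<nu> < derivative_norm M U \<mu> + e"
proof (rule ccontr)
  assume "\<not> ?thesis"
  then have "derivative_norm M U \<mu> + e \<le> derivative_norm M U \<mu>"
    by (intro derivative_norm_greatest[OF assms(1)]) (simp add: not_less)
  then show False using assms(2) by simp
qed

lemma derivative_norm_nonneg: "is_measure_derivative M U \<mu> \<nu> \<Longrightarrow> 0 \<le> derivative_norm M U \<mu>"
  by (rule derivative_norm_greatest) (auto simp: is_measure_derivative_def intro: total_variation_nonneg)

lemma derivative_norm_lincomb:
  assumes U: "continuous_vector_field M U" and \<mu>: "\<mu> \<in> complex_measures" "\<mu>' \<in> complex_measures"
    and d: "is_measure_derivative M U \<mu> \<nu>" "is_measure_derivative M U \<mu>' \<nu>'"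
  shows "derivative_norm M U (\<lambda>A. \<mu> A + c * \<mu>' A) \<le> derivative_norm M U \<mu> + norm c * derivative_norm M U \<mu>'"
proof (rule field_le_epsilon)
  fix e :: real assume e: "e > 0"
  \<comment> \<open>Chosen so that the error of the first near-minimal derivative plus
    \<open>norm c\<close> times that of the second is exactly \<open>e\<close>.\<close>
  define e' where "e' = e / (1 + norm c)"
  have e': "e' > 0" "e' * (1 + norm c) = e" 
  proof -
    have "1 + norm c > 0" by (simp add: add_pos_nonneg)
    then show "e' > 0" "e' * (1 + norm c) = e" unfolding e'_def using e by simp_all
  qed
  obtain \<rho> \<rho>' where \<rho>: "is_measure_derivative M U \<mu> \<rho>" "total_variation \<rho> < derivative_norm M U \<mu> + e'"
    "is_measure_derivative M U \<mu>' \<rho>'" "total_variation \<rho>' < derivative_norm M U \<mu>' + e'"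
    using derivative_norm_approx[OF d(1) e'(1)] derivative_norm_approx[OF d(2) e'(1)] by blast
  have \<rho>c: "\<rho> \<in> complex_measures" "\<rho>' \<in> complex_measures" using \<rho> unfolding is_measure_derivative_def by auto
  have "derivative_norm M U (\<lambda>A. \<mu> A + c * \<mu>' A) \<le> total_variation (\<lambda>A. \<rho> A + c * \<rho>' A)"
    by (rule derivative_norm_le[OF is_measure_derivative_lincomb[OF U \<mu> \<rho>(1,3)]])
  also have "\<dots> \<le> total_variation \<rho> + norm c * total_variation \<rho>'"
    by (rule total_variation_lincomb[OF \<rho>c])
  also have "\<dots> \<le> (derivative_norm M U \<mu> + e') + norm c * (derivative_norm M U \<mu>' + e')"
    using \<rho>(2,4) by (intro add_mono mult_left_mono) auto
  also have "\<dots> = derivative_norm M U \<mu> + norm c * derivative_norm M U \<mu>' + e"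
    unfolding e'(2)[symmetric] by (simp add: algebra_simps)
  finally show "derivative_norm M U (\<lambda>A. \<mu> A + c * \<mu>' A)
      \<le> derivative_norm M U \<mu> + norm c * derivative_norm M U \<mu>' + e" .
qed

end

locale riemannian_branched_manifold = finite_branched_manifold M
  for M :: "('a::metric_space, 'e::euclidean_space) branched_atlas" +
  fixes g :: "nat \<Rightarrow> 'a \<Rightarrow> 'e \<Rightarrow> 'e \<Rightarrow> real"
  assumes g: "tangent_inner_product M g"
begin

lemma unit_test_fields_continuous: "U \<in> unit_test_fields M g \<Longrightarrow> continuous_vector_field M U"
  unfolding unit_test_fields_def Ck_vector_field_def by blast

text \<open>Makes the supremum in \<open>diff_norm\<close> range over a nonempty set. The point to
  check is that coordinate changes fix the zero vector: \<open>Dtrans\<close> is linear because the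
  transition map itself is differentiable at the points concerned.\<close>

lemma zero_unit_test_field: "(\<lambda>_ _. 0) \<in> unit_test_fields M g"
proof -
  have "Dtrans M i k x 0 = 0" if ik: "i \<in> idx M" "k \<in> idx M" "x \<in> chart M i \<inter> chart M k" for i k x
  proof -
    have "\<forall>i\<in>idx M. \<forall>k\<in>idx M.
        Ck_diffeo_on 2 (coord M k ` (chart M i \<inter> chart M k)) (transition M i k)
        \<and> (\<forall>x\<in>chart M i \<inter> chart M k. coord M i x = transition M i k (coord M k x))"
      using bm unfolding branched_manifold_def by (elim conjE)
    from bspec[OF bspec[OF this ik(1)] ik(2)]
    have "Ck_diffeo_on 2 (coord M k ` (chart M i \<inter> chart M k)) (transition M i k)" by (rule conjunct1)
    then obtain W where W: "coord M k ` (chart M i \<inter> chart M k) \<subseteq> W" "Ck_on 2 W (transition M i k)"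
      unfolding Ck_diffeo_on_def by (elim exE conjE)
    have "transition M i k differentiable (at (coord M k x))"
      using W ik by (auto simp: numeral_2_eq_2)
    then have "linear (Dtrans M i k x)"
      unfolding Dtrans_def frechet_derivative_works by (rule has_derivative_linear)
    then show ?thesis by (rule linear_0)
  qed
  then have "vector_field M (\<lambda>_ _. 0)" unfolding vector_field_def by auto
  moreover have "Ck_on_set 1 S (local_rep M i j (\<lambda>_. 0 :: 'e))" for S i j
    unfolding Ck_on_set_def local_rep_def
    by (intro exI[of _ UNIV] exI[of _ "\<lambda>_. 0"]) (auto simp: Ck_on_1)
  moreover have "tnorm g i x 0 \<le> 1" if "i \<in> idx M" "x \<in> chart M i" for i x
  proof -
    have "bilinear (g i x)" using g that unfolding tangent_inner_product_def by blast
    then show ?thesis by (simp add: tnorm_def bilinear_lzero)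
  qed
  moreover have "\<exists>L. (local_rep M i j (\<lambda>_. 0 :: 'e) has_derivative L) F \<and> onorm L \<le> 1" for i j F
    unfolding local_rep_def by (intro exI[of _ "\<lambda>_. 0"]) (auto simp: comp_def onorm_zero)
  ultimately show ?thesis
    unfolding unit_test_fields_def Ck_vector_field_def continuous_vector_field_def by auto
qed

section \<open>The Banach space of differentiable measures\<close>

abbreviation "D \<equiv> diff_measures M g"
abbreviation "nD \<equiv> diff_norm M g"
abbreviation "TF \<equiv> unit_test_fields M g"

lemma diff_measuresD:
  assumes "\<mu> \<in> D"
  shows "\<mu> \<in> complex_measures" and "U \<in> TF \<Longrightarrow> \<exists>\<nu>. is_measure_derivative M U \<mu> \<nu>"
    and "bdd_above ((\<lambda>U. derivative_norm M U \<mu>) ` TF)"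
  using assms unfolding diff_measures_def by (blast, blast, simp)

lemma derivative_norm_le_SUP:
  "\<mu> \<in> D \<Longrightarrow> U \<in> TF \<Longrightarrow> derivative_norm M U \<mu> \<le> (SUP U\<in>TF. derivative_norm M U \<mu>)"
  by (rule cSUP_upper[OF _ diff_measuresD(3)])

lemma SUP_derivative_norm_nonneg:
  assumes "\<mu> \<in> D" shows "0 \<le> (SUP U\<in>TF. derivative_norm M U \<mu>)"
  using diff_measuresD(2)[OF assms zero_unit_test_field] derivative_norm_nonneg
    derivative_norm_le_SUP[OF assms zero_unit_test_field] order_trans by blast

lemma total_variation_le_diff_norm: "\<mu> \<in> D \<Longrightarrow> total_variation \<mu> \<le> nD \<mu>"
  using SUP_derivative_norm_nonneg[of \<mu>] unfolding diff_norm_def by simp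

lemma derivative_norm_le_diff_norm: "\<mu> \<in> D \<Longrightarrow> U \<in> TF \<Longrightarrow> derivative_norm M U \<mu> \<le> nD \<mu>"
  using derivative_norm_le_SUP[of \<mu> U] total_variation_nonneg[OF diff_measuresD(1), of \<mu>]
  unfolding diff_norm_def by linarith

lemma diff_measuresI:
  assumes "\<mu> \<in> complex_measures"
    and "\<And>U. U \<in> TF \<Longrightarrow> \<exists>\<nu>. is_measure_derivative M U \<mu> \<nu>" "\<And>U. U \<in> TF \<Longrightarrow> derivative_norm M U \<mu> \<le> K"
  shows "\<mu> \<in> D" and "nD \<mu> \<le> K + total_variation \<mu>"
proof -
  have "bdd_above ((\<lambda>U. derivative_norm M U \<mu>) ` TF)"
  proof (rule bdd_aboveI2)
    show "derivative_norm M U \<mu> \<le> K" if "U \<in> TF" for U by (rule assms(3)[OF that])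
  qed
  then show "\<mu> \<in> D" unfolding diff_measures_def using assms(1,2) by blast
  have "(SUP U\<in>TF. derivative_norm M U \<mu>) \<le> K"
    using assms(3) zero_unit_test_field by (intro cSUP_least) auto
  then show "nD \<mu> \<le> K + total_variation \<mu>" unfolding diff_norm_def by simp
qed

lemma diff_measures_lincomb:
  assumes \<mu>: "\<mu> \<in> D" and \<nu>: "\<nu> \<in> D"
  shows "(\<lambda>A. \<mu> A + c * \<nu> A) \<in> D" and "nD (\<lambda>A. \<mu> A + c * \<nu> A) \<le> nD \<mu> + norm c * nD \<nu>"
proof -
  note \<mu>c = diff_measuresD(1)[OF \<mu>] and \<nu>c = diff_measuresD(1)[OF \<nu>]
  let ?K = "(SUP U\<in>TF. derivative_norm M U \<mu>) + norm c * (SUP U\<in>TF. derivative_norm M U \<nu>)"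
  have ex: "\<exists>\<rho>. is_measure_derivative M U (\<lambda>A. \<mu> A + c * \<nu> A) \<rho>" if U: "U \<in> TF" for U
    using is_measure_derivative_lincomb[OF unit_test_fields_continuous[OF U] \<mu>c \<nu>c]
      diff_measuresD(2)[OF \<mu> U] diff_measuresD(2)[OF \<nu> U] by blast
  have le: "derivative_norm M U (\<lambda>A. \<mu> A + c * \<nu> A) \<le> ?K" if U: "U \<in> TF" for U
  proof -
    obtain \<rho> \<rho>' where "is_measure_derivative M U \<mu> \<rho>" "is_measure_derivative M U \<nu> \<rho>'"
      using diff_measuresD(2)[OF \<mu> U] diff_measuresD(2)[OF \<nu> U] by blast
    then have "derivative_norm M U (\<lambda>A. \<mu> A + c * \<nu> A) \<le> derivative_norm M U \<mu> + norm c * derivative_norm M U \<nu>"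
      by (rule derivative_norm_lincomb[OF unit_test_fields_continuous[OF U] \<mu>c \<nu>c])
    also have "\<dots> \<le> ?K" by (intro add_mono mult_left_mono derivative_norm_le_SUP \<mu> \<nu> U) auto
    finally show ?thesis .
  qed
  show "(\<lambda>A. \<mu> A + c * \<nu> A) \<in> D" by (rule diff_measuresI(1)[OF complex_measures_lincomb[OF \<mu>c \<nu>c] ex le])
  have "nD (\<lambda>A. \<mu> A + c * \<nu> A) \<le> ?K + total_variation (\<lambda>A. \<mu> A + c * \<nu> A)"
    by (rule diff_measuresI(2)[OF complex_measures_lincomb[OF \<mu>c \<nu>c] ex le])
  also have "\<dots> \<le> ?K + (total_variation \<mu> + norm c * total_variation \<nu>)"
    using total_variation_lincomb[OF \<mu>c \<nu>c, of c] by simp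
  also have "\<dots> = nD \<mu> + norm c * nD \<nu>" unfolding diff_norm_def by (simp add: algebra_simps)
  finally show "nD (\<lambda>A. \<mu> A + c * \<nu> A) \<le> nD \<mu> + norm c * nD \<nu>" .
qed

lemma diff_measures_zero: "(\<lambda>A. 0) \<in> D" and diff_norm_zero: "nD (\<lambda>A. 0) = 0"
proof -
  have *: "\<exists>\<nu>. is_measure_derivative M U (\<lambda>A. 0) \<nu>" "derivative_norm M U (\<lambda>A. 0) \<le> 0" for U
    using is_measure_derivative_zero[of U] derivative_norm_le[OF is_measure_derivative_zero, of U]
    by (auto simp: total_variation_zero)
  show z: "(\<lambda>A. 0) \<in> D" using * by (intro diff_measuresI(1)[OF complex_measures_zero]) auto
  have "nD (\<lambda>A. 0) \<le> 0 + total_variation (\<lambda>A::'a set. 0)"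
    using * by (intro diff_measuresI(2)[OF complex_measures_zero]) auto
  then show "nD (\<lambda>A. 0) = 0"
    using total_variation_le_diff_norm[OF z] by (simp add: total_variation_zero)
qed

text \<open>Derivatives are determined only up to measures on the boundary, so derivatives chosen
  separately for each \<open>x k\<close> need not converge. Instead near-minimal derivatives of the
  increments are added to one derivative of \<open>x 0\<close>. These sums are derivatives of the
  \<open>x k\<close> and form a fast Cauchy sequence, whose limit is a derivative of the limit; the
  estimates are uniform in the field \<open>U\<close>.\<close>

lemma diff_measures_complete:
  assumes x: "\<And>k. x k \<in> D" and d: "\<And>k. nD (\<lambda>A. x (Suc k) A - x k A) \<le> K * (1/2) ^ k"
  shows "\<exists>l\<in>D. (\<lambda>k. nD (\<lambda>A. x k A - l A)) \<longlonglongrightarrow> 0"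
proof -
  have diff: "(\<lambda>A. \<mu> A - \<nu> A) \<in> D" if "\<mu> \<in> D" "\<nu> \<in> D" for \<mu> \<nu>
    using diff_measures_lincomb(1)[OF that, of "-1"] by simp
  note xc = diff_measuresD(1)[OF x]
  have tv: "total_variation (\<lambda>A. x (Suc k) A - x k A) \<le> K * (1/2) ^ k" for k
    by (rule order_trans[OF total_variation_le_diff_norm[OF diff[OF x x]] d])
  have "\<exists>l. l \<in> complex_measures \<and> (\<forall>A. (\<lambda>k. x k A) \<longlonglongrightarrow> l A) \<and>
      (\<forall>k. total_variation (\<lambda>A. x k A - l A) \<le> 8 * K * (1/2) ^ k)"
    by (rule complex_measures_complete[OF xc tv]) auto
  then obtain l where l: "l \<in> complex_measures" "\<And>A. (\<lambda>k. x k A) \<longlonglongrightarrow> l A"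
    "\<And>k. total_variation (\<lambda>A. x k A - l A) \<le> 8 * K * (1/2) ^ k" by auto
  have geo: "(\<lambda>k. c * (1/2) ^ k :: real) \<longlonglongrightarrow> 0" for c
    by (intro tendsto_mult_right_zero LIMSEQ_power_zero) simp
  have xl: "(\<lambda>k. total_variation (\<lambda>A. x k A - l A)) \<longlonglongrightarrow> 0"
    using l(3) total_variation_nonneg[OF complex_measures_minus[OF xc l(1)]]
    by (intro tendsto_sandwich[OF _ _ tendsto_const geo[of "8 * K"]] always_eventually) auto
  have *: "\<exists>\<nu>. is_measure_derivative M U l \<nu> \<and> (\<forall>k. derivative_norm M U (\<lambda>A. x k A - l A) \<le> 8 * (K + 1) * (1/2) ^ k)"
    if U: "U \<in> TF" for U
  proof -
    note Uc = unit_test_fields_continuous[OF U]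
    \<comment> \<open>The \<open>+ 1\<close> pays for the slack \<open>(1/2) ^ k\<close> of a
      derivative that is only nearly minimal.\<close>
    have "\<exists>\<nu>. is_measure_derivative M U (\<lambda>A. x (Suc k) A - x k A) \<nu> \<and> total_variation \<nu> \<le> (K + 1) * (1/2) ^ k" for k
    proof -
      obtain \<nu>0 where "is_measure_derivative M U (\<lambda>A. x (Suc k) A - x k A) \<nu>0"
        using diff_measuresD(2)[OF diff[OF x x] U] by blast
      from derivative_norm_approx[OF this, of "(1/2) ^ k"]
      obtain \<nu> where "is_measure_derivative M U (\<lambda>A. x (Suc k) A - x k A) \<nu>"
        "total_variation \<nu> < derivative_norm M U (\<lambda>A. x (Suc k) A - x k A) + (1/2) ^ k" by auto
      then show ?thesis
        using derivative_norm_le_diff_norm[OF diff[OF x x] U, of "Suc k" k] d[of k]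
        by (intro exI[of _ \<nu>]) (simp add: algebra_simps)
    qed
    then obtain \<nu> where \<nu>: "\<And>k. is_measure_derivative M U (\<lambda>A. x (Suc k) A - x k A) (\<nu> k)"
      "\<And>k. total_variation (\<nu> k) \<le> (K + 1) * (1/2) ^ k" by metis
    obtain \<rho> where \<rho>: "is_measure_derivative M U (x 0) \<rho>" using diff_measuresD(2)[OF x U] by blast
    define \<sigma> where "\<sigma> k A = \<rho> A + (\<Sum>j<k. \<nu> j A)" for k A
    have \<sigma>: "is_measure_derivative M U (x k) (\<sigma> k)" for k
    proof (induction k)
      case 0
      then show ?case using \<rho> by (simp add: \<sigma>_def[abs_def])
    next
      case (Suc k)
      show ?case
      proof -
        have "is_measure_derivative M U (\<lambda>A. x k A + 1 * (x (Suc k) A - x k A)) (\<lambda>A. \<sigma> k A + 1 * \<nu> k A)"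
          by (rule is_measure_derivative_lincomb[OF Uc xc diff_measuresD(1)[OF diff[OF x x]] Suc \<nu>(1)])
        moreover have "(\<lambda>A. x k A + 1 * (x (Suc k) A - x k A)) = x (Suc k)" by simp
        moreover have "(\<lambda>A. \<sigma> k A + 1 * \<nu> k A) = \<sigma> (Suc k)" by (simp add: \<sigma>_def fun_eq_iff)
        ultimately show ?thesis by (simp only:)
      qed
    qed
    have \<sigma>c: "\<sigma> k \<in> complex_measures" for k using \<sigma> unfolding is_measure_derivative_def by blast
    have tv\<sigma>: "total_variation (\<lambda>A. \<sigma> (Suc k) A - \<sigma> k A) \<le> (K + 1) * (1/2) ^ k" for k
      using \<nu>(2)[of k] by (simp add: \<sigma>_def)
    have "\<exists>m. m \<in> complex_measures \<and> (\<forall>A. (\<lambda>k. \<sigma> k A) \<longlonglongrightarrow> m A) \<and>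
        (\<forall>k. total_variation (\<lambda>A. \<sigma> k A - m A) \<le> 8 * (K + 1) * (1/2) ^ k)"
      by (rule complex_measures_complete[OF \<sigma>c tv\<sigma>]) auto
    then obtain m where m: "m \<in> complex_measures" "\<And>A. (\<lambda>k. \<sigma> k A) \<longlonglongrightarrow> m A"
      "\<And>k. total_variation (\<lambda>A. \<sigma> k A - m A) \<le> 8 * (K + 1) * (1/2) ^ k" by auto
    have "(\<lambda>k. total_variation (\<lambda>A. \<sigma> k A - m A)) \<longlonglongrightarrow> 0"
      using m(3) total_variation_nonneg[OF complex_measures_minus[OF \<sigma>c m(1)]]
      by (intro tendsto_sandwich[OF _ _ tendsto_const geo[of "8 * (K + 1)"]] always_eventually) auto
    then have lm: "is_measure_derivative M U l m"
      by (rule is_measure_derivative_limit[OF Uc xc l(1) \<sigma> m(1) l(2) xl])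
    have "derivative_norm M U (\<lambda>A. x k A - l A) \<le> 8 * (K + 1) * (1/2) ^ k" for k
      using derivative_norm_le[OF is_measure_derivative_diff[OF Uc xc l(1) \<sigma> lm]] m(3) order_trans by blast
    then show ?thesis using lm by blast
  qed
  have ex: "\<exists>\<nu>. is_measure_derivative M U (\<lambda>A. x k A - l A) \<nu>" if U: "U \<in> TF" for U k
    using *[OF U] diff_measuresD(2)[OF x U, of k]
      is_measure_derivative_diff[OF unit_test_fields_continuous[OF U] xc l(1)] by blast
  have dn: "derivative_norm M U (\<lambda>A. x k A - l A) \<le> 8 * (K + 1) * (1/2) ^ k" if "U \<in> TF" for U k
    using *[OF that] by blast
  note xlc = complex_measures_minus[OF xc l(1)]
  have xlD: "(\<lambda>A. x k A - l A) \<in> D" for k by (rule diff_measuresI(1)[OF xlc ex dn])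
  have "l \<in> D" using diff[OF x xlD, of 0 0] by simp
  moreover have "(\<lambda>k. nD (\<lambda>A. x k A - l A)) \<longlonglongrightarrow> 0"
  proof (rule tendsto_sandwich[OF _ _ tendsto_const geo[of "8 * (K + 1) + 8 * K"]])
    have "nD (\<lambda>A. x k A - l A) \<le> (8 * (K + 1) + 8 * K) * (1/2) ^ k" for k
      using diff_measuresI(2)[OF xlc ex dn, of k] l(3)[of k] by (simp add: algebra_simps)
    then show "\<forall>\<^sub>F k in sequentially. nD (\<lambda>A. x k A - l A) \<le> (8 * (K + 1) + 8 * K) * (1/2) ^ k" by simp
    have "0 \<le> nD (\<lambda>A. x k A - l A)" for k
      using total_variation_le_diff_norm[OF xlD] total_variation_nonneg[OF xlc] order_trans by blast
    then show "\<forall>\<^sub>F k in sequentially. 0 \<le> nD (\<lambda>A. x k A - l A)" by simp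
  qed
  ultimately show ?thesis by blast
qed

sublocale function_banach_space D nD
proof
  show "0 \<le> nD \<mu>" if "\<mu> \<in> D" for \<mu>
    using total_variation_le_diff_norm[OF that] total_variation_nonneg[OF diff_measuresD(1)[OF that]] by linarith
  show "\<mu> = (\<lambda>A. 0)" if "\<mu> \<in> D" "nD \<mu> = 0" for \<mu>
    using total_variation_eq_0[OF diff_measuresD(1)[OF that(1)]] total_variation_le_diff_norm[OF that(1)] that(2) by simp
qed (fact diff_measures_zero diff_measures_lincomb diff_norm_zero diff_measures_complete)+

end

subsection \<open>A smooth density on a subchart\<close>

text \<open>Difference quotients of \<open>F\<close> have integral 0 by translation invariance of
  Lebesgue measure. The mean value inequality bounds them by \<open>K\<close>, and since the steps
  are at most 1 they are supported in a ball enlarged by \<open>norm b\<close>, so dominated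
  convergence passes to the derivative. This works for a bounded derivative and also yields its
  measurability.\<close>

lemma integral_derivative_compact_support:
  fixes F :: "'e::euclidean_space \<Rightarrow> 'b::{banach, second_countable_topology}"
  assumes der: "\<And>x. (F has_derivative F' x) (at x)" and supp: "\<And>x. x \<notin> cball c r \<Longrightarrow> F x = 0"
    and K: "\<And>x. norm (F' x b) \<le> K"
  shows "(\<integral>x. F' x b \<partial>lborel) = 0" and "(\<lambda>x. F' x b) \<in> borel_measurable borel"
proof -
  define t where "t n = inverse (real (Suc n))" for n
  have t: "0 < t n" "t n \<le> 1" for n unfolding t_def by (auto simp: field_simps)
  have t0: "t \<longlonglongrightarrow> 0" unfolding t_def[abs_def] by (rule LIMSEQ_inverse_real_of_nat)
  define q where "q n x = (F (x + t n *\<^sub>R b) - F x) /\<^sub>R t n" for n x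
  have K0: "K \<ge> 0" using K[of undefined] norm_ge_zero order_trans by blast
  have contF: "continuous_on UNIV F"
    using der by (meson continuous_at_imp_continuous_on has_derivative_continuous)
  have [measurable]: "F \<in> borel_measurable borel" by (rule borel_measurable_continuous_onI[OF contF])
  have lim: "(\<lambda>n. q n x) \<longlonglongrightarrow> F' x b" for x
  proof -
    have g: "((\<lambda>s. F (x + s *\<^sub>R b)) has_derivative (\<lambda>s. F' x (s *\<^sub>R b))) (at 0)"
      using der[of x] by (auto intro!: derivative_eq_intros has_derivative_compose[of "\<lambda>s. x + s *\<^sub>R b" _ _ _ F])
    interpret linear "F' x" using der by (rule has_derivative_linear)
    have "((\<lambda>s. (F (x + s *\<^sub>R b) - F (x + 0 *\<^sub>R b) - F' x ((s - 0) *\<^sub>R b)) /\<^sub>R norm (s - 0)) \<longlongrightarrow> 0) (at 0)"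
      using g unfolding has_derivative_at_within by blast
    moreover have "filterlim t (at 0) sequentially"
      using t0 t(1) by (auto simp: filterlim_at less_imp_neq[symmetric])
    ultimately have "(\<lambda>n. (F (x + t n *\<^sub>R b) - F (x + 0 *\<^sub>R b) - F' x ((t n - 0) *\<^sub>R b)) /\<^sub>R norm (t n - 0)) \<longlonglongrightarrow> 0"
      by (rule filterlim_compose)
    moreover have "(F (x + t n *\<^sub>R b) - F (x + 0 *\<^sub>R b) - F' x ((t n - 0) *\<^sub>R b)) /\<^sub>R norm (t n - 0)
        = q n x - F' x b" for n
      using t(1)[of n] by (simp add: q_def scale scaleR_diff_right)
    ultimately have "(\<lambda>n. q n x - F' x b) \<longlonglongrightarrow> 0" by (simp only:)
    then show ?thesis by (rule LIM_zero_cancel)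
  qed
  have qb: "norm (q n x) \<le> K" for n x
  proof -
    have "norm (F (x + t n *\<^sub>R b) - F (x + 0 *\<^sub>R b)) \<le> K * norm (t n - 0)"
    proof (rule differentiable_bound[of UNIV "\<lambda>s. F (x + s *\<^sub>R b)" "\<lambda>s h. F' (x + s *\<^sub>R b) (h *\<^sub>R b)"])
      fix s :: real
      show "((\<lambda>s. F (x + s *\<^sub>R b)) has_derivative (\<lambda>h. F' (x + s *\<^sub>R b) (h *\<^sub>R b))) (at s within UNIV)"
        using der[of "x + s *\<^sub>R b"]
        by (auto intro!: derivative_eq_intros has_derivative_compose[of "\<lambda>s. x + s *\<^sub>R b" _ _ _ F])
      interpret linear "F' (x + s *\<^sub>R b)" using der by (rule has_derivative_linear)
      show "onorm (\<lambda>h. F' (x + s *\<^sub>R b) (h *\<^sub>R b)) \<le> K"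
        using K[of "x + s *\<^sub>R b"] K0 by (intro onorm_bound) (auto simp: scale mult.commute[of K] mult_left_mono)
    qed auto
    then have le: "norm (F (x + t n *\<^sub>R b) - F x) \<le> K * t n" using t(1)[of n] by simp
    have "norm (q n x) = inverse (t n) * norm (F (x + t n *\<^sub>R b) - F x)"
      unfolding q_def norm_scaleR using t(1)[of n] by simp
    also have "\<dots> \<le> inverse (t n) * (K * t n)"
      using t(1)[of n] by (intro mult_left_mono le) simp
    also have "\<dots> = K" using t(1)[of n] by simp
    finally show ?thesis .
  qed
  have qs: "q n x = 0" if "x \<notin> cball c (r + norm b)" for n x
  proof -
    have "norm (t n *\<^sub>R b) \<le> norm b" using t[of n] by (simp add: mult_left_le_one_le)
    then have "dist c x \<le> dist c (x + t n *\<^sub>R b) + norm b"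
      using dist_triangle[of c x "x + t n *\<^sub>R b"] by (simp add: dist_norm)
    then have "x \<notin> cball c r" "x + t n *\<^sub>R b \<notin> cball c r"
      using that norm_ge_zero[of b] by (auto simp del: norm_ge_zero)
    then show ?thesis unfolding q_def by (simp add: supp)
  qed
  have qm: "q n \<in> borel_measurable borel" for n unfolding q_def[abs_def] by measurable
  show Fm: "(\<lambda>x. F' x b) \<in> borel_measurable borel"
    by (rule borel_measurable_LIMSEQ_metric[OF qm lim])
  have intF: "integrable lborel F"
  proof -
    have "integrable lborel (\<lambda>x. indicator (cball c r) x *\<^sub>R F x)"
      by (intro borel_integrable_compact compact_cball continuous_on_subset[OF contF]) simp
    moreover have "(\<lambda>x. indicator (cball c r) x *\<^sub>R F x) = F"
      using supp by (auto simp: indicator_def fun_eq_iff)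
    ultimately show ?thesis by simp
  qed
  have tr: "integrable lborel (\<lambda>x. F (x + v))" "(\<integral>x. F (x + v) \<partial>lborel) = (\<integral>x. F x \<partial>lborel)" for v
  proof -
    have d: "distr lborel borel (\<lambda>x. x + v) = (lborel :: 'e measure)"
    proof -
      have "(\<lambda>x. x + v) = (+) v" by (simp add: fun_eq_iff add.commute)
      then show ?thesis using lborel_distr_plus[of v] by (simp only:)
    qed
    have "integrable (distr lborel borel (\<lambda>x. x + v)) F" unfolding d by (rule intF)
    then show "integrable lborel (\<lambda>x. F (x + v))" by (subst (asm) integrable_distr_eq) auto
    show "(\<integral>x. F (x + v) \<partial>lborel) = (\<integral>x. F x \<partial>lborel)"
      using integral_distr[of "\<lambda>x. x + v" lborel borel F] unfolding d by simp
  qed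
  have q0: "(\<integral>x. q n x \<partial>lborel) = 0" for n
    unfolding q_def using tr[of "t n *\<^sub>R b"] intF by simp
  have "(\<lambda>n. \<integral>x. q n x \<partial>lborel) \<longlonglongrightarrow> (\<integral>x. F' x b \<partial>lborel)"
  proof (rule integral_dominated_convergence[of _ _ _ "\<lambda>x. indicator (cball c (r + norm b)) x *\<^sub>R K"])
    show "integrable lborel (\<lambda>x. indicator (cball c (r + norm b)) x *\<^sub>R K)"
      by (intro borel_integrable_compact) auto
    show "AE x in lborel. norm (q n x) \<le> indicator (cball c (r + norm b)) x *\<^sub>R K" for n
    proof (rule AE_I2)
      fix x :: 'e
      show "norm (q n x) \<le> indicator (cball c (r + norm b)) x *\<^sub>R K"
        using qb[of n x] qs[of x n] by (cases "x \<in> cball c (r + norm b)") simp_all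
    qed
    show "AE x in lborel. (\<lambda>n. q n x) \<longlonglongrightarrow> F' x b" using lim by (intro AE_I2)
  qed (use Fm qm in auto)
  then show "(\<integral>x. F' x b \<partial>lborel) = 0" unfolding q0 by (simp add: LIMSEQ_const_iff)
qed

text \<open>The square of the positive part is C^1 across the sphere, where the positive part alone
  would have a kink. One derivative is enough for the integration by parts.\<close>

definition bump :: "'e::euclidean_space \<Rightarrow> real \<Rightarrow> 'e \<Rightarrow> real" where
  "bump c r x = (max 0 (r\<^sup>2 - (x - c) \<bullet> (x - c)))\<^sup>2"

definition bump_deriv :: "'e::euclidean_space \<Rightarrow> real \<Rightarrow> 'e \<Rightarrow> 'e \<Rightarrow> real" where
  "bump_deriv c r x v = - 4 * max 0 (r\<^sup>2 - (x - c) \<bullet> (x - c)) * ((x - c) \<bullet> v)"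

lemma has_derivative_positive_part_square:
  "((\<lambda>t::real. (max 0 t)\<^sup>2) has_real_derivative 2 * max 0 t) (at t)"
proof -
  consider "t > 0" | "t < 0" | "t = 0" by linarith
  then show ?thesis
  proof cases
    case 1
    have "((\<lambda>t::real. t\<^sup>2) has_real_derivative 2 * max 0 t) (at t)"
      using 1 by (auto intro!: derivative_eq_intros)
    then show ?thesis
      by (rule DERIV_cong_ev[THEN iffD1, rotated 3])
        (use eventually_gt_at_top 1 in \<open>auto simp: eventually_nhds intro!: exI[of _ "{0<..}"]\<close>)
  next
    case 2
    have "((\<lambda>t::real. 0) has_real_derivative 2 * max 0 t) (at t)" using 2 by simp
    then show ?thesis
      by (rule DERIV_cong_ev[THEN iffD1, rotated 3])
        (use 2 in \<open>auto simp: eventually_nhds intro!: exI[of _ "{..<0}"]\<close>)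
  next
    case 3
    have "((\<lambda>h. ((max 0 (0 + h))\<^sup>2 - (max 0 0)\<^sup>2) / h) \<longlongrightarrow> 0) (at (0::real))"
    proof (rule Lim_null_comparison)
      show "\<forall>\<^sub>F h in at (0::real). norm (((max 0 (0 + h))\<^sup>2 - (max 0 0)\<^sup>2) / h) \<le> \<bar>h\<bar>"
        by (rule always_eventually) (auto simp: max_def power2_eq_square)
      show "((\<lambda>h::real. \<bar>h\<bar>) \<longlongrightarrow> 0) (at 0)" by (rule tendsto_rabs_zero) (rule tendsto_ident_at)
    qed
    then show ?thesis using 3 by (simp add: DERIV_def)
  qed
qed

lemma has_derivative_bump: "(bump c r has_derivative bump_deriv c r x) (at x)"
proof -
  let ?u = "\<lambda>x. r\<^sup>2 - (x - c) \<bullet> (x - c)"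
  have u: "(?u has_derivative (\<lambda>v. - 2 * ((x - c) \<bullet> v))) (at x)"
    by (auto intro!: derivative_eq_intros simp: inner_commute)
  have s: "((\<lambda>t::real. (max 0 t)\<^sup>2) has_derivative (\<lambda>h. (2 * max 0 (?u x)) * h)) (at (?u x))"
    using has_derivative_positive_part_square[of "?u x"] unfolding has_field_derivative_def .
  show ?thesis
    using has_derivative_compose[OF u s]
    unfolding bump_def[abs_def] bump_deriv_def[abs_def] by (simp add: algebra_simps)
qed

lemma bump_outside:
  assumes "0 < r" "x \<notin> cball c r"
  shows "bump c r x = 0" and "bump_deriv c r x v = 0"
proof -
  have "r\<^sup>2 \<le> (norm (x - c))\<^sup>2"
    using assms by (intro power_mono) (auto simp: dist_norm norm_minus_commute)
  then have "max 0 (r\<^sup>2 - (x - c) \<bullet> (x - c)) = 0" by (simp add: power2_norm_eq_inner)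
  then show "bump c r x = 0" "bump_deriv c r x v = 0" unfolding bump_def bump_deriv_def by simp_all
qed

lemma bump_bounds:
  assumes "0 < r"
  shows "0 \<le> bump c r x" and "bump c r x \<le> r ^ 4" and "\<bar>bump_deriv c r x v\<bar> \<le> 4 * r ^ 3 * norm v"
proof -
  have m: "0 \<le> max 0 (r\<^sup>2 - (x - c) \<bullet> (x - c))" "max 0 (r\<^sup>2 - (x - c) \<bullet> (x - c)) \<le> r\<^sup>2" by auto
  show "0 \<le> bump c r x" unfolding bump_def by simp
  have "bump c r x \<le> (r\<^sup>2)\<^sup>2" unfolding bump_def using m by (intro power_mono) auto
  then show "bump c r x \<le> r ^ 4" by simp
  show "\<bar>bump_deriv c r x v\<bar> \<le> 4 * r ^ 3 * norm v"
  proof (cases "x \<in> cball c r")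
    case True
    have "\<bar>(x - c) \<bullet> v\<bar> \<le> norm (x - c) * norm v" by (rule Cauchy_Schwarz_ineq2)
    also have "\<dots> \<le> r * norm v" using True by (intro mult_right_mono) (auto simp: dist_norm norm_minus_commute)
    finally have "max 0 (r\<^sup>2 - (x - c) \<bullet> (x - c)) * \<bar>(x - c) \<bullet> v\<bar> \<le> r\<^sup>2 * (r * norm v)"
      using m by (intro mult_mono) auto
    then show ?thesis unfolding bump_deriv_def by (simp add: abs_mult power3_eq_cube power2_eq_square mult.assoc)
  next
    case False
    then show ?thesis using bump_outside(2)[OF assms False, of v] assms by simp
  qed
qed

lemma continuous_bump: "continuous_on S (bump c r)"
  unfolding bump_def[abs_def] by (intro continuous_intros)

lemma integral_bump_pos:
  fixes c :: "'e::euclidean_space"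
  assumes r: "0 < r" shows "integrable lborel (bump c r)" and "0 < (\<integral>x. bump c r x \<partial>lborel)"
proof -
  have "integrable lborel (\<lambda>x. indicator (cball c r) x *\<^sub>R bump c r x)"
    by (intro borel_integrable_compact compact_cball continuous_bump)
  moreover have "(\<lambda>x. indicator (cball c r) x *\<^sub>R bump c r x) = bump c r"
    using bump_outside[OF r] by (auto simp: indicator_def fun_eq_iff)
  ultimately show int: "integrable lborel (bump c r)" by simp
  have "(\<integral>x. bump c r x \<partial>lborel) \<noteq> 0"
  proof
    assume "(\<integral>x. bump c r x \<partial>lborel) = 0"
    then have "AE x in lborel. bump c r x = 0"
      using int bump_bounds(1)[OF r] by (subst (asm) integral_nonneg_eq_0_iff_AE) auto
    then have "AE x in lborel. x \<notin> ball c r"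
    proof (rule AE_mp, intro AE_I2 impI)
      fix x assume 0: "bump c r x = 0"
      show "x \<notin> ball c r"
      proof
        assume "x \<in> ball c r"
        then have "(norm (x - c))\<^sup>2 < r\<^sup>2" by (intro power_strict_mono) (auto simp: dist_norm norm_minus_commute)
        then show False using 0 by (simp add: bump_def power2_norm_eq_inner)
      qed
    qed
    then have "ball c r \<in> null_sets lborel" by (subst (asm) AE_iff_null_sets[symmetric]) auto
    then have "negligible (ball c r)"
      unfolding negligible_iff_null_sets by (rule null_sets_completionI)
    then show False using open_not_negligible[of "ball c r"] r by auto
  qed
  moreover have "0 \<le> (\<integral>x. bump c r x \<partial>lborel)" using bump_bounds(1)[OF r] by (intro Bochner_Integration.integral_nonneg) auto
  ultimately show "0 < (\<integral>x. bump c r x \<partial>lborel)" by simp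
qed

text \<open>The image under \<open>\<Psi>\<close> of the measure with Lebesgue density
  \<open>d\<close>, written as a superposition of point masses \<open>d x\<close> at
  \<open>\<Psi> x\<close>. This is the shape to which \<open>complex_measures_mixture\<close>
  applies.\<close>

definition density_measure :: "('e::euclidean_space \<Rightarrow> 'a::topological_space) \<Rightarrow> ('e \<Rightarrow> complex) \<Rightarrow> 'a set \<Rightarrow> complex" where
  "density_measure \<Psi> d A = (\<integral>x. (if A \<in> sets borel then d x * indicator A (\<Psi> x) else 0) \<partial>lborel)"

lemma density_measure:
  assumes \<Psi>: "\<Psi> \<in> borel_measurable borel" and d: "integrable lborel d"
  shows "density_measure \<Psi> d \<in> complex_measures"
    and "f \<in> bounded_borel \<Longrightarrow> cint (density_measure \<Psi> d) f = (\<integral>x. d x * f (\<Psi> x) \<partial>lborel)"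
    and "total_variation (density_measure \<Psi> d) \<le> (\<integral>x. norm (d x) \<partial>lborel)"
proof -
  define \<kappa> where "\<kappa> x A = (if A \<in> sets borel then d x * indicator A (\<Psi> x) else 0)" for x A
  have \<kappa>: "\<kappa> x \<in> complex_measures" "g \<in> bounded_borel \<Longrightarrow> cint (\<kappa> x) g = d x * g (\<Psi> x)" for x g
    using cint_dirac[of "indicator {}" "d x" "\<Psi> x"] cint_dirac(2)[of g "d x" "\<Psi> x"]
      bounded_borel_indicator[of "{}"] unfolding \<kappa>_def by auto
  have dm: "d \<in> borel_measurable borel" using d by auto
  have meas: "(\<lambda>x. \<kappa> x A) \<in> borel_measurable lborel" if A: "A \<in> sets borel" for A
  proof -
    have "\<Psi> -` A \<in> sets borel" using measurable_sets[OF \<Psi> A] by simp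
    then have "(\<lambda>x. d x * indicator (\<Psi> -` A) x) \<in> borel_measurable borel" using dm by measurable
    moreover have "(\<lambda>x. \<kappa> x A) = (\<lambda>x. d x * indicator (\<Psi> -` A) x)"
      using A by (auto simp: \<kappa>_def indicator_def fun_eq_iff)
    ultimately show ?thesis by simp
  qed
  have w: "norm (\<kappa> x A) \<le> norm (d x)" for x A by (simp add: \<kappa>_def indicator_def)
  have eq: "density_measure \<Psi> d = (\<lambda>A. \<integral>x. \<kappa> x A \<partial>lborel)"
    unfolding density_measure_def[abs_def] \<kappa>_def ..
  have mix1: "(\<lambda>A. \<integral>x. \<kappa> x A \<partial>lborel) \<in> complex_measures"
    by (rule complex_measures_mixture(1)[of lborel \<kappa> "\<lambda>x. norm (d x)"])
      (use \<kappa>(1) meas w integrable_norm[OF d] in auto)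
  have mix3: "cint (\<lambda>A. \<integral>x. \<kappa> x A \<partial>lborel) f = (\<integral>x. cint (\<kappa> x) f \<partial>lborel)" if "f \<in> bounded_borel" for f
    by (rule complex_measures_mixture(3)[of lborel \<kappa> "\<lambda>x. norm (d x)"])
      (use \<kappa>(1) meas w integrable_norm[OF d] that in auto)
  show cm: "density_measure \<Psi> d \<in> complex_measures" unfolding eq by (rule mix1)
  show c: "cint (density_measure \<Psi> d) f = (\<integral>x. d x * f (\<Psi> x) \<partial>lborel)" if "f \<in> bounded_borel" for f
    unfolding eq mix3[OF that] \<kappa>(2)[OF that] ..
  show "total_variation (density_measure \<Psi> d) \<le> (\<integral>x. norm (d x) \<partial>lborel)"
  proof (rule total_variation_least)
    fix \<eta> :: "'b \<Rightarrow> complex" assume \<eta>: "continuous_on UNIV \<eta>" "\<And>x. norm (\<eta> x) \<le> 1"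
    have \<eta>b: "\<eta> \<in> bounded_borel" by (rule bounded_borel_continuous[OF \<eta>])
    have m: "(\<lambda>x. d x * \<eta> (\<Psi> x)) \<in> borel_measurable borel"
      using dm measurable_compose[OF \<Psi> bounded_borel_measurable[OF \<eta>b]] by measurable
    have le: "norm (d x * \<eta> (\<Psi> x)) \<le> norm (d x)" for x
      using \<eta>(2)[of "\<Psi> x"] by (simp add: norm_mult mult_left_le)
    have int: "integrable lborel (\<lambda>x. d x * \<eta> (\<Psi> x))"
      by (rule Bochner_Integration.integrable_bound[OF d]) (use m le in auto)
    have "norm (\<integral>x. d x * \<eta> (\<Psi> x) \<partial>lborel) \<le> (\<integral>x. norm (d x * \<eta> (\<Psi> x)) \<partial>lborel)"
      by (rule integral_norm_bound)
    also have "\<dots> \<le> (\<integral>x. norm (d x) \<partial>lborel)"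
      by (rule integral_mono[OF integrable_norm[OF int] integrable_norm[OF d] le])
    finally show "norm (cint (density_measure \<Psi> d) \<eta>) \<le> (\<integral>x. norm (d x) \<partial>lborel)"
      unfolding c[OF \<eta>b] .
  qed
qed

lemma (in finite_branched_manifold) Ck_on_set_1_extension:
  fixes f :: "'e \<Rightarrow> 'b::real_normed_vector"
  assumes "Ck_on_set 1 S f"
  obtains h h' where "\<And>y. y \<in> S \<Longrightarrow> h y = f y" "\<And>y. y \<in> S \<Longrightarrow> (h has_derivative h' y) (at y)"
    "\<And>v. continuous_on S (\<lambda>y. h' y v)"
proof -
  obtain W h where "open W \<and> S \<subseteq> W \<and> Ck_on 1 W h \<and> (\<forall>x\<in>S. h x = f x)"
    using assms unfolding Ck_on_set_def by (elim exE)
  then have h: "S \<subseteq> W" "\<And>x. x \<in> W \<Longrightarrow> h differentiable (at x)"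
    "\<And>v. continuous_on W (\<lambda>x. frechet_derivative h (at x) v)" "\<And>x. x \<in> S \<Longrightarrow> h x = f x"
    unfolding Ck_on_1 by auto
  have "(h has_derivative frechet_derivative h (at y)) (at y)" if "y \<in> S" for y
    using h(2)[of y] h(1) that unfolding frechet_derivative_works by blast
  moreover have "continuous_on S (\<lambda>y. frechet_derivative h (at y) v)" for v
    by (rule continuous_on_subset[OF h(3) h(1)])
  ultimately show ?thesis using that[of h "\<lambda>y. frechet_derivative h (at y)"] h(4) by blast
qed

lemma compact_continuous_norm_bound:
  fixes f :: "'b::topological_space \<Rightarrow> 'c::real_normed_vector"
  assumes "compact S" "continuous_on S f" shows "\<exists>B. \<forall>x\<in>S. norm (f x) \<le> B"
  using compact_imp_bounded[OF compact_continuous_image[OF assms(2,1)]] unfolding bounded_iff by simp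

lemma has_derivative_within_interior_unique:
  fixes f :: "'e::euclidean_space \<Rightarrow> 'b::real_normed_vector"
  assumes "(f has_derivative L) (at x within S)" "(h has_derivative D) (at x)"
    and "\<And>y. y \<in> S \<Longrightarrow> h y = f y" "x \<in> interior S"
  shows "L = D"
proof -
  have xS: "x \<in> S" using assms(4) interior_subset by blast
  have D: "(f has_derivative D) (at x within S)"
    by (rule has_derivative_transform[OF xS assms(3)[symmetric] has_derivative_at_withinI[OF assms(2)]])
  have e: "at x within S = at x" by (rule at_within_interior[OF assms(4)])
  show ?thesis by (rule has_derivative_unique[OF assms(1)[unfolded e] D[unfolded e]])
qed

context riemannian_branched_manifold
begin

text \<open>The quadratic form attains a positive minimum \<open>m\<close> on the product of the
  compact chart and the unit sphere, and homogeneity does the rest. It converts the bound on test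
  fields, stated in the inner product, into one in coordinates.\<close>

lemma norm_le_tnorm:
  assumes i: "i \<in> idx M"
  shows "\<exists>A\<ge>0. \<forall>p\<in>chart M i. \<forall>v. norm v \<le> A * tnorm g i p v"
proof (cases "chart M i = {}")
  case True then show ?thesis by (intro exI[of _ 0]) auto
next
  case False
  have gi: "\<And>x. x \<in> chart M i \<Longrightarrow> bilinear (g i x)" "\<And>x v. x \<in> chart M i \<Longrightarrow> v \<noteq> 0 \<Longrightarrow> 0 < g i x v v"
    "\<And>v w. continuous_on (chart M i) (\<lambda>x. g i x v w)"
    using g i unfolding tangent_inner_product_def by auto
  \<comment> \<open>The inner product is known to be continuous in the point for fixed vectors only;
    expansion in the basis shows joint continuity in point and vector.\<close>
  define G where "G q = (\<Sum>a\<in>Basis. \<Sum>b\<in>Basis. (snd q \<bullet> a) * ((snd q \<bullet> b) * g i (fst q) a b))" for q :: "'a \<times> 'e"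
  have G: "g i x v v = G (x, v)" if x: "x \<in> chart M i" for x v
  proof -
    have "g i x v v = g i x (\<Sum>a\<in>Basis. (v \<bullet> a) *\<^sub>R a) (\<Sum>b\<in>Basis. (v \<bullet> b) *\<^sub>R b)"
      by (simp add: euclidean_representation)
    also have "\<dots> = G (x, v)"
      unfolding bilinear_sum[OF gi(1)[OF x]] G_def
      by (simp add: sum.cartesian_product[symmetric] bilinear_lmul[OF gi(1)[OF x]] bilinear_rmul[OF gi(1)[OF x]]
          mult.left_commute)
    finally show ?thesis .
  qed
  have Gc: "continuous_on (chart M i \<times> sphere 0 1) G"
    unfolding G_def
    by (intro continuous_intros continuous_on_compose2[OF gi(3) continuous_on_fst[OF continuous_on_id]]) auto
  have comp: "compact (chart M i \<times> sphere (0::'e) 1)"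
    by (intro compact_Times compact_chart i) simp
  have "chart M i \<times> sphere (0::'e) 1 \<noteq> {}" using False by (simp add: Sigma_empty_iff)
  from continuous_attains_inf[OF comp this Gc]
  obtain q where q0: "q \<in> chart M i \<times> sphere 0 1" "\<forall>p\<in>chart M i \<times> sphere 0 1. G q \<le> G p"
    by (elim bexE)
  note q = q0(1) bspec[OF q0(2)]
  define m where "m = G q"
  have "fst q \<in> chart M i" "snd q \<noteq> 0" using q(1) by force+
  then have m: "m > 0"
    using G[of "fst q" "snd q"] gi(2)[of "fst q" "snd q"] unfolding m_def by simp
  have low: "m * (norm v)\<^sup>2 \<le> g i x v v" if x: "x \<in> chart M i" for x v
  proof (cases "v = 0")
    case True then show ?thesis using bilinear_lzero[OF gi(1)[OF x]] by simp
  next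
    case False
    have "m \<le> G (x, v /\<^sub>R norm v)" unfolding m_def using x False by (intro q(2)) simp
    also have "\<dots> = g i x v v / (norm v)\<^sup>2"
      unfolding G[OF x, symmetric]
      by (simp add: bilinear_lmul[OF gi(1)[OF x]] bilinear_rmul[OF gi(1)[OF x]] power2_eq_square field_simps)
    finally show ?thesis using False by (simp add: field_simps)
  qed
  show ?thesis
  proof (intro exI[of _ "1 / sqrt m"] conjI ballI allI)
    fix p v assume p: "p \<in> chart M i"
    have "sqrt (m * (norm v)\<^sup>2) \<le> tnorm g i p v" unfolding tnorm_def by (rule real_sqrt_le_mono[OF low[OF p]])
    then show "norm v \<le> 1 / sqrt m * tnorm g i p v"
      using m by (simp add: real_sqrt_mult field_simps)
  qed (use m in simp)
qed

lemma integrable_indicator_continuous: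
  fixes f :: "'e \<Rightarrow> 'c::euclidean_space"
  assumes "continuous_on (cball c r) f"
  shows "integrable lborel (\<lambda>x. indicator (cball c r) x *\<^sub>R f x)"
  by (rule borel_integrable_compact[OF compact_cball assms])

text \<open>The measure has a bump as coordinate density. Integration by parts shows that its
  derivative along \<open>U\<close> has the divergence of the bump times the field as density. The
  bounds on the field and on its first derivative in \<open>unit_test_fields\<close> control this
  density by a constant independent of \<open>U\<close>.\<close>

lemma exists_diff_measure:
  assumes i: "i \<in> idx M" and j: "j \<in> subidx M i" and int: "interior (coord M i ` subchart M i j) \<noteq> {}"
  shows "\<exists>\<mu>\<in>D. \<mu> UNIV \<noteq> 0"
proof -
  define S where "S = coord M i ` subchart M i j"
  define \<psi> where "\<psi> = inv_into (subchart M i j) (coord M i)"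
  obtain c where c: "c \<in> interior S" using int unfolding S_def by blast
  obtain R where R: "R > 0" "ball c R \<subseteq> interior S"
    using open_contains_ball[of "interior S"] c by auto
  \<comment> \<open>The support \<open>cball c r\<close> gets some room inside an open ball on which
    the C^1 extensions of all local representatives are differentiable.\<close>
  define r where "r = R / 2"
  have r: "r > 0" "cball c r \<subseteq> ball c R" unfolding r_def using R(1) by auto
  have bS: "ball c R \<subseteq> S" "cball c r \<subseteq> S" "cball c r \<subseteq> interior S"
    using R(2) r(2) interior_subset by blast+
  have \<psi>: "\<psi> x \<in> subchart M i j" "coord M i (\<psi> x) = x" if "x \<in> S" for x
    using that unfolding \<psi>_def S_def by (auto simp: inv_into_into f_inv_into_f)
  have \<psi>chart: "\<psi> x \<in> chart M i" if "x \<in> S" for x using \<psi>(1)[OF that] UN_subchart[OF i] j by blast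
  have \<psi>cont: "continuous_on (cball c r) \<psi>"
    unfolding \<psi>_def using bS(2) unfolding S_def by (intro continuous_on_subset[OF continuous_on_inv_coord[OF i j]])
  have loc: "local_rep M i j f x = f (\<psi> x)" for f :: "'a \<Rightarrow> 'z" and x unfolding local_rep_def \<psi>_def by simp
  \<comment> \<open>A Borel map on the whole space; its value off the ball is immaterial since the
    density vanishes there.\<close>
  define \<Psi> where "\<Psi> x = (if x \<in> cball c r then \<psi> x else undefined)" for x
  have \<Psi>: "\<Psi> \<in> borel_measurable borel"
    unfolding \<Psi>_def[abs_def] by (intro borel_measurable_continuous_on_if \<psi>cont continuous_on_const) simp
  have \<Psi>in: "\<Psi> x = \<psi> x" if "x \<in> cball c r" for x using that by (simp add: \<Psi>_def)
  define \<rho> where "\<rho> x = complex_of_real (bump c r x)" for x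
  have \<rho>0: "\<rho> x = 0" if "x \<notin> cball c r" for x using bump_outside(1)[OF r(1) that] by (simp add: \<rho>_def)
  have \<rho>int: "integrable lborel \<rho>" unfolding \<rho>_def[abs_def] by (rule integrable_of_real[OF integral_bump_pos(1)[OF r(1)]])
  define \<mu> where "\<mu> = density_measure \<Psi> \<rho>"
  note dm = density_measure[OF \<Psi>]
  have \<mu>c: "\<mu> \<in> complex_measures" unfolding \<mu>_def by (rule dm(1)[OF \<rho>int])
  have \<mu>cint: "cint \<mu> f = (\<integral>x. \<rho> x * f (\<Psi> x) \<partial>lborel)" if "f \<in> bounded_borel" for f
    unfolding \<mu>_def by (rule dm(2)[OF \<rho>int that])
  have mass: "\<mu> UNIV \<noteq> 0"
  proof -
    have "\<mu> UNIV = cint \<mu> (indicator UNIV)" by (rule cint_indicator[OF \<mu>c, symmetric]) simp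
    also have "\<dots> = (\<integral>x. \<rho> x \<partial>lborel)" using \<mu>cint[OF bounded_borel_indicator[of UNIV]] by simp
    also have "\<dots> = complex_of_real (\<integral>x. bump c r x \<partial>lborel)" unfolding \<rho>_def by (rule integral_complex_of_real)
    finally show ?thesis using integral_bump_pos(2)[OF r(1), of c] by simp
  qed
  obtain A where A: "A \<ge> 0" "\<And>p v. p \<in> chart M i \<Longrightarrow> norm v \<le> A * tnorm g i p v"
    using norm_le_tnorm[OF i] by blast
  \<comment> \<open>The bump is at most \<open>r ^ 4\<close> and the divergence of the field at most
    the dimension, as each partial derivative is at most 1; the other term pairs the derivative
    \<open>4 * r ^ 3\<close> of the bump with the bound \<open>A\<close> on the field.\<close>
  define K where "K = r ^ 4 * real DIM('e) + 4 * r ^ 3 * A"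
  have K: "K \<ge> 0" unfolding K_def using r(1) A(1) by simp
  define B where "B = (\<integral>x. indicator (cball c r) x *\<^sub>R K \<partial>(lborel :: 'e measure))"
  have main: "\<exists>\<nu>. is_measure_derivative M U \<mu> \<nu> \<and> total_variation \<nu> \<le> B" if U: "U \<in> TF" for U
  proof -
    have Ucc: "Ck_on_set 1 S (local_rep M i j (U i))" and Unorm: "\<And>p. p \<in> chart M i \<Longrightarrow> tnorm g i p (U i p) \<le> 1"
      and UL: "\<And>p. p \<in> subchart M i j \<Longrightarrow> \<exists>L. (local_rep M i j (U i) has_derivative L) (at (coord M i p) within S) \<and> onorm L \<le> 1"
      using U i j unfolding unit_test_fields_def Ck_vector_field_def S_def by auto
    obtain u u' where u: "\<And>y. y \<in> S \<Longrightarrow> u y = local_rep M i j (U i) y" "\<And>y. y \<in> S \<Longrightarrow> (u has_derivative u' y) (at y)"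
      "\<And>v. continuous_on S (\<lambda>y. u' y v)"
      using Ck_on_set_1_extension[OF Ucc] by blast
    have u\<psi>: "u x = U i (\<psi> x)" if "x \<in> S" for x using u(1)[OF that] loc by simp
    have ub: "norm (u x) \<le> A" if x: "x \<in> S" for x
    proof -
      have "norm (u x) \<le> A * tnorm g i (\<psi> x) (U i (\<psi> x))" unfolding u\<psi>[OF x] by (rule A(2)[OF \<psi>chart[OF x]])
      also have "\<dots> \<le> A * 1" using Unorm[OF \<psi>chart[OF x]] A(1) by (intro mult_left_mono)
      finally show ?thesis by simp
    qed
    have u'b: "norm (u' x v) \<le> norm v" if x: "x \<in> interior S" for x v
    proof -
      have xS: "x \<in> S" using x interior_subset by blast
      obtain L where L: "(local_rep M i j (U i) has_derivative L) (at x within S)" "onorm L \<le> 1"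
        using UL[OF \<psi>(1)[OF xS]] \<psi>(2)[OF xS] by auto
      have "L = u' x" by (rule has_derivative_within_interior_unique[OF L(1) u(2)[OF xS] u(1) x])
      then show ?thesis
        using onorm[OF has_derivative_bounded_linear[OF u(2)[OF xS]], of v] L(2)
          mult_right_mono[OF L(2) norm_ge_zero[of v]] by simp
    qed
    \<comment> \<open>\<open>dv\<close> is the divergence of the field in coordinates, and
      \<open>e\<close> that of the bump times the field, by the product rule.\<close>
    define dv where "dv x = (\<Sum>b\<in>Basis. u' x b \<bullet> b)" for x
    define e where "e x = complex_of_real (bump c r x * dv x + bump_deriv c r x (u x))" for x
    define d where "d x = indicator (cball c r) x *\<^sub>R e x" for x
    have ucont: "continuous_on (cball c r) u"
      using u(2) bS(2) by (intro continuous_at_imp_continuous_on ballI has_derivative_continuous) blast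
    have econt: "continuous_on (cball c r) e"
      unfolding e_def dv_def bump_deriv_def
      by (intro continuous_intros continuous_bump ucont continuous_on_subset[OF u(3) bS(2)])
    have dint: "integrable lborel d" unfolding d_def by (rule integrable_indicator_continuous[OF econt])
    have db: "norm (d x) \<le> indicator (cball c r) x *\<^sub>R K" for x
    proof (cases "x \<in> cball c r")
      case True
      then have xi: "x \<in> interior S" and xS: "x \<in> S" using bS by auto
      have "\<bar>dv x\<bar> \<le> (\<Sum>b\<in>Basis. \<bar>u' x b \<bullet> b\<bar>)" unfolding dv_def by (rule sum_abs)
      also have "\<dots> \<le> (\<Sum>b\<in>(Basis::'e set). 1)"
      proof (rule sum_mono)
        fix b :: 'e assume b: "b \<in> Basis"
        show "\<bar>u' x b \<bullet> b\<bar> \<le> 1" using Basis_le_norm[OF b, of "u' x b"] u'b[OF xi, of b] b by simp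
      qed
      finally have dvb: "\<bar>dv x\<bar> \<le> real DIM('e)" by simp
      have "\<bar>bump c r x * dv x\<bar> \<le> r ^ 4 * real DIM('e)"
        unfolding abs_mult using bump_bounds(1,2)[OF r(1), of c x] dvb by (intro mult_mono) auto
      moreover have "\<bar>bump_deriv c r x (u x)\<bar> \<le> 4 * r ^ 3 * A"
      proof -
        have "4 * r ^ 3 * norm (u x) \<le> 4 * r ^ 3 * A" using r(1) by (intro mult_left_mono ub xS) auto
        then show ?thesis using bump_bounds(3)[OF r(1), of c x "u x"] by linarith
      qed
      ultimately have "\<bar>bump c r x * dv x + bump_deriv c r x (u x)\<bar> \<le> K" unfolding K_def by linarith
      then show ?thesis using True by (simp add: d_def e_def del: of_real_add of_real_mult)
    next
      case False then show ?thesis by (simp add: d_def)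
    qed
    define \<nu> where "\<nu> = density_measure \<Psi> d"
    have "total_variation \<nu> \<le> (\<integral>x. norm (d x) \<partial>lborel)" unfolding \<nu>_def by (rule dm(3)[OF dint])
    also have "\<dots> \<le> B" unfolding B_def
      by (rule integral_mono[OF integrable_norm[OF dint] integrable_indicator_continuous[OF continuous_on_const] db])
    finally have \<nu>tv: "total_variation \<nu> \<le> B" .
    have "is_measure_derivative M U \<mu> \<nu>"
      unfolding is_measure_derivative_def
    proof (intro conjI ballI allI impI)
      show "\<nu> \<in> complex_measures" unfolding \<nu>_def by (rule dm(1)[OF dint])
      fix \<eta> \<zeta> assume \<eta>: "\<eta> \<in> C10 M" and \<zeta>: "has_derivative_along M U \<eta> \<zeta>"
      have \<eta>b: "\<eta> \<in> bounded_borel" using \<eta> unfolding C10_def by (auto intro: continuous_bounded_borel)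
      have "Ck_on_set 1 S (local_rep M i j \<eta>)" using \<eta> i j unfolding C10_def Ck_function_def S_def by simp
      from Ck_on_set_1_extension[OF this]
      obtain h h' where h: "\<And>y. y \<in> S \<Longrightarrow> h y = local_rep M i j \<eta> y" "\<And>y. y \<in> S \<Longrightarrow> (h has_derivative h' y) (at y)"
        "\<And>v. continuous_on S (\<lambda>y. h' y v)" by blast
      have h\<psi>: "h x = \<eta> (\<psi> x)" if "x \<in> S" for x using h(1)[OF that] loc by simp
      have hcont: "continuous_on (cball c r) h"
        using h(2) bS(2) by (intro continuous_at_imp_continuous_on ballI has_derivative_continuous) blast
      have h'u: "h' x (u x) = (\<Sum>b\<in>Basis. (u x \<bullet> b) *\<^sub>R h' x b)" if x: "x \<in> S" for x
      proof -
        interpret linear "h' x" by (rule has_derivative_linear[OF h(2)[OF x]])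
        have "h' x (u x) = h' x (\<Sum>b\<in>Basis. (u x \<bullet> b) *\<^sub>R b)" by (simp add: euclidean_representation)
        then show ?thesis by (simp add: sum scale)
      qed
      have \<zeta>\<psi>: "\<zeta> (\<psi> x) = h' x (u x)" if x: "x \<in> interior S" for x
      proof -
        have xS: "x \<in> S" using x interior_subset by blast
        obtain L where L: "(local_rep M i j \<eta> has_derivative L) (at x within S)" "\<zeta> (\<psi> x) = L (U i (\<psi> x))"
          using \<zeta> i j \<psi>[OF xS] unfolding has_derivative_along_def S_def by metis
        have "L = h' x" by (rule has_derivative_within_interior_unique[OF L(1) h(2)[OF xS] h(1) x])
        then show ?thesis using L(2) u\<psi>[OF xS] by simp
      qed
      define w where "w x = (\<Sum>b\<in>Basis. (u x \<bullet> b) *\<^sub>R h' x b)" for x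
      have wcont: "continuous_on (cball c r) w"
        unfolding w_def by (intro continuous_intros ucont continuous_on_subset[OF h(3) bS(2)])
      have \<zeta>w: "\<zeta> (\<psi> x) = w x" if "x \<in> cball c r" for x
        unfolding w_def using \<zeta>\<psi>[OF subsetD[OF bS(3) that]] h'u[OF subsetD[OF bS(2) that]] by simp
      from compact_continuous_norm_bound[OF compact_cball wcont]
      obtain Bw where Bw0: "\<forall>x\<in>cball c r. norm (w x) \<le> Bw" by (elim exE)
      note Bw = bspec[OF Bw0]
      \<comment> \<open>The measure is carried by \<open>Z\<close>. There the image has interior, so
        \<open>\<zeta>\<close> is the unique derivative and is bounded, whatever it does
        elsewhere.\<close>
      define Z where "Z = \<psi> ` cball c r"
      have Zc: "closed Z" unfolding Z_def by (intro compact_imp_closed compact_continuous_image \<psi>cont compact_cball)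
      have Zb: "Z \<in> sets borel" using Zc by simp
      have \<zeta>m: "\<zeta> \<in> borel_measurable borel" using \<zeta> unfolding has_derivative_along_def by blast
      define \<zeta>1 where "\<zeta>1 x = indicator Z x *\<^sub>R \<zeta> x" for x
      have \<zeta>1b: "\<zeta>1 \<in> bounded_borel"
      proof (rule bounded_borelI)
        show "\<zeta>1 \<in> borel_measurable borel" unfolding \<zeta>1_def[abs_def] using \<zeta>m Zb by measurable
        show "norm (\<zeta>1 x) \<le> \<bar>Bw\<bar>" for x
        proof (cases "x \<in> Z")
          case True
          then obtain y where y: "y \<in> cball c r" "x = \<psi> y" unfolding Z_def by blast
          then show ?thesis using Bw[OF y(1)] \<zeta>w[OF y(1)] True by (simp add: \<zeta>1_def)
        next
          case False then show ?thesis by (simp add: \<zeta>1_def)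
        qed
      qed
      have "cint \<mu> \<zeta> = cint \<mu> \<zeta>1"
      proof (rule cint_cong_null[OF \<mu>c \<zeta>m bounded_borel_measurable[OF \<zeta>1b], of "- Z"])
        fix C assume C: "C \<in> sets borel" "C \<subseteq> - Z"
        have "\<mu> C = cint \<mu> (indicator C)" by (rule cint_indicator[OF \<mu>c C(1), symmetric])
        also have "\<dots> = (\<integral>x. \<rho> x * indicator C (\<Psi> x) \<partial>lborel)" by (rule \<mu>cint[OF bounded_borel_indicator[OF C(1)]])
        also have "\<dots> = (\<integral>x. 0 \<partial>(lborel :: 'e measure))"
        proof (rule Bochner_Integration.integral_cong[OF refl])
          fix x show "\<rho> x * indicator C (\<Psi> x) = 0"
          proof (cases "x \<in> cball c r")
            case True
            then have "\<Psi> x \<notin> C" using C(2) \<Psi>in[OF True] unfolding Z_def by auto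
            then show ?thesis by simp
          next
            case False then show ?thesis using \<rho>0 by simp
          qed
        qed
        finally show "\<mu> C = 0" by simp
      next
        fix x assume "x \<notin> - Z"
        then show "\<zeta> x = \<zeta>1 x" by (simp add: \<zeta>1_def)
      qed
      also have "\<dots> = (\<integral>x. \<rho> x * \<zeta>1 (\<Psi> x) \<partial>lborel)" by (rule \<mu>cint[OF \<zeta>1b])
      also have "\<dots> = (\<integral>x. indicator (cball c r) x *\<^sub>R (\<rho> x * w x) \<partial>lborel)"
      proof (rule Bochner_Integration.integral_cong[OF refl])
        fix x show "\<rho> x * \<zeta>1 (\<Psi> x) = indicator (cball c r) x *\<^sub>R (\<rho> x * w x)"
        proof (cases "x \<in> cball c r")
          case True
          have "\<psi> x \<in> Z" unfolding Z_def using True by blast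
          then show ?thesis using True \<Psi>in[OF True] \<zeta>w[OF True] by (simp add: \<zeta>1_def)
        next
          case False then show ?thesis using \<rho>0 by simp
        qed
      qed
      finally have lhs: "cint \<mu> \<zeta> = (\<integral>x. indicator (cball c r) x *\<^sub>R (\<rho> x * w x) \<partial>lborel)" .
      have "cint \<nu> \<eta> = (\<integral>x. d x * \<eta> (\<Psi> x) \<partial>lborel)" unfolding \<nu>_def by (rule dm(2)[OF dint \<eta>b])
      also have "\<dots> = (\<integral>x. indicator (cball c r) x *\<^sub>R (e x * h x) \<partial>lborel)"
      proof (rule Bochner_Integration.integral_cong[OF refl])
        fix x show "d x * \<eta> (\<Psi> x) = indicator (cball c r) x *\<^sub>R (e x * h x)"
          using \<Psi>in[of x] h\<psi>[of x] bS(2) by (cases "x \<in> cball c r") (auto simp: d_def)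
      qed
      finally have rhs: "cint \<nu> \<eta> = (\<integral>x. indicator (cball c r) x *\<^sub>R (e x * h x) \<partial>lborel)" .
      \<comment> \<open>\<open>F b\<close> is the component in direction \<open>b\<close> of bump
        times field times test function. It is set to 0 off \<open>ball c R\<close>, where the
        extensions \<open>u\<close> and \<open>h\<close> need not be differentiable. Each integral
        of \<open>F' b x b\<close> vanishes, and their sum is the integral of the
        divergence.\<close>
      define G where "G b x = complex_of_real (u x \<bullet> b) * h x" for b x
      define G' where "G' b x v = complex_of_real (u x \<bullet> b) * h' x v + complex_of_real (u' x v \<bullet> b) * h x" for b x v
      define F where "F b x = (if x \<in> ball c R then \<rho> x * G b x else 0)" for b x
      define F' where "F' b x v = (if x \<in> ball c R then \<rho> x * G' b x v + complex_of_real (bump_deriv c r x v) * G b x else 0)" for b x v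
      have Gder: "(G b has_derivative G' b x) (at x)" if x: "x \<in> S" for b x
        unfolding G_def[abs_def] G'_def[abs_def]
        by (intro has_derivative_mult has_derivative_of_real has_derivative_inner_left u(2)[OF x] h(2)[OF x])
      have \<rho>der: "(\<rho> has_derivative (\<lambda>v. complex_of_real (bump_deriv c r x v))) (at x)" for x
        unfolding \<rho>_def[abs_def] by (rule has_derivative_of_real[OF has_derivative_bump])
      have Fder: "(F b has_derivative F' b x) (at x)" for b x
      proof (cases "x \<in> ball c R")
        case True
        have "((\<lambda>x. \<rho> x * G b x) has_derivative (\<lambda>v. \<rho> x * G' b x v + complex_of_real (bump_deriv c r x v) * G b x)) (at x)"
          using True bS(1) by (intro has_derivative_mult \<rho>der Gder) blast
        then have "(F b has_derivative (\<lambda>v. \<rho> x * G' b x v + complex_of_real (bump_deriv c r x v) * G b x)) (at x)"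
          by (rule has_derivative_transform_within_open[OF _ open_ball True]) (simp add: F_def)
        then show ?thesis using True by (simp add: F'_def[abs_def])
      next
        case False
        have "((\<lambda>x. 0) has_derivative (\<lambda>v. 0)) (at x)" by simp
        moreover have "open (- cball c r)" "x \<in> - cball c r" using False r(2) by auto
        ultimately have "(F b has_derivative (\<lambda>v. 0)) (at x)"
          by (rule has_derivative_transform_within_open) (simp add: F_def \<rho>0)
        then show ?thesis using False by (simp add: F'_def[abs_def])
      qed
      have F'cb: "F' b x v = indicator (cball c r) x *\<^sub>R (\<rho> x * G' b x v + complex_of_real (bump_deriv c r x v) * G b x)" for b x v
      proof (cases "x \<in> cball c r")
        case True then show ?thesis using r(2) by (auto simp: F'_def)
      next
        case False then show ?thesis using \<rho>0[OF False] bump_outside(2)[OF r(1) False, of v] by (simp add: F'_def)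
      qed
      have F'c: "continuous_on (cball c r) (\<lambda>x. \<rho> x * G' b x v + complex_of_real (bump_deriv c r x v) * G b x)" for b v
        unfolding \<rho>_def G'_def G_def bump_deriv_def
        by (intro continuous_intros continuous_bump ucont hcont continuous_on_subset[OF h(3) bS(2)]
            continuous_on_subset[OF u(3) bS(2)])
      have F'int: "integrable lborel (\<lambda>x. F' b x v)" for b v
        unfolding F'cb by (rule integrable_indicator_continuous[OF F'c])
      have "(\<integral>x. F' b x b \<partial>lborel) = 0" for b
      proof -
        from compact_continuous_norm_bound[OF compact_cball F'c[of b b]]
        obtain KF where KF0: "\<forall>x\<in>cball c r. norm (\<rho> x * G' b x b + complex_of_real (bump_deriv c r x b) * G b x) \<le> KF"
          by (elim exE)
        note KF = bspec[OF KF0]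
        show ?thesis
        proof (rule integral_derivative_compact_support(1)[OF Fder, of c r b b "\<bar>KF\<bar>"])
          show "F b x = 0" if "x \<notin> cball c r" for x using \<rho>0[OF that] by (simp add: F_def)
          show "norm (F' b x b) \<le> \<bar>KF\<bar>" for x
          proof (cases "x \<in> cball c r")
            case True
            then show ?thesis unfolding F'cb using KF[OF True] by simp
          next
            case False then show ?thesis unfolding F'cb by simp
          qed
        qed
      qed
      then have "0 = (\<integral>x. (\<Sum>b\<in>Basis. F' b x b) \<partial>lborel)"
        using F'int by (subst Bochner_Integration.integral_sum) auto
      also have "\<dots> = (\<integral>x. indicator (cball c r) x *\<^sub>R (\<rho> x * w x) + indicator (cball c r) x *\<^sub>R (e x * h x) \<partial>lborel)"
      proof (rule Bochner_Integration.integral_cong[OF refl])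
        fix x
        show "(\<Sum>b\<in>Basis. F' b x b) = indicator (cball c r) x *\<^sub>R (\<rho> x * w x) + indicator (cball c r) x *\<^sub>R (e x * h x)"
        proof (cases "x \<in> cball c r")
          case True
          have bd: "bump_deriv c r x (u x) = (\<Sum>b\<in>Basis. bump_deriv c r x b * (u x \<bullet> b))"
          proof -
            have "(x - c) \<bullet> u x = (\<Sum>b\<in>Basis. ((x - c) \<bullet> b) * (u x \<bullet> b))" by (rule euclidean_inner)
            then show ?thesis unfolding bump_deriv_def by (simp add: sum_distrib_left mult.assoc)
          qed
          have "(\<Sum>b\<in>Basis. F' b x b)
            = (\<Sum>b\<in>Basis. \<rho> x * (complex_of_real (u x \<bullet> b) * h' x b) + \<rho> x * (complex_of_real (u' x b \<bullet> b) * h x)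
                + complex_of_real (bump_deriv c r x b * (u x \<bullet> b)) * h x)"
            using True by (intro sum.cong) (auto simp: F'cb G'_def G_def algebra_simps)
          also have "\<dots> = \<rho> x * (\<Sum>b\<in>Basis. complex_of_real (u x \<bullet> b) * h' x b)
              + (\<rho> x * complex_of_real (dv x) + complex_of_real (bump_deriv c r x (u x))) * h x"
            unfolding bd dv_def by (simp add: sum.distrib sum_distrib_left sum_distrib_right algebra_simps)
          also have "\<dots> = \<rho> x * w x + e x * h x"
            by (simp add: w_def e_def \<rho>_def scaleR_conv_of_real)
          finally show ?thesis using True by simp
        next
          case False then show ?thesis by (simp add: F'cb)
        qed
      qed
      also have "\<dots> = (\<integral>x. indicator (cball c r) x *\<^sub>R (\<rho> x * w x) \<partial>lborel)
          + (\<integral>x. indicator (cball c r) x *\<^sub>R (e x * h x) \<partial>lborel)"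
        by (intro Bochner_Integration.integral_add integrable_indicator_continuous continuous_on_mult econt hcont wcont)
          (auto simp: \<rho>_def[abs_def] intro!: continuous_intros continuous_bump)
      finally show "cint \<mu> \<zeta> = - cint \<nu> \<eta>" unfolding lhs rhs by (simp add: eq_neg_iff_add_eq_0)
    qed
    then show ?thesis using \<nu>tv by blast
  qed
  have "\<mu> \<in> D"
  proof (rule diff_measuresI(1)[OF \<mu>c, of B])
    fix U assume "U \<in> TF"
    then obtain \<nu> where \<nu>: "is_measure_derivative M U \<mu> \<nu>" "total_variation \<nu> \<le> B" using main by blast
    then show "\<exists>\<nu>. is_measure_derivative M U \<mu> \<nu>" "derivative_norm M U \<mu> \<le> B"
      using derivative_norm_le[OF \<nu>(1)] by (blast, linarith)
  qed
  then show ?thesis using mass by blast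
qed

end

subsection \<open>Laplace transforms\<close>

definition laplace :: "complex \<Rightarrow> (real \<Rightarrow> complex) \<Rightarrow> complex" where
  "laplace z h = (LINT t:{0..}|lborel. exp (- z * of_real t) * h t)"

lemma integrable_exp_decay:
  assumes a: "0 < (a::real)"
  shows "integrable lborel (\<lambda>t. indicator {0..} t *\<^sub>R exp (- a * t))"
proof (rule integrableI_bounded)
  have "((\<lambda>t. - exp (- a * t) / a) \<longlongrightarrow> 0) at_top"
    using a by real_asymp
  then have "(\<integral>\<^sup>+t. ennreal (exp (- a * t)) * indicator {0..} t \<partial>lborel) = ennreal (0 - (- exp (- a * 0) / a))"
    using a by (intro nn_integral_FTC_atLeast) (auto intro!: derivative_eq_intros)
  moreover have "(\<integral>\<^sup>+t. ennreal (norm (indicator {0..} t *\<^sub>R exp (- a * t))) \<partial>lborel)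
      = (\<integral>\<^sup>+t. ennreal (exp (- a * t)) * indicator {0..} t \<partial>lborel)"
    by (intro nn_integral_cong) (simp add: indicator_def)
  ultimately show "(\<integral>\<^sup>+t. ennreal (norm (indicator {0..} t *\<^sub>R exp (- a * t))) \<partial>lborel) < \<infinity>" by simp
qed auto

context
  fixes h :: "real \<Rightarrow> complex" and B :: real
  assumes h: "continuous_on {0..} h" and B: "\<And>t. 0 \<le> t \<Longrightarrow> norm (h t) \<le> B"
begin

lemma laplace_bound_nonneg: "0 \<le> B"
  using B[OF order_refl] norm_ge_zero[of "h 0"] by linarith

lemma laplace_measurable:
  assumes "continuous_on UNIV f"
  shows "(\<lambda>t. indicator {0..} t *\<^sub>R (f t * h t)) \<in> borel_measurable borel"
  by (intro borel_measurable_continuous_on_indicator continuous_on_mult h continuous_on_subset[OF assms]) auto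

lemma laplace_integrable:
  assumes z: "0 < Re z"
  shows "integrable lborel (\<lambda>t. indicator {0..} t *\<^sub>R (exp (- z * of_real t) * h t))"
proof (rule Bochner_Integration.integrable_bound[OF integrable_mult_right[OF integrable_exp_decay[OF z], of B]])
  show "(\<lambda>t. indicator {0..} t *\<^sub>R (exp (- z * of_real t) * h t)) \<in> borel_measurable lborel"
  proof -
    have "continuous_on UNIV (\<lambda>t::real. exp (- z * of_real t))" by (intro continuous_intros)
    from laplace_measurable[OF this] show ?thesis by simp
  qed
  show "AE t in lborel. norm (indicator {0..} t *\<^sub>R (exp (- z * of_real t) * h t))
      \<le> norm (B * indicator {0..} t *\<^sub>R exp (- Re z * t))"
  proof (rule AE_I2)
    fix t :: real
    show "norm (indicator {0..} t *\<^sub>R (exp (- z * of_real t) * h t)) \<le> norm (B * indicator {0..} t *\<^sub>R exp (- Re z * t))"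
    proof (cases "t \<ge> 0")
      case True
      have "norm (h t) * exp (- Re z * t) \<le> B * exp (- Re z * t)" using B[OF True] by (intro mult_right_mono) auto
      then show ?thesis using True laplace_bound_nonneg by (simp add: norm_mult mult.commute)
    next
      case False then show ?thesis by simp
    qed
  qed
qed

lemma laplace_FTC:
  assumes z: "0 < Re z" and F: "\<And>t. 0 \<le> t \<Longrightarrow> (F has_vector_derivative exp (- z * of_real t) * h t) (at t within {0..})"
    and lim: "(F \<longlongrightarrow> L) at_top"
  shows "laplace z h = L - F 0"
proof -
  let ?f = "\<lambda>t. exp (- z * of_real t) * h t"
  have fc: "continuous_on {0..} ?f" by (intro continuous_intros h)
  have "(\<integral>t. indicator {0..real n} t *\<^sub>R ?f t \<partial>lborel) = F (real n) - F 0" for n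
  proof (rule integral_FTC_Icc)
    show "(F has_vector_derivative ?f t) (at t within {0..real n})" if "0 \<le> t" "t \<le> real n" for t
      by (rule has_vector_derivative_within_subset[OF F[OF that(1)]]) auto
    show "continuous_on {0..real n} ?f" by (rule continuous_on_subset[OF fc]) auto
  qed simp
  moreover have "(\<lambda>n. \<integral>t. indicator {0..real n} t *\<^sub>R ?f t \<partial>lborel) \<longlonglongrightarrow> (\<integral>t. indicator {0..} t *\<^sub>R ?f t \<partial>lborel)"
  proof (rule integral_dominated_convergence[of _ _ _ "\<lambda>t. norm (indicator {0..} t *\<^sub>R ?f t)"])
    show "integrable lborel (\<lambda>t. norm (indicator {0..} t *\<^sub>R ?f t))" by (rule integrable_norm[OF laplace_integrable[OF z]])
    show "(\<lambda>t. indicator {0..} t *\<^sub>R ?f t) \<in> borel_measurable lborel" using laplace_integrable[OF z] by auto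
    show "(\<lambda>t. indicator {0..real n} t *\<^sub>R ?f t) \<in> borel_measurable lborel" for n
    proof -
      have "(\<lambda>t. indicator {0..real n} t *\<^sub>R ?f t) \<in> borel_measurable borel"
        by (intro borel_measurable_continuous_on_indicator continuous_on_subset[OF fc]) auto
      then show ?thesis by simp
    qed
    show "AE t in lborel. norm (indicator {0..real n} t *\<^sub>R ?f t) \<le> norm (indicator {0..} t *\<^sub>R ?f t)" for n
      by (intro AE_I2) (simp add: indicator_def)
    show "AE t in lborel. (\<lambda>n. indicator {0..real n} t *\<^sub>R ?f t) \<longlonglongrightarrow> indicator {0..} t *\<^sub>R ?f t"
    proof (rule AE_I2)
      fix t :: real
      have "\<forall>\<^sub>F n in sequentially. real n \<ge> t"
        using filterlim_real_sequentially unfolding filterlim_at_top by blast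
      then have "\<forall>\<^sub>F n in sequentially. indicator {0..real n} t *\<^sub>R ?f t = indicator {0..} t *\<^sub>R ?f t"
        by (rule eventually_mono) (simp add: indicator_def)
      then show "(\<lambda>n. indicator {0..real n} t *\<^sub>R ?f t) \<longlonglongrightarrow> indicator {0..} t *\<^sub>R ?f t"
        by (rule tendsto_eventually)
    qed
  qed
  moreover have "(\<lambda>n. F (real n) - F 0) \<longlonglongrightarrow> L - F 0"
    by (intro tendsto_diff tendsto_const filterlim_compose[OF lim filterlim_real_sequentially])
  ultimately show ?thesis
    unfolding laplace_def set_lebesgue_integral_def using LIMSEQ_unique by simp
qed

text \<open>Differentiation under the integral sign along sequences. With
  \<open>a = Re z / 2\<close>, all but finitely many points lie in the half plane
  \<open>Re w > a\<close>, where the difference quotients of the exponential are at most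
  \<open>t * exp (- a * t)\<close>. The inequality \<open>y \<le> exp y\<close> trades the factor
  \<open>t\<close> for half of the decay, leaving an integrable majorant.\<close>

lemma laplace_holomorphic: "(\<lambda>z. laplace z h) holomorphic_on {z. 0 < Re z}"
proof -
  have op: "open {z. 0 < Re z}" by (rule open_halfspace_Re_gt)
  have "((\<lambda>z. laplace z h) has_field_derivative (\<integral>t. indicator {0..} t *\<^sub>R (- of_real t * exp (- z * of_real t) * h t) \<partial>lborel)) (at z)"
    if z: "0 < Re z" for z
    unfolding has_field_derivative_iff tendsto_at_iff_sequentially comp_def
  proof (intro allI impI)
    fix w :: "nat \<Rightarrow> complex" assume w: "\<forall>n. w n \<in> UNIV - {z}" "w \<longlonglongrightarrow> z"
    define a where "a = Re z / 2"
    have a: "a > 0" "a < Re z" using z by (auto simp: a_def)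
    have "(\<lambda>n. Re (w n)) \<longlonglongrightarrow> Re z" by (intro tendsto_intros w(2))
    then have "\<forall>\<^sub>F n in sequentially. a < Re (w n)" by (rule order_tendstoD(1)[OF _ a(2)])
    then obtain N where N: "\<And>n. n \<ge> N \<Longrightarrow> a < Re (w n)" by (auto simp: eventually_sequentially)
    define v where "v n = w (n + N)" for n
    have v: "v n \<noteq> z" "a < Re (v n)" for n using w(1) N unfolding v_def by auto
    have vz: "v \<longlonglongrightarrow> z" unfolding v_def[abs_def] by (rule LIMSEQ_ignore_initial_segment[OF w(2)])
    let ?q = "\<lambda>n t. indicator {0..} t *\<^sub>R ((exp (- v n * of_real t) - exp (- z * of_real t)) / (v n - z) * h t)"
    have "(\<lambda>n. \<integral>t. ?q n t \<partial>lborel) \<longlonglongrightarrow> (\<integral>t. indicator {0..} t *\<^sub>R (- of_real t * exp (- z * of_real t) * h t) \<partial>lborel)"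
    proof (rule integral_dominated_convergence[of _ _ _ "\<lambda>t. (2 * B / a) * (indicator {0..} t *\<^sub>R exp (- (a / 2) * t))"])
      show "integrable lborel (\<lambda>t. (2 * B / a) * (indicator {0..} t *\<^sub>R exp (- (a / 2) * t)))"
        using a by (intro integrable_mult_right integrable_exp_decay) simp
      show "(\<lambda>t. indicator {0..} t *\<^sub>R (- of_real t * exp (- z * of_real t) * h t)) \<in> borel_measurable lborel"
      proof -
        have "continuous_on UNIV (\<lambda>t::real. - of_real t * exp (- z * of_real t))" by (intro continuous_intros)
        from laplace_measurable[OF this] show ?thesis by simp
      qed
      show "?q n \<in> borel_measurable lborel" for n
      proof -
        have "continuous_on UNIV (\<lambda>t::real. (exp (- v n * of_real t) - exp (- z * of_real t)) / (v n - z))"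
          using v(1)[of n] by (intro continuous_intros) simp
        from laplace_measurable[OF this] show ?thesis by simp
      qed
      show "AE t in lborel. (\<lambda>n. ?q n t) \<longlonglongrightarrow> indicator {0..} t *\<^sub>R (- of_real t * exp (- z * of_real t) * h t)"
      proof (rule AE_I2)
        fix t :: real
        have "((\<lambda>z. exp (- z * of_real t)) has_field_derivative - of_real t * exp (- z * of_real t)) (at z)"
          by (auto intro!: derivative_eq_intros)
        then have "(\<lambda>n. (exp (- v n * of_real t) - exp (- z * of_real t)) / (v n - z)) \<longlonglongrightarrow> - of_real t * exp (- z * of_real t)"
          unfolding has_field_derivative_iff tendsto_at_iff_sequentially comp_def using v(1) vz by auto
        then show "(\<lambda>n. ?q n t) \<longlonglongrightarrow> indicator {0..} t *\<^sub>R (- of_real t * exp (- z * of_real t) * h t)"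
          by (intro tendsto_scaleR tendsto_mult tendsto_const)
      qed
      show "AE t in lborel. norm (?q n t) \<le> (2 * B / a) * (indicator {0..} t *\<^sub>R exp (- (a / 2) * t))" for n
      proof (rule AE_I2)
        fix t :: real
        show "norm (?q n t) \<le> (2 * B / a) * (indicator {0..} t *\<^sub>R exp (- (a / 2) * t))"
        proof (cases "t \<ge> 0")
          case t: True
          have "norm (exp (- v n * of_real t) - exp (- z * of_real t)) \<le> t * exp (- a * t) * norm (v n - z)"
          proof (rule field_differentiable_bound[of "{w. Re w \<ge> a}" "\<lambda>z. exp (- z * of_real t)" "\<lambda>z. - of_real t * exp (- z * of_real t)"])
            show "convex {w. Re w \<ge> a}" by (rule convex_halfspace_Re_ge)
            fix y assume y: "y \<in> {w. Re w \<ge> a}"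
            show "((\<lambda>z. exp (- z * of_real t)) has_field_derivative - of_real t * exp (- y * of_real t)) (at y within {w. Re w \<ge> a})"
              by (auto intro!: derivative_eq_intros)
            have "exp (- (Re y * t)) \<le> exp (- (a * t))" using y t by (simp add: mult_right_mono)
            then show "norm (- of_real t * exp (- y * of_real t)) \<le> t * exp (- a * t)"
              using t by (simp add: norm_mult mult_left_mono)
          qed (use less_imp_le[OF v(2)] a in auto)
          then have "norm ((exp (- v n * of_real t) - exp (- z * of_real t)) / (v n - z)) \<le> t * exp (- a * t)"
            using v(1)[of n] by (simp add: norm_divide divide_le_eq)
          also have "\<dots> \<le> (2 / a) * exp (- (a / 2) * t)"
          proof -
            have "a / 2 * t \<le> exp (a / 2 * t)" using exp_ge_add_one_self[of "a / 2 * t"] by linarith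
            then have "t \<le> (2 / a) * exp (a / 2 * t)" using a by (simp add: field_simps)
            then have "t * exp (- a * t) \<le> (2 / a) * exp (a / 2 * t) * exp (- a * t)" by (intro mult_right_mono) auto
            moreover have "exp (a / 2 * t) * exp (- a * t) = exp (- (a / 2) * t)"
              by (simp add: exp_add[symmetric] field_simps)
            ultimately show ?thesis by (simp only: mult.assoc)
          qed
          finally have le: "norm ((exp (- v n * of_real t) - exp (- z * of_real t)) / (v n - z)) * norm (h t)
              \<le> (2 / a) * exp (- (a / 2) * t) * B"
            using B[OF t] a by (intro mult_mono) auto
          have eq1: "indicator {0..} t = (1::real)" using t by simp
          have eq2: "(2 * B / a) * exp (- (a / 2) * t) = (2 / a) * exp (- (a / 2) * t) * B" by simp
          show ?thesis unfolding eq1 scaleR_one norm_mult eq2 by (rule le)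
        next
          case False then show ?thesis by simp
        qed
      qed
    qed
    moreover have "(\<integral>t. ?q n t \<partial>lborel) = (laplace (v n) h - laplace z h) / (v n - z)" for n
    proof -
      have "0 < Re (v n)" using v(2)[of n] a by linarith
      then have "laplace (v n) h - laplace z h = (\<integral>t. indicator {0..} t *\<^sub>R (exp (- v n * of_real t) * h t)
          - indicator {0..} t *\<^sub>R (exp (- z * of_real t) * h t) \<partial>lborel)"
        unfolding laplace_def set_lebesgue_integral_def using laplace_integrable z
        by (intro Bochner_Integration.integral_diff[symmetric]) auto
      then have "(laplace (v n) h - laplace z h) / (v n - z) = (\<integral>t. (indicator {0..} t *\<^sub>R (exp (- v n * of_real t) * h t)
          - indicator {0..} t *\<^sub>R (exp (- z * of_real t) * h t)) / (v n - z) \<partial>lborel)" by simp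
      also have "\<dots> = (\<integral>t. ?q n t \<partial>lborel)"
        by (intro Bochner_Integration.integral_cong refl) (simp add: indicator_def diff_divide_distrib algebra_simps)
      finally show ?thesis by simp
    qed
    ultimately have "(\<lambda>n. (laplace (w (n + N)) h - laplace z h) / (w (n + N) - z))
        \<longlonglongrightarrow> (\<integral>t. indicator {0..} t *\<^sub>R (- of_real t * exp (- z * of_real t) * h t) \<partial>lborel)"
      by (simp add: v_def)
    then show "(\<lambda>n. (laplace (w n) h - laplace z h) / (w n - z))
        \<longlonglongrightarrow> (\<integral>t. indicator {0..} t *\<^sub>R (- of_real t * exp (- z * of_real t) * h t) \<partial>lborel)"
      by (rule LIMSEQ_offset)
  qed
  then show ?thesis by (subst holomorphic_on_open[OF op]) blast
qed

text \<open>The left-hand side is the integral of \<open>exp (- z * u) * h u\<close> over the tail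
  from \<open>t\<close> on. Written as the whole minus an initial piece, it becomes differentiable
  in \<open>t\<close> by the fundamental theorem.\<close>

lemma laplace_shift:
  assumes z: "0 < Re z" and t: "0 \<le> t"
  shows "exp (- z * of_real t) * laplace z (\<lambda>s. h (s + t))
    = laplace z h - integral {0..t} (\<lambda>u. exp (- z * of_real u) * h u)"
proof -
  let ?f = "\<lambda>u. exp (- z * of_real u) * h u"
  have fc: "continuous_on {0..t} ?f" by (intro continuous_intros continuous_on_subset[OF h]) auto
  have i0: "integrable lborel (\<lambda>u. indicator {0..t} u *\<^sub>R ?f u)"
    by (intro borel_integrable_compact fc) simp
  have I0: "(\<integral>u. indicator {0..t} u *\<^sub>R ?f u \<partial>lborel) = integral {0..t} ?f"
    using set_borel_integral_eq_integral(2)[of "{0..t}" ?f] i0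
    unfolding set_integrable_def set_lebesgue_integral_def by simp
  have "exp (- z * of_real t) * laplace z (\<lambda>s. h (s + t)) = (\<integral>s. exp (- z * of_real t) * (indicator {0..} s *\<^sub>R (exp (- z * of_real s) * h (s + t))) \<partial>lborel)"
    unfolding laplace_def set_lebesgue_integral_def by (rule integral_mult_right_zero[symmetric])
  also have "\<dots> = (\<integral>s. indicator {t..} (t + 1 * s) *\<^sub>R ?f (t + 1 * s) \<partial>lborel)"
    by (intro Bochner_Integration.integral_cong refl) (auto simp: indicator_def exp_add[symmetric] algebra_simps)
  also have "\<dots> = (\<integral>u. indicator {t..} u *\<^sub>R ?f u \<partial>lborel)"
    using lborel_integral_real_affine[of 1 "\<lambda>u. indicator {t..} u *\<^sub>R ?f u" t] by simp
  also have "\<dots> = (\<integral>u. indicator {0..} u *\<^sub>R ?f u - indicator {0..t} u *\<^sub>R ?f u \<partial>lborel)"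
  proof (rule integral_cong_AE)
    show "(\<lambda>u. indicator {t..} u *\<^sub>R ?f u) \<in> borel_measurable lborel"
    proof -
      have "(\<lambda>u. indicator {t..} u *\<^sub>R ?f u) \<in> borel_measurable borel"
        using t by (intro borel_measurable_continuous_on_indicator continuous_intros continuous_on_subset[OF h]) auto
      then show ?thesis by simp
    qed
    show "(\<lambda>u. indicator {0..} u *\<^sub>R ?f u - indicator {0..t} u *\<^sub>R ?f u) \<in> borel_measurable lborel"
      using laplace_integrable[OF z] i0 by (intro borel_measurable_diff) auto
    show "AE u in lborel. indicator {t..} u *\<^sub>R ?f u = indicator {0..} u *\<^sub>R ?f u - indicator {0..t} u *\<^sub>R ?f u"
      using AE_lborel_singleton[of t] by eventually_elim (use t in \<open>auto simp: indicator_def\<close>)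
  qed
  also have "\<dots> = laplace z h - integral {0..t} ?f"
    unfolding laplace_def set_lebesgue_integral_def I0[symmetric]
    by (rule Bochner_Integration.integral_diff[OF laplace_integrable[OF z] i0])
  finally show ?thesis .
qed

lemma laplace_shift_derivative:
  assumes w: "0 < Re w" and t: "0 \<le> t"
  shows "((\<lambda>t. exp (- w * of_real t) * laplace w (\<lambda>s. h (s + t))) has_vector_derivative
    - (exp (- w * of_real t) * h t)) (at t within {0..})"
proof -
  let ?f = "\<lambda>u. exp (- w * of_real u) * h u"
  have fc: "continuous_on {0..t + 1} ?f" by (intro continuous_intros continuous_on_subset[OF h]) auto
  have "((\<lambda>u. integral {0..u} ?f) has_vector_derivative ?f t) (at t within {0..t + 1})"
    by (rule integral_has_vector_derivative[OF fc]) (use t in auto)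
  then have "((\<lambda>u. laplace w h - integral {0..u} ?f) has_vector_derivative 0 - ?f t) (at t within {0..t + 1})"
    by (intro has_vector_derivative_diff has_vector_derivative_const)
  then have "((\<lambda>u. exp (- w * of_real u) * laplace w (\<lambda>s. h (s + u))) has_vector_derivative 0 - ?f t) (at t within {0..t + 1})"
    by (rule has_vector_derivative_transform[rotated 2]) (use t laplace_shift[OF w] in auto)
  moreover have "at t within {0..t + 1} = at t within {0..}"
    using t by (intro at_within_nhd[of t "{..<t + 1}"]) auto
  ultimately show ?thesis by simp
qed

lemma norm_laplace_le:
  assumes z: "0 < Re z"
  shows "norm (laplace z h) \<le> B * (\<integral>t. indicator {0..} t *\<^sub>R exp (- Re z * t) \<partial>lborel)"
proof -
  have "norm (laplace z h) \<le> (\<integral>t. norm (indicator {0..} t *\<^sub>R (exp (- z * of_real t) * h t)) \<partial>lborel)"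
    unfolding laplace_def set_lebesgue_integral_def by (rule integral_norm_bound)
  also have "\<dots> \<le> (\<integral>t. B * (indicator {0..} t *\<^sub>R exp (- Re z * t)) \<partial>lborel)"
  proof (rule integral_mono[OF integrable_norm[OF laplace_integrable[OF z]] integrable_mult_right[OF integrable_exp_decay[OF z]]])
    fix t :: real
    show "norm (indicator {0..} t *\<^sub>R (exp (- z * of_real t) * h t)) \<le> B * (indicator {0..} t *\<^sub>R exp (- Re z * t))"
    proof (cases "t \<ge> 0")
      case True
      have "norm (h t) * exp (- Re z * t) \<le> B * exp (- Re z * t)" using B[OF True] by (intro mult_right_mono) auto
      then show ?thesis using True by (simp add: norm_mult mult.commute)
    next
      case False then show ?thesis by simp
    qed
  qed
  finally show ?thesis by simp
qed

end

lemma laplace_const: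
  assumes z: "0 < Re z" shows "laplace z (\<lambda>_. c) = c / z"
proof -
  have z0: "z \<noteq> 0" using z by auto
  have "laplace z (\<lambda>_. c) = 0 - (- c * exp (- z * of_real 0) / z)"
  proof (rule laplace_FTC[of "\<lambda>_. c" "norm c", OF _ _ z])
    show "((\<lambda>t. - c * exp (- z * of_real t) / z) has_vector_derivative exp (- z * of_real t) * c) (at t within {0..})" for t
    proof -
      have "((\<lambda>y. - c * exp (- z * y) / z) has_field_derivative exp (- z * of_real t) * c) (at (of_real t))"
        using z0 by (auto intro!: derivative_eq_intros)
      then have "((\<lambda>t. - c * exp (- z * of_real t) / z) has_vector_derivative exp (- z * of_real t) * c) (at t)"
        by (rule has_vector_derivative_real_field)
      then show ?thesis by (rule has_vector_derivative_at_within)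
    qed
    have "((\<lambda>t. exp (- Re z * t)) \<longlongrightarrow> 0) at_top" using z by real_asymp
    then have "((\<lambda>t. norm c * exp (- Re z * t) / norm z) \<longlongrightarrow> norm c * 0 / norm z) at_top"
      using z0 by (intro tendsto_intros) auto
    then have "((\<lambda>t. norm c * exp (- Re z * t) / norm z) \<longlongrightarrow> 0) at_top" by simp
    then show "((\<lambda>t. - c * exp (- z * of_real t) / z) \<longlongrightarrow> 0) at_top"
      by (rule Lim_null_comparison[rotated]) (simp add: norm_mult norm_divide)
  qed auto
  then show ?thesis by simp
qed

text \<open>The resolvent identity for Laplace transforms: with \<open>K t = e\<^bsup>wt\<^esup> \<integral>\<^bsub>u\<ge>t\<^esub> e\<^bsup>-wu\<^esup> h u du\<close>, integrate the
  derivative \<open>(w - z) e\<^bsup>-zt\<^esup> K t - e\<^bsup>-zt\<^esup> h t\<close> of \<open>e\<^bsup>-zt\<^esup> K t\<close>.\<close>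

lemma laplace_resolvent:
  assumes h: "continuous_on {0..} h" and B: "\<And>t. 0 \<le> t \<Longrightarrow> norm (h t) \<le> B"
    and z: "0 < Re z" and w: "0 < Re w"
  defines "K \<equiv> \<lambda>t. laplace w (\<lambda>s. h (s + t))"
  shows "(w - z) * laplace z K = laplace z h - laplace w h"
    and "continuous_on {0..} K"
proof -
  have K': "((\<lambda>t. exp (- w * of_real t) * K t) has_vector_derivative - (exp (- w * of_real t) * h t)) (at t within {0..})"
    if "0 \<le> t" for t unfolding K_def by (rule laplace_shift_derivative[OF h B w that])
  have expd: "((\<lambda>t. exp (a * of_real t)) has_vector_derivative a * exp (a * of_real t)) (at t within {0..})" for a :: complex and t
    by (rule has_vector_derivative_at_within[OF has_vector_derivative_real_field]) (auto intro!: derivative_eq_intros)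
  have KE: "K t = exp (w * of_real t) * (exp (- w * of_real t) * K t)" for t
    by (simp add: mult.assoc[symmetric] exp_add[symmetric])
  have "continuous_on {0..} (\<lambda>t. exp (- w * of_real t) * K t)"
    unfolding continuous_on_eq_continuous_within
    using has_vector_derivative_continuous[OF K'] by simp
  then have "continuous_on {0..} (\<lambda>t. exp (w * of_real t) * (exp (- w * of_real t) * K t))"
    by (rule continuous_on_mult[rotated]) (intro continuous_intros)
  then show Kc: "continuous_on {0..} K" by (simp only: KE[symmetric])
  define BK where "BK = B * (\<integral>t. indicator {0..} t *\<^sub>R exp (- Re w * t) \<partial>lborel)"
  have KB: "norm (K t) \<le> BK" if t: "0 \<le> t" for t
    unfolding K_def BK_def
  proof (rule norm_laplace_le[OF _ _ w])
    show "continuous_on {0..} (\<lambda>s. h (s + t))"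
      by (rule continuous_on_compose2[OF h]) (use t in \<open>auto intro!: continuous_intros\<close>)
    show "norm (h (s + t)) \<le> B" if "0 \<le> s" for s using that t by (intro B) simp
  qed
  have c: "continuous_on {0..} (\<lambda>t. (w - z) * K t - h t)" by (intro continuous_intros Kc h)
  have cB: "norm ((w - z) * K t - h t) \<le> norm (w - z) * BK + B" if "0 \<le> t" for t
    using KB[OF that] B[OF that]
    by (intro norm_triangle_le_diff add_mono) (auto simp: norm_mult intro!: mult_left_mono)
  have "laplace z (\<lambda>t. (w - z) * K t - h t) = 0 - exp (- z * of_real 0) * K 0"
  proof (rule laplace_FTC[OF c cB z])
    fix t :: real assume t: "0 \<le> t"
    have "((\<lambda>t. exp ((w - z) * of_real t) * (exp (- w * of_real t) * K t)) has_vector_derivative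
        exp ((w - z) * of_real t) * (- (exp (- w * of_real t) * h t))
        + (w - z) * exp ((w - z) * of_real t) * (exp (- w * of_real t) * K t)) (at t within {0..})"
      by (rule has_vector_derivative_mult[OF expd K'[OF t]])
    moreover have "exp ((w - z) * of_real t) * exp (- w * of_real t) = exp (- z * of_real t)" for t
      by (simp add: exp_add[symmetric] algebra_simps)
    then have e: "exp ((w - z) * of_real t) * (exp (- w * of_real t) * x) = exp (- z * of_real t) * x" for t x
      by (simp add: mult.assoc[symmetric])
    ultimately have "((\<lambda>t. exp (- z * of_real t) * K t) has_vector_derivative
        - (exp (- z * of_real t) * h t) + (w - z) * (exp (- z * of_real t) * K t)) (at t within {0..})"
      by (simp only: e mult_minus_right mult.assoc)
    then show "((\<lambda>t. exp (- z * of_real t) * K t) has_vector_derivative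
        exp (- z * of_real t) * ((w - z) * K t - h t)) (at t within {0..})"
      by (simp add: algebra_simps)
  next
    have "((\<lambda>t. exp (- Re z * t)) \<longlongrightarrow> 0) at_top" using z by real_asymp
    then have "((\<lambda>t. exp (- Re z * t) * BK) \<longlongrightarrow> 0) at_top" by (rule tendsto_mult_left_zero)
    moreover have "\<forall>\<^sub>F t in at_top. norm (exp (- z * of_real t) * K t) \<le> exp (- Re z * t) * BK"
      using eventually_ge_at_top[of 0]
    proof eventually_elim
      case (elim t)
      then show ?case using KB[of t] by (simp add: norm_mult mult_left_mono)
    qed
    ultimately show "((\<lambda>t. exp (- z * of_real t) * K t) \<longlongrightarrow> 0) at_top"
      by (rule Lim_null_comparison[rotated])
  qed
  moreover have "laplace z (\<lambda>t. (w - z) * K t - h t) = (w - z) * laplace z K - laplace z h"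
  proof -
    have "laplace z (\<lambda>t. (w - z) * K t - h t) = (\<integral>t. (w - z) * (indicator {0..} t *\<^sub>R (exp (- z * of_real t) * K t))
        - indicator {0..} t *\<^sub>R (exp (- z * of_real t) * h t) \<partial>lborel)"
      unfolding laplace_def set_lebesgue_integral_def
      by (intro Bochner_Integration.integral_cong refl) (simp add: indicator_def algebra_simps)
    also have "\<dots> = (w - z) * laplace z K - laplace z h"
      unfolding laplace_def set_lebesgue_integral_def
      by (subst Bochner_Integration.integral_diff[OF integrable_mult_right[OF laplace_integrable[OF Kc KB z]]
            laplace_integrable[OF h B z]], assumption, assumption,
          subst Bochner_Integration.integral_mult_right_zero, rule refl)
    finally show ?thesis .
  qed
  moreover have "K 0 = laplace w h" by (simp add: K_def)
  ultimately show "(w - z) * laplace z K = laplace z h - laplace w h" by (simp add: algebra_simps)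
qed

subsection \<open>Semiflows acting on measures\<close>

locale semiflow_on_manifold = riemannian_branched_manifold M g
  for M :: "('a::metric_space, 'e::euclidean_space) branched_atlas" and g +
  fixes \<Phi> :: "real \<Rightarrow> 'a \<Rightarrow> 'a"
  assumes flow_0: "\<Phi> 0 = id" and flow_add: "0 \<le> t \<Longrightarrow> 0 \<le> s \<Longrightarrow> \<Phi> (t + s) = \<Phi> t \<circ> \<Phi> s"
    and flow_continuous: "continuous_on ({0..} \<times> UNIV) (\<lambda>(t, x). \<Phi> t x)"
begin

lemma continuous_flow:
  assumes "0 \<le> t" shows "continuous_on UNIV (\<Phi> t)"
proof -
  have c: "continuous_on UNIV (\<lambda>x::'a. (t, x))"
    by (intro continuous_on_Pair continuous_on_const continuous_on_id)
  have "continuous_on UNIV (\<lambda>x. case (t, x) of (t, x) \<Rightarrow> \<Phi> t x)"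
    by (rule continuous_on_compose2[OF flow_continuous c]) (use assms in auto)
  then show ?thesis by simp
qed

lemma continuous_orbit: "continuous_on {0..} (\<lambda>t. \<Phi> t x)"
proof -
  have c: "continuous_on {0..} (\<lambda>t::real. (t, x))"
    by (intro continuous_on_Pair continuous_on_const continuous_on_id)
  have "continuous_on {0..} (\<lambda>t. case (t, x) of (t, x) \<Rightarrow> \<Phi> t x)"
    by (rule continuous_on_compose2[OF flow_continuous c]) auto
  then show ?thesis by simp
qed

lemma flow_measurable: "0 \<le> t \<Longrightarrow> \<Phi> t \<in> borel_measurable borel"
  by (intro borel_measurable_continuous_onI continuous_flow)

lemma push_forward_eq:
  assumes \<mu>: "\<mu> \<in> complex_measures" and t: "0 \<le> t"
  shows "push_forward \<Phi> t \<mu> = image_measure (\<Phi> t) \<mu>"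
  unfolding push_forward_def
proof (rule the_equality)
  note im = image_measure[OF \<mu> flow_measurable[OF t]]
  have eq: "cint (image_measure (\<Phi> t) \<mu>) \<eta> = cint \<mu> (\<eta> \<circ> \<Phi> t)" if "continuous_on UNIV \<eta>" for \<eta>
    by (rule im(2)[OF continuous_bounded_borel[OF that]])
  then show "image_measure (\<Phi> t) \<mu> \<in> complex_measures \<and>
      (\<forall>\<eta>. continuous_on UNIV \<eta> \<longrightarrow> cint (image_measure (\<Phi> t) \<mu>) \<eta> = cint \<mu> (\<eta> \<circ> \<Phi> t))"
    using im(1) by blast
  fix \<nu> assume \<nu>: "\<nu> \<in> complex_measures \<and> (\<forall>\<eta>. continuous_on UNIV \<eta> \<longrightarrow> cint \<nu> \<eta> = cint \<mu> (\<eta> \<circ> \<Phi> t))"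
  show "\<nu> = image_measure (\<Phi> t) \<mu>"
    by (rule complex_measures_eqI_continuous) (use \<nu> im(1) eq in auto)
qed

text \<open>The scalar orbit of \<open>\<mu>\<close> seen by one test function. Through it the
  semiflow enters only by time shifts and \<open>P\<close> only by Laplace transforms, so that the
  semigroup theory becomes calculus for bounded continuous functions on the half line.\<close>

definition correlation :: "('a set \<Rightarrow> complex) \<Rightarrow> ('a \<Rightarrow> complex) \<Rightarrow> real \<Rightarrow> complex" where
  "correlation \<mu> \<eta> t = cint \<mu> (\<eta> \<circ> \<Phi> t)"

lemma continuous_correlation:
  assumes \<mu>: "\<mu> \<in> complex_measures" and \<eta>: "continuous_on UNIV \<eta>"
  shows "continuous_on {0..} (correlation \<mu> \<eta>)"
  unfolding continuous_on_sequentially comp_def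
proof (intro allI ballI impI)
  fix x :: "nat \<Rightarrow> real" and t assume t: "t \<in> {0..}" and x: "(\<forall>n. x n \<in> {0..}) \<and> x \<longlonglongrightarrow> t"
  obtain B where B: "\<And>x. norm (\<eta> x) \<le> B"
    using continuous_bounded_borel[OF \<eta>] unfolding bounded_borel_def by blast
  have bb: "\<eta> \<circ> \<Phi> s \<in> bounded_borel" if "0 \<le> s" for s
    by (rule bounded_borel_comp[OF continuous_bounded_borel[OF \<eta>] flow_measurable[OF that]])
  show "(\<lambda>n. correlation \<mu> \<eta> (x n)) \<longlonglongrightarrow> correlation \<mu> \<eta> t"
    unfolding correlation_def
  proof (rule cint_dominated_convergence[OF \<mu>])
    show "\<eta> \<circ> \<Phi> (x n) \<in> bounded_borel" for n using x by (intro bb) simp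
    show "\<eta> \<circ> \<Phi> t \<in> bounded_borel" using t by (intro bb) simp
    show "norm ((\<eta> \<circ> \<Phi> (x n)) p) \<le> B" for n p using B by simp
    fix p
    have "continuous_on {0..} (\<lambda>t. \<eta> (\<Phi> t p))"
      by (rule continuous_on_compose2[OF \<eta> continuous_orbit]) simp
    then show "(\<lambda>n. (\<eta> \<circ> \<Phi> (x n)) p) \<longlonglongrightarrow> (\<eta> \<circ> \<Phi> t) p"
      using t x unfolding continuous_on_sequentially comp_def by blast
  qed
qed

lemma correlation_bound:
  assumes \<mu>: "\<mu> \<in> complex_measures" and \<eta>: "continuous_on UNIV \<eta>"
  shows "\<exists>B. \<forall>t\<ge>0. norm (correlation \<mu> \<eta> t) \<le> B"
proof -
  obtain B where B: "\<And>x. norm (\<eta> x) \<le> B"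
    using continuous_bounded_borel[OF \<eta>] unfolding bounded_borel_def by blast
  have "norm (correlation \<mu> \<eta> t) \<le> B * total_variation \<mu>" if "0 \<le> t" for t
    unfolding correlation_def
    by (rule cint_le_total_variation_bound[OF \<mu> continuous_on_compose[OF continuous_flow[OF that]]])
      (use B continuous_on_subset[OF \<eta>] in auto)
  then show ?thesis by blast
qed

lemma correlation_add: "0 \<le> s \<Longrightarrow> 0 \<le> t \<Longrightarrow> correlation \<mu> (\<eta> \<circ> \<Phi> t) s = correlation \<mu> \<eta> (s + t)"
  unfolding correlation_def using flow_add[of t s] by (simp add: comp_assoc add.commute)

lemma correlation_0: "correlation \<mu> \<eta> 0 = cint \<mu> \<eta>"
  unfolding correlation_def flow_0 by simp

text \<open>Needed to integrate the image measures over time. Correlations are continuous in time;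
  indicators of closed sets are limits of continuous functions, and complements and disjoint unions
  preserve measurability.\<close>

lemma image_measure_measurable:
  assumes \<mu>: "\<mu> \<in> complex_measures" and A: "A \<in> sets borel"
  shows "(\<lambda>t. indicator {0..} t *\<^sub>R image_measure (\<Phi> t) \<mu> A) \<in> borel_measurable borel"
  using A
proof (induction rule: borel_induct_closed)
  note im = image_measure[OF \<mu> flow_measurable]
  case (closed F)
  obtain s :: "nat \<Rightarrow> 'a \<Rightarrow> real" where s: "\<And>n. continuous_on UNIV (s n)"
    "\<And>n x. 0 \<le> s n x \<and> s n x \<le> 1" "\<And>x. (\<lambda>n. s n x) \<longlonglongrightarrow> indicator F x"
    using closed_indicator_limit[OF closed] by blast
  have c: "continuous_on UNIV (\<lambda>x. complex_of_real (s n x))" for n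
    by (intro continuous_intros s(1))
  have b: "norm (complex_of_real (s n x)) \<le> 1" for n x using s(2)[of n x] by simp
  have l: "(\<lambda>n. complex_of_real (s n x)) \<longlonglongrightarrow> indicator F x" for x
    using tendsto_of_real[OF s(3)[of x], where ?'a = complex] by (cases "x \<in> F") auto
  have Fb: "F \<in> sets borel" using closed by simp
  show ?case
  proof (rule borel_measurable_LIMSEQ_metric)
    show "(\<lambda>t. indicator {0..} t *\<^sub>R correlation \<mu> (\<lambda>x. complex_of_real (s n x)) t) \<in> borel_measurable borel" for n
      by (intro borel_measurable_continuous_on_indicator continuous_correlation[OF \<mu> c]) simp
    fix t :: real
    show "(\<lambda>n. indicator {0..} t *\<^sub>R correlation \<mu> (\<lambda>x. complex_of_real (s n x)) t)
        \<longlonglongrightarrow> indicator {0..} t *\<^sub>R image_measure (\<Phi> t) \<mu> F"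
    proof (cases "t \<ge> 0")
      case True
      have "(\<lambda>n. cint (image_measure (\<Phi> t) \<mu>) (\<lambda>x. complex_of_real (s n x))) \<longlonglongrightarrow> cint (image_measure (\<Phi> t) \<mu>) (indicator F)"
        by (rule cint_dominated_convergence[OF im(1)[OF True] bounded_borel_continuous[OF c b]
              bounded_borel_indicator[OF Fb] b l])
      then show ?thesis
        unfolding im(2)[OF True bounded_borel_continuous[OF c b]] cint_indicator[OF im(1)[OF True] Fb] correlation_def
        by (intro tendsto_scaleR tendsto_const)
    next
      case False then show ?thesis by simp
    qed
  qed
next
  case (compl A)
  have "indicator {0..} t *\<^sub>R image_measure (\<Phi> t) \<mu> (- A)
      = indicator {0..} t *\<^sub>R \<mu> UNIV - indicator {0..} t *\<^sub>R image_measure (\<Phi> t) \<mu> A" for t :: real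
  proof (cases "t \<ge> 0")
    case True
    have "image_measure (\<Phi> t) \<mu> UNIV = \<mu> UNIV" by (simp add: image_measure_def)
    then show ?thesis
      using complex_measures_Compl[OF image_measure(1)[OF \<mu> flow_measurable[OF True]] compl(1)] True by simp
  next
    case False then show ?thesis by simp
  qed
  then show ?case using compl(2) by simp
next
  case (union A)
  show ?case
  proof (rule borel_measurable_LIMSEQ_metric)
    show "(\<lambda>t. \<Sum>i<n. indicator {0..} t *\<^sub>R image_measure (\<Phi> t) \<mu> (A i)) \<in> borel_measurable borel" for n
      by (intro borel_measurable_sum union(3))
    fix t :: real
    show "(\<lambda>n. \<Sum>i<n. indicator {0..} t *\<^sub>R image_measure (\<Phi> t) \<mu> (A i))
        \<longlonglongrightarrow> indicator {0..} t *\<^sub>R image_measure (\<Phi> t) \<mu> (\<Union>i. A i)"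
    proof (cases "t \<ge> 0")
      case True
      then show ?thesis
        using complex_measures_sums[OF image_measure(1)[OF \<mu> flow_measurable[OF True]] union(2,1)]
        unfolding sums_def by simp
    next
      case False then show ?thesis by simp
    qed
  qed
qed

text \<open>\<open>resolvent_measure\<close> is a definite description, so a measure with the
  required integrals has to be constructed. It is the mixture over time of the image measures with
  weight \<open>exp (- z * t)\<close>; uniqueness comes from testing with continuous
  functions.\<close>

lemma resolvent_measure:
  assumes \<mu>: "\<mu> \<in> complex_measures" and z: "0 < Re z" and \<eta>: "continuous_on UNIV \<eta>"
  shows "cint (resolvent_measure \<Phi> z \<mu>) \<eta> = laplace z (correlation \<mu> \<eta>)"
proof -
  note im = image_measure[OF \<mu> flow_measurable]
  define \<kappa> where "\<kappa> t A = (indicator {0..} t * exp (- z * of_real t)) * image_measure (\<Phi> t) \<mu> A" for t A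
  define w where "w t = sup_measure_norm \<mu> * (indicator {0..} t *\<^sub>R exp (- Re z * t))" for t
  have \<kappa>: "\<kappa> t \<in> complex_measures" for t
  proof (cases "t \<ge> 0")
    case True then show ?thesis unfolding \<kappa>_def[abs_def] by (intro complex_measures_scale im(1))
  next
    case False
    then have "\<kappa> t = (\<lambda>A. 0)" by (simp add: \<kappa>_def fun_eq_iff)
    then show ?thesis using complex_measures_zero by simp
  qed
  have m: "(\<lambda>t. \<kappa> t A) \<in> borel_measurable lborel" if A: "A \<in> sets borel" for A
  proof -
    have "(\<lambda>t. exp (- z * of_real t) * (indicator {0..} t *\<^sub>R image_measure (\<Phi> t) \<mu> A)) \<in> borel_measurable borel"
      by (intro borel_measurable_times image_measure_measurable[OF \<mu> A] borel_measurable_continuous_onI continuous_intros)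
    moreover have "(\<lambda>t. exp (- z * of_real t) * (indicator {0..} t *\<^sub>R image_measure (\<Phi> t) \<mu> A)) = (\<lambda>t. \<kappa> t A)"
      by (auto simp: \<kappa>_def indicator_def fun_eq_iff)
    ultimately show ?thesis by simp
  qed
  have wb: "norm (\<kappa> t A) \<le> w t" for t A
  proof (cases "t \<ge> 0")
    case True
    have "norm (image_measure (\<Phi> t) \<mu> A) \<le> sup_measure_norm \<mu>"
      using norm_le_sup_measure_norm[OF \<mu>] sup_measure_norm_nonneg[OF \<mu>] by (simp add: image_measure_def)
    then show ?thesis using True by (simp add: \<kappa>_def w_def norm_mult mult.commute mult_left_mono)
  next
    case False then show ?thesis by (simp add: \<kappa>_def w_def)
  qed
  have wi: "integrable lborel w" unfolding w_def[abs_def] by (intro integrable_mult_right integrable_exp_decay z)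
  define \<nu> where "\<nu> A = (\<integral>t. \<kappa> t A \<partial>lborel)" for A
  have \<nu>c: "\<nu> \<in> complex_measures"
    unfolding \<nu>_def[abs_def] by (rule complex_measures_mixture(1)[of lborel \<kappa> w]) (use \<kappa> m wb wi in auto)
  have \<nu>: "cint \<nu> \<eta> = laplace z (correlation \<mu> \<eta>)" if \<eta>: "continuous_on UNIV \<eta>" for \<eta>
  proof -
    note \<eta>b = continuous_bounded_borel[OF \<eta>]
    have "cint \<nu> \<eta> = (\<integral>t. cint (\<kappa> t) \<eta> \<partial>lborel)"
      unfolding \<nu>_def[abs_def] by (rule complex_measures_mixture(3)[of lborel \<kappa> w]) (use \<kappa> m wb wi \<eta>b in auto)
    also have "\<dots> = (\<integral>t. indicator {0..} t *\<^sub>R (exp (- z * of_real t) * correlation \<mu> \<eta> t) \<partial>lborel)"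
    proof (rule Bochner_Integration.integral_cong[OF refl])
      fix t :: real
      show "cint (\<kappa> t) \<eta> = indicator {0..} t *\<^sub>R (exp (- z * of_real t) * correlation \<mu> \<eta> t)"
      proof (cases "t \<ge> 0")
        case True
        have "cint (\<kappa> t) \<eta> = (indicator {0..} t * exp (- z * of_real t)) * cint (image_measure (\<Phi> t) \<mu>) \<eta>"
          unfolding \<kappa>_def[abs_def] by (rule cint_scale[OF im(1)[OF True] \<eta>b])
        then show ?thesis using True im(2)[OF True \<eta>b] by (simp add: correlation_def)
      next
        case False
        then have "\<kappa> t = (\<lambda>A. 0 * \<mu> A)" by (simp add: \<kappa>_def fun_eq_iff)
        then show ?thesis using False cint_scale[OF \<mu> \<eta>b, of 0] by simp
      qed
    qed
    finally show ?thesis unfolding laplace_def set_lebesgue_integral_def .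
  qed
  have pf: "(LINT t:{0..}|lborel. exp (- z * of_real t) * cint (push_forward \<Phi> t \<mu>) \<eta>) = laplace z (correlation \<mu> \<eta>)"
    if \<eta>: "continuous_on UNIV \<eta>" for \<eta>
    unfolding laplace_def set_lebesgue_integral_def
  proof (rule Bochner_Integration.integral_cong[OF refl])
    fix t :: real
    show "indicator {0..} t *\<^sub>R (exp (- z * of_real t) * cint (push_forward \<Phi> t \<mu>) \<eta>)
        = indicator {0..} t *\<^sub>R (exp (- z * of_real t) * correlation \<mu> \<eta> t)"
    proof (cases "t \<ge> 0")
      case True
      then show ?thesis
        using push_forward_eq[OF \<mu> True] im(2)[OF True continuous_bounded_borel[OF \<eta>]] by (simp add: correlation_def)
    next
      case False then show ?thesis by simp
    qed
  qed
  have "resolvent_measure \<Phi> z \<mu> = \<nu>"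
    unfolding resolvent_measure_def
  proof (rule the_equality)
    show "\<nu> \<in> complex_measures \<and> (\<forall>\<eta>. continuous_on UNIV \<eta> \<longrightarrow>
        cint \<nu> \<eta> = (LINT t:{0..}|lborel. exp (- z * of_real t) * cint (push_forward \<Phi> t \<mu>) \<eta>))"
      using \<nu>c \<nu> pf by simp
    fix \<nu>' assume \<nu>': "\<nu>' \<in> complex_measures \<and> (\<forall>\<eta>. continuous_on UNIV \<eta> \<longrightarrow>
        cint \<nu>' \<eta> = (LINT t:{0..}|lborel. exp (- z * of_real t) * cint (push_forward \<Phi> t \<mu>) \<eta>))"
    show "\<nu>' = \<nu>"
      by (rule complex_measures_eqI_continuous) (use \<nu>' \<nu>c \<nu> pf in auto)
  qed
  then show ?thesis using \<nu>[OF \<eta>] by simp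
qed

lemma cint_functional:
  assumes \<eta>: "continuous_on UNIV \<eta>" shows "functional (\<lambda>\<mu>. cint \<mu> \<eta>)"
  unfolding functional_def
proof (intro conjI ballI allI)
  show "cint (\<lambda>A. x A + c * y A) \<eta> = cint x \<eta> + c * cint y \<eta>" if "x \<in> D" "y \<in> D" for x y c
    by (rule cint_lincomb[OF diff_measuresD(1)[OF that(1)] diff_measuresD(1)[OF that(2)] continuous_bounded_borel[OF \<eta>]])
  obtain B where B: "\<And>x. norm (\<eta> x) \<le> B"
    using continuous_bounded_borel[OF \<eta>] unfolding bounded_borel_def by blast
  have B0: "B \<ge> 0" using B[of undefined] norm_ge_zero[of "\<eta> undefined"] by linarith
  have "norm (cint x \<eta>) \<le> B * nD x" if "x \<in> D" for x
    using cint_le_total_variation_bound[OF diff_measuresD(1)[OF that] \<eta> B]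
      mult_left_mono[OF total_variation_le_diff_norm[OF that] B0] by linarith
  then show "\<exists>K. \<forall>x\<in>D. norm (cint x \<eta>) \<le> K * nD x" by blast
qed

lemma diff_measures_eqI:
  assumes "\<mu> \<in> D" "\<nu> \<in> D" "\<And>\<eta>. continuous_on UNIV \<eta> \<Longrightarrow> cint \<mu> \<eta> = cint \<nu> \<eta>"
  shows "\<mu> = \<nu>"
  by (rule complex_measures_eqI_continuous) (use assms diff_measuresD(1) in auto)

end

locale semiflow_resolvent = semiflow_on_manifold M g \<Phi>
  for M :: "('a::metric_space, 'e::euclidean_space) branched_atlas" and g \<Phi> +
  fixes P :: "complex \<Rightarrow> ('a set \<Rightarrow> complex) \<Rightarrow> 'a set \<Rightarrow> complex" and \<alpha> :: real
  assumes P_eq: "0 < Re z \<Longrightarrow> \<alpha> < Re z \<Longrightarrow> \<mu> \<in> D \<Longrightarrow> P z \<mu> = resolvent_measure \<Phi> z \<mu>"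
    and P_hol: "op_holomorphic_on D nD P {z. 0 < Re z}"
begin

section \<open>The operators \<open>P z\<close> as a resolvent\<close>

lemma P_ops: "0 < Re z \<Longrightarrow> P z \<in> ops"
  using P_hol unfolding op_holomorphic_on_def by simp

text \<open>Both sides are holomorphic on the connected half plane \<open>Re z > 0\<close> and agree
  where \<open>Re z > max 0 \<alpha>\<close>, since \<open>P z \<mu>\<close> is the resolvent
  measure there. From here on \<open>\<alpha>\<close> has disappeared.\<close>

lemma cint_P:
  assumes z: "0 < Re z" and \<mu>: "\<mu> \<in> D" and \<eta>: "continuous_on UNIV \<eta>"
  shows "cint (P z \<mu>) \<eta> = laplace z (correlation \<mu> \<eta>)"
proof -
  note \<mu>c = diff_measuresD(1)[OF \<mu>]
  obtain B where B: "\<And>t. 0 \<le> t \<Longrightarrow> norm (correlation \<mu> \<eta> t) \<le> B" using correlation_bound[OF \<mu>c \<eta>] by blast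
  show ?thesis
  proof (rule analytic_continuation_open[of "{z. max 0 \<alpha> < Re z}" "{z. 0 < Re z}"
        "\<lambda>z. cint (P z \<mu>) \<eta>" "\<lambda>z. laplace z (correlation \<mu> \<eta>)"])
    show "open {z. max 0 \<alpha> < Re z}" "open {z. 0 < Re z}" by (rule open_halfspace_Re_gt)+
    have "max 0 \<alpha> < Re (of_real (max 0 \<alpha> + 1))" by simp
    then show "{z. max 0 \<alpha> < Re z} \<noteq> {}" by blast
    show "connected {z. 0 < Re z}" by (intro convex_connected convex_halfspace_Re_gt)
    show "(\<lambda>z. cint (P z \<mu>) \<eta>) holomorphic_on {z. 0 < Re z}"
      by (rule op_holomorphic_functional(1)[OF P_hol open_halfspace_Re_gt cint_functional[OF \<eta>] \<mu>])
    show "(\<lambda>z. laplace z (correlation \<mu> \<eta>)) holomorphic_on {z. 0 < Re z}"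
      by (rule laplace_holomorphic[OF continuous_correlation[OF \<mu>c \<eta>] B])
    show "cint (P z \<mu>) \<eta> = laplace z (correlation \<mu> \<eta>)" if "z \<in> {z. max 0 \<alpha> < Re z}" for z
      using P_eq[of z \<mu>] resolvent_measure[OF \<mu>c _ \<eta>, of z] \<mu> that by simp
  qed (use z in auto)
qed

lemma correlation_P:
  assumes w: "0 < Re w" and \<mu>: "\<mu> \<in> D" and \<eta>: "continuous_on UNIV \<eta>" and t: "0 \<le> t"
  shows "correlation (P w \<mu>) \<eta> t = laplace w (\<lambda>s. correlation \<mu> \<eta> (s + t))"
proof -
  have c: "continuous_on UNIV (\<eta> \<circ> \<Phi> t)"
    by (rule continuous_on_compose[OF continuous_flow[OF t] continuous_on_subset[OF \<eta>]]) simp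
  have "correlation (P w \<mu>) \<eta> t = laplace w (correlation \<mu> (\<eta> \<circ> \<Phi> t))"
    unfolding correlation_def[of "P w \<mu>"] by (rule cint_P[OF w \<mu> c])
  also have "\<dots> = laplace w (\<lambda>s. correlation \<mu> \<eta> (s + t))"
    unfolding laplace_def by (rule set_lebesgue_integral_cong) (use t in \<open>auto simp: correlation_add\<close>)
  finally show ?thesis .
qed

text \<open>The correlation of \<open>P w \<mu>\<close> at time \<open>t\<close> is the Laplace
  transform of the correlation of \<open>\<mu>\<close> shifted by \<open>t\<close>. After pairing
  with a continuous function, the identity is therefore \<open>laplace_resolvent\<close>.\<close>

lemma resolvent_identity:
  assumes z: "0 < Re z" and w: "0 < Re w" and \<mu>: "\<mu> \<in> D"
  shows "(\<lambda>A. P z \<mu> A - P w \<mu> A) = (\<lambda>A. (w - z) * P z (P w \<mu>) A)"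
proof (rule diff_measures_eqI)
  note Pz = opsD(1)[OF P_ops[OF z]] and Pw = opsD(1)[OF P_ops[OF w]]
  show "(\<lambda>A. P z \<mu> A - P w \<mu> A) \<in> D" by (intro diff Pz Pw \<mu>)
  show "(\<lambda>A. (w - z) * P z (P w \<mu>) A) \<in> D" by (intro scale Pz Pw \<mu>)
  fix \<eta> :: "'a \<Rightarrow> complex" assume \<eta>: "continuous_on UNIV \<eta>"
  note \<mu>c = diff_measuresD(1)[OF \<mu>] and f = cint_functional[OF \<eta>]
  obtain B where B: "\<And>t. 0 \<le> t \<Longrightarrow> norm (correlation \<mu> \<eta> t) \<le> B" using correlation_bound[OF \<mu>c \<eta>] by blast
  have "cint (P z (P w \<mu>)) \<eta> = laplace z (correlation (P w \<mu>) \<eta>)" by (rule cint_P[OF z Pw[OF \<mu>] \<eta>])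
  also have "\<dots> = laplace z (\<lambda>t. laplace w (\<lambda>s. correlation \<mu> \<eta> (s + t)))"
    unfolding laplace_def[of z] by (rule set_lebesgue_integral_cong) (auto simp: correlation_P[OF w \<mu> \<eta>])
  finally have "(w - z) * cint (P z (P w \<mu>)) \<eta> = cint (P z \<mu>) \<eta> - cint (P w \<mu>) \<eta>"
    using laplace_resolvent(1)[OF continuous_correlation[OF \<mu>c \<eta>] B z w] cint_P[OF z \<mu> \<eta>] cint_P[OF w \<mu> \<eta>] by simp
  then show "cint (\<lambda>A. P z \<mu> A - P w \<mu> A) \<eta> = cint (\<lambda>A. (w - z) * P z (P w \<mu>) A) \<eta>"
    using functional_diff[OF f Pz[OF \<mu>] Pw[OF \<mu>]] functional_scale[OF f Pz[OF Pw[OF \<mu>]], of "w - z"] by simp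
qed

text \<open>Inserting the eigenvalue equation for \<open>P z\<close> into the resolvent identity
  leaves a linear equation for \<open>P w \<mu>\<close>, whose solution is \<open>inverse w\<close>
  times \<open>\<mu>\<close>.\<close>

lemma eigenvector_transfer:
  assumes z: "0 < Re z" and w: "0 < Re w" and e: "is_eigenvector D (P z) (inverse z) \<mu>"
  shows "is_eigenvector D (P w) (inverse w) \<mu>"
proof -
  have \<mu>: "\<mu> \<in> D" "\<mu> \<noteq> (\<lambda>_. 0)" "P z \<mu> = (\<lambda>A. inverse z * \<mu> A)" using e unfolding is_eigenvector_def by auto
  have z0: "z \<noteq> 0" and w0: "w \<noteq> 0" using z w by auto
  have "P w \<mu> A - inverse z * \<mu> A = (z - w) * (inverse z * P w \<mu> A)" for A
    using fun_cong[OF resolvent_identity[OF w z \<mu>(1)], of A] ops_scale[OF P_ops[OF w] \<mu>(1), of "inverse z"]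
    by (simp add: \<mu>(3))
  then have "P w \<mu> A = inverse w * \<mu> A" for A
    using z0 w0 by (simp add: field_simps)
  then show ?thesis unfolding is_eigenvector_def using \<mu>(1,2) by blast
qed

text \<open>The equation at \<open>w = 1\<close> alone carries the argument. It says that the
  correlation \<open>h\<close> satisfies \<open>laplace 1 (\<lambda>s. h (s + t)) = h t\<close>, so
  \<open>exp (- t) * h t\<close> is a tail integral whose derivative is its own negative. Hence
  \<open>h\<close> has derivative 0 and is constant, which is invariance.\<close>

lemma eigenvector_invariant:
  assumes e: "\<And>w. 0 < Re w \<Longrightarrow> is_eigenvector D (P w) (inverse w) \<mu>" and t: "0 \<le> t"
  shows "is_eigenvector D (push_forward \<Phi> t) 1 \<mu>"
proof -
  have \<mu>: "\<mu> \<in> D" "\<mu> \<noteq> (\<lambda>_. 0)" "P 1 \<mu> = \<mu>" using e[of 1] unfolding is_eigenvector_def by auto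
  note \<mu>c = diff_measuresD(1)[OF \<mu>(1)]
  note im = image_measure[OF \<mu>c flow_measurable[OF t]]
  have "image_measure (\<Phi> t) \<mu> = \<mu>"
  proof (rule complex_measures_eqI_continuous[OF im(1) \<mu>c])
    fix \<eta> :: "'a \<Rightarrow> complex" assume \<eta>: "continuous_on UNIV \<eta>"
    define h where "h = correlation \<mu> \<eta>"
    obtain B where B: "\<And>t. 0 \<le> t \<Longrightarrow> norm (h t) \<le> B" using correlation_bound[OF \<mu>c \<eta>] unfolding h_def by blast
    have hc: "continuous_on {0..} h" unfolding h_def by (rule continuous_correlation[OF \<mu>c \<eta>])
    have K: "laplace 1 (\<lambda>s. h (s + t)) = h t" if "0 \<le> t" for t
      using correlation_P[OF _ \<mu>(1) \<eta> that, of 1] \<mu>(3) unfolding h_def by simp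
    have der: "(h has_vector_derivative 0) (at t within {0..})" if t: "0 \<le> t" for t
    proof -
      have "((\<lambda>t. exp (- 1 * of_real t) * laplace 1 (\<lambda>s. h (s + t))) has_vector_derivative
          - (exp (- 1 * of_real t) * h t)) (at t within {0..})"
        by (rule laplace_shift_derivative[OF hc B _ t]) auto
      then have "((\<lambda>t. exp (- 1 * of_real t) * h t) has_vector_derivative - (exp (- 1 * of_real t) * h t)) (at t within {0..})"
        by (rule has_vector_derivative_transform[rotated 2]) (use t K in auto)
      then have "((\<lambda>t. exp (- of_real t) * h t) has_vector_derivative - (exp (- of_real t) * h t)) (at t within {0..})"
        by simp
      moreover have "((\<lambda>t. exp (of_real t :: complex)) has_vector_derivative exp (of_real t)) (at t within {0..})"
        by (rule has_vector_derivative_at_within[OF has_vector_derivative_real_field]) (auto intro!: derivative_eq_intros)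
      ultimately have "((\<lambda>t. exp (of_real t) * (exp (- of_real t) * h t)) has_vector_derivative
          exp (of_real t) * - (exp (- of_real t) * h t) + exp (of_real t) * (exp (- of_real t) * h t)) (at t within {0..})"
        by (rule has_vector_derivative_mult[rotated])
      moreover have "exp (of_real t) * (exp (- of_real t) * x) = x" for t and x :: complex
        by (simp add: mult.assoc[symmetric] exp_add[symmetric])
      ultimately show ?thesis by simp
    qed
    have "h t = h 0"
    proof (rule has_derivative_zero_unique[of "{0..}" h])
      show "(h has_derivative (\<lambda>_. 0)) (at s within {0..})" if "s \<in> {0..}" for s
        using der[of s] that unfolding has_vector_derivative_def by simp
    qed (use t in auto)
    then show "cint (image_measure (\<Phi> t) \<mu>) \<eta> = cint \<mu> \<eta>"
      using im(2)[OF continuous_bounded_borel[OF \<eta>]] unfolding h_def correlation_0 by (simp add: correlation_def)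
  qed
  then show ?thesis unfolding is_eigenvector_def using \<mu>(1,2) push_forward_eq[OF \<mu>c t] by simp
qed

text \<open>Invariance at all positive times makes every correlation constant on the half line, and
  the Laplace transform of a constant \<open>c\<close> is \<open>c / z\<close>.\<close>

lemma invariant_eigenvector:
  assumes inv: "\<And>t. 0 < t \<Longrightarrow> is_eigenvector D (push_forward \<Phi> t) 1 \<mu>" and z: "0 < Re z"
  shows "is_eigenvector D (P z) (inverse z) \<mu>"
proof -
  have \<mu>: "\<mu> \<in> D" "\<mu> \<noteq> (\<lambda>_. 0)" "\<And>t. 0 < t \<Longrightarrow> push_forward \<Phi> t \<mu> = \<mu>"
    using inv[of 1] inv unfolding is_eigenvector_def by auto
  note \<mu>c = diff_measuresD(1)[OF \<mu>(1)]
  have "P z \<mu> = (\<lambda>A. inverse z * \<mu> A)"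
  proof (rule diff_measures_eqI[OF opsD(1)[OF P_ops[OF z] \<mu>(1)] scale[OF \<mu>(1)]])
    fix \<eta> :: "'a \<Rightarrow> complex" assume \<eta>: "continuous_on UNIV \<eta>"
    note \<eta>b = continuous_bounded_borel[OF \<eta>]
    have "correlation \<mu> \<eta> t = cint \<mu> \<eta>" if t: "0 \<le> t" for t
    proof (cases "t = 0")
      case True then show ?thesis by (simp add: correlation_0)
    next
      case False
      then have "push_forward \<Phi> t \<mu> = \<mu>" using t by (intro \<mu>(3)) simp
      then show ?thesis
        using push_forward_eq[OF \<mu>c t] image_measure(2)[OF \<mu>c flow_measurable[OF t] \<eta>b] by (simp add: correlation_def)
    qed
    then have "laplace z (correlation \<mu> \<eta>) = laplace z (\<lambda>_. cint \<mu> \<eta>)"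
      unfolding laplace_def by (intro set_lebesgue_integral_cong) auto
    then show "cint (P z \<mu>) \<eta> = cint (\<lambda>A. inverse z * \<mu> A) \<eta>"
      using cint_P[OF z \<mu>(1) \<eta>] laplace_const[OF z] cint_scale[OF \<mu>c \<eta>b, of "inverse z"]
      by (simp add: field_simps)
  qed
  then show ?thesis unfolding is_eigenvector_def using \<mu>(1,2) by blast
qed

text \<open>If \<open>P\<close> were regular at 0, its norm would stay bounded there. Pairing with
  the constant function 1, which the semiflow does not change, gives \<open>\<mu> UNIV / w\<close>
  on the positive reals, and this blows up.\<close>

lemma P_has_pole:
  assumes L: "op_laurent_at D nD P 0 m Q" and \<mu>: "\<mu> \<in> D" "\<mu> UNIV \<noteq> 0"
  shows "op_has_pole D nD P 0"
proof (rule ccontr)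
  assume "\<not> op_has_pole D nD P 0"
  then obtain Q where "op_laurent_at D nD P 0 0 Q" using op_pole_or_regular[OF L] by blast
  then obtain r where r: "r > 0" "op_holomorphic_on D nD Q (ball 0 r)"
    "\<And>w \<mu>. w \<in> ball 0 r - {0} \<Longrightarrow> \<mu> \<in> D \<Longrightarrow> P w \<mu> = Q w \<mu>"
    unfolding op_laurent_at_def by auto
  have "cball 0 (r / 2) \<subseteq> ball (0::complex) r" using r(1) by auto
  from op_holomorphic_bounded[OF r(2) open_ball compact_cball this]
  obtain C where C: "C \<ge> 0" "\<And>w \<mu>. w \<in> cball 0 (r / 2) \<Longrightarrow> \<mu> \<in> D \<Longrightarrow> nD (Q w \<mu>) \<le> C * nD \<mu>" by blast
  have "norm (\<mu> UNIV) \<le> x * (C * nD \<mu>)" if x: "0 < x" "x \<le> r / 2" for x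
  proof -
    define w where "w = complex_of_real x"
    have w: "0 < Re w" "w \<in> cball 0 (r / 2)" "w \<in> ball 0 r - {0}" "norm w = x" using x r(1) by (auto simp: w_def)
    have one: "continuous_on UNIV (\<lambda>_::'a. 1 :: complex)" by simp
    have "cint \<mu> (\<lambda>_. 1) = \<mu> UNIV"
      using cint_indicator[OF diff_measuresD(1)[OF \<mu>(1)], of UNIV] by (simp add: indicator_def)
    moreover have "correlation \<mu> (\<lambda>_. 1) = (\<lambda>_. cint \<mu> (\<lambda>_. 1))" by (simp add: correlation_def comp_def fun_eq_iff)
    ultimately have "cint (P w \<mu>) (\<lambda>_. 1) = \<mu> UNIV / w"
      using cint_P[OF w(1) \<mu>(1) one] laplace_const[OF w(1)] by simp
    then have "norm (\<mu> UNIV) = x * norm (cint (Q w \<mu>) (\<lambda>_. 1))"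
      using r(3)[OF w(3) \<mu>(1)] w x by (simp add: norm_divide)
    also have "\<dots> \<le> x * (C * nD \<mu>)"
    proof (rule mult_left_mono)
      have Q: "Q w \<mu> \<in> D" using opsD(1)[OF P_ops[OF w(1)] \<mu>(1)] r(3)[OF w(3) \<mu>(1)] by simp
      show "norm (cint (Q w \<mu>) (\<lambda>_. 1)) \<le> C * nD \<mu>"
        using cint_le_total_variation[OF diff_measuresD(1)[OF Q] one] total_variation_le_diff_norm[OF Q] C(2)[OF w(2) \<mu>(1)]
        by simp
    qed (use x in simp)
    finally show ?thesis .
  qed
  note le = this
  define K where "K = C * nD \<mu>"
  have K: "K \<ge> 0" unfolding K_def using C(1) n_nonneg[OF \<mu>(1)] by simp
  \<comment> \<open>Small enough for \<open>x * K\<close> to be at most half of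
    \<open>norm (\<mu> UNIV)\<close>; the \<open>+ 1\<close> avoids a division by 0 when
    \<open>K\<close> is 0.\<close>
  define x where "x = min (r / 2) (norm (\<mu> UNIV) / (2 * (K + 1)))"
  have pos: "norm (\<mu> UNIV) > 0" using \<mu>(2) by simp
  have x: "x \<le> r / 2" "x \<le> norm (\<mu> UNIV) / (2 * (K + 1))" unfolding x_def by (rule min.cobounded1 min.cobounded2)+
  have "0 < norm (\<mu> UNIV) / (2 * (K + 1))" using pos K by (intro divide_pos_pos) auto
  then have x0: "0 < x" unfolding x_def using r(1) by simp
  have "norm (\<mu> UNIV) \<le> x * K" using le[OF x0 x(1)] unfolding K_def .
  also have "\<dots> \<le> x * (K + 1)" using x0 by simp
  also have "\<dots> \<le> norm (\<mu> UNIV) / (2 * (K + 1)) * (K + 1)" using x(2) K by (intro mult_right_mono) auto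
  also have "\<dots> = norm (\<mu> UNIV) / 2" using K by (simp add: field_simps)
  finally show False using pos by simp
qed

text \<open>Letting \<open>z\<close> tend to 0 in \<open>P(z) \<mu> - P(w) \<mu> = (w - z) P(w) P(z) \<mu>\<close> shows that the range of the leading
  Laurent coefficient consists of eigenvectors.\<close>

lemma pole_eigenvector:
  assumes pole: "op_has_pole D nD P 0"
  shows "\<exists>\<nu>. \<forall>w. 0 < Re w \<longrightarrow> is_eigenvector D (P w) (inverse w) \<nu>"
proof -
  obtain m Q \<mu> where m: "0 < m" and L: "op_laurent_at D nD P 0 m Q" and \<mu>: "\<mu> \<in> D" "Q 0 \<mu> \<noteq> (\<lambda>_. 0)"
    using pole unfolding op_has_pole_def by blast
  obtain r where r: "r > 0" "op_holomorphic_on D nD Q (ball 0 r)"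
    "\<And>w \<mu>. w \<in> ball 0 r - {0} \<Longrightarrow> \<mu> \<in> D \<Longrightarrow> P w \<mu> = (\<lambda>A. Q w \<mu> A / (w - 0) ^ m)"
    using L unfolding op_laurent_at_def by blast
  have Qop: "Q w \<in> ops" if "w \<in> ball 0 r" for w using r(2) that unfolding op_holomorphic_on_def by blast
  have 0: "0 \<in> ball (0::complex) r" using r(1) by simp
  define \<nu> where "\<nu> = Q 0 \<mu>"
  have \<nu>: "\<nu> \<in> D" "\<nu> \<noteq> (\<lambda>_. 0)" unfolding \<nu>_def using opsD(1)[OF Qop[OF 0] \<mu>(1)] \<mu>(2) by auto
  have "is_eigenvector D (P w) (inverse w) \<nu>" if w: "0 < Re w" for w
  proof -
    have w0: "w \<noteq> 0" using w by auto
    note Pw = P_ops[OF w]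
    have "\<nu> = (\<lambda>A. w * P w \<nu> A)"
    proof (rule diff_measures_eqI[OF \<nu>(1) scale[OF opsD(1)[OF Pw \<nu>(1)]]])
      fix \<eta> :: "'a \<Rightarrow> complex" assume \<eta>: "continuous_on UNIV \<eta>"
      note f = cint_functional[OF \<eta>]
      \<comment> \<open>\<open>P w\<close> followed by the pairing is again a bounded functional, so
        the limit of \<open>Q (x k) \<mu>\<close> can be taken inside \<open>P w\<close>.\<close>
      have fP: "functional (\<lambda>\<mu>. cint (P w \<mu>) \<eta>)"
        unfolding functional_def
      proof (intro conjI ballI allI)
        show "cint (P w (\<lambda>A. x A + c * y A)) \<eta> = cint (P w x) \<eta> + c * cint (P w y) \<eta>" if "x \<in> D" "y \<in> D" for x y c
          unfolding opsD(2)[OF Pw that] by (rule functional_lincomb[OF f opsD(1)[OF Pw that(1)] opsD(1)[OF Pw that(2)]])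
        obtain K where K: "\<And>x. x \<in> D \<Longrightarrow> norm (cint x \<eta>) \<le> K * nD x" using f unfolding functional_def by blast
        have "norm (cint (P w x) \<eta>) \<le> (\<bar>K\<bar> * operator_norm D nD (P w)) * nD x" if x: "x \<in> D" for x
        proof -
          have "norm (cint (P w x) \<eta>) \<le> \<bar>K\<bar> * nD (P w x)"
            using K[OF opsD(1)[OF Pw x]] mult_right_mono[OF abs_ge_self n_nonneg[OF opsD(1)[OF Pw x]], of K] by linarith
          also have "\<dots> \<le> \<bar>K\<bar> * (operator_norm D nD (P w) * nD x)" by (intro mult_left_mono ops_bound[OF Pw x]) simp
          finally show ?thesis by (simp add: mult.assoc)
        qed
        then show "\<exists>K. \<forall>x\<in>D. norm (cint (P w x) \<eta>) \<le> K * nD x" by blast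
      qed
      \<comment> \<open>Approaching 0 along positive reals keeps \<open>x k\<close> in the half
        plane where the resolvent identity is available.\<close>
      define x where "x k = complex_of_real (r / 2 * (1/2) ^ k)" for k
      have x: "0 < Re (x k)" "x k \<in> ball 0 r" "x k \<noteq> 0" for k
      proof -
        have "(1/2) ^ k \<le> (1::real)" by (simp add: power_le_one)
        then have "r / 2 * (1/2) ^ k \<le> r / 2 * 1" using r(1) by (intro mult_left_mono) auto
        then have "r / 2 * (1/2) ^ k < r" "0 < r / 2 * (1/2) ^ k" using r(1) by auto
        then show "0 < Re (x k)" "x k \<in> ball 0 r" "x k \<noteq> 0" unfolding x_def by (auto simp del: of_real_mult of_real_divide of_real_power)
      qed
      have "(\<lambda>k. r / 2 * (1/2) ^ k) \<longlonglongrightarrow> 0" by (intro tendsto_mult_right_zero LIMSEQ_power_zero) simp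
      then have x0: "x \<longlonglongrightarrow> 0" unfolding x_def[abs_def] using tendsto_of_real[where ?'a = complex] by fastforce
      have lim: "(\<lambda>k. \<psi> (Q (x k) \<mu>)) \<longlonglongrightarrow> \<psi> \<nu>" if \<psi>: "functional \<psi>" for \<psi>
      proof -
        have "isCont (\<lambda>z. \<psi> (Q z \<mu>)) 0"
          using holomorphic_on_imp_continuous_on[OF op_holomorphic_functional(1)[OF r(2) open_ball \<psi> \<mu>(1)]] 0
          by (simp add: continuous_on_eq_continuous_at)
        then show ?thesis unfolding \<nu>_def by (rule isCont_tendsto_compose[OF _ x0])
      qed
      \<comment> \<open>The resolvent identity multiplied by \<open>x k ^ m\<close>. The term with
        \<open>P w \<mu>\<close> then carries a factor tending to 0, because \<open>m\<close> is
        positive.\<close>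
      have eq: "cint (Q (x k) \<mu>) \<eta> - x k ^ m * cint (P w \<mu>) \<eta> = (w - x k) * cint (P w (Q (x k) \<mu>)) \<eta>" for k
      proof -
        note xk = x[of k]
        have QD: "Q (x k) \<mu> \<in> D" by (rule opsD(1)[OF Qop[OF xk(2)] \<mu>(1)])
        have PQ: "P (x k) \<mu> = (\<lambda>A. inverse (x k ^ m) * Q (x k) \<mu> A)"
          using r(3)[of "x k" \<mu>] xk \<mu>(1) by (simp add: divide_inverse mult.commute)
        have "(\<lambda>A. P w \<mu> A - P (x k) \<mu> A) = (\<lambda>A. (x k - w) * P w (P (x k) \<mu>) A)"
          by (rule resolvent_identity[OF w xk(1) \<mu>(1)])
        also have "P w (P (x k) \<mu>) = (\<lambda>A. inverse (x k ^ m) * P w (Q (x k) \<mu>) A)"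
          unfolding PQ by (rule ops_scale[OF Pw QD])
        finally have "cint (P w \<mu>) \<eta> - inverse (x k ^ m) * cint (Q (x k) \<mu>) \<eta>
            = (x k - w) * (inverse (x k ^ m) * cint (P w (Q (x k) \<mu>)) \<eta>)"
          unfolding PQ
          using functional_diff[OF f opsD(1)[OF Pw \<mu>(1)] scale[OF QD, of "inverse (x k ^ m)"]]
            functional_scale[OF f QD, of "inverse (x k ^ m)"]
            functional_scale[OF f scale[OF opsD(1)[OF Pw QD], of "inverse (x k ^ m)"], of "x k - w"]
            functional_scale[OF f opsD(1)[OF Pw QD], of "inverse (x k ^ m)"] by metis
        then show ?thesis using xk(3) by (simp add: field_simps)
      qed
      have "(\<lambda>k. cint (Q (x k) \<mu>) \<eta> - x k ^ m * cint (P w \<mu>) \<eta>) \<longlonglongrightarrow> cint \<nu> \<eta> - 0 ^ m * cint (P w \<mu>) \<eta>"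
        by (intro tendsto_diff tendsto_mult tendsto_power x0 tendsto_const lim f)
      moreover have "(\<lambda>k. (w - x k) * cint (P w (Q (x k) \<mu>)) \<eta>) \<longlonglongrightarrow> (w - 0) * cint (P w \<nu>) \<eta>"
        by (intro tendsto_mult tendsto_diff tendsto_const x0 lim[OF fP])
      ultimately have "cint \<nu> \<eta> - 0 ^ m * cint (P w \<mu>) \<eta> = (w - 0) * cint (P w \<nu>) \<eta>"
        unfolding eq by (rule LIMSEQ_unique)
      then show "cint \<nu> \<eta> = cint (\<lambda>A. w * P w \<nu> A) \<eta>"
        using m functional_scale[OF f opsD(1)[OF Pw \<nu>(1)], of w] by (simp add: power_0_left)
    qed
    then have "\<nu> A = w * P w \<nu> A" for A by (rule fun_cong)
    then have "P w \<nu> A = inverse w * \<nu> A" for A using w0 by (metis left_inverse mult.assoc mult_1)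
    then show ?thesis unfolding is_eigenvector_def using \<nu> by blast
  qed
  then show ?thesis by blast
qed

lemma eigenvalue_in_spectrum:
  assumes T: "T \<in> ops" and e: "is_eigenvector D T c \<mu>"
  shows "c \<in> operator_spectrum D nD T"
  unfolding operator_spectrum_def
proof (rule CollectI, rule notI)
  assume "\<exists>R\<in>ops. \<forall>\<mu>\<in>D. R (\<lambda>A. c * \<mu> A - T \<mu> A) = \<mu> \<and> (\<lambda>A. c * R \<mu> A - T (R \<mu>) A) = \<mu>"
  then obtain R where R: "R \<in> ops" "R (\<lambda>A. c * \<mu> A - T \<mu> A) = \<mu>" using e unfolding is_eigenvector_def by blast
  have "(\<lambda>A. c * \<mu> A - T \<mu> A) = (\<lambda>A. 0)" using e unfolding is_eigenvector_def by simp
  then have "\<mu> = (\<lambda>A. 0)" using R ops_zero by metis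
  then show False using e unfolding is_eigenvector_def by simp
qed

end

subsection \<open>Transversality and charts with interior\<close>

text \<open>Brouwer's theorem on a small disc in the half plane, where the map is close to an invertible
  affine one.\<close>

lemma half_plane_image_interior:
  fixes F :: "real \<Rightarrow> real \<Rightarrow> real^2"
  assumes e0: "0 < e0" and cont: "continuous_on (cball 0 e0 \<times> {0..e0}) (\<lambda>(s, t). F s t)"
    and V0: "V0 \<noteq> 0" and X0: "\<And>s. X0 \<noteq> s *\<^sub>R V0"
    and est: "\<And>e. e > 0 \<Longrightarrow> \<exists>d>0. \<forall>s t. \<bar>s\<bar> \<le> d \<longrightarrow> 0 \<le> t \<longrightarrow> t \<le> d \<longrightarrow>
      norm (F s t - F 0 0 - s *\<^sub>R V0 - t *\<^sub>R X0) \<le> e * (\<bar>s\<bar> + t)"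
  shows "interior ((\<lambda>(s, t). F s t) ` (cball 0 e0 \<times> {0..e0})) \<noteq> {}"
proof -
  define A where "A v = (vec_nth v 1) *\<^sub>R V0 + (vec_nth v 2) *\<^sub>R X0" for v :: "real^2"
  have linA: "linear A" unfolding A_def[abs_def]
    by (intro linearI) (simp_all add: scaleR_left_distrib algebra_simps)
  have "inj A"
    unfolding linear_injective_0[OF linA]
  proof (intro allI impI)
    fix v :: "real^2" assume 0: "A v = 0"
    have v2: "vec_nth v 2 = 0"
    proof (rule ccontr)
      assume ne: "vec_nth v 2 \<noteq> 0"
      have "(vec_nth v 2) *\<^sub>R X0 = (- (vec_nth v 1)) *\<^sub>R V0" using 0 unfolding A_def by (simp add: add_eq_0_iff)
      then have "inverse (vec_nth v 2) *\<^sub>R ((vec_nth v 2) *\<^sub>R X0) = inverse (vec_nth v 2) *\<^sub>R ((- (vec_nth v 1)) *\<^sub>R V0)" by simp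
      then show False using ne X0[of "inverse (vec_nth v 2) * (- (vec_nth v 1))"] by simp
    qed
    then have "vec_nth v 1 = 0" using 0 V0 unfolding A_def by simp
    then show "v = 0" using v2 by (simp add: vec_eq_iff forall_2)
  qed
  then obtain Bf where Bf: "linear Bf" "\<And>x. Bf (A x) = x" "\<And>x. A (Bf x) = x"
    using linear_injective_isomorphism[OF linA] by blast
  obtain k where k: "k > 0" "\<And>x. norm (Bf x) \<le> k * norm x" using linear_bounded_pos[OF Bf(1)] by blast
  \<comment> \<open>The tolerance is matched to the bound \<open>k\<close> on the inverse map: on
    the disc used below, where \<open>\<bar>s\<bar> + t\<close> is at most \<open>2 * a\<close>, the
    error costs \<open>a / 8\<close> after applying \<open>Bf\<close>, and moving \<open>y\<close>
    by \<open>a / (4 * k)\<close> costs \<open>a / 4\<close>. The total \<open>3 * a / 8\<close> is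
    below the radius \<open>a / 2\<close>, so the disc is mapped into itself.\<close>
  obtain d where d: "d > 0" "\<And>s t. \<bar>s\<bar> \<le> d \<Longrightarrow> 0 \<le> t \<Longrightarrow> t \<le> d \<Longrightarrow>
      norm (F s t - F 0 0 - s *\<^sub>R V0 - t *\<^sub>R X0) \<le> (1 / (16 * k)) * (\<bar>s\<bar> + t)"
    using est[of "1 / (16 * k)"] k(1) by auto
  define a where "a = min d e0 / 2"
  have a: "a > 0" "2 * a \<le> d" "2 * a \<le> e0" unfolding a_def using d(1) e0 by auto
  \<comment> \<open>The centre lies at height \<open>a\<close> in the time direction, so that the
    disc of radius \<open>a / 2\<close> stays in the half plane on which the map is defined.\<close>
  define p0 :: "real^2" where "p0 = vector [0, a]"
  have p0: "vec_nth p0 1 = 0" "vec_nth p0 2 = a" unfolding p0_def by simp_all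
  have dom: "\<bar>vec_nth v 1\<bar> \<le> a / 2" "a / 2 \<le> vec_nth v 2" "vec_nth v 2 \<le> 3 * a / 2" if v: "v \<in> cball p0 (a / 2)" for v
  proof -
    have n: "norm (v - p0) \<le> a / 2" using v by (simp add: dist_norm norm_minus_commute)
    show "\<bar>vec_nth v 1\<bar> \<le> a / 2" using component_le_norm_cart[of "v - p0" 1] n p0 by simp
    have "\<bar>vec_nth v 2 - a\<bar> \<le> a / 2" using component_le_norm_cart[of "v - p0" 2] n p0 by simp
    then show "a / 2 \<le> vec_nth v 2" "vec_nth v 2 \<le> 3 * a / 2" by linarith+
  qed
  define G where "G v = F (vec_nth v 1) (vec_nth v 2)" for v :: "real^2"
  have inrect: "(vec_nth v 1, vec_nth v 2) \<in> cball 0 e0 \<times> {0..e0}" if "v \<in> cball p0 (a / 2)" for v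
    using dom[OF that] a by (auto simp: dist_real_def)
  have Gc: "continuous_on (cball p0 (a / 2)) G"
  proof -
    have c: "continuous_on (cball p0 (a / 2)) (\<lambda>v. (vec_nth v 1, vec_nth v 2))"
      by (intro continuous_on_Pair continuous_on_component continuous_on_id)
    have "continuous_on (cball p0 (a / 2)) (\<lambda>v. case (vec_nth v 1, vec_nth v 2) of (s, t) \<Rightarrow> F s t)"
      by (rule continuous_on_compose2[OF cont c]) (use inrect in blast)
    then show ?thesis by (simp add: G_def[abs_def])
  qed
  have "y \<in> (\<lambda>(s, t). F s t) ` (cball 0 e0 \<times> {0..e0})" if y: "y \<in> ball (F 0 0 + A p0) (a / (4 * k))" for y
  proof -
    \<comment> \<open>A simplified Newton step: since \<open>Bf\<close> is injective, a fixed point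
      of \<open>T\<close> solves \<open>G v = y\<close>.\<close>
    define T where "T v = v + Bf (y - G v)" for v
    have Tc: "continuous_on (cball p0 (a / 2)) T"
      unfolding T_def
      by (intro continuous_intros Gc linear_continuous_on_compose[OF _ Bf(1)])
    have "T v \<in> cball p0 (a / 2)" if v: "v \<in> cball p0 (a / 2)" for v
    proof -
      have "norm (G v - F 0 0 - (vec_nth v 1) *\<^sub>R V0 - (vec_nth v 2) *\<^sub>R X0) \<le> (1 / (16 * k)) * (\<bar>vec_nth v 1\<bar> + vec_nth v 2)"
        unfolding G_def using dom[OF v] a by (intro d(2)) auto
      also have "\<dots> \<le> (1 / (16 * k)) * (2 * a)"
        using dom[OF v] k(1) by (intro mult_left_mono) auto
      finally have "norm (A v - (G v - F 0 0)) \<le> (1 / (16 * k)) * (2 * a)"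
        unfolding A_def by (subst norm_minus_commute) (simp add: algebra_simps)
      then have 1: "norm (Bf (A v - (G v - F 0 0))) \<le> k * ((1 / (16 * k)) * (2 * a))"
        using k(1) by (intro order_trans[OF k(2)] mult_left_mono) auto
      have "norm (y - F 0 0 - A p0) \<le> a / (4 * k)" using y by (simp add: dist_norm norm_minus_commute algebra_simps)
      then have 2: "norm (Bf (y - F 0 0 - A p0)) \<le> k * (a / (4 * k))"
        using k(1) by (intro order_trans[OF k(2)] mult_left_mono) auto
      have "T v - p0 = Bf (A v) + Bf (y - G v) - Bf (A p0)" by (simp add: T_def Bf(2))
      also have "\<dots> = Bf (A v - (G v - F 0 0)) + Bf (y - F 0 0 - A p0)"
        by (simp add: linear_diff[OF Bf(1)] linear_add[OF Bf(1)])
      finally have "norm (T v - p0) \<le> k * ((1 / (16 * k)) * (2 * a)) + k * (a / (4 * k))"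
        using norm_triangle_le[OF add_mono[OF 1 2]] by simp
      also have "\<dots> = 3 * a / 8" using k(1) by (simp add: field_simps)
      finally show ?thesis using a(1) by (simp add: dist_norm norm_minus_commute)
    qed
    then obtain v where v: "v \<in> cball p0 (a / 2)" "T v = v"
      using brouwer_ball[of "a / 2" p0 T] Tc a(1) by auto
    then have "Bf (y - G v) = 0" by (simp add: T_def)
    then have "y - G v = 0" using Bf(3)[of "y - G v"] linear_0[OF linA] by simp
    then have "y = (\<lambda>(s, t). F s t) (vec_nth v 1, vec_nth v 2)" by (simp add: G_def)
    then show ?thesis using inrect[OF v(1)] by (rule image_eqI)
  qed
  then have "ball (F 0 0 + A p0) (a / (4 * k)) \<subseteq> interior ((\<lambda>(s, t). F s t) ` (cball 0 e0 \<times> {0..e0}))"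
    by (intro interior_maximal) auto
  moreover have "F 0 0 + A p0 \<in> ball (F 0 0 + A p0) (a / (4 * k))" using a(1) k(1) by simp
  ultimately show ?thesis by blast
qed

text \<open>The finite case of Baire's theorem: joining a closed set with empty interior to another
  set creates no interior.\<close>

lemma interior_finite_UN_closed:
  assumes "finite I" "\<And>j. j \<in> I \<Longrightarrow> closed (S j)" "interior (\<Union>j\<in>I. S j) \<noteq> {}"
  shows "\<exists>j\<in>I. interior (S j) \<noteq> {}"
proof (rule ccontr)
  assume no: "\<not> ?thesis"
  have "interior (\<Union>j\<in>J. S j) = {}" if "J \<subseteq> I" for J
    using finite_subset[OF that assms(1)] that
  proof (induction J rule: finite_induct)
    case empty then show ?case by simp
  next
    case (insert j J)
    have "interior (S j \<union> (\<Union>j\<in>J. S j)) = interior (S j)"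
      using insert assms(2) by (intro interior_closed_Un_empty_interior) auto
    then show ?case using no insert.prems by simp
  qed
  then show False using assms(3) by blast
qed

text \<open>Both alternatives for a leaf, an arc longer than \<open>\<delta>\<close> and a closed
  curve, contain a nondegenerate segment. At its inner parameters the derivative within the
  parameter set is an ordinary two-sided derivative.\<close>

lemma leaf_curve_segment:
  assumes "leaf_curve M V \<delta> S" "0 < \<delta>"
  shows "\<exists>\<gamma> a b. a < b \<and> continuous_on {a..b} \<gamma> \<and>
    (\<forall>t i. a < t \<longrightarrow> t < b \<longrightarrow> i \<in> idx M \<longrightarrow> \<gamma> t \<in> interior (chart M i) \<longrightarrow>
      ((\<lambda>s. coord M i (\<gamma> s)) has_vector_derivative V i (\<gamma> t)) (at t))"
proof -
  from assms(1)[unfolded leaf_curve_def]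
  obtain T \<gamma> where T: "is_interval T" and ic: "integral_curve M V T \<gamma>"
    and alt: "(inj_on \<gamma> T \<and> (\<exists>a\<in>T. \<exists>b\<in>T. b - a > \<delta>)
         \<and> (\<forall>t\<in>T. (\<forall>s\<in>T. t \<le> s) \<or> (\<forall>s\<in>T. s \<le> t) \<longrightarrow> \<gamma> t \<in> bm_boundary M))
      \<or> (T = UNIV \<and> (\<exists>l>\<delta>. \<forall>s t. \<gamma> s = \<gamma> t \<longleftrightarrow> (\<exists>k::int. t - s = of_int k * l)))"
    by (elim exE conjE)
  have "\<exists>a b. a \<in> T \<and> b \<in> T \<and> a < b"
    using alt
  proof
    assume "inj_on \<gamma> T \<and> (\<exists>a\<in>T. \<exists>b\<in>T. b - a > \<delta>)
         \<and> (\<forall>t\<in>T. (\<forall>s\<in>T. t \<le> s) \<or> (\<forall>s\<in>T. s \<le> t) \<longrightarrow> \<gamma> t \<in> bm_boundary M)"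
    then obtain a b where "a \<in> T" "b \<in> T" "b - a > \<delta>" by (elim conjE bexE)
    then show ?thesis using assms(2) by (intro exI[of _ a] exI[of _ b]) simp
  next
    assume "T = UNIV \<and> (\<exists>l>\<delta>. \<forall>s t. \<gamma> s = \<gamma> t \<longleftrightarrow> (\<exists>k::int. t - s = of_int k * l))"
    then show ?thesis by (intro exI[of _ 0] exI[of _ 1]) simp
  qed
  then obtain a b where ab: "a \<in> T" "b \<in> T" "a < b" by (elim exE conjE)
  have sub: "{a..b} \<subseteq> T"
  proof
    fix x assume "x \<in> {a..b}"
    then show "x \<in> T" using T[unfolded is_interval_1, rule_format, OF ab(1,2), of x] by simp
  qed
  have "((\<lambda>s. coord M i (\<gamma> s)) has_vector_derivative V i (\<gamma> t)) (at t)"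
    if t: "a < t" "t < b" and i: "i \<in> idx M" and int: "\<gamma> t \<in> interior (chart M i)" for t i
  proof -
    have tT: "t \<in> T" using sub t by auto
    have "((\<lambda>s. coord M i (\<gamma> s)) has_vector_derivative V i (\<gamma> t)) (at t within T)"
      using ic tT i int unfolding integral_curve_def by simp
    moreover have "at t within T = at t"
      using sub t by (intro at_within_interior) (auto intro!: interiorI[of "{a<..<b}"])
    ultimately show ?thesis by simp
  qed
  moreover have "continuous_on {a..b} \<gamma>"
    using ic continuous_on_subset[OF _ sub] unfolding integral_curve_def by blast
  ultimately show ?thesis using ab(3) by blast
qed

lemma expanding_semiflow_settingD:
  assumes "expanding_semiflow_setting M g X \<Phi> lam"
  shows "branched_manifold 2 M" "finite_branches M" "tangent_inner_product M g"
    "Ck_vector_field 2 M X" "associated_semiflow M X \<Phi>" "uniformly_expanding M g X \<Phi> lam"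
  using assms by (simp_all only: expanding_semiflow_setting_def)

lemma uniformly_expandingE:
  assumes "uniformly_expanding M g X \<Phi> lam"
  obtains N F V \<delta> \<kappa> where "\<forall>i\<in>idx M. \<forall>x\<in>chart M i. tnorm g i x (V i x) = 1"
    "\<delta> > 0" "\<forall>p. leaf_curve M V \<delta> (leaf N F p)"
    "\<kappa> > 0" "\<forall>i\<in>idx M. \<forall>x\<in>chart M i. X i x \<noteq> 0 \<and>
      (\<forall>s. tnorm g i x (X i x - s *\<^sub>R V i x) \<ge> \<kappa> * tnorm g i x (X i x))"
proof -
  from conjunct2[OF assms[unfolded uniformly_expanding_def]] show thesis
  proof (elim exE conjE)
    fix N F V \<delta> \<kappa>
    assume 1: "\<forall>i\<in>idx M. \<forall>x\<in>chart M i. tnorm g i x (V i x) = 1"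
      and 2: "\<delta> > 0" "\<forall>p. leaf_curve M V \<delta> (leaf N F p)"
      and 3: "\<kappa> > 0" "\<forall>i\<in>idx M. \<forall>x\<in>chart M i. X i x \<noteq> 0 \<and>
      (\<forall>s. tnorm g i x (X i x - s *\<^sub>R V i x) \<ge> \<kappa> * tnorm g i x (X i x))"
    show thesis by (rule that[OF 1 2 3])
  qed
qed

text \<open>The map \<open>Fm\<close> from leaf parameter and time to coordinates is differentiable
  along the leaf at time 0 only, and forward in time only. The first-order estimate is therefore
  taken in two steps: along the leaf at time 0, then along a flow line by the mean value inequality,
  the field \<open>X\<close> being close to its value at the base point.\<close>

lemma exists_subchart_interior:
  fixes M :: "('a::metric_space, real^2) branched_atlas"
  assumes setting: "expanding_semiflow_setting M g X \<Phi> lam"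
  shows "\<exists>i\<in>idx M. \<exists>j\<in>subidx M i. interior (coord M i ` subchart M i j) \<noteq> {}"
proof -
  note bm = expanding_semiflow_settingD(1)[OF setting] and fb = expanding_semiflow_settingD(2)[OF setting]
    and g = expanding_semiflow_settingD(3)[OF setting] and Xf = expanding_semiflow_settingD(4)[OF setting]
    and flow = expanding_semiflow_settingD(5)[OF setting] and ue = expanding_semiflow_settingD(6)[OF setting]
  interpret riemannian_branched_manifold M g by unfold_locales (fact bm fb g)+
  from ue obtain N F V \<delta> \<kappa> where V1': "\<forall>i\<in>idx M. \<forall>x\<in>chart M i. tnorm g i x (V i x) = 1"
    and \<delta>: "\<delta> > 0" "\<forall>p. leaf_curve M V \<delta> (leaf N F p)"
    and \<kappa>0: "\<kappa> > 0" and trans': "\<forall>i\<in>idx M. \<forall>x\<in>chart M i. X i x \<noteq> 0 \<and>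
      (\<forall>s. tnorm g i x (X i x - s *\<^sub>R V i x) \<ge> \<kappa> * tnorm g i x (X i x))"
    by (rule uniformly_expandingE)
  note V1 = bspec[OF bspec[OF V1']]
  note Xn = conjunct1[OF bspec[OF bspec[OF trans']]]
  note trans = spec[OF conjunct2[OF bspec[OF bspec[OF trans']]]]
  from leaf_curve_segment[OF \<delta>(2)[rule_format] \<delta>(1)]
  obtain \<gamma> a b where ab: "a < b" and \<gamma>c: "continuous_on {a..b} \<gamma>"
    and \<gamma>d: "\<And>t i. a < t \<Longrightarrow> t < b \<Longrightarrow> i \<in> idx M \<Longrightarrow> \<gamma> t \<in> interior (chart M i) \<Longrightarrow>
      ((\<lambda>s. coord M i (\<gamma> s)) has_vector_derivative V i (\<gamma> t)) (at t)" by blast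
  \<comment> \<open>Midpoint of the segment and a quarter of its length, so that all parameters
    within \<open>h\<close> of \<open>s0\<close> stay strictly inside.\<close>
  define s0 where "s0 = (a + b) / 2"
  define h where "h = (b - a) / 4"
  have h: "h > 0" "\<And>s. \<bar>s\<bar> \<le> h \<Longrightarrow> a < s0 + s \<and> s0 + s < b"
    using ab unfolding h_def s0_def by (auto simp: field_simps)
  obtain i where i: "i \<in> idx M" and q0: "\<gamma> s0 \<in> interior (chart M i)" using interior_chart_cover by blast
  have q0c: "\<gamma> s0 \<in> chart M i" using q0 interior_subset by blast
  define V0 X0 where "V0 = V i (\<gamma> s0)" and "X0 = X i (\<gamma> s0)"
  have flow0: "\<Phi> 0 = id" and flowc: "continuous_on ({0..} \<times> UNIV) (\<lambda>(t, x). \<Phi> t x)"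
    and flowd: "\<And>p t. 0 \<le> t \<Longrightarrow> \<Phi> t p \<in> interior (chart M i) \<Longrightarrow>
        ((\<lambda>s. coord M i (\<Phi> s p)) has_vector_derivative X i (\<Phi> t p)) (at t within {0..})"
    using flow i unfolding associated_semiflow_def by auto
  have bil: "bilinear (g i (\<gamma> s0))" and pos: "\<And>v. v \<noteq> 0 \<Longrightarrow> 0 < g i (\<gamma> s0) v v"
    using g i q0c unfolding tangent_inner_product_def by auto
  have t0: "tnorm g i (\<gamma> s0) 0 = 0" unfolding tnorm_def using bilinear_lzero[OF bil] by simp
  have V0n: "V0 \<noteq> 0" using V1[OF i q0c] t0 unfolding V0_def by auto
  have \<kappa>: "\<kappa> > 0" "X0 \<noteq> 0" "\<And>s. tnorm g i (\<gamma> s0) (X0 - s *\<^sub>R V0) \<ge> \<kappa> * tnorm g i (\<gamma> s0) X0"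
    unfolding X0_def V0_def by (rule \<kappa>0 Xn[OF i q0c] trans[OF i q0c])+
  have X0n: "X0 \<noteq> s *\<^sub>R V0" for s
  proof
    \<comment> \<open>For this \<open>s\<close> the left side of the transversality bound is the
      length of the zero vector, while the right side is positive.\<close>
    assume "X0 = s *\<^sub>R V0"
    then have "\<kappa> * tnorm g i (\<gamma> s0) X0 \<le> 0" using \<kappa>(3)[of s] t0 by simp
    moreover have "tnorm g i (\<gamma> s0) X0 > 0" unfolding tnorm_def using pos[OF \<kappa>(2)] by simp
    ultimately show False using \<kappa>(1) by (simp add: mult_le_0_iff)
  qed
  define \<Gamma> where "\<Gamma> q = \<Phi> (snd q) (\<gamma> (s0 + fst q))" for q
  define R where "R = cball (0::real) h \<times> {0::real..}"
  have \<Gamma>c: "continuous_on R \<Gamma>"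
  proof -
    have "continuous_on R (\<lambda>q. \<gamma> (s0 + fst q))"
      by (rule continuous_on_compose2[OF \<gamma>c])
        (use h(2) in \<open>auto intro!: continuous_intros simp: R_def dist_real_def less_imp_le\<close>)
    then have c: "continuous_on R (\<lambda>q. (snd q, \<gamma> (s0 + fst q)))" by (intro continuous_intros)
    have "continuous_on R (\<lambda>q. case (snd q, \<gamma> (s0 + fst q)) of (t, x) \<Rightarrow> \<Phi> t x)"
      by (rule continuous_on_compose2[OF flowc c]) (auto simp: R_def)
    then show ?thesis by (simp add: \<Gamma>_def[abs_def])
  qed
  have 0: "(0, 0) \<in> R" "\<Gamma> (0, 0) = \<gamma> s0" using h(1) flow0 by (auto simp: R_def \<Gamma>_def)
  \<comment> \<open>Continuity at the corner of the half plane, in rectangular form; it is used once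
    to stay in the chart and once to keep \<open>X\<close> close to \<open>X0\<close>.\<close>
  have near: "\<exists>d>0. d \<le> h \<and> (\<forall>s t. \<bar>s\<bar> \<le> d \<longrightarrow> 0 \<le> t \<longrightarrow> t \<le> d \<longrightarrow> \<Gamma> (s, t) \<in> W)"
    if W: "open W" "\<gamma> s0 \<in> W" for W
  proof -
    have "\<Gamma> (0, 0) \<in> W" using 0(2) W(2) by simp
    from \<Gamma>c[unfolded continuous_on_topological, rule_format, OF 0(1) W(1) this]
    obtain U where U: "open U" "(0, 0) \<in> U" "\<forall>q\<in>R. q \<in> U \<longrightarrow> \<Gamma> q \<in> W" by (elim exE conjE)
    obtain e where e: "e > 0" "ball (0, 0) e \<subseteq> U" using U(1,2) open_contains_ball by blast
    define d where "d = min h (e / 3)"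
    have d: "d > 0" "d \<le> h" "d \<le> e / 3" unfolding d_def using h(1) e(1) by auto
    have "\<Gamma> (s, t) \<in> W" if st: "\<bar>s\<bar> \<le> d" "0 \<le> t" "t \<le> d" for s t
    proof (rule U(3)[rule_format])
      show "(s, t) \<in> R" using st d by (simp add: R_def dist_real_def)
      have "norm (s, t) \<le> norm s + norm t" by (rule norm_Pair_le)
      moreover have "dist (0, 0) (s, t) = norm (s, t)" by (simp add: dist_norm norm_Pair)
      ultimately have "dist (0, 0) (s, t) < e" using st d e(1) by simp
      then show "(s, t) \<in> U" using e(2) by auto
    qed
    then show ?thesis using d by blast
  qed
  from near[OF open_interior q0]
  obtain e0 where e0': "e0 > 0" "e0 \<le> h"
    "\<forall>s t. \<bar>s\<bar> \<le> e0 \<longrightarrow> 0 \<le> t \<longrightarrow> t \<le> e0 \<longrightarrow> \<Gamma> (s, t) \<in> interior (chart M i)" by (elim exE conjE)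
  note e0 = e0'(1,2) e0'(3)[rule_format]
  define Fm where "Fm s t = coord M i (\<Gamma> (s, t))" for s t
  have rect: "\<Gamma> (s, t) \<in> chart M i" if "\<bar>s\<bar> \<le> e0" "0 \<le> t" "t \<le> e0" for s t
    using e0(3)[OF that] interior_subset by blast
  have Fc: "continuous_on (cball 0 e0 \<times> {0..e0}) (\<lambda>(s, t). Fm s t)"
  proof -
    have "continuous_on (cball 0 e0 \<times> {0..e0}) \<Gamma>"
      by (rule continuous_on_subset[OF \<Gamma>c]) (use e0(2) in \<open>auto simp: R_def\<close>)
    then have "continuous_on (cball 0 e0 \<times> {0..e0}) (\<lambda>q. coord M i (\<Gamma> q))"
      by (rule continuous_on_compose2[OF continuous_on_coord[OF i]]) (use rect in \<open>auto simp: dist_real_def\<close>)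
    then show ?thesis by (simp add: Fm_def case_prod_unfold)
  qed
  have "interior ((\<lambda>(s, t). Fm s t) ` (cball 0 e0 \<times> {0..e0})) \<noteq> {}"
  proof (rule half_plane_image_interior[OF e0(1) Fc V0n X0n])
    fix e :: real assume e: "e > 0"
    have "continuous_on (chart M i) (X i)"
      using Xf i unfolding Ck_vector_field_def continuous_vector_field_def by blast
    then have "continuous_on (interior (chart M i)) (X i)" by (rule continuous_on_subset[OF _ interior_subset])
    then have "open (X i -` ball X0 e \<inter> interior (chart M i))"
      using continuous_on_open_vimage[OF open_interior] open_ball by blast
    moreover have "\<gamma> s0 \<in> X i -` ball X0 e \<inter> interior (chart M i)" using q0 e by (simp add: X0_def)
    ultimately have "\<exists>d>0. d \<le> h \<and> (\<forall>s t. \<bar>s\<bar> \<le> d \<longrightarrow> 0 \<le> t \<longrightarrow> t \<le> d \<longrightarrow>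
        \<Gamma> (s, t) \<in> X i -` ball X0 e \<inter> interior (chart M i))" by (rule near)
    then obtain d1 where d1': "d1 > 0" "d1 \<le> h" "\<forall>s t. \<bar>s\<bar> \<le> d1 \<longrightarrow> 0 \<le> t \<longrightarrow> t \<le> d1 \<longrightarrow>
        \<Gamma> (s, t) \<in> X i -` ball X0 e \<inter> interior (chart M i)" by (elim exE conjE)
    note d1 = d1'(1,2) d1'(3)[rule_format]
    have "((\<lambda>s. coord M i (\<gamma> s)) has_derivative (\<lambda>s. s *\<^sub>R V0)) (at s0)"
      using \<gamma>d[of s0 i] h(2)[of 0] h(1) i q0 unfolding V0_def has_vector_derivative_def by simp
    then obtain d2 where d2: "d2 > 0" "\<And>s. norm (s - s0) < d2 \<Longrightarrow>
        norm (coord M i (\<gamma> s) - coord M i (\<gamma> s0) - (s - s0) *\<^sub>R V0) \<le> e * norm (s - s0)"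
      unfolding has_derivative_at_alt using e by blast
    define d where "d = min d1 (d2 / 2)"
    have d: "d > 0" "d \<le> d1" "d < d2" unfolding d_def using d1(1) d2(1) by auto
    have "norm (Fm s t - Fm 0 0 - s *\<^sub>R V0 - t *\<^sub>R X0) \<le> e * (\<bar>s\<bar> + t)"
      if st: "\<bar>s\<bar> \<le> d" "0 \<le> t" "t \<le> d" for s t
    proof -
      have F0: "Fm s 0 = coord M i (\<gamma> (s0 + s))" for s using flow0 by (simp add: Fm_def \<Gamma>_def)
      have 1: "norm (Fm s 0 - Fm 0 0 - s *\<^sub>R V0) \<le> e * \<bar>s\<bar>"
        using d2(2)[of "s0 + s"] st(1) d(3) unfolding F0 by simp
      have "norm ((Fm s t - t *\<^sub>R X0) - (Fm s 0 - 0 *\<^sub>R X0)) \<le> e * norm (t - 0)"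
      proof (rule differentiable_bound[of "{0..t}" "\<lambda>\<tau>. Fm s \<tau> - \<tau> *\<^sub>R X0" "\<lambda>\<tau> k. k *\<^sub>R (X i (\<Gamma> (s, \<tau>)) - X0)"])
        fix \<tau> assume \<tau>: "\<tau> \<in> {0..t}"
        have G: "\<Gamma> (s, \<tau>) \<in> X i -` ball X0 e \<inter> interior (chart M i)" using d1(3)[of s \<tau>] st d \<tau> by simp
        have "((\<lambda>\<tau>. Fm s \<tau>) has_vector_derivative X i (\<Gamma> (s, \<tau>))) (at \<tau> within {0..})"
          using flowd[of \<tau> "\<gamma> (s0 + s)"] G \<tau> by (simp add: Fm_def \<Gamma>_def)
        then have "((\<lambda>\<tau>. Fm s \<tau>) has_vector_derivative X i (\<Gamma> (s, \<tau>))) (at \<tau> within {0..t})"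
          by (rule has_vector_derivative_within_subset) auto
        then show "((\<lambda>\<tau>. Fm s \<tau> - \<tau> *\<^sub>R X0) has_derivative (\<lambda>k. k *\<^sub>R (X i (\<Gamma> (s, \<tau>)) - X0))) (at \<tau> within {0..t})"
          unfolding has_vector_derivative_def by (auto intro!: derivative_eq_intros simp: scaleR_diff_right)
        have "norm (X i (\<Gamma> (s, \<tau>)) - X0) \<le> e" using G by (simp add: dist_norm norm_minus_commute)
        then show "onorm (\<lambda>k. k *\<^sub>R (X i (\<Gamma> (s, \<tau>)) - X0)) \<le> e"
          using e by (intro onorm_bound) (auto simp: mult.commute[of e] mult_left_mono)
      qed (use st in auto)
      then have 2: "norm (Fm s t - Fm s 0 - t *\<^sub>R X0) \<le> e * t" using st by (simp add: algebra_simps)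
      have "Fm s t - Fm 0 0 - s *\<^sub>R V0 - t *\<^sub>R X0 = (Fm s t - Fm s 0 - t *\<^sub>R X0) + (Fm s 0 - Fm 0 0 - s *\<^sub>R V0)" by simp
      then show ?thesis using norm_triangle_le[OF add_mono[OF 2 1]] by (simp add: algebra_simps)
    qed
    then show "\<exists>d>0. \<forall>s t. \<bar>s\<bar> \<le> d \<longrightarrow> 0 \<le> t \<longrightarrow> t \<le> d \<longrightarrow>
        norm (Fm s t - Fm 0 0 - s *\<^sub>R V0 - t *\<^sub>R X0) \<le> e * (\<bar>s\<bar> + t)" using d(1) by blast
  qed
  moreover have "(\<lambda>(s, t). Fm s t) ` (cball 0 e0 \<times> {0..e0}) \<subseteq> (\<Union>j\<in>subidx M i. coord M i ` subchart M i j)"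
    using rect unfolding image_UN[symmetric] UN_subchart[OF i] by (auto simp: Fm_def dist_real_def)
  ultimately have "interior (\<Union>j\<in>subidx M i. coord M i ` subchart M i j) \<noteq> {}"
    using interior_mono by blast
  then have "\<exists>j\<in>subidx M i. interior (coord M i ` subchart M i j) \<noteq> {}"
    using fb i compact_imp_closed[OF compact_coord_subchart[OF i]] unfolding finite_branches_def
    by (intro interior_finite_UN_closed) auto
  then show ?thesis using i by blast
qed

theorem theorem3:
  fixes M :: "('a::metric_space, real^2) branched_atlas"
    and g :: "nat \<Rightarrow> 'a \<Rightarrow> real^2 \<Rightarrow> real^2 \<Rightarrow> real"
    and X :: "nat \<Rightarrow> 'a \<Rightarrow> real^2"
    and \<Phi> :: "real \<Rightarrow> 'a \<Rightarrow> 'a"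
    and P :: "complex \<Rightarrow> ('a set \<Rightarrow> complex) \<Rightarrow> ('a set \<Rightarrow> complex)"
    and lam C \<alpha> :: real
  assumes setting: "expanding_semiflow_setting M g X \<Phi> lam"
    and bound: "\<And>t. 0 \<le> t \<Longrightarrow> push_forward \<Phi> t \<in> bounded_operators (diff_measures M g) (diff_norm M g)
                  \<and> operator_norm (diff_measures M g) (diff_norm M g) (push_forward \<Phi> t) \<le> C * exp (\<alpha> * t)"
    and P_eq: "\<And>z \<mu>. 0 < Re z \<Longrightarrow> \<alpha> < Re z \<Longrightarrow> \<mu> \<in> diff_measures M g \<Longrightarrow> P z \<mu> = resolvent_measure \<Phi> z \<mu>"
    and P_holomorphic: "op_holomorphic_on (diff_measures M g) (diff_norm M g) P {z. 0 < Re z}"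
    and P_meromorphic: "op_meromorphic_on (diff_measures M g) (diff_norm M g) P {z. - lam < Re z}"
  shows "(\<forall>z. 0 < Re z \<longrightarrow> inverse z \<in> operator_spectrum (diff_measures M g) (diff_norm M g) (P z)
              \<and> (norm z < Re z + lam \<longrightarrow> is_eigenvalue (diff_measures M g) (P z) (inverse z)))
       \<and> (\<forall>z w \<mu>. 0 < Re z \<longrightarrow> 0 < Re w \<longrightarrow> is_eigenvector (diff_measures M g) (P z) (inverse z) \<mu>
              \<longrightarrow> is_eigenvector (diff_measures M g) (P w) (inverse w) \<mu>)
       \<and> ((\<forall>t>0. is_eigenvalue (diff_measures M g) (push_forward \<Phi> t) 1)
          \<and> (\<forall>\<mu>. (\<forall>t>0. is_eigenvector (diff_measures M g) (push_forward \<Phi> t) 1 \<mu>)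
               \<longrightarrow> (\<forall>z. 0 < Re z \<longrightarrow> is_eigenvector (diff_measures M g) (P z) (inverse z) \<mu>)))
       \<and> op_has_pole (diff_measures M g) (diff_norm M g) P 0"
proof -
  note bm = expanding_semiflow_settingD(1)[OF setting] and fb = expanding_semiflow_settingD(2)[OF setting]
    and g = expanding_semiflow_settingD(3)[OF setting] and flow = expanding_semiflow_settingD(5)[OF setting]
  have lam: "0 < lam"
    by (rule conjunct1[OF expanding_semiflow_settingD(6)[OF setting, unfolded uniformly_expanding_def]])
  have flow': "\<Phi> 0 = id" "\<And>t s. 0 \<le> t \<Longrightarrow> 0 \<le> s \<Longrightarrow> \<Phi> (t + s) = \<Phi> t \<circ> \<Phi> s"
    "continuous_on ({0..} \<times> UNIV) (\<lambda>(t, x). \<Phi> t x)"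
    using flow unfolding associated_semiflow_def by auto
  interpret semiflow_resolvent M g \<Phi> P \<alpha>
    by unfold_locales (fact bm fb g flow' P_eq P_holomorphic)+
  obtain \<mu> where \<mu>: "\<mu> \<in> diff_measures M g" "\<mu> UNIV \<noteq> 0"
    using exists_subchart_interior[OF setting] exists_diff_measure by blast
  \<comment> \<open>The expansion constant is positive, so 0 lies in the domain of
    meromorphy.\<close>
  obtain m Q where L: "op_laurent_at (diff_measures M g) (diff_norm M g) P 0 m Q"
    using P_meromorphic[unfolded op_meromorphic_on_def] lam by (metis (mono_tags, lifting) mem_Collect_eq neg_less_0_iff_less zero_complex.simps(1))
  have pole: "op_has_pole (diff_measures M g) (diff_norm M g) P 0" by (rule P_has_pole[OF L \<mu>])
  \<comment> \<open>A single measure \<open>\<nu>\<close> serves all \<open>w\<close> at once. It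
    supplies the eigenvalue \<open>inverse z\<close> of each \<open>P z\<close>, hence the point of
    the spectrum, and the eigenvalue 1 of each push-forward.\<close>
  obtain \<nu> where \<nu>: "\<And>w. 0 < Re w \<Longrightarrow> is_eigenvector (diff_measures M g) (P w) (inverse w) \<nu>"
    using pole_eigenvector[OF pole] by blast
  have "inverse z \<in> operator_spectrum (diff_measures M g) (diff_norm M g) (P z)"
    "is_eigenvalue (diff_measures M g) (P z) (inverse z)" if "0 < Re z" for z
    using eigenvalue_in_spectrum[OF P_ops[OF that] \<nu>[OF that]] \<nu>[OF that] unfolding is_eigenvalue_def by blast+
  moreover have "is_eigenvalue (diff_measures M g) (push_forward \<Phi> t) 1" if "t > 0" for t
    using eigenvector_invariant[OF \<nu>, of t] that unfolding is_eigenvalue_def by auto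
  ultimately show ?thesis
    using eigenvector_transfer invariant_eigenvector pole by blast
qed

end
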